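(* Let $1<p<\infty$ and let $\tau:[0,\infty)^2\to\mathbb{C}$ be a bounded function satisfying the following three conditions, where $\tau_N(j,k)=\tau(j/N,k/N)$ for $j,k\in\mathbb{Z}_+$, $N\ge 1$: (A$_p$) $\sup_{N\ge1}\|\tau_N\|_{\mathfrak{M}_p}<\infty$; (B) $\tau(0,0)=1$ and for some $\varepsilon>0$ and some $\beta>1/2$ there exists $C_\beta>0$ such that $|\tau(x,y)-1|\le C_\beta|\log(x+y)|^{-\beta}$ for all $0\le x,y\le\varepsilon$; (C) for some $\alpha>1/2$ there exists $C_\alpha$ such that $|\tau(x,y)|\le C_\alpha(\log(x+y+2))^{-\alpha}$ for all $x,y\ge 0$. Let $\omega\in PC(\mathbb{T})$ have a finite set $\Omega\subset\mathbb{T}$ of jump discontinuities and suppose that $$\omega(v)=-i\sum_{z\in\Omega}\varkappa_z(\omega)\gamma(\overline zv)+\eta(v),\quad v\in\mathbb{T},$$ where $\eta$ is a symbol with $\Gamma(\widehat\eta)\in\mathfrak{S}_p$. Then for every $t>0$ $$\lim_{N\to\infty}\frac{\mathsf{n}(t;\tau_N\star\Gamma(\widehat\omega))}{\log N}=\sum_{z\in\Omega}\mathsf{c}\left(t|\varkappa_z(\omega)|^{-1}\right).$$ Furthermore, if $\tau(x,y)=\overline{\tau(y,x)}$ for all $x,y\ge0$ and $\omega(v)=\overline{\omega(\overline v)}$ for $v\in\mathbb{T}$, then, with $\Omega^+=\{z\in\Omega:\operatorname{Im}z>0\}$, for every $t>0$ and each sign $\pm$ $$\lim_{N\to\infty}\frac{\mathsf{n}_\pm(t;\tau_N\star\Gamma(\widehat\omega))}{\log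 N}=\sum_{z\in\Omega^+}\mathsf{c}\left(t|\varkappa_z(\omega)|^{-1}\right)+\mathsf{c}\left(t|\varkappa_1(\omega)|^{-1}\right)\mathbf{1}_\pm(-i\varkappa_1(\omega))+\mathsf{c}\left(t|\varkappa_{-1}(\omega)|^{-1}\right)\mathbf{1}_\pm(-i\varkappa_{-1}(\omega)),$$ where $\mathbf{1}_+$ and $\mathbf{1}_-$ are the characteristic functions of $(0,\infty)$ and $(-\infty,0)$ respectively (a term with $\varkappa_{\pm1}(\omega)=0$ is read as $0$).
   Context: $\mathbb{Z}_+=\{0,1,2,\dots\}$, $\mathbb{T}$ is the unit circle in $\mathbb{C}$. A symbol is an essentially bounded function on $\mathbb{T}$. $PC(\mathbb{T})$ is the class of functions $\omega:\mathbb{T}\to\mathbb{C}$ for which the limits $\omega(z\pm)=\lim_{\epsilon\to0+}\omega(ze^{\pm i\epsilon})$ exist and are finite for all $z\in\mathbb{T}$. Put $\varkappa_z(\omega)=\frac{\omega(z+)-\omega(z-)}{2}$; the jump discontinuities of $\omega$ are the points $z$ with $\varkappa_z(\omega)\ne0$. If $\omega(v)=\overline{\omega(\overline v)}$, then $\varkappa_{\overline z}(\omega)=-\overline{\varkappa_z(\omega)}$, so $\varkappa_{\pm1}(\omega)$ are purely imaginary. $\gamma(e^{i\theta})=i\pi^{-1}e^{-i\theta}(\pi-\theta)$ for $\theta\in[0,2\pi)$. For a symbol $\omega$, $\widehat\omega(j)=\int_0^{2\pi}\omega(e^{i\theta})e^{-ij\theta}\frac{d\theta}{2\pi}$, and $\Gamma(\widehat\omega)$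 is the bounded operator on $\ell^2(\mathbb{Z}_+)$ with matrix entries $\widehat\omega(j+k)$, $j,k\ge0$. $\mathfrak{S}_p$ is the Schatten class of compact operators on $\ell^2(\mathbb{Z}_+)$ with $p$-summable singular values, with norm $\|A\|_{\mathfrak{S}_p}=(\sum_n s_n(A)^p)^{1/p}$. Schur–Hadamard multiplication: for a bounded double sequence $\sigma=(\sigma(j,k))_{j,k\ge0}$ and a bounded operator $A$ on $\ell^2(\mathbb{Z}_+)$, $\sigma\star A$ is the operator with entries $((\sigma\star A)e_j,e_k)=\sigma(j,k)(Ae_j,e_k)$, where $(e_j)$ is the standard basis; $\|\sigma\|_{\mathfrak{M}_p}=\sup_{\|A\|_{\mathfrak{S}_p}=1}\|\sigma\star A\|_{\mathfrak{S}_p}$. For a compact operator $K$ and $t>0$, $\mathsf{n}(t;K)$ is the number of singular values of $K$ greater than $t$; for compact self-adjoint $K$, $\mathsf{n}_\pm(t;K)$ is the number of eigenvalues of $\pm K$ greater than $t$ (all counted with multiplicity). $\mathsf{c}(t)=\frac{1}{\pi^2}\log\left(\frac{1+\sqrt{1-t^2}}{t}\right)$ for $t\in(0,1]$ and $\mathsf{c}(t)=0$ for $t\notin(0,1)$. *)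

theory Defs
  imports "HOL-Analysis.Analysis"
begin

typedef ell2 = "{x :: nat \<Rightarrow> complex. summable (\<lambda>n. (cmod (x n))\<^sup>2)}"
  morphisms ell2_nth Abs_ell2
  by (rule exI[of _ "\<lambda>_. 0"]) simp

setup_lifting type_definition_ell2

lemma square_summable_add:
  fixes x y :: "nat \<Rightarrow> complex"
  assumes "summable (\<lambda>n. (cmod (x n))\<^sup>2)" "summable (\<lambda>n. (cmod (y n))\<^sup>2)"
  shows "summable (\<lambda>n. (cmod (x n + y n))\<^sup>2)"
proof (rule summable_comparison_test)
  show "\<exists>N. \<forall>n\<ge>N. norm ((cmod (x n + y n))\<^sup>2) \<le> 2 * (cmod (x n))\<^sup>2 + 2 * (cmod (y n))\<^sup>2"
  proof (intro exI allI impI)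
    fix n :: nat
    have "(cmod (x n + y n))\<^sup>2 \<le> (cmod (x n) + cmod (y n))\<^sup>2"
      by (intro power_mono norm_triangle_ineq) auto
    also have "\<dots> \<le> 2 * (cmod (x n))\<^sup>2 + 2 * (cmod (y n))\<^sup>2"
      using zero_le_power2[of "cmod (x n) - cmod (y n)"]
      by (simp add: power2_eq_square algebra_simps)
    finally show "norm ((cmod (x n + y n))\<^sup>2) \<le> 2 * (cmod (x n))\<^sup>2 + 2 * (cmod (y n))\<^sup>2"
      by simp
  qed
  show "summable (\<lambda>n. 2 * (cmod (x n))\<^sup>2 + 2 * (cmod (y n))\<^sup>2)"
    using assms by (intro summable_add summable_mult)
qed

lemma square_summable_mult:
  fixes x :: "nat \<Rightarrow> complex"
  assumes "summable (\<lambda>n. (cmod (x n))\<^sup>2)"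
  shows "summable (\<lambda>n. (cmod (c * x n))\<^sup>2)"
  using summable_mult[OF assms, of "(cmod c)\<^sup>2"] by (simp add: norm_mult power_mult_distrib)

lemma square_summable_prod:
  fixes x y :: "nat \<Rightarrow> complex"
  assumes "summable (\<lambda>n. (cmod (x n))\<^sup>2)" "summable (\<lambda>n. (cmod (y n))\<^sup>2)"
  shows "summable (\<lambda>n. x n * cnj (y n))"
proof (rule summable_comparison_test)
  show "\<exists>N. \<forall>n\<ge>N. norm (x n * cnj (y n)) \<le> (cmod (x n))\<^sup>2 + (cmod (y n))\<^sup>2"
  proof (intro exI allI impI)
    fix n :: nat
    have "2 * (cmod (x n) * cmod (y n)) \<le> (cmod (x n))\<^sup>2 + (cmod (y n))\<^sup>2"
      using sum_squares_bound[of "cmod (x n)" "cmod (y n)"] by (simp add: mult.assoc)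
    moreover have "0 \<le> cmod (x n) * cmod (y n)"
      by simp
    ultimately show "norm (x n * cnj (y n)) \<le> (cmod (x n))\<^sup>2 + (cmod (y n))\<^sup>2"
      unfolding norm_mult complex_mod_cnj by linarith
  qed
  show "summable (\<lambda>n. (cmod (x n))\<^sup>2 + (cmod (y n))\<^sup>2)"
    using assms by (rule summable_add)
qed

lemma ell2_nth_summable: "summable (\<lambda>n. (cmod (ell2_nth x n))\<^sup>2)"
  using ell2_nth[of x] by simp

lemma ell2_nth_prod_summable: "summable (\<lambda>n. ell2_nth x n * cnj (ell2_nth y n))"
  by (intro square_summable_prod ell2_nth_summable)

lift_definition ell2_scale :: "complex \<Rightarrow> ell2 \<Rightarrow> ell2" is "\<lambda>c x n. c * x n"
  by (rule square_summable_mult)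

definition ell2_cinner :: "ell2 \<Rightarrow> ell2 \<Rightarrow> complex" where
  "ell2_cinner x y = (\<Sum>n. ell2_nth x n * cnj (ell2_nth y n))"

lift_definition ell2_basis :: "nat \<Rightarrow> ell2" is "\<lambda>j n. if n = j then 1 else 0"
proof -
  fix j :: nat
  show "summable (\<lambda>n. (cmod (if n = j then 1 else 0))\<^sup>2)"
    by (rule summable_finite[of "{j}"]) auto
qed

instantiation ell2 :: real_vector
begin

lift_definition zero_ell2 :: ell2 is "\<lambda>_. 0" by simp

lift_definition plus_ell2 :: "ell2 \<Rightarrow> ell2 \<Rightarrow> ell2" is "\<lambda>x y n. x n + y n"
  by (rule square_summable_add)

lift_definition uminus_ell2 :: "ell2 \<Rightarrow> ell2" is "\<lambda>x n. - x n" by simp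

definition minus_ell2 :: "ell2 \<Rightarrow> ell2 \<Rightarrow> ell2" where
  "minus_ell2 x y = x + (- y)"

definition scaleR_ell2 :: "real \<Rightarrow> ell2 \<Rightarrow> ell2" where
  "scaleR_ell2 r = ell2_scale (complex_of_real r)"

instance
  by standard
    (unfold minus_ell2_def scaleR_ell2_def, (transfer, simp add: fun_eq_iff algebra_simps)+)

end

text \<open>The real inner product is the real part of the complex one, so the norm, metric and
  topology provided by the type class are those of the complex Hilbert space.\<close>

instantiation ell2 :: real_inner
begin

definition inner_ell2 :: "ell2 \<Rightarrow> ell2 \<Rightarrow> real" where
  "inner_ell2 x y = Re (ell2_cinner x y)"

definition norm_ell2 :: "ell2 \<Rightarrow> real" where
  "norm_ell2 x = sqrt (inner x x)"

definition dist_ell2 :: "ell2 \<Rightarrow> ell2 \<Rightarrow> real" where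
  "dist_ell2 x y = norm (x - y)"

definition sgn_ell2 :: "ell2 \<Rightarrow> ell2" where
  "sgn_ell2 x = x /\<^sub>R norm x"

definition uniformity_ell2 :: "(ell2 \<times> ell2) filter" where
  "uniformity_ell2 = (INF e\<in>{0<..}. principal {(x, y). dist x y < e})"

definition open_ell2 :: "ell2 set \<Rightarrow> bool" where
  "open_ell2 U \<longleftrightarrow> (\<forall>x\<in>U. \<forall>\<^sub>F (x', y) in uniformity. x' = x \<longrightarrow> y \<in> U)"

instance
proof
  fix x y z :: ell2 and r :: real and U :: "ell2 set"
  show "dist x y = norm (x - y)" by (rule dist_ell2_def)
  show "sgn x = x /\<^sub>R norm x" by (rule sgn_ell2_def)
  show "uniformity = (INF e\<in>{0<..}. principal {(x, y :: ell2). dist x y < e})"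
    by (rule uniformity_ell2_def)
  show "open U \<longleftrightarrow> (\<forall>x\<in>U. \<forall>\<^sub>F (x', y) in uniformity. x' = x \<longrightarrow> y \<in> U)"
    by (rule open_ell2_def)
  show "norm x = sqrt (inner x x)" by (rule norm_ell2_def)
  have in_eq: "inner u v = (\<Sum>n. Re (ell2_nth u n * cnj (ell2_nth v n)))" for u v :: ell2
    unfolding inner_ell2_def ell2_cinner_def by (rule Re_suminf[OF ell2_nth_prod_summable])
  have sm: "summable (\<lambda>n. Re (ell2_nth u n * cnj (ell2_nth v n)))" for u v :: ell2
    by (rule summable_Re[OF ell2_nth_prod_summable])
  show "inner x y = inner y x"
    unfolding in_eq by (intro suminf_cong) (simp add: algebra_simps)
  show "inner (x + y) z = inner x z + inner y z"
    unfolding in_eq suminf_add[OF sm sm]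
    by (intro suminf_cong) (simp add: plus_ell2.rep_eq algebra_simps)
  show "inner (r *\<^sub>R x) y = r * inner x y"
    unfolding in_eq suminf_mult[OF sm, symmetric]
    by (intro suminf_cong) (simp add: scaleR_ell2_def ell2_scale.rep_eq algebra_simps)
  have sq: "Re (ell2_nth x n * cnj (ell2_nth x n)) = (cmod (ell2_nth x n))\<^sup>2" for n
    by (simp add: complex_norm_square[symmetric] del: complex_cnj_mult)
  show "0 \<le> inner x x"
    unfolding in_eq sq by (intro suminf_nonneg ell2_nth_summable) simp
  show "inner x x = 0 \<longleftrightarrow> x = 0"
    unfolding in_eq sq
    by (subst suminf_eq_zero_iff[OF ell2_nth_summable])
      (simp_all add: ell2_nth_inject[symmetric] zero_ell2.rep_eq fun_eq_iff)
qed

end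

global_interpretation ell2: vector_space ell2_scale
  by unfold_locales (transfer, simp add: fun_eq_iff algebra_simps)+

definition bounded_operator :: "(ell2 \<Rightarrow> ell2) \<Rightarrow> bool" where
  "bounded_operator A \<longleftrightarrow>
     bounded_linear A \<and> (\<forall>c x. A (ell2_scale c x) = ell2_scale c (A x))"

definition compact_operator :: "(ell2 \<Rightarrow> ell2) \<Rightarrow> bool" where
  "compact_operator A \<longleftrightarrow> bounded_operator A \<and> compact (closure (A ` cball 0 1))"

definition self_adjoint :: "(ell2 \<Rightarrow> ell2) \<Rightarrow> bool" where
  "self_adjoint A \<longleftrightarrow> bounded_operator A \<and>
     (\<forall>x y. ell2_cinner (A x) y = ell2_cinner x (A y))"

definition operator_adjoint :: "(ell2 \<Rightarrow> ell2) \<Rightarrow> (ell2 \<Rightarrow> ell2)" where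
  "operator_adjoint A =
     (THE B. bounded_operator B \<and> (\<forall>x y. ell2_cinner (A x) y = ell2_cinner x (B y)))"

definition eigenspace :: "(ell2 \<Rightarrow> ell2) \<Rightarrow> real \<Rightarrow> ell2 set" where
  "eigenspace A \<mu> = {x. A x = \<mu> *\<^sub>R x}"

text \<open>Number of real eigenvalues greater than \<open>t\<close>, counted with their multiplicity
  \<open>ell2.dim\<close>, the dimension over the complex numbers.  For a compact self-adjoint operator and
  \<open>t > 0\<close> the sum is finite, and so is each multiplicity.\<close>

definition eigenvalue_count :: "real \<Rightarrow> (ell2 \<Rightarrow> ell2) \<Rightarrow> nat" where
  "eigenvalue_count t A =
     (\<Sum>\<mu> \<in> {\<mu>. \<mu> > t \<and> eigenspace A \<mu> \<noteq> {0}}. ell2.dim (eigenspace A \<mu>))"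

definition n_plus :: "real \<Rightarrow> (ell2 \<Rightarrow> ell2) \<Rightarrow> nat" where
  "n_plus t K = eigenvalue_count t K"

definition n_minus :: "real \<Rightarrow> (ell2 \<Rightarrow> ell2) \<Rightarrow> nat" where
  "n_minus t K = eigenvalue_count t (\<lambda>x. - K x)"

text \<open>The nonzero singular values of \<open>K\<close> are the \<open>s > 0\<close> such that \<open>s\<^sup>2\<close> is an eigenvalue of
  \<open>K\<^sup>*K\<close>, with the same multiplicity.\<close>

definition singular_count :: "real \<Rightarrow> (ell2 \<Rightarrow> ell2) \<Rightarrow> nat" where
  "singular_count t K =
     (\<Sum>s \<in> {s. s > t \<and> eigenspace (operator_adjoint K \<circ> K) (s\<^sup>2) \<noteq> {0}}.
        ell2.dim (eigenspace (operator_adjoint K \<circ> K) (s\<^sup>2)))"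

text \<open>Nonincreasing enumeration of the singular values with multiplicity, starting at index 0
  and continued by zeros.  The value \<open>t = 0\<close> is left out because there may be infinitely many
  positive singular values, where \<open>singular_count 0 K\<close> would not be the true count.\<close>

definition singular_value :: "(ell2 \<Rightarrow> ell2) \<Rightarrow> nat \<Rightarrow> real" where
  "singular_value K n = Inf {t. t > 0 \<and> singular_count t K \<le> n}"

definition schatten_class :: "real \<Rightarrow> (ell2 \<Rightarrow> ell2) set" where
  "schatten_class p = {A. compact_operator A \<and> summable (\<lambda>n. singular_value A n powr p)}"

definition schatten_norm :: "real \<Rightarrow> (ell2 \<Rightarrow> ell2) \<Rightarrow> real" where
  "schatten_norm p A = (\<Sum>n. singular_value A n powr p) powr (1 / p)"

definition matrix_entry :: "(ell2 \<Rightarrow> ell2) \<Rightarrow> nat \<Rightarrow> nat \<Rightarrow> complex" where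
  "matrix_entry A j k = ell2_cinner (A (ell2_basis j)) (ell2_basis k)"

definition is_operator_matrix :: "(nat \<Rightarrow> nat \<Rightarrow> complex) \<Rightarrow> bool" where
  "is_operator_matrix a \<longleftrightarrow> (\<exists>A. bounded_operator A \<and> matrix_entry A = a)"

definition operator_of_matrix :: "(nat \<Rightarrow> nat \<Rightarrow> complex) \<Rightarrow> (ell2 \<Rightarrow> ell2)" where
  "operator_of_matrix a = (THE A. bounded_operator A \<and> matrix_entry A = a)"

text \<open>The operator \<open>schur \<sigma> A\<close> is meaningful only if \<open>schur_defined \<sigma> A\<close> holds.\<close>

definition schur_defined :: "(nat \<Rightarrow> nat \<Rightarrow> complex) \<Rightarrow> (ell2 \<Rightarrow> ell2) \<Rightarrow> bool" where
  "schur_defined \<sigma> A \<longleftrightarrow> is_operator_matrix (\<lambda>j k. \<sigma> j k * matrix_entry A j k)"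

definition schur :: "(nat \<Rightarrow> nat \<Rightarrow> complex) \<Rightarrow> (ell2 \<Rightarrow> ell2) \<Rightarrow> (ell2 \<Rightarrow> ell2)" where
  "schur \<sigma> A = operator_of_matrix (\<lambda>j k. \<sigma> j k * matrix_entry A j k)"

text \<open>The supremum is infinite as soon as some \<open>A\<close> of Schatten norm 1 is mapped outside the
  Schatten class.\<close>

definition multiplier_norm :: "real \<Rightarrow> (nat \<Rightarrow> nat \<Rightarrow> complex) \<Rightarrow> ennreal" where
  "multiplier_norm p \<sigma> =
     (SUP A \<in> {A. A \<in> schatten_class p \<and> schatten_norm p A = 1}.
        if schur_defined \<sigma> A \<and> schur \<sigma> A \<in> schatten_class p
        then ennreal (schatten_norm p (schur \<sigma> A)) else \<infinity>)"

definition dilate :: "(real \<Rightarrow> real \<Rightarrow> complex) \<Rightarrow> nat \<Rightarrow> nat \<Rightarrow> nat \<Rightarrow> complex" where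
  "dilate \<tau> N j k = \<tau> (real j / real N) (real k / real N)"

text \<open>Functions on the unit circle are functions on the complex plane whose values are used on
  \<open>sphere 0 1\<close> only.\<close>

definition bounded_symbol :: "(complex \<Rightarrow> complex) \<Rightarrow> bool" where
  "bounded_symbol \<omega> \<longleftrightarrow> (\<lambda>\<theta>. \<omega> (cis \<theta>)) \<in> borel_measurable lebesgue \<and>
     (\<exists>C. AE \<theta> in lebesgue. cmod (\<omega> (cis \<theta>)) \<le> C)"

definition fourier_coeff :: "(complex \<Rightarrow> complex) \<Rightarrow> int \<Rightarrow> complex" where
  "fourier_coeff \<omega> j =
     (LINT \<theta>:{0..2 * pi}|lebesgue. \<omega> (cis \<theta>) * cis (- (of_int j * \<theta>))) / (2 * pi)"

definition hankel :: "(int \<Rightarrow> complex) \<Rightarrow> (ell2 \<Rightarrow> ell2)" where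
  "hankel a = operator_of_matrix (\<lambda>j k. a (int (j + k)))"

definition PC :: "(complex \<Rightarrow> complex) set" where
  "PC = {\<omega>. \<forall>z \<in> sphere 0 1.
     (\<exists>l. ((\<lambda>\<epsilon>. \<omega> (z * cis \<epsilon>)) \<longlongrightarrow> l) (at_right 0)) \<and>
     (\<exists>l. ((\<lambda>\<epsilon>. \<omega> (z * cis (- \<epsilon>))) \<longlongrightarrow> l) (at_right 0))}"

definition limit_plus :: "(complex \<Rightarrow> complex) \<Rightarrow> complex \<Rightarrow> complex" where
  "limit_plus \<omega> z = Lim (at_right 0) (\<lambda>\<epsilon>. \<omega> (z * cis \<epsilon>))"

definition limit_minus :: "(complex \<Rightarrow> complex) \<Rightarrow> complex \<Rightarrow> complex" where
  "limit_minus \<omega> z = Lim (at_right 0) (\<lambda>\<epsilon>. \<omega> (z * cis (- \<epsilon>)))"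

definition half_jump :: "(complex \<Rightarrow> complex) \<Rightarrow> complex \<Rightarrow> complex" where
  "half_jump \<omega> z = (limit_plus \<omega> z - limit_minus \<omega> z) / 2"

definition jump_set :: "(complex \<Rightarrow> complex) \<Rightarrow> complex set" where
  "jump_set \<omega> = {z \<in> sphere 0 1. half_jump \<omega> z \<noteq> 0}"

definition gamma_symbol :: "complex \<Rightarrow> complex" where
  "gamma_symbol v = \<i> / pi * cis (- Arg2pi v) * (pi - Arg2pi v)"

definition log_density :: "real \<Rightarrow> real" where
  "log_density t =
     (if 0 < t \<and> t \<le> 1 then 1 / pi\<^sup>2 * ln ((1 + sqrt (1 - t\<^sup>2)) / t) else 0)"

end

theory Submission
  imports Defs "HOL-Complex_Analysis.Complex_Analysis"
begin

text \<open>With \<open>a\<^sub>z = - \<i> \<kappa>\<^sub>z\<close>, the cut-off Hankel matrix differs from the sharp truncation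
  \<open>J\<^sub>N(j,k) = \<Sum>\<^sub>z a\<^sub>z cnj z^(j+k) / (\<pi> (j+k+1))\<close> for \<open>j + k < N\<close>, zero otherwise, by a matrix of uniformly bounded
  Hilbert--Schmidt norm (this uses \<open>\<alpha>, \<beta> > 1/2\<close>) and by Schur multiples of one fixed Schatten class operator.
  Outside a space of bounded dimension both perturbations are small, so only \<open>J\<^sub>N\<close> has to be counted, up to
  \<open>O(1)\<close> errors.

  Lower bound: averaging the truncated Hilbert matrix over geometric blocks gives a Toeplitz matrix with symbol
  close to \<open>sech (\<pi> \<xi>)\<close>, whence \<open>(log_density t - \<epsilon>) ln N - O(1)\<close> eigenvalues above \<open>t\<close>; test vectors
  modulated by different \<open>z\<close> decouple by Abel summation.  Upper bound: the squared Hilbert--Schmidt norm of \<open>J\<^sub>N\<close>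
  is \<open>(\<Sum>\<^sub>z |a\<^sub>z|\<^sup>2 / \<pi>\<^sup>2) ln N + O(1)\<close>, which is exactly what the lower bounds at all levels add up to, so none
  of them can be improved.  In the self-adjoint case the positive and the negative lower bounds add up to the
  singular value count, which settles both signs.\<close>

section \<open>Square summable sequences and bounded operators\<close>

text \<open>The logarithmic count arises as follows. With ratio q and h = ln q, about M = ln N / h
  geometric blocks fit below N. The k-th Fourier mode on them has frequency 2 pi k / (M h), so about
  (x / pi) ln N modes have frequency at most x; and sech (pi x) = t turns x / pi into arcosh (1 / t)
  / pi^2, which is \<open>log_density t\<close>. Test vectors bound counts only from below, and a
  direct upper bound would need the form on a whole complement. The Hilbert--Schmidt norm can
  replace this because the integral of 2 t \<open>log_density t\<close> over (0,1) is exactly 1 /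
  pi^2; a jump of modulus |a| scales it by |a|^2. Each jump enters as U H U with the same rotation U
  on both sides, not as a conjugate of H. Hence a vector is tested against a partner built with
  conjugate rotations. Cross terms are small only when they contain H U H with a nontrivial rotation
  U, so the pieces of a test vector must have the form H g with control of g; this is why they are
  spanned by eigenvectors of H whose eigenvalues stay away from 0.\<close>

lemma ell2_eqI: "(\<And>n. ell2_nth x n = ell2_nth y n) \<Longrightarrow> x = y"
  by (simp add: ell2_nth_inject[symmetric] fun_eq_iff)

lemma ell2_nth_add [simp]: "ell2_nth (x + y) n = ell2_nth x n + ell2_nth y n"
  by (simp add: plus_ell2.rep_eq)

lemma ell2_nth_uminus [simp]: "ell2_nth (- x) n = - ell2_nth x n"
  by (simp add: uminus_ell2.rep_eq)

lemma ell2_nth_diff [simp]: "ell2_nth (x - y) n = ell2_nth x n - ell2_nth y n"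
  unfolding minus_ell2_def ell2_nth_add ell2_nth_uminus by simp

lemma ell2_nth_zero [simp]: "ell2_nth 0 n = 0"
  by (simp add: zero_ell2.rep_eq)

lemma ell2_nth_scale [simp]: "ell2_nth (ell2_scale c x) n = c * ell2_nth x n"
  by (simp add: ell2_scale.rep_eq)

lemma ell2_nth_basis [simp]: "ell2_nth (ell2_basis j) n = (if n = j then 1 else 0)"
  by (simp add: ell2_basis.rep_eq)

lemma ell2_scaleR: "r *\<^sub>R (x :: ell2) = ell2_scale (of_real r) x"
  by (simp add: scaleR_ell2_def)

lemma ell2_nth_sum [simp]: "ell2_nth (sum f I) n = (\<Sum>i\<in>I. ell2_nth (f i) n)"
  by (induction I rule: infinite_finite_induct) auto

lemma cinner_commute: "ell2_cinner x y = cnj (ell2_cinner y x)"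
  unfolding ell2_cinner_def bounded_linear.suminf[OF bounded_linear_cnj ell2_nth_prod_summable]
  by (simp add: mult.commute)

lemma cinner_add_left: "ell2_cinner (x + y) z = ell2_cinner x z + ell2_cinner y z"
  unfolding ell2_cinner_def suminf_add[OF ell2_nth_prod_summable ell2_nth_prod_summable]
  by (simp add: algebra_simps)

lemma cinner_scale_left: "ell2_cinner (ell2_scale c x) z = c * ell2_cinner x z"
  unfolding ell2_cinner_def suminf_mult[OF ell2_nth_prod_summable, symmetric]
  by (simp add: algebra_simps)

lemma cinner_add_right: "ell2_cinner z (x + y) = ell2_cinner z x + ell2_cinner z y"
  using cinner_add_left[of x y z] by (metis cinner_commute complex_cnj_add)

lemma cinner_scale_right: "ell2_cinner z (ell2_scale c x) = cnj c * ell2_cinner z x"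
  using cinner_scale_left[of c x z] by (metis cinner_commute complex_cnj_mult)

lemma cinner_zero [simp]: "ell2_cinner 0 x = 0" "ell2_cinner x 0 = 0"
  by (simp_all add: ell2_cinner_def)

lemma cinner_uminus_left: "ell2_cinner (- x) z = - ell2_cinner x z"
  using cinner_add_left[of x "-x" z] by (simp add: add_eq_0_iff)

lemma cinner_uminus_right: "ell2_cinner z (- x) = - ell2_cinner z x"
  using cinner_add_right[of z x "-x"] by (simp add: add_eq_0_iff)

lemma cinner_diff_left: "ell2_cinner (x - y) z = ell2_cinner x z - ell2_cinner y z"
  using cinner_add_left[of x "-y" z] by (simp add: cinner_uminus_left)

lemma cinner_diff_right: "ell2_cinner z (x - y) = ell2_cinner z x - ell2_cinner z y"
  using cinner_add_right[of z x "-y"] by (simp add: cinner_uminus_right)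

lemma cinner_sum_left: "ell2_cinner (sum f I) z = (\<Sum>i\<in>I. ell2_cinner (f i) z)"
  by (induction I rule: infinite_finite_induct) (auto simp: cinner_add_left)

lemma cinner_sum_right: "ell2_cinner z (sum f I) = (\<Sum>i\<in>I. ell2_cinner z (f i))"
  by (induction I rule: infinite_finite_induct) (auto simp: cinner_add_right)

lemmas cinner_simps = cinner_add_left cinner_add_right cinner_diff_left cinner_diff_right
  cinner_uminus_left cinner_uminus_right cinner_scale_left cinner_scale_right

lemma norm_ell2_power2: "(norm x)\<^sup>2 = (\<Sum>n. (cmod (ell2_nth x n))\<^sup>2)"
proof -
  have "(norm x)\<^sup>2 = Re (ell2_cinner x x)"
    by (simp add: power2_norm_eq_inner inner_ell2_def)
  also have "ell2_cinner x x = of_real (\<Sum>n. (cmod (ell2_nth x n))\<^sup>2)"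
    unfolding ell2_cinner_def
    by (simp add: suminf_of_real[OF ell2_nth_summable] complex_norm_square[symmetric] del: complex_cnj_mult)
  finally show ?thesis by simp
qed

lemma cinner_self: "ell2_cinner x x = of_real ((norm x)\<^sup>2)"
  unfolding norm_ell2_power2 ell2_cinner_def
  by (simp add: suminf_of_real[OF ell2_nth_summable] complex_norm_square[symmetric] del: complex_cnj_mult)

lemma norm_ell2_scale: "norm (ell2_scale c x) = cmod c * norm x"
proof -
  have "(norm (ell2_scale c x))\<^sup>2 = (cmod c * norm x)\<^sup>2"
    by (simp add: norm_ell2_power2 power_mult_distrib norm_mult suminf_mult[OF ell2_nth_summable])
  then show ?thesis by (simp add: power2_eq_iff_nonneg)
qed

lemma cinner_basis: "ell2_cinner x (ell2_basis k) = ell2_nth x k"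
proof -
  have "ell2_cinner x (ell2_basis k) = (\<Sum>n\<in>{k}. ell2_nth x n * cnj (ell2_nth (ell2_basis k) n))"
    unfolding ell2_cinner_def by (rule suminf_finite) auto
  then show ?thesis by simp
qed

lemma cinner_cauchy_schwarz: "cmod (ell2_cinner x y) \<le> norm x * norm y"
proof (cases "ell2_cinner x y = 0")
  case False
  \<comment> \<open>Rotating x by this phase makes the inner product real and nonnegative, so the
    real Cauchy--Schwarz inequality of the type class applies.\<close>
  define u where "u = cnj (sgn (ell2_cinner x y))"
  have u: "cmod u = 1" using False by (simp add: u_def norm_sgn)
  have "ell2_cinner x y * cnj (ell2_cinner x y)
      = of_real (cmod (ell2_cinner x y)) * of_real (cmod (ell2_cinner x y))"
    using complex_norm_square[of "ell2_cinner x y"] by (simp add: power2_eq_square)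
  then have "ell2_cinner (ell2_scale u x) y = of_real (cmod (ell2_cinner x y))"
    using False by (simp add: u_def cinner_scale_left complex_sgn_def scaleR_conv_of_real
        divide_simps mult.commute)
  then have "cmod (ell2_cinner x y) = inner (ell2_scale u x) y"
    by (simp add: inner_ell2_def)
  also have "\<dots> \<le> norm (ell2_scale u x) * norm y" by (rule norm_cauchy_schwarz)
  finally show ?thesis by (simp add: norm_ell2_scale u)
qed simp

lemma Re_cinner_le: "Re (ell2_cinner x y) \<le> norm x * norm y"
  using cinner_cauchy_schwarz complex_Re_le_cmod order_trans by blast

section \<open>Linear combinations and orthonormal families\<close>

definition lincomb :: "'i set \<Rightarrow> ('i \<Rightarrow> complex) \<Rightarrow> ('i \<Rightarrow> ell2) \<Rightarrow> ell2" where
  "lincomb I c v = (\<Sum>i\<in>I. ell2_scale (c i) (v i))"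

definition orthonormal :: "'i set \<Rightarrow> ('i \<Rightarrow> ell2) \<Rightarrow> bool" where
  "orthonormal I e \<longleftrightarrow> (\<forall>i\<in>I. \<forall>j\<in>I. ell2_cinner (e i) (e j) = (if i = j then 1 else 0))"

lemma orthonormalD:
  "orthonormal I e \<Longrightarrow> i \<in> I \<Longrightarrow> j \<in> I \<Longrightarrow> ell2_cinner (e i) (e j) = (if i = j then 1 else 0)"
  by (simp add: orthonormal_def)

lemma orthonormal_subset: "orthonormal I e \<Longrightarrow> J \<subseteq> I \<Longrightarrow> orthonormal J e"
  unfolding orthonormal_def by blast

lemma orthonormal_norm: "orthonormal I e \<Longrightarrow> i \<in> I \<Longrightarrow> norm (e i) = 1"
  using orthonormalD[of I e i i] cinner_self[of "e i"] power2_eq_imp_eq[of "norm (e i)" 1]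
  by (simp flip: of_real_power)

lemma cinner_lincomb_left: "ell2_cinner (lincomb I c v) y = (\<Sum>i\<in>I. c i * ell2_cinner (v i) y)"
  by (simp add: lincomb_def cinner_sum_left cinner_scale_left)

lemma cinner_lincomb_right: "ell2_cinner y (lincomb I c v) = (\<Sum>i\<in>I. cnj (c i) * ell2_cinner y (v i))"
  by (simp add: lincomb_def cinner_sum_right cinner_scale_right)

lemma cinner_lincomb_orthonormal:
  assumes "finite I" "orthonormal I e" "i \<in> I"
  shows "ell2_cinner (lincomb I c e) (e i) = c i"
proof -
  have "(\<Sum>j\<in>I. c j * ell2_cinner (e j) (e i)) = (\<Sum>j\<in>I. if j = i then c i else 0)"
    using orthonormalD[OF assms(2)] assms(3) by (intro sum.cong) auto
  with assms show ?thesis by (simp add: cinner_lincomb_left)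
qed

lemma cinner_lincomb_lincomb:
  assumes "finite I" "orthonormal I e"
  shows "ell2_cinner (lincomb I c e) (lincomb I d e) = (\<Sum>i\<in>I. c i * cnj (d i))"
  unfolding cinner_lincomb_right
  by (intro sum.cong) (auto simp: cinner_lincomb_orthonormal[OF assms] mult.commute)

lemma norm_lincomb_orthonormal:
  assumes "finite I" "orthonormal I e"
  shows "(norm (lincomb I c e))\<^sup>2 = (\<Sum>i\<in>I. (cmod (c i))\<^sup>2)"
proof -
  have "complex_of_real ((norm (lincomb I c e))\<^sup>2) = of_real (\<Sum>i\<in>I. (cmod (c i))\<^sup>2)"
    unfolding cinner_self[symmetric] cinner_lincomb_lincomb[OF assms]
    by (simp add: complex_norm_square del: of_real_power)
  then show ?thesis by (rule of_real_eq_iff[THEN iffD1])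
qed

lemma bessel_inequality:
  assumes "finite I" "orthonormal I e"
  shows "(\<Sum>i\<in>I. (cmod (ell2_cinner x (e i)))\<^sup>2) \<le> (norm x)\<^sup>2"
proof -
  define y where "y = lincomb I (\<lambda>i. ell2_cinner x (e i)) e"
  have yy: "ell2_cinner y y = of_real (\<Sum>i\<in>I. (cmod (ell2_cinner x (e i)))\<^sup>2)"
    unfolding y_def cinner_lincomb_lincomb[OF assms]
    by (simp add: complex_norm_square del: of_real_power)
  have xy: "ell2_cinner x y = of_real (\<Sum>i\<in>I. (cmod (ell2_cinner x (e i)))\<^sup>2)"
    unfolding y_def cinner_lincomb_right
    by (simp add: complex_norm_square mult.commute del: of_real_power)
  then have yx: "ell2_cinner y x = of_real (\<Sum>i\<in>I. (cmod (ell2_cinner x (e i)))\<^sup>2)"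
    by (subst cinner_commute) simp
  have "ell2_cinner (x - y) (x - y) = of_real ((norm x)\<^sup>2 - (\<Sum>i\<in>I. (cmod (ell2_cinner x (e i)))\<^sup>2))"
    unfolding cinner_diff_left cinner_diff_right xy yx yy cinner_self[of x] by simp
  then have "(norm (x - y))\<^sup>2 = (norm x)\<^sup>2 - (\<Sum>i\<in>I. (cmod (ell2_cinner x (e i)))\<^sup>2)"
    unfolding cinner_self by (rule of_real_eq_iff[THEN iffD1])
  then show ?thesis using zero_le_power2[of "norm (x - y)"] by linarith
qed

lemma lincomb_cong: "(\<And>i. i \<in> I \<Longrightarrow> c i = d i) \<Longrightarrow> (\<And>i. i \<in> I \<Longrightarrow> v i = w i) \<Longrightarrow> lincomb I c v = lincomb I d w"
  by (simp add: lincomb_def)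

section \<open>Complex linear bounded operators and linear systems\<close>

lemma bounded_operatorD:
  assumes "bounded_operator A"
  shows "A (x + y) = A x + A y" "A (x - y) = A x - A y" "A (ell2_scale c x) = ell2_scale c (A x)"
    "A 0 = 0" "A (- x) = - A x" "A (r *\<^sub>R x) = r *\<^sub>R A x" "A (sum f I) = (\<Sum>i\<in>I. A (f i))"
    "A (lincomb I d v) = lincomb I d (\<lambda>i. A (v i))"
proof -
  have A: "linear A" "\<And>c x. A (ell2_scale c x) = ell2_scale c (A x)"
    using assms bounded_linear.linear[of A] by (auto simp: bounded_operator_def)
  show "A (x + y) = A x + A y" "A (x - y) = A x - A y" "A (ell2_scale c x) = ell2_scale c (A x)"
    "A 0 = 0" "A (- x) = - A x" "A (r *\<^sub>R x) = r *\<^sub>R A x" "A (sum f I) = (\<Sum>i\<in>I. A (f i))"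
    using A linear_add[of A] linear_diff[of A] linear_0[of A] linear_neg[of A] linear_scale[of A]
      linear_sum[of A] by simp_all
  show "A (lincomb I d v) = lincomb I d (\<lambda>i. A (v i))"
    by (simp add: lincomb_def linear_sum[OF A(1)] A(2))
qed

lemma bounded_operator_bound:
  assumes "bounded_operator A"
  obtains B where "B > 0" "\<And>x. norm (A x) \<le> B * norm x"
proof -
  from assms have "bounded_linear A" by (simp add: bounded_operator_def)
  from bounded_linear.pos_bounded[OF this] show ?thesis
    using that by (metis mult.commute)
qed

lemma bounded_operatorI:
  assumes "\<And>x y. A (x + y) = A x + A y" "\<And>c x. A (ell2_scale c x) = ell2_scale c (A x)"
    "\<And>x. norm (A x) \<le> B * norm x"
  shows "bounded_operator A"
proof -
  have "bounded_linear A"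
    by (rule bounded_linear_intro[of _ B]) (use assms in \<open>simp_all add: ell2_scaleR mult.commute\<close>)
  with assms(2) show ?thesis by (simp add: bounded_operator_def)
qed

lemma bounded_operator_compose:
  assumes "bounded_operator A" "bounded_operator B"
  shows "bounded_operator (A \<circ> B)"
  using assms bounded_linear_compose[of A B] by (simp add: bounded_operator_def o_def)

lemma bounded_operator_add:
  assumes "bounded_operator A" "bounded_operator B"
  shows "bounded_operator (\<lambda>x. A x + B x)"
  using assms bounded_linear_add[of A B] by (simp add: bounded_operator_def ell2.scale_right_distrib)

lemma bounded_operator_uminus:
  assumes "bounded_operator A"
  shows "bounded_operator (\<lambda>x. - A x)"
  using assms bounded_linear_minus[of A] by (simp add: bounded_operator_def ell2.scale_minus_right)

lemma bounded_operator_scale: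
  assumes "bounded_operator A"
  shows "bounded_operator (\<lambda>x. ell2_scale c (A x))"
proof -
  obtain B where B: "B > 0" "\<And>x. norm (A x) \<le> B * norm x"
    using bounded_operator_bound[OF assms] by metis
  show ?thesis
  proof (rule bounded_operatorI[of _ "cmod c * B"])
    show "norm (ell2_scale c (A x)) \<le> cmod c * B * norm x" for x
      using mult_left_mono[OF B(2)[of x], of "cmod c"] by (simp add: norm_ell2_scale mult.assoc)
  qed (simp_all add: bounded_operatorD[OF assms] ell2.scale_right_distrib mult.commute)
qed

text \<open>Gaussian elimination, one equation per induction step. The min-max comparisons below
  rest on it: constraints are the equations and coefficients of test vectors the unknowns, so test
  vectors never have to be shown independent.\<close>

lemma homogeneous_system_nontrivial:
  fixes a :: "'i \<Rightarrow> 'q \<Rightarrow> complex"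
  assumes "finite Q" "finite I" "card Q < card I"
  shows "\<exists>c. (\<exists>i\<in>I. c i \<noteq> 0) \<and> (\<forall>q\<in>Q. (\<Sum>i\<in>I. c i * a i q) = 0)"
  using assms
proof (induction Q arbitrary: I a rule: finite_induct)
  case empty
  then have "I \<noteq> {}" by auto
  then show ?case by (intro exI[of _ "\<lambda>_. 1"]) auto
next
  case (insert q Q)
  show ?case
  proof (cases "\<forall>i\<in>I. a i q = 0")
    case True
    obtain c where "\<exists>i\<in>I. c i \<noteq> 0" "\<forall>q\<in>Q. (\<Sum>i\<in>I. c i * a i q) = 0"
      using insert.IH[of I a] insert.prems insert.hyps by (metis card_insert_disjoint Suc_lessD)
    with True show ?thesis by (intro exI[of _ c]) auto
  next
    case False
    then obtain i0 where i0: "i0 \<in> I" "a i0 q \<noteq> 0" by auto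
    define J where "J = I - {i0}"
    \<comment> \<open>Equation \<open>q\<close> is used to eliminate the unknown \<open>i0\<close>
      from the remaining equations; afterwards \<open>d\<close> gives \<open>i0\<close> the value
      that makes equation \<open>q\<close> itself hold.\<close>
    define b where "b i q' = a i q' - a i q / a i0 q * a i0 q'" for i q'
    have J: "finite J" "card Q < card J" using insert i0 by (auto simp: J_def)
    obtain c where c: "\<exists>i\<in>J. c i \<noteq> 0" "\<forall>q'\<in>Q. (\<Sum>i\<in>J. c i * b i q') = 0"
      using insert.IH[OF J, of b] by auto
    define d where "d = c(i0 := - (\<Sum>i\<in>J. c i * a i q) / a i0 q)"
    have split: "(\<Sum>i\<in>I. d i * a i q') = d i0 * a i0 q' + (\<Sum>i\<in>J. c i * a i q')" for q'
    proof -
      have "(\<Sum>i\<in>I. d i * a i q') = d i0 * a i0 q' + (\<Sum>i\<in>J. d i * a i q')"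
        using insert.prems i0 by (simp add: J_def sum.remove)
      moreover have "(\<Sum>i\<in>J. d i * a i q') = (\<Sum>i\<in>J. c i * a i q')"
        by (intro sum.cong) (auto simp: d_def J_def)
      ultimately show ?thesis by simp
    qed
    have "(\<Sum>i\<in>I. d i * a i q') = 0" if "q' \<in> Q" for q'
    proof -
      have "(\<Sum>i\<in>J. c i * b i q') = (\<Sum>i\<in>J. c i * a i q') - (\<Sum>i\<in>J. c i * a i q) / a i0 q * a i0 q'"
        by (simp add: b_def right_diff_distrib sum_subtractf sum_divide_distrib sum_distrib_right mult.assoc)
      with c that show ?thesis unfolding split by (simp add: d_def)
    qed
    moreover have "(\<Sum>i\<in>I. d i * a i q) = 0"
      using i0 unfolding split by (simp add: d_def)
    moreover have "\<exists>i\<in>I. d i \<noteq> 0" using c(1) by (auto simp: d_def J_def)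
    ultimately show ?thesis by (intro exI[of _ d]) auto
  qed
qed

section \<open>Eigenvalue counting for compact self-adjoint operators\<close>

lemma compact_operator_bounded: "compact_operator A \<Longrightarrow> bounded_operator A"
  by (simp add: compact_operator_def)

lemma self_adjoint_bounded: "self_adjoint A \<Longrightarrow> bounded_operator A"
  by (simp add: self_adjoint_def)

lemma self_adjointD: "self_adjoint A \<Longrightarrow> ell2_cinner (A x) y = ell2_cinner x (A y)"
  by (simp add: self_adjoint_def)

lemma bounded_operator_tendsto:
  assumes "bounded_operator A" "(x \<longlongrightarrow> y) F"
  shows "((\<lambda>n. A (x n)) \<longlongrightarrow> A y) F"
  using assms bounded_linear.tendsto[of A] by (simp add: bounded_operator_def)

lemma tendsto_cinner_left:
  assumes "(x \<longlongrightarrow> y) F"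
  shows "((\<lambda>n. ell2_cinner (x n) z) \<longlongrightarrow> ell2_cinner y z) F"
proof (rule bounded_linear.tendsto[OF _ assms])
  show "bounded_linear (\<lambda>x. ell2_cinner x z)"
    by (rule bounded_linear_intro[of _ "norm z"])
      (auto simp: cinner_add_left ell2_scaleR cinner_scale_left scaleR_conv_of_real cinner_cauchy_schwarz)
qed

lemma norm_diff_eigenvectors:
  assumes "ell2_cinner (x :: ell2) y = 0"
  shows "(norm (x - y))\<^sup>2 = (norm x)\<^sup>2 + (norm y)\<^sup>2"
proof -
  have "ell2_cinner y x = 0" using assms cinner_commute[of y x] by simp
  then have "ell2_cinner (x - y) (x - y) = of_real ((norm x)\<^sup>2 + (norm y)\<^sup>2)"
    unfolding cinner_diff_left cinner_diff_right using assms by (simp add: cinner_self[of x] cinner_self[of y])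
  then show ?thesis unfolding cinner_self by (rule of_real_eq_iff[THEN iffD1])
qed

text \<open>A finite cover of the compact image by balls of radius t/2 bounds the number: the images
  of two orthonormal eigenvectors with eigenvalues a, b > t have squared distance a^2 + b^2 > t^2,
  so no ball contains both.\<close>

lemma compact_operator_eigenvectors_bound:
  assumes "compact_operator A" "t > 0"
  shows "\<exists>M. \<forall>(n::nat) e. orthonormal {..<n} e \<and> (\<forall>i<n. \<exists>\<mu>>t. A (e i) = \<mu> *\<^sub>R e i) \<longrightarrow> n \<le> (M::nat)"
proof -
  have "compact (closure (A ` cball 0 1))" using assms by (simp add: compact_operator_def)
  moreover have "closure (A ` cball 0 1) \<subseteq> (\<Union>x\<in>UNIV. ball x (t/2))"
  proof
    fix x :: ell2
    show "x \<in> (\<Union>x\<in>UNIV. ball x (t/2))" by (rule UN_I[of x]) (use assms(2) in simp_all)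
  qed
  ultimately have "\<exists>C\<subseteq>UNIV. finite C \<and> closure (A ` cball 0 1) \<subseteq> (\<Union>x\<in>C. ball x (t/2))"
    using compactE_image[of "closure (A ` cball 0 1)" UNIV "\<lambda>x. ball x (t/2)"] by (metis open_ball)
  then obtain C where C: "finite C" "closure (A ` cball 0 1) \<subseteq> (\<Union>x\<in>C. ball x (t/2))" by blast
  have "n \<le> card C" if e: "orthonormal {..<n} e" "\<forall>i<n. \<exists>\<mu>>t. A (e i) = \<mu> *\<^sub>R e i" for n e
  proof -
    have "\<exists>x\<in>C. A (e i) \<in> ball x (t/2)" if "i < n" for i
    proof -
      have "norm (e i) = 1" using e that by (intro orthonormal_norm) auto
      then have "A (e i) \<in> closure (A ` cball 0 1)"
        by (intro subsetD[OF closure_subset] imageI) auto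
      with C(2) have "A (e i) \<in> (\<Union>x\<in>C. ball x (t/2))" by (rule subsetD)
      then show ?thesis by (rule UN_E) (rule bexI)
    qed
    then obtain g where g: "\<And>i. i < n \<Longrightarrow> g i \<in> C \<and> A (e i) \<in> ball (g i) (t/2)" by metis
    have "inj_on g {..<n}"
    proof (rule inj_onI, rule ccontr)
      fix i j assume ij: "i \<in> {..<n}" "j \<in> {..<n}" "g i = g j" "i \<noteq> j"
      obtain a where a: "a > t" "A (e i) = a *\<^sub>R e i" using e ij by auto
      obtain b where b: "b > t" "A (e j) = b *\<^sub>R e j" using e ij by auto
      have n: "norm (e i) = 1" "norm (e j) = 1" using e ij by (auto intro: orthonormal_norm)
      have "ell2_cinner (A (e i)) (A (e j)) = 0"
        using orthonormalD[OF e(1) ij(1,2)] ij(4) by (simp add: a b ell2_scaleR cinner_simps)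
      from norm_diff_eigenvectors[OF this] have "(norm (A (e i) - A (e j)))\<^sup>2 = a\<^sup>2 + b\<^sup>2"
        using n by (simp add: a b)
      moreover have "a\<^sup>2 > t\<^sup>2" "b\<^sup>2 > 0" using a b assms(2) by (auto intro: power_strict_mono)
      ultimately have "(norm (A (e i) - A (e j)))\<^sup>2 > t\<^sup>2" by linarith
      then have "norm (A (e i) - A (e j)) > t"
        by (rule power_less_imp_less_base) simp
      moreover have "dist (g i) (A (e i)) < t/2" "dist (g i) (A (e j)) < t/2"
        using g[of i] g[of j] ij by auto
      then have "dist (A (e i)) (A (e j)) < t" by (metis dist_commute dist_triangle_half_l)
      ultimately show False by (simp add: dist_norm)
    qed
    then show ?thesis using g C(1) card_inj_on_le[of g "{..<n}" C] by auto
  qed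
  then show ?thesis by blast
qed

text \<open>Cauchy--Schwarz for the nonnegative form \<open>\<mu>\<langle>x,y\<rangle> - \<langle>Ax,y\<rangle>\<close>: almost maximizers of the quotient are
  almost eigenvectors.\<close>

lemma residual_bound:
  assumes "self_adjoint A" "\<And>x. norm (A x) \<le> B * norm x" "\<mu> > 0" "B \<ge> 0"
    and M: "\<And>s. Re (ell2_cinner (A (x - s *\<^sub>R (\<mu> *\<^sub>R x - A x))) (x - s *\<^sub>R (\<mu> *\<^sub>R x - A x)))
              \<le> \<mu> * (norm (x - s *\<^sub>R (\<mu> *\<^sub>R x - A x)))\<^sup>2"
  shows "(norm (\<mu> *\<^sub>R x - A x))\<^sup>2 \<le> (\<mu> + B) * (\<mu> * (norm x)\<^sup>2 - Re (ell2_cinner (A x) x))"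
proof -
  note bo = bounded_operatorD[OF self_adjoint_bounded[OF assms(1)]]
  define w where "w = \<mu> *\<^sub>R x - A x"
  \<comment> \<open>This step length minimizes the quadratic polynomial in s that results when
    -<Aw,w> is replaced by its bound B |w|^2.\<close>
  define s where "s = 1 / (\<mu> + B)"
  define D where "D = \<mu> * (norm x)\<^sup>2 - Re (ell2_cinner (A x) x)"
  have s: "s > 0" using assms by (simp add: s_def)
  have sym: "Re (ell2_cinner (A w) x) = inner (A x) w"
    using self_adjointD[OF assms(1), of w x] cinner_commute[of w "A x"] by (simp add: inner_ell2_def)
  have q: "inner (A (x - s *\<^sub>R w)) (x - s *\<^sub>R w) = inner (A x) x - 2 * s * inner (A x) w + s\<^sup>2 * inner (A w) w"
  proof -
    have "inner (A w) x = inner (A x) w" using sym by (simp add: inner_ell2_def)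
    then show ?thesis
      by (simp add: bo inner_diff_left inner_diff_right power2_eq_square algebra_simps)
  qed
  have n: "(norm (x - s *\<^sub>R w))\<^sup>2 = (norm x)\<^sup>2 - 2 * s * inner x w + s\<^sup>2 * (norm w)\<^sup>2"
    unfolding power2_norm_eq_inner
    by (simp add: inner_diff_left inner_diff_right power2_eq_square inner_commute[of w x] algebra_simps)
  have ww: "(norm w)\<^sup>2 = \<mu> * inner x w - inner (A x) w"
    by (simp add: power2_norm_eq_inner w_def inner_diff_left)
  have Aw: "- inner (A w) w \<le> B * (norm w)\<^sup>2"
  proof -
    have "- inner (A w) w \<le> norm (A w) * norm w"
      using norm_cauchy_schwarz[of "- A w" w] by simp
    also have "\<dots> \<le> B * norm w * norm w" by (intro mult_right_mono assms(2)) simp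
    finally show ?thesis by (simp add: power2_eq_square mult.assoc)
  qed
  have "inner (A (x - s *\<^sub>R w)) (x - s *\<^sub>R w) \<le> \<mu> * (norm (x - s *\<^sub>R w))\<^sup>2"
    using M[of s] by (simp add: w_def inner_ell2_def)
  then have "0 \<le> D - 2 * s * (norm w)\<^sup>2 + s\<^sup>2 * (\<mu> * (norm w)\<^sup>2 - inner (A w) w)"
    unfolding q n D_def by (simp add: ww inner_ell2_def algebra_simps)
  also have "\<dots> \<le> D - 2 * s * (norm w)\<^sup>2 + s\<^sup>2 * ((\<mu> + B) * (norm w)\<^sup>2)"
    using Aw by (intro add_left_mono mult_left_mono) (auto simp: algebra_simps)
  also have "s\<^sup>2 * ((\<mu> + B) * (norm w)\<^sup>2) = s * (norm w)\<^sup>2"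
    using assms by (simp add: s_def power2_eq_square)
  finally have "s * (norm w)\<^sup>2 \<le> D" by simp
  then have "(\<mu> + B) * (s * (norm w)\<^sup>2) \<le> (\<mu> + B) * D"
    using assms by (intro mult_left_mono) auto
  then show ?thesis using assms by (simp add: s_def D_def w_def)
qed

text \<open>The quadratic form is maximized over the unit sphere of the complement \<open>M\<close>,
  which A preserves because the \<open>e i\<close> are eigenvectors of a self-adjoint operator. A
  maximizing sequence consists of almost eigenvectors by \<open>residual_bound\<close>; compactness
  makes the images converge along a subsequence, and since \<mu> > 0 the vectors then converge as
  well.\<close>

lemma eigenvector_in_complement:
  assumes A: "compact_operator A" "self_adjoint A" and t: "t > 0"
    and e: "\<And>i. i \<in> I \<Longrightarrow> A (e i) = l i *\<^sub>R e i"
    and x0: "\<And>i. i \<in> I \<Longrightarrow> ell2_cinner x0 (e i) = 0" "Re (ell2_cinner (A x0) x0) > t * (norm x0)\<^sup>2"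
  shows "\<exists>u \<mu>. norm u = 1 \<and> (\<forall>i\<in>I. ell2_cinner u (e i) = 0) \<and> \<mu> > t \<and> A u = \<mu> *\<^sub>R u"
proof -
  note bA = compact_operator_bounded[OF A(1)]
  note bo = bounded_operatorD[OF bA]
  obtain B where B: "B > 0" "\<And>x. norm (A x) \<le> B * norm x" using bounded_operator_bound[OF bA] by metis
  define M where "M = {x. \<forall>i\<in>I. ell2_cinner x (e i) = 0}"
  define q where "q x = Re (ell2_cinner (A x) x)" for x
  define S where "S = q ` {x\<in>M. norm x = 1}"
  define \<mu> where "\<mu> = Sup S"
  have q_scale: "q (r *\<^sub>R x) = r\<^sup>2 * q x" for r x
    by (simp add: q_def bo ell2_scaleR cinner_simps power2_eq_square mult.assoc)
  have M_scale: "r *\<^sub>R x \<in> M" if "x \<in> M" for r x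
    using that by (simp add: M_def ell2_scaleR cinner_simps)
  have M_diff: "x - y \<in> M" if "x \<in> M" "y \<in> M" for x y
    using that by (simp add: M_def cinner_simps)
  have M_A: "A x \<in> M" if "x \<in> M" for x
    using that by (simp add: M_def self_adjointD[OF A(2)] e ell2_scaleR cinner_simps)
  have q_le: "q x \<le> B * (norm x)\<^sup>2" for x
  proof -
    have "q x \<le> norm (A x) * norm x" by (simp add: q_def Re_cinner_le)
    also have "\<dots> \<le> B * norm x * norm x" by (intro mult_right_mono B) simp
    finally show ?thesis by (simp add: power2_eq_square mult.assoc)
  qed
  have bdd: "bdd_above S"
  proof (rule bdd_aboveI[of _ B])
    fix s assume "s \<in> S"
    then obtain x where "norm x = 1" "s = q x" by (auto simp: S_def)
    then show "s \<le> B" using q_le[of x] by simp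
  qed
  have "x0 \<noteq> 0" using x0(2) by (auto simp: bo)
  define x1 where "x1 = (1 / norm x0) *\<^sub>R x0"
  have x1: "x1 \<in> M" "norm x1 = 1" "q x1 > t"
    using x0 \<open>x0 \<noteq> 0\<close> M_scale[of x0 "1 / norm x0"]
    by (auto simp: x1_def M_def q_scale power_divide field_simps) (simp add: q_def mult.commute)
  have mu: "\<mu> > t"
    using cSup_upper[OF _ bdd, of "q x1"] x1 unfolding \<mu>_def by (force simp: S_def)
  have q_mu: "q x \<le> \<mu> * (norm x)\<^sup>2" if "x \<in> M" for x
  proof (cases "x = 0")
    case False
    have "q ((1 / norm x) *\<^sub>R x) \<in> S"
      using that False M_scale by (auto simp: S_def)
    then have "q ((1 / norm x) *\<^sub>R x) \<le> \<mu>" unfolding \<mu>_def by (rule cSup_upper[OF _ bdd])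
    with False show ?thesis by (simp add: q_scale power_divide field_simps)
  qed (simp add: q_def bo)
  have "\<exists>x. x \<in> M \<and> norm x = 1 \<and> q x > \<mu> - 1 / real (Suc n)" for n
  proof -
    have "S \<noteq> {}" using x1 by (auto simp: S_def)
    then have "\<exists>y\<in>S. \<mu> - 1 / real (Suc n) < y"
      unfolding \<mu>_def by (intro less_cSupD) auto
    then show ?thesis by (auto simp: S_def)
  qed
  then obtain x where x: "\<And>n. x n \<in> M" "\<And>n. norm (x n) = 1" "\<And>n. q (x n) > \<mu> - 1 / real (Suc n)"
    by metis
  have "A (x n) \<in> closure (A ` cball 0 1)" for n
    by (intro subsetD[OF closure_subset] imageI) (simp add: x)
  moreover have "seq_compact (closure (A ` cball 0 1))"
    using A(1) by (simp add: compact_operator_def compact_eq_seq_compact_metric)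
  ultimately obtain y r where r: "strict_mono r" "((\<lambda>n. A (x n)) \<circ> r) \<longlonglongrightarrow> y"
    by (meson seq_compactE)
  have w: "(norm (\<mu> *\<^sub>R x n - A (x n)))\<^sup>2 \<le> (\<mu> + B) * (1 / real (Suc n))" for n
  proof -
    have "(norm (\<mu> *\<^sub>R x n - A (x n)))\<^sup>2 \<le> (\<mu> + B) * (\<mu> * (norm (x n))\<^sup>2 - Re (ell2_cinner (A (x n)) (x n)))"
    proof (rule residual_bound[OF A(2) B(2)])
      fix s
      show "Re (ell2_cinner (A (x n - s *\<^sub>R (\<mu> *\<^sub>R x n - A (x n)))) (x n - s *\<^sub>R (\<mu> *\<^sub>R x n - A (x n))))
         \<le> \<mu> * (norm (x n - s *\<^sub>R (\<mu> *\<^sub>R x n - A (x n))))\<^sup>2"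
        unfolding q_def[symmetric] by (intro q_mu M_diff M_scale M_A x)
    qed (use mu t B in auto)
    also have "\<dots> \<le> (\<mu> + B) * (1 / real (Suc n))"
      using x(2,3)[of n] mu t B(1) by (intro mult_left_mono) (auto simp: q_def)
    finally show ?thesis .
  qed
  have "(\<lambda>n. (\<mu> + B) * (1 / real (Suc n))) \<longlonglongrightarrow> (\<mu> + B) * 0"
    by (intro tendsto_mult tendsto_const LIMSEQ_Suc[OF lim_1_over_n])
  then have lim0: "(\<lambda>n. (\<mu> + B) * (1 / real (Suc n))) \<longlonglongrightarrow> 0" by simp
  have "(\<lambda>n. (norm (\<mu> *\<^sub>R x n - A (x n)))\<^sup>2) \<longlonglongrightarrow> 0"
  proof (rule Lim_null_comparison[OF _ lim0])
    show "\<forall>\<^sub>F n in sequentially. norm ((norm (\<mu> *\<^sub>R x n - A (x n)))\<^sup>2) \<le> (\<mu> + B) * (1 / real (Suc n))"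
      using w by (intro always_eventually allI) (simp only: real_norm_def abs_of_nonneg zero_le_power2)
  qed
  then have "(\<lambda>n. sqrt ((norm (\<mu> *\<^sub>R x n - A (x n)))\<^sup>2)) \<longlonglongrightarrow> sqrt 0" by (rule tendsto_real_sqrt)
  then have "(\<lambda>n. \<mu> *\<^sub>R x n - A (x n)) \<longlonglongrightarrow> 0" by (simp add: tendsto_norm_zero_iff)
  then have "((\<lambda>n. \<mu> *\<^sub>R x n - A (x n)) \<circ> r) \<longlonglongrightarrow> 0" by (rule LIMSEQ_subseq_LIMSEQ[OF _ r(1)])
  from tendsto_add[OF this r(2)] have "(\<lambda>n. \<mu> *\<^sub>R x (r n)) \<longlonglongrightarrow> y" by (simp add: o_def)
  from tendsto_scaleR[OF tendsto_const[of "1/\<mu>"] this] have lim: "(\<lambda>n. x (r n)) \<longlonglongrightarrow> (1/\<mu>) *\<^sub>R y"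
    using mu t by simp
  define u where "u = (1/\<mu>) *\<^sub>R y"
  have "norm u = 1"
    using tendsto_norm[OF lim] unfolding x(2) u_def[symmetric] LIMSEQ_const_iff by simp
  moreover have "ell2_cinner u (e i) = 0" if "i \<in> I" for i
    using tendsto_cinner_left[OF lim, of "e i"] x(1) that
    by (simp add: u_def M_def LIMSEQ_const_iff)
  moreover have "A u = \<mu> *\<^sub>R u"
    using LIMSEQ_unique[OF bounded_operator_tendsto[OF bA lim]] r(2) mu t by (simp add: u_def o_def)
  ultimately show ?thesis using mu by blast
qed

text \<open>A family of maximal length works: the length is bounded by compactness, and a vector
  violating the last claim would produce one more eigenvector. Only the finite part of the spectrum
  above \<open>t\<close> is resolved.\<close>

lemma spectral_theorem_above:
  assumes A: "compact_operator A" "self_adjoint A" and t: "t > 0"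
  shows "\<exists>(n::nat) e l. orthonormal {..<n} e \<and> (\<forall>i<n. A (e i) = l i *\<^sub>R e i \<and> l i > t)
    \<and> (\<forall>x. (\<forall>i<n. ell2_cinner x (e i) = 0) \<longrightarrow> Re (ell2_cinner (A x) x) \<le> t * (norm x)\<^sup>2)"
proof -
  define P where "P n \<longleftrightarrow> (\<exists>e. orthonormal {..<n} e \<and> (\<forall>i<n. \<exists>\<mu>>t. A (e i) = \<mu> *\<^sub>R e i))" for n :: nat
  obtain m where m: "\<And>n. P n \<Longrightarrow> n \<le> m"
    using compact_operator_eigenvectors_bound[OF A(1) t] unfolding P_def by blast
  have "P 0" by (auto simp: P_def orthonormal_def)
  then have "P (Greatest P)" by (rule GreatestI_nat) (use m in auto)
  moreover define n where "n = Greatest P"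
  ultimately obtain e l where e: "orthonormal {..<n} e" "\<And>i. i < n \<Longrightarrow> l i > t \<and> A (e i) = l i *\<^sub>R e i"
    unfolding P_def by metis
  have "Re (ell2_cinner (A x) x) \<le> t * (norm x)\<^sup>2" if x: "\<forall>i<n. ell2_cinner x (e i) = 0" for x
  proof (rule ccontr)
    assume "\<not> ?thesis"
    then obtain u \<mu> where u: "norm u = 1" "\<And>i. i < n \<Longrightarrow> ell2_cinner u (e i) = 0" "\<mu> > t" "A u = \<mu> *\<^sub>R u"
      using eigenvector_in_complement[OF A t, of "{..<n}" e l x] e x by auto
    have "ell2_cinner (e i) u = 0" if "i < n" for i using u(2)[OF that] cinner_commute[of "e i" u] by simp
    then have "orthonormal {..<Suc n} (e(n := u))"
      using e(1) u cinner_self[of u] by (auto simp: orthonormal_def less_Suc_eq)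
    moreover have "\<forall>i<Suc n. \<exists>\<mu>>t. A ((e(n := u)) i) = \<mu> *\<^sub>R (e(n := u)) i"
      using e(2) u by (auto simp: less_Suc_eq)
    ultimately have "P (Suc n)" unfolding P_def by blast
    then have "Suc n \<le> n" unfolding n_def by (rule Greatest_le_nat) (use m in auto)
    then show False by simp
  qed
  with e show ?thesis by (intro exI[of _ n] exI[of _ e] exI[of _ l]) blast
qed

lemma orthonormal_independent:
  assumes "finite I" "orthonormal I e"
  shows "inj_on e I" "ell2.independent (e ` I)"
proof -
  show inj: "inj_on e I"
  proof (rule inj_onI, rule ccontr)
    fix i j assume "i \<in> I" "j \<in> I" "e i = e j" "i \<noteq> j"
    then show False using orthonormalD[OF assms(2), of i j] orthonormalD[OF assms(2), of i i] by simp
  qed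
  have "u v = 0" if u: "(\<Sum>v\<in>e ` I. ell2_scale (u v) v) = 0" and v: "v \<in> e ` I" for u v
  proof -
    obtain i where i: "i \<in> I" "v = e i" using v by auto
    have "lincomb I (\<lambda>i. u (e i)) e = 0" using u inj by (simp add: lincomb_def sum.reindex)
    then show ?thesis
      using cinner_lincomb_orthonormal[OF assms i(1), of "\<lambda>i. u (e i)"] i by simp
  qed
  then show "ell2.independent (e ` I)"
    using ell2.dependent_finite[of "e ` I"] assms(1) by blast
qed

text \<open>Links the count, a sum of dimensions of eigenspaces, to a concrete family. The level
  \<open>t'\<close> may exceed \<open>t\<close>, so one family resolved at a low level yields the
  counts at all higher levels.\<close>

lemma eigenvalue_count_eq:
  fixes n :: nat
  assumes A: "self_adjoint A" and e: "orthonormal {..<n} e" "\<And>i. i < n \<Longrightarrow> A (e i) = l i *\<^sub>R e i \<and> l i > t"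
    and compl: "\<And>x. \<forall>i<n. ell2_cinner x (e i) = 0 \<Longrightarrow> Re (ell2_cinner (A x) x) \<le> t * (norm x)\<^sup>2"
    and t': "t \<le> t'"
  shows "eigenvalue_count t' A = card {i\<in>{..<n}. l i > t'}"
proof -
  note bo = bounded_operatorD[OF self_adjoint_bounded[OF A]]
  define J where "J \<mu> = {i\<in>{..<n}. l i = \<mu>}" for \<mu>
  have J: "finite (J \<mu>)" "orthonormal (J \<mu>) e" for \<mu>
    using e(1) by (auto simp: J_def intro: orthonormal_subset)
  have span: "eigenspace A \<mu> \<subseteq> ell2.span (e ` J \<mu>)" if "\<mu> > t" for \<mu>
  proof
    fix x assume "x \<in> eigenspace A \<mu>"
    then have x: "A x = \<mu> *\<^sub>R x" by (simp add: eigenspace_def)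
    define p where "p = lincomb (J \<mu>) (\<lambda>i. ell2_cinner x (e i)) e"
    define y where "y = x - p"
    have "A p = lincomb (J \<mu>) (\<lambda>i. ell2_cinner x (e i)) (\<lambda>i. \<mu> *\<^sub>R e i)"
      unfolding p_def bo by (intro lincomb_cong) (use e(2) in \<open>auto simp: J_def\<close>)
    then have Ap: "A p = \<mu> *\<^sub>R p"
      by (simp add: lincomb_def p_def scaleR_sum_right ell2_scaleR ell2.scale_sum_right mult.commute)
    then have Ay: "A y = \<mu> *\<^sub>R y" by (simp add: y_def bo x scaleR_diff_right)
    have "ell2_cinner y (e i) = 0" if i: "i < n" for i
    proof (cases "l i = \<mu>")
      case True
      then have "i \<in> J \<mu>" using i by (simp add: J_def)
      then show ?thesis
        using cinner_lincomb_orthonormal[OF J, of i \<mu>] by (simp add: y_def p_def cinner_diff_left)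
    next
      case False
      have "of_real \<mu> * ell2_cinner y (e i) = of_real (l i) * ell2_cinner y (e i)"
        using self_adjointD[OF A, of y "e i"] e(2)[OF i] Ay by (simp add: ell2_scaleR cinner_simps)
      with False show ?thesis by simp
    qed
    then have "Re (ell2_cinner (A y) y) \<le> t * (norm y)\<^sup>2" by (intro compl) auto
    moreover have "Re (ell2_cinner (A y) y) = \<mu> * (norm y)\<^sup>2"
      by (simp add: Ay ell2_scaleR cinner_simps cinner_self[of y])
    ultimately have "(\<mu> - t) * (norm y)\<^sup>2 \<le> 0" by (simp add: algebra_simps)
    with \<open>\<mu> > t\<close> have "y = 0" by (simp add: mult_le_0_iff)
    then have "x = p" by (simp add: y_def)
    moreover have "p \<in> ell2.span (e ` J \<mu>)"
      unfolding p_def lincomb_def by (intro ell2.span_sum ell2.span_scale ell2.span_base imageI)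
    ultimately show "x \<in> ell2.span (e ` J \<mu>)" by simp
  qed
  have sub: "e ` J \<mu> \<subseteq> eigenspace A \<mu>" for \<mu>
    using e(2) by (auto simp: J_def eigenspace_def)
  have dim: "ell2.dim (eigenspace A \<mu>) = card (J \<mu>)" if "\<mu> > t" for \<mu>
    by (rule ell2.dim_unique[OF sub span[OF that]])
      (use orthonormal_independent[OF J] in \<open>auto simp: card_image\<close>)
  have nz: "e i \<noteq> 0" if "i < n" for i
    using orthonormal_norm[OF e(1), of i] that by auto
  define I where "I = {i\<in>{..<n}. l i > t'}"
  have "{\<mu>. \<mu> > t' \<and> eigenspace A \<mu> \<noteq> {0}} = l ` I"
  proof (intro equalityI subsetI)
    fix \<mu> assume "\<mu> \<in> {\<mu>. \<mu> > t' \<and> eigenspace A \<mu> \<noteq> {0}}"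
    then have \<mu>: "\<mu> > t'" "eigenspace A \<mu> \<noteq> {0}" by auto
    have "0 \<in> eigenspace A \<mu>" by (simp add: eigenspace_def bo)
    with \<mu> span[of \<mu>] t' have "J \<mu> \<noteq> {}" by auto
    then show "\<mu> \<in> l ` I" using \<mu>(1) by (auto simp: J_def I_def)
  next
    fix \<mu> assume "\<mu> \<in> l ` I"
    then obtain i where i: "i < n" "\<mu> = l i" "l i > t'" by (auto simp: I_def)
    moreover have "e i \<in> eigenspace A (l i)" using e(2)[OF i(1)] by (simp add: eigenspace_def)
    ultimately show "\<mu> \<in> {\<mu>. \<mu> > t' \<and> eigenspace A \<mu> \<noteq> {0}}"
      using nz[OF i(1)] by auto
  qed
  then have "eigenvalue_count t' A = (\<Sum>\<mu>\<in>l ` I. card {i\<in>I. l i = \<mu>})"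
    unfolding eigenvalue_count_def using t'
    by (auto intro!: sum.cong arg_cong[of _ _ card] simp: I_def dim J_def)
  also have "\<dots> = card I"
    using sum.image_gen[of I "\<lambda>_. 1::nat" l] by (simp add: I_def)
  finally show ?thesis by (simp add: I_def)
qed

lemma eigenvalue_countE:
  assumes "compact_operator A" "self_adjoint A" "t > 0"
  obtains e l where "orthonormal {..<eigenvalue_count t A} e"
    "\<And>i. i < eigenvalue_count t A \<Longrightarrow> A (e i) = l i *\<^sub>R e i \<and> l i > t"
    "\<And>x. \<forall>i<eigenvalue_count t A. ell2_cinner x (e i) = 0 \<Longrightarrow> Re (ell2_cinner (A x) x) \<le> t * (norm x)\<^sup>2"
proof -
  obtain n :: nat and e l where n: "orthonormal {..<n} e" "\<And>i. i < n \<Longrightarrow> A (e i) = l i *\<^sub>R e i \<and> l i > t"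
    "\<And>x. \<forall>i<n. ell2_cinner x (e i) = 0 \<Longrightarrow> Re (ell2_cinner (A x) x) \<le> t * (norm x)\<^sup>2"
    using spectral_theorem_above[OF assms] by blast
  have "{i\<in>{..<n}. l i > t} = {..<n}" using n(2) by auto
  with eigenvalue_count_eq[OF assms(2) n order_refl] have "eigenvalue_count t A = n" by simp
  with n that show thesis by metis
qed

text \<open>Lower half of the min-max principle. If the bound failed, the equations from
  \<open>Q\<close> together with orthogonality to the eigenvectors above \<open>t\<close> would have
  a nonzero solution, on which the form would be both at most and greater than t times the squared
  norm. The \<open>v i\<close> may be dependent: only coefficients are counted.\<close>

lemma eigenvalue_count_ge:
  assumes A: "compact_operator A" "self_adjoint A" "t > 0" and fin: "finite I" "finite Q"
    and *: "\<And>c. \<exists>i\<in>I. c i \<noteq> 0 \<Longrightarrow> \<forall>q\<in>Q. (\<Sum>i\<in>I. c i * b i q) = 0 \<Longrightarrow>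
      Re (ell2_cinner (A (lincomb I c v)) (lincomb I c v)) > t * (norm (lincomb I c v))\<^sup>2"
  shows "card I \<le> eigenvalue_count t A + card Q"
proof (rule ccontr)
  assume "\<not> ?thesis"
  then have less: "card Q + eigenvalue_count t A < card I" by simp
  obtain e where e: "\<And>x. \<forall>i<eigenvalue_count t A. ell2_cinner x (e i) = 0 \<Longrightarrow> Re (ell2_cinner (A x) x) \<le> t * (norm x)\<^sup>2"
    by (rule eigenvalue_countE[OF A]) blast
  define R where "R = Q <+> {..<eigenvalue_count t A}"
  define a where "a i = case_sum (b i) (\<lambda>k. ell2_cinner (v i) (e k))" for i
  have "finite R" "card R < card I" using fin less by (auto simp: R_def card_Plus)
  then obtain c where c: "\<exists>i\<in>I. c i \<noteq> 0" "\<forall>q\<in>R. (\<Sum>i\<in>I. c i * a i q) = 0"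
    using homogeneous_system_nontrivial[OF _ fin(1), of R a] by auto
  have "\<forall>q\<in>Q. (\<Sum>i\<in>I. c i * b i q) = 0" using c(2) by (force simp: R_def a_def)
  from *[OF c(1) this] e[of "lincomb I c v"] c(2) show False
    by (force simp: R_def a_def cinner_lincomb_left)
qed

text \<open>Upper half of the min-max principle: with more eigenvectors than constraints, some
  nonzero combination of them is orthogonal to \<open>F\<close>, and there the form exceeds its
  supposed bound.\<close>

lemma eigenvalue_count_le:
  assumes A: "compact_operator A" "self_adjoint A" "t > 0" and "finite F"
    and *: "\<And>x. \<forall>f\<in>F. ell2_cinner x f = 0 \<Longrightarrow> Re (ell2_cinner (A x) x) \<le> t * (norm x)\<^sup>2"
  shows "eigenvalue_count t A \<le> card F"
proof (rule ccontr)
  let ?n = "eigenvalue_count t A"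
  assume "\<not> ?thesis"
  then have less: "card F < card {..<?n}" by simp
  obtain e l where e: "orthonormal {..<?n} e" "\<And>i. i < ?n \<Longrightarrow> A (e i) = l i *\<^sub>R e i \<and> l i > t"
    by (rule eigenvalue_countE[OF A]) blast
  obtain c where c: "\<exists>i<?n. c i \<noteq> 0" "\<forall>f\<in>F. (\<Sum>i<?n. c i * ell2_cinner (e i) f) = 0"
    using homogeneous_system_nontrivial[OF assms(4) _ less, of "\<lambda>i f. ell2_cinner (e i) f"] by auto
  define x where "x = lincomb {..<?n} c e"
  have "Re (ell2_cinner (A x) x) \<le> t * (norm x)\<^sup>2"
    by (rule *) (use c(2) in \<open>simp add: x_def cinner_lincomb_left\<close>)
  moreover have "A x = lincomb {..<?n} (\<lambda>i. of_real (l i) * c i) e"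
    unfolding x_def bounded_operatorD(8)[OF self_adjoint_bounded[OF A(2)]]
    unfolding lincomb_def by (intro sum.cong) (use e(2) in \<open>auto simp: ell2_scaleR mult.commute\<close>)
  then have "ell2_cinner (A x) x = (\<Sum>i<?n. of_real (l i) * c i * cnj (c i))"
    by (simp add: x_def cinner_lincomb_lincomb[OF _ e(1)])
  then have "ell2_cinner (A x) x = of_real (\<Sum>i<?n. l i * (cmod (c i))\<^sup>2)"
    by (simp only: mult.assoc complex_norm_square[symmetric] of_real_sum of_real_mult)
  ultimately have "(\<Sum>i<?n. l i * (cmod (c i))\<^sup>2) \<le> (\<Sum>i<?n. t * (cmod (c i))\<^sup>2)"
    using norm_lincomb_orthonormal[OF _ e(1), of c] by (simp add: x_def sum_distrib_left)
  moreover have "(\<Sum>i<?n. t * (cmod (c i))\<^sup>2) < (\<Sum>i<?n. l i * (cmod (c i))\<^sup>2)"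
  proof (rule sum_strict_mono_ex1)
    show "\<forall>i\<in>{..<?n}. t * (cmod (c i))\<^sup>2 \<le> l i * (cmod (c i))\<^sup>2"
      using e(2) by (intro ballI mult_right_mono) (auto intro: less_imp_le)
    show "\<exists>i\<in>{..<?n}. t * (cmod (c i))\<^sup>2 < l i * (cmod (c i))\<^sup>2"
    proof -
      from c(1) obtain i where "i < ?n" "c i \<noteq> 0" by auto
      then have "t * (cmod (c i))\<^sup>2 < l i * (cmod (c i))\<^sup>2"
        using e(2)[of i] by (intro mult_strict_right_mono) auto
      with \<open>i < ?n\<close> show ?thesis by blast
    qed
  qed simp
  ultimately show False by simp
qed

section \<open>Matrix entries and singular values\<close>

lemma truncation_tendsto:
  "(\<lambda>M. lincomb {..<M} (ell2_nth x) ell2_basis) \<longlonglongrightarrow> x"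
proof -
  have nth: "ell2_nth (lincomb {..<M} (ell2_nth x) ell2_basis) n = (if n < M then ell2_nth x n else 0)" for M n
    by (simp add: lincomb_def if_distrib[of "\<lambda>u. _ * u"] sum.delta cong: if_cong)
  have "(norm (lincomb {..<M} (ell2_nth x) ell2_basis - x))\<^sup>2 = (\<Sum>n. (cmod (ell2_nth x (n + M)))\<^sup>2)" for M
  proof -
    let ?f = "\<lambda>n. (cmod (ell2_nth (lincomb {..<M} (ell2_nth x) ell2_basis - x) n))\<^sup>2"
    have "(\<Sum>n. ?f n) = (\<Sum>n. ?f (n + M)) + (\<Sum>n<M. ?f n)"
      by (rule suminf_split_initial_segment[OF ell2_nth_summable])
    then show ?thesis unfolding norm_ell2_power2 by (simp add: nth)
  qed
  moreover have "(\<lambda>M. \<Sum>n. (cmod (ell2_nth x (n + M)))\<^sup>2) \<longlonglongrightarrow> 0"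
    by (rule suminf_exist_split2[OF ell2_nth_summable])
  ultimately have "(\<lambda>M. (norm (lincomb {..<M} (ell2_nth x) ell2_basis - x))\<^sup>2) \<longlonglongrightarrow> 0" by simp
  then have "(\<lambda>M. sqrt ((norm (lincomb {..<M} (ell2_nth x) ell2_basis - x))\<^sup>2)) \<longlonglongrightarrow> sqrt 0"
    by (rule tendsto_real_sqrt)
  then show ?thesis by (simp add: tendsto_norm_zero_iff LIM_zero_iff)
qed

text \<open>Finite truncations of a vector converge to it and both operators are continuous. This
  uniqueness is what gives the description \<open>operator_of_matrix\<close> a value.\<close>

lemma bounded_operator_eqI:
  assumes A: "bounded_operator A" and B: "bounded_operator B" and eq: "matrix_entry A = matrix_entry B"
  shows "A = B"
proof
  fix x
  have "A (ell2_basis j) = B (ell2_basis j)" for j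
    by (rule ell2_eqI) (use fun_cong[OF fun_cong[OF eq, of j]] in \<open>simp add: matrix_entry_def cinner_basis\<close>)
  then have "(\<lambda>M. A (lincomb {..<M} (ell2_nth x) ell2_basis)) = (\<lambda>M. B (lincomb {..<M} (ell2_nth x) ell2_basis))"
    by (simp add: bounded_operatorD[OF A] bounded_operatorD[OF B])
  then show "A x = B x"
    using bounded_operator_tendsto[OF A truncation_tendsto[of x]]
      bounded_operator_tendsto[OF B truncation_tendsto[of x]] by (simp add: LIMSEQ_unique)
qed

lemma operator_of_matrix_eq:
  assumes "bounded_operator A" "matrix_entry A = a"
  shows "operator_of_matrix a = A"
  unfolding operator_of_matrix_def using assms bounded_operator_eqI by (intro the_equality) auto

lemma is_operator_matrixD:
  assumes "is_operator_matrix a"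
  shows "bounded_operator (operator_of_matrix a)" "matrix_entry (operator_of_matrix a) = a"
  using assms operator_of_matrix_eq unfolding is_operator_matrix_def by auto

lemma ell2_nth_Abs:
  assumes "\<And>n. (\<Sum>k<n. (cmod (f k))\<^sup>2) \<le> C"
  shows "ell2_nth (Abs_ell2 f) k = f k" "(norm (Abs_ell2 f))\<^sup>2 \<le> C"
proof -
  have s: "summable (\<lambda>k. (cmod (f k))\<^sup>2)" by (rule summableI_nonneg_bounded[OF _ assms]) simp
  then have nth: "ell2_nth (Abs_ell2 f) = f" by (simp add: Abs_ell2_inverse)
  then show "ell2_nth (Abs_ell2 f) k = f k" by simp
  show "(norm (Abs_ell2 f))\<^sup>2 \<le> C"
    unfolding norm_ell2_power2 nth by (rule suminf_le_const[OF s assms])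
qed

lemma sum_cmod_nth_le: "(\<Sum>k<n. (cmod (ell2_nth x k))\<^sup>2) \<le> (norm x)\<^sup>2"
  unfolding norm_ell2_power2 by (rule sum_le_suminf[OF ell2_nth_summable]) auto

lemma adjoint_exists:
  assumes "bounded_operator K"
  shows "\<exists>B. bounded_operator B \<and> (\<forall>x y. ell2_cinner (K x) y = ell2_cinner x (B y))"
proof -
  note bo = bounded_operatorD[OF assms]
  obtain C where C: "C > 0" "\<And>x. norm (K x) \<le> C * norm x" using bounded_operator_bound[OF assms] by metis
  define b where "b y n = ell2_cinner y (K (ell2_basis n))" for y n
  have bound: "(\<Sum>n<M. (cmod (b y n))\<^sup>2) \<le> (C * norm y)\<^sup>2" for y M
  proof -
    \<comment> \<open>Testing K on the truncated candidate gives |v|^2 \<le> C |v| |y|. The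
      resulting bound does not depend on \<open>M\<close>, so the candidate coordinates of the
      adjoint are square summable.\<close>
    define v where "v = lincomb {..<M} (b y) ell2_basis"
    define S where "S = (\<Sum>n<M. (cmod (b y n))\<^sup>2)"
    have on: "orthonormal {..<M} ell2_basis" by (auto simp: orthonormal_def cinner_basis)
    have v: "(norm v)\<^sup>2 = S" unfolding v_def S_def by (rule norm_lincomb_orthonormal[OF _ on]) simp
    have "ell2_cinner (K v) y = (\<Sum>n<M. b y n * cnj (b y n))"
      unfolding v_def bo cinner_lincomb_left b_def by (intro sum.cong arg_cong2[of _ _ _ _ "(*)"] cinner_commute refl)
    also have "\<dots> = of_real S"
      by (simp add: S_def complex_norm_square del: of_real_power)
    finally have "\<bar>S\<bar> \<le> norm (K v) * norm y" using cinner_cauchy_schwarz[of "K v" y] by simp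
    also have "\<dots> \<le> C * norm v * norm y" by (intro mult_right_mono C) simp
    finally have "norm v * norm v \<le> norm v * (C * norm y)"
      using v by (simp add: power2_eq_square mult_ac)
    then have "norm v \<le> C * norm y"
      using C(1) by (cases "norm v = 0") (auto simp: mult_le_cancel_left)
    then show ?thesis using v by (metis S_def norm_ge_zero power_mono)
  qed
  define B where "B y = Abs_ell2 (b y)" for y
  have nth: "ell2_nth (B y) n = b y n" for y n unfolding B_def by (rule ell2_nth_Abs(1)[OF bound])
  have nB: "norm (B y) \<le> C * norm y" for y
  proof (rule power2_le_imp_le)
    show "(norm (B y))\<^sup>2 \<le> (C * norm y)\<^sup>2" unfolding B_def by (rule ell2_nth_Abs(2)[OF bound])
  qed (use C(1) in simp)
  have bB: "bounded_operator B"
    by (rule bounded_operatorI[OF _ _ nB]) (auto intro!: ell2_eqI simp: nth b_def cinner_simps)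
  moreover have "ell2_cinner (K x) y = ell2_cinner x (B y)" for x y
  proof -
    let ?x = "\<lambda>M. lincomb {..<M} (ell2_nth x) ell2_basis"
    have "ell2_cinner (K (ell2_basis n)) y = ell2_cinner (ell2_basis n) (B y)" for n
      using cinner_commute[of "ell2_basis n" "B y"] cinner_commute[of "K (ell2_basis n)" y]
      by (simp add: cinner_basis nth b_def)
    then have "ell2_cinner (K (?x M)) y = ell2_cinner (?x M) (B y)" for M
      by (simp add: bo cinner_lincomb_left)
    moreover have "(\<lambda>M. ell2_cinner (K (?x M)) y) \<longlonglongrightarrow> ell2_cinner (K x) y"
      by (intro tendsto_cinner_left bounded_operator_tendsto[OF assms] truncation_tendsto)
    moreover have "(\<lambda>M. ell2_cinner (?x M) (B y)) \<longlonglongrightarrow> ell2_cinner x (B y)"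
      by (intro tendsto_cinner_left truncation_tendsto)
    ultimately show ?thesis by (simp add: LIMSEQ_unique)
  qed
  ultimately show ?thesis by blast
qed

lemma cinner_ext: "(\<And>x. ell2_cinner x y = ell2_cinner x z) \<Longrightarrow> y = z"
proof -
  assume "\<And>x. ell2_cinner x y = ell2_cinner x z"
  then have "ell2_cinner (y - z) (y - z) = 0" by (simp add: cinner_diff_right)
  then show "y = z" by (simp add: cinner_self)
qed

lemma operator_adjoint:
  assumes "bounded_operator K"
  shows "bounded_operator (operator_adjoint K)" "ell2_cinner (K x) y = ell2_cinner x (operator_adjoint K y)"
proof -
  have "\<exists>!B. bounded_operator B \<and> (\<forall>x y. ell2_cinner (K x) y = ell2_cinner x (B y))"
  proof (rule ex_ex1I[OF adjoint_exists[OF assms]])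
    fix B B' assume B: "bounded_operator B \<and> (\<forall>x y. ell2_cinner (K x) y = ell2_cinner x (B y))"
      "bounded_operator B' \<and> (\<forall>x y. ell2_cinner (K x) y = ell2_cinner x (B' y))"
    show "B = B'" by (rule ext, rule cinner_ext) (use B in metis)
  qed
  from theI'[OF this] have h: "bounded_operator (operator_adjoint K) \<and>
      (\<forall>x y. ell2_cinner (K x) y = ell2_cinner x (operator_adjoint K y))"
    unfolding operator_adjoint_def .
  show "bounded_operator (operator_adjoint K)" by (rule conjunct1[OF h])
  show "ell2_cinner (K x) y = ell2_cinner x (operator_adjoint K y)"
    by (rule conjunct2[OF h, rule_format])
qed

section \<open>Compact operators and their Gram operators\<close>

lemma compact_operator_subset:
  assumes "bounded_operator A" "compact S" "A ` cball 0 1 \<subseteq> S"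
  shows "compact_operator A"
proof -
  have "closure (A ` cball 0 1) \<subseteq> S" using assms by (intro closure_minimal compact_imp_closed) auto
  with assms have "compact (S \<inter> closure (A ` cball 0 1))" by (intro compact_Int_closed) auto
  with \<open>closure (A ` cball 0 1) \<subseteq> S\<close> show ?thesis
    using assms(1) by (simp add: compact_operator_def Int_absorb1)
qed

lemma compact_operator_compose:
  assumes A: "bounded_operator A" and K: "compact_operator K"
  shows "compact_operator (A \<circ> K)"
proof (rule compact_operator_subset)
  show "bounded_operator (A \<circ> K)" by (rule bounded_operator_compose[OF A compact_operator_bounded[OF K]])
  have "continuous_on UNIV A" using A by (simp add: bounded_operator_def linear_continuous_on)
  then show "compact (A ` closure (K ` cball 0 1))"
    using K by (intro compact_continuous_image) (auto simp: compact_operator_def intro: continuous_on_subset)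
  show "(A \<circ> K) ` cball 0 1 \<subseteq> A ` closure (K ` cball 0 1)"
    unfolding image_comp[symmetric] by (intro image_mono closure_subset)
qed

lemma compact_operator_add:
  assumes A: "compact_operator A" and B: "compact_operator B"
  shows "compact_operator (\<lambda>x. A x + B x)"
proof (rule compact_operator_subset)
  show "bounded_operator (\<lambda>x. A x + B x)"
    by (intro bounded_operator_add compact_operator_bounded A B)
  show "compact {x + y | x y. x \<in> closure (A ` cball 0 1) \<and> y \<in> closure (B ` cball 0 1)}"
    using A B by (intro compact_sums) (auto simp: compact_operator_def)
  show "(\<lambda>x. A x + B x) ` cball 0 1 \<subseteq> {x + y | x y. x \<in> closure (A ` cball 0 1) \<and> y \<in> closure (B ` cball 0 1)}"
    using closure_subset[of "A ` cball 0 1"] closure_subset[of "B ` cball 0 1"] by blast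
qed

lemma compact_operator_uminus:
  assumes "compact_operator A"
  shows "compact_operator (\<lambda>x. - A x)"
proof -
  have "bounded_operator uminus"
    by (rule bounded_operatorI[of _ 1]) auto
  from compact_operator_compose[OF this assms] show ?thesis by (simp add: o_def)
qed

lemma self_adjoint_uminus:
  assumes "self_adjoint A"
  shows "self_adjoint (\<lambda>x. - A x)"
  using assms bounded_operator_uminus by (auto simp: self_adjoint_def cinner_simps)

lemma gram_operator:
  assumes "compact_operator K"
  shows "compact_operator (operator_adjoint K \<circ> K)" "self_adjoint (operator_adjoint K \<circ> K)"
    "ell2_cinner ((operator_adjoint K \<circ> K) x) y = ell2_cinner (K x) (K y)"
proof -
  note b = compact_operator_bounded[OF assms]
  note a = operator_adjoint[OF b]
  show "compact_operator (operator_adjoint K \<circ> K)" by (rule compact_operator_compose[OF a(1) assms])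
  have a': "ell2_cinner (operator_adjoint K x) y = ell2_cinner x (K y)" for x y
    using a(2)[of y x] cinner_commute by metis
  show "ell2_cinner ((operator_adjoint K \<circ> K) x) y = ell2_cinner (K x) (K y)" by (simp add: a')
  show "self_adjoint (operator_adjoint K \<circ> K)"
    unfolding self_adjoint_def using bounded_operator_compose[OF a(1) b] by (simp add: a' a(2)[symmetric])
qed

lemma gram_form:
  assumes "compact_operator K"
  shows "Re (ell2_cinner ((operator_adjoint K \<circ> K) x) x) = (norm (K x))\<^sup>2"
  by (simp add: gram_operator(3)[OF assms] cinner_self del: o_apply)

lemma singular_count_eq:
  assumes "t \<ge> 0"
  shows "singular_count t K = eigenvalue_count (t\<^sup>2) (operator_adjoint K \<circ> K)"
  unfolding singular_count_def eigenvalue_count_def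
proof (rule sum.reindex_bij_witness[of _ sqrt "\<lambda>s. s\<^sup>2"])
  fix s assume "s \<in> {s. s > t \<and> eigenspace (operator_adjoint K \<circ> K) (s\<^sup>2) \<noteq> {0}}"
  then show "sqrt (s\<^sup>2) = s" "s\<^sup>2 \<in> {\<mu>. \<mu> > t\<^sup>2 \<and> eigenspace (operator_adjoint K \<circ> K) \<mu> \<noteq> {0}}"
    using assms by (auto intro: power_strict_mono)
next
  fix \<mu> assume \<mu>: "\<mu> \<in> {\<mu>. \<mu> > t\<^sup>2 \<and> eigenspace (operator_adjoint K \<circ> K) \<mu> \<noteq> {0}}"
  then have "\<mu> > t\<^sup>2" by simp
  then have "\<mu> > 0" using zero_le_power2[of t] by linarith
  with \<mu> show "(sqrt \<mu>)\<^sup>2 = \<mu>" "sqrt \<mu> \<in> {s. s > t \<and> eigenspace (operator_adjoint K \<circ> K) (s\<^sup>2) \<noteq> {0}}"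
    by (auto intro: real_less_rsqrt)
qed simp

text \<open>In the usual language, the approximation number of index m + 1 is at most
  \<open>t\<close>. With \<open>m\<close> independent of N, this is the form in which O(1) errors of
  counts are carried through the proof.\<close>

definition small_off :: "(ell2 \<Rightarrow> ell2) \<Rightarrow> real \<Rightarrow> nat \<Rightarrow> bool" where
  "small_off K t m \<longleftrightarrow> (\<exists>F. finite F \<and> card F \<le> m \<and>
     (\<forall>x. (\<forall>f\<in>F. ell2_cinner x f = 0) \<longrightarrow> norm (K x) \<le> t * norm x))"

text \<open>The constraints of both operators are imposed together. This is the counting form of the
  Ky Fan inequality for sums.\<close>

lemma small_off_add:
  assumes "small_off A s m" "small_off B t n"
  shows "small_off (\<lambda>x. A x + B x) (s + t) (m + n)"
proof -
  obtain F where F: "finite F" "card F \<le> m" "\<And>x. \<forall>f\<in>F. ell2_cinner x f = 0 \<Longrightarrow> norm (A x) \<le> s * norm x"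
    using assms(1) unfolding small_off_def by blast
  obtain G where G: "finite G" "card G \<le> n" "\<And>x. \<forall>f\<in>G. ell2_cinner x f = 0 \<Longrightarrow> norm (B x) \<le> t * norm x"
    using assms(2) unfolding small_off_def by blast
  have "norm (A x + B x) \<le> (s + t) * norm x" if "\<forall>f\<in>F \<union> G. ell2_cinner x f = 0" for x
    using norm_triangle_ineq[of "A x" "B x"] F(3)[of x] G(3)[of x] that by (auto simp: algebra_simps)
  then show ?thesis
    unfolding small_off_def using F G card_Un_le[of F G] by (intro exI[of _ "F \<union> G"]) auto
qed

text \<open>The \<open>l i\<close> are square roots of eigenvalues of the Gram operator. The last
  property gives the counts at all higher levels from one family; the layer cake sum needs them
  simultaneously.\<close>

lemma singular_countE:
  assumes "compact_operator K" "t > 0"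
  obtains e l where "orthonormal {..<singular_count t K} e"
    "\<And>i. i < singular_count t K \<Longrightarrow> l i > t \<and> (norm (K (e i)))\<^sup>2 = (l i)\<^sup>2"
    "\<And>x. \<forall>i<singular_count t K. ell2_cinner x (e i) = 0 \<Longrightarrow> norm (K x) \<le> t * norm x"
    "\<And>t'. t \<le> t' \<Longrightarrow> singular_count t' K = card {i\<in>{..<singular_count t K}. l i > t'}"
proof -
  let ?A = "operator_adjoint K \<circ> K"
  note g = gram_operator[OF assms(1)]
  have n: "eigenvalue_count (t\<^sup>2) ?A = singular_count t K" using assms by (simp add: singular_count_eq)
  obtain e l where e: "orthonormal {..<singular_count t K} e"
    "\<And>i. i < singular_count t K \<Longrightarrow> ?A (e i) = l i *\<^sub>R e i \<and> l i > t\<^sup>2"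
    "\<And>x. \<forall>i<singular_count t K. ell2_cinner x (e i) = 0 \<Longrightarrow> Re (ell2_cinner (?A x) x) \<le> t\<^sup>2 * (norm x)\<^sup>2"
    using eigenvalue_countE[OF g(1,2), of "t\<^sup>2"] assms(2) unfolding n by (metis zero_less_power)
  have l: "l i > 0" if "i < singular_count t K" for i
    using e(2)[OF that] zero_le_power2[of t] by linarith
  show thesis
  proof (rule that[OF e(1), of "\<lambda>i. sqrt (l i)"])
    fix i assume i: "i < singular_count t K"
    have "norm (e i) = 1" by (rule orthonormal_norm[OF e(1)]) (use i in auto)
    then have "(norm (K (e i)))\<^sup>2 = l i"
      using e(2)[OF i] unfolding gram_form[OF assms(1), symmetric]
      by (simp add: ell2_scaleR cinner_simps cinner_self[of "e i"] del: o_apply)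
    then show "sqrt (l i) > t \<and> (norm (K (e i)))\<^sup>2 = (sqrt (l i))\<^sup>2"
      using e(2)[OF i] l[OF i] by (auto intro: real_less_rsqrt)
  next
    fix x assume "\<forall>i<singular_count t K. ell2_cinner x (e i) = 0"
    from e(3)[OF this] have "(norm (K x))\<^sup>2 \<le> (t * norm x)\<^sup>2"
      unfolding gram_form[OF assms(1)] by (simp add: power_mult_distrib)
    then show "norm (K x) \<le> t * norm x" by (rule power2_le_imp_le) (use assms in auto)
  next
    fix t' assume t': "t \<le> t'"
    have "singular_count t' K = eigenvalue_count (t'\<^sup>2) ?A" using assms t' by (simp add: singular_count_eq)
    also have "\<dots> = card {i\<in>{..<singular_count t K}. l i > t'\<^sup>2}"
      by (rule eigenvalue_count_eq[OF g(2) e]) (use t' assms in \<open>auto intro: power_mono\<close>)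
    also have "{i\<in>{..<singular_count t K}. l i > t'\<^sup>2} = {i\<in>{..<singular_count t K}. sqrt (l i) > t'}"
    proof -
      have "t'\<^sup>2 < l i \<longleftrightarrow> t' < sqrt (l i)" if "i < singular_count t K" for i
        using l[OF that] t' assms(2) real_sqrt_less_iff[of "t'\<^sup>2" "l i"] by simp
      then show ?thesis by auto
    qed
    finally show "singular_count t' K = card {i\<in>{..<singular_count t K}. sqrt (l i) > t'}" .
  qed
qed

lemma small_off_singular_count:
  assumes "compact_operator K" "t > 0"
  shows "small_off K t (singular_count t K)"
proof -
  obtain e where "\<And>x. \<forall>i<singular_count t K. ell2_cinner x (e i) = 0 \<Longrightarrow> norm (K x) \<le> t * norm x"
    by (rule singular_countE[OF assms]) blast
  then show ?thesis
    unfolding small_off_def using card_image_le[of "{..<singular_count t K}" e]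
    by (intro exI[of _ "e ` {..<singular_count t K}"]) auto
qed

lemma singular_count_le:
  assumes "compact_operator K" "t > 0" "small_off K t m"
  shows "singular_count t K \<le> m"
proof -
  obtain F where F: "finite F" "card F \<le> m" "\<And>x. \<forall>f\<in>F. ell2_cinner x f = 0 \<Longrightarrow> norm (K x) \<le> t * norm x"
    using assms(3) unfolding small_off_def by blast
  have "singular_count t K \<le> card F"
    unfolding singular_count_eq[OF less_imp_le[OF assms(2)]]
  proof (rule eigenvalue_count_le[OF gram_operator(1,2)[OF assms(1)] _ F(1)])
    fix x assume "\<forall>f\<in>F. ell2_cinner x f = 0"
    from F(3)[OF this] show "Re (ell2_cinner ((operator_adjoint K \<circ> K) x) x) \<le> t\<^sup>2 * (norm x)\<^sup>2"
      unfolding gram_form[OF assms(1)] power_mult_distrib[symmetric] by (rule power_mono) simp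
  qed (use assms in auto)
  with F show ?thesis by simp
qed

lemma singular_count_ge:
  assumes K: "compact_operator K" "t > 0" and fin: "finite I" "finite Q"
    and *: "\<And>c. \<exists>i\<in>I. c i \<noteq> 0 \<Longrightarrow> \<forall>q\<in>Q. (\<Sum>i\<in>I. c i * b i q) = 0 \<Longrightarrow>
      norm (K (lincomb I c v)) > t * norm (lincomb I c v)"
  shows "card I \<le> singular_count t K + card Q"
  unfolding singular_count_eq[OF less_imp_le[OF assms(2)]]
proof (rule eigenvalue_count_ge[OF gram_operator(1,2)[OF K(1)] _ fin, where b = b and v = v])
  fix c assume "\<exists>i\<in>I. c i \<noteq> 0" "\<forall>q\<in>Q. (\<Sum>i\<in>I. c i * b i q) = 0"
  from *[OF this] show "Re (ell2_cinner ((operator_adjoint K \<circ> K) (lincomb I c v)) (lincomb I c v))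
      > t\<^sup>2 * (norm (lincomb I c v))\<^sup>2"
    unfolding gram_form[OF K(1)] power_mult_distrib[symmetric]
    by (intro power_strict_mono) (use K(2) in auto)
qed (use K in auto)

text \<open>Monotonicity passes through a spectral family, because the defining sum would collapse
  to 0 over an infinite index set.\<close>

lemma singular_count_antimono:
  assumes "compact_operator K" "0 < s" "s \<le> t"
  shows "singular_count t K \<le> singular_count s K"
proof -
  obtain l where "singular_count t K = card {i\<in>{..<singular_count s K}. l i > t}"
    by (rule singular_countE[OF assms(1,2)]) (use assms(3) in blast)
  also have "\<dots> \<le> card {..<singular_count s K}" by (intro card_mono) auto
  finally show ?thesis by simp
qed

section \<open>Hilbert--Schmidt matrices\<close>

text \<open>Row bounds describe a Hilbert cube, which is compact by Tychonoff's theorem and dominated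
  convergence.\<close>

lemma compact_hilbert_cube:
  assumes r: "summable (\<lambda>k. (r k)\<^sup>2)" "\<And>k. r k \<ge> 0"
  shows "compact {x :: ell2. \<forall>k. cmod (ell2_nth x k) \<le> r k}"
  unfolding compact_eq_seq_compact_metric seq_compact_def
proof (intro allI impI)
  fix f :: "nat \<Rightarrow> ell2"
  assume f: "\<forall>n. f n \<in> {x. \<forall>k. cmod (ell2_nth x k) \<le> r k}"
  define P where "P = (PiE UNIV (\<lambda>k. cball 0 (r k)) :: (nat \<Rightarrow> complex) set)"
  have "compactin (product_topology (\<lambda>_. euclidean) UNIV) P"
    unfolding P_def compactin_PiE by simp
  then have "compact P" by (simp add: euclidean_product_topology)
  then have "seq_compact P" by (simp add: compact_eq_seq_compact_metric)
  moreover have "ell2_nth (f n) \<in> P" for n using f by (auto simp: P_def)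
  ultimately obtain l s where l: "l \<in> P" "strict_mono s" "((\<lambda>n. ell2_nth (f n)) \<circ> s) \<longlonglongrightarrow> l"
    by (meson seq_compactE)
  have lim: "(\<lambda>n. ell2_nth (f (s n)) k) \<longlonglongrightarrow> l k" for k
  proof -
    have "continuous_on UNIV (\<lambda>x :: nat \<Rightarrow> complex. x k)" by (rule continuous_on_product_coordinates)
    from continuous_on_tendsto_compose[OF this l(3)] show ?thesis by (simp add: o_def)
  qed
  have lr: "cmod (l k) \<le> r k" for k using l(1) by (auto simp: P_def PiE_iff)
  have "summable (\<lambda>k. (cmod (l k))\<^sup>2)"
    by (rule summable_comparison_test[OF _ r(1)]) (use lr in \<open>auto intro!: exI[of _ 0] power_mono\<close>)
  then have nth: "ell2_nth (Abs_ell2 l) = l" by (simp add: Abs_ell2_inverse)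
  have fr: "cmod (ell2_nth (f n) k) \<le> r k" for n k using f by auto
  have "(\<lambda>n. \<Sum>k. (cmod (ell2_nth (f (s n)) k - l k))\<^sup>2) \<longlonglongrightarrow> (\<Sum>k. 0)"
  proof (rule tannerys_theorem[THEN conjunct2, THEN conjunct2])
    show "\<forall>\<^sub>F (k, n) in at_top \<times>\<^sub>F sequentially. norm ((cmod (ell2_nth (f (s n)) k - l k))\<^sup>2) \<le> 4 * (r k)\<^sup>2"
    proof (rule always_eventually, safe)
      fix n k
      \<comment> \<open>Both points lie in the cube, so each coordinate of the difference is at most
        twice the side; the squares are the summable majorant.\<close>
      have "cmod (ell2_nth (f (s n)) k - l k) \<le> 2 * r k"
        using norm_triangle_ineq4[of "ell2_nth (f (s n)) k" "l k"] fr[of "s n" k] lr[of k] by linarith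
      then have "(cmod (ell2_nth (f (s n)) k - l k))\<^sup>2 \<le> (2 * r k)\<^sup>2" by (intro power_mono) auto
      then show "norm ((cmod (ell2_nth (f (s n)) k - l k))\<^sup>2) \<le> 4 * (r k)\<^sup>2" by (simp add: power_mult_distrib)
    qed
    show "((\<lambda>n. (cmod (ell2_nth (f (s n)) k - l k))\<^sup>2) \<longlongrightarrow> 0) sequentially" for k
    proof -
      have "(\<lambda>n. (cmod (ell2_nth (f (s n)) k - l k))\<^sup>2) \<longlonglongrightarrow> (cmod (l k - l k))\<^sup>2"
        by (intro tendsto_intros lim)
      then show ?thesis by simp
    qed
  qed (use summable_mult[OF r(1), of 4] in auto)
  then have "(\<lambda>n. (norm (f (s n) - Abs_ell2 l))\<^sup>2) \<longlonglongrightarrow> 0"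
    by (simp add: norm_ell2_power2 nth)
  then have "(\<lambda>n. sqrt ((norm (f (s n) - Abs_ell2 l))\<^sup>2)) \<longlonglongrightarrow> sqrt 0" by (rule tendsto_real_sqrt)
  then have "(f \<circ> s) \<longlonglongrightarrow> Abs_ell2 l" by (simp add: tendsto_norm_zero_iff LIM_zero_iff o_def)
  moreover have "Abs_ell2 l \<in> {x. \<forall>k. cmod (ell2_nth x k) \<le> r k}" using lr by (simp add: nth)
  ultimately show "\<exists>l\<in>{x. \<forall>k. cmod (ell2_nth x k) \<le> r k}. \<exists>s. strict_mono s \<and> (f \<circ> s) \<longlonglongrightarrow> l"
    using l(2) by blast
qed

text \<open>Square sections replace the infinite double sum, so that no summability has to be
  carried along.\<close>

definition hs_bound :: "(nat \<Rightarrow> nat \<Rightarrow> complex) \<Rightarrow> real \<Rightarrow> bool" where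
  "hs_bound a C \<longleftrightarrow> (\<forall>n. (\<Sum>j<n. \<Sum>k<n. (cmod (a j k))\<^sup>2) \<le> C)"

context
  fixes a :: "nat \<Rightarrow> nat \<Rightarrow> complex" and C :: real
  assumes hs: "hs_bound a C"
begin

text \<open>The first index of a matrix is the input index. The conjugation makes coordinate
  \<open>k\<close> of the image equal to the inner product of \<open>x\<close> with this
  vector.\<close>

definition hs_row :: "nat \<Rightarrow> ell2" where
  "hs_row k = Abs_ell2 (\<lambda>j. cnj (a j k))"

lemma hs_sum_le: "(\<Sum>k<n. \<Sum>j<m. (cmod (a j k))\<^sup>2) \<le> C"
proof -
  have "(\<Sum>k<n. \<Sum>j<m. (cmod (a j k))\<^sup>2) \<le> (\<Sum>k<max n m. \<Sum>j<max n m. (cmod (a j k))\<^sup>2)"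
    by (intro order.trans[OF sum_mono sum_mono2] sum_mono2 sum_nonneg) auto
  also have "\<dots> = (\<Sum>j<max n m. \<Sum>k<max n m. (cmod (a j k))\<^sup>2)" by (rule sum.swap)
  also have "\<dots> \<le> C" using hs unfolding hs_bound_def by blast
  finally show ?thesis .
qed

lemma hs_bound_nonneg: "0 \<le> C"
  using hs_sum_le[of 0 0] by simp

lemma hs_row: "ell2_nth (hs_row k) j = cnj (a j k)"
proof -
  have "(\<Sum>j<n. (cmod (cnj (a j k)))\<^sup>2) \<le> C" for n
  proof -
    have "(\<Sum>j<n. (cmod (a j k))\<^sup>2) \<le> (\<Sum>k<Suc k. \<Sum>j<n. (cmod (a j k))\<^sup>2)"
      by (rule member_le_sum[of k "{..<Suc k}" "\<lambda>k. \<Sum>j<n. (cmod (a j k))\<^sup>2"]) (auto intro: sum_nonneg)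
    also have "\<dots> \<le> C" by (rule hs_sum_le)
    finally show ?thesis by simp
  qed
  then show ?thesis unfolding hs_row_def by (rule ell2_nth_Abs(1))
qed

lemma sum_norm_hs_row: "(\<Sum>k<n. (norm (hs_row k))\<^sup>2) \<le> C"
proof -
  have "(\<lambda>m. \<Sum>j<m. (cmod (a j k))\<^sup>2) \<longlonglongrightarrow> (norm (hs_row k))\<^sup>2" for k
    using summable_LIMSEQ[OF ell2_nth_summable[of "hs_row k"]]
    unfolding norm_ell2_power2 by (simp add: hs_row)
  then have "(\<lambda>m. \<Sum>k<n. \<Sum>j<m. (cmod (a j k))\<^sup>2) \<longlonglongrightarrow> (\<Sum>k<n. (norm (hs_row k))\<^sup>2)"
    by (intro tendsto_sum)
  then show ?thesis by (rule LIMSEQ_le_const2) (use hs_sum_le in auto)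
qed

lemma summable_norm_hs_row: "summable (\<lambda>k. (norm (hs_row k))\<^sup>2)"
  by (rule summableI_nonneg_bounded[OF _ sum_norm_hs_row]) simp

definition hs_operator :: "ell2 \<Rightarrow> ell2" where
  "hs_operator x = Abs_ell2 (\<lambda>k. ell2_cinner x (hs_row k))"

lemma hs_operator: "ell2_nth (hs_operator x) k = ell2_cinner x (hs_row k)"
  "(norm (hs_operator x))\<^sup>2 \<le> C * (norm x)\<^sup>2"
proof -
  have "(\<Sum>k<n. (cmod (ell2_cinner x (hs_row k)))\<^sup>2) \<le> C * (norm x)\<^sup>2" for n
  proof -
    have "(\<Sum>k<n. (cmod (ell2_cinner x (hs_row k)))\<^sup>2) \<le> (\<Sum>k<n. (norm x * norm (hs_row k))\<^sup>2)"
      by (intro sum_mono power_mono cinner_cauchy_schwarz) auto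
    also have "\<dots> = (norm x)\<^sup>2 * (\<Sum>k<n. (norm (hs_row k))\<^sup>2)"
      by (simp add: power_mult_distrib sum_distrib_left)
    also have "\<dots> \<le> (norm x)\<^sup>2 * C" by (intro mult_left_mono sum_norm_hs_row) simp
    finally show ?thesis by (simp add: mult.commute)
  qed
  from ell2_nth_Abs[OF this] show "ell2_nth (hs_operator x) k = ell2_cinner x (hs_row k)"
    "(norm (hs_operator x))\<^sup>2 \<le> C * (norm x)\<^sup>2" unfolding hs_operator_def by blast+
qed

lemma bounded_hs_operator: "bounded_operator hs_operator"
proof (rule bounded_operatorI)
  fix x y c
  show "hs_operator (x + y) = hs_operator x + hs_operator y"
    "hs_operator (ell2_scale c x) = ell2_scale c (hs_operator x)"
    by (auto intro!: ell2_eqI simp: hs_operator(1) cinner_simps)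
  have "(norm (hs_operator x))\<^sup>2 \<le> (sqrt C * norm x)\<^sup>2"
    using hs_operator(2)[of x] hs_bound_nonneg by (simp add: power_mult_distrib)
  then show "norm (hs_operator x) \<le> sqrt C * norm x"
    by (rule power2_le_imp_le) (use hs_bound_nonneg in auto)
qed

lemma matrix_entry_hs_operator: "matrix_entry hs_operator = a"
proof (intro ext)
  fix j k
  show "matrix_entry hs_operator j k = a j k"
    using cinner_commute[of "ell2_basis j" "hs_row k"]
    by (simp add: matrix_entry_def cinner_basis hs_operator(1) hs_row)
qed

lemma operator_of_hs_matrix: "operator_of_matrix a = hs_operator"
  by (rule operator_of_matrix_eq[OF bounded_hs_operator matrix_entry_hs_operator])

lemma hs_is_operator_matrix: "is_operator_matrix a"
  unfolding is_operator_matrix_def using bounded_hs_operator matrix_entry_hs_operator by blast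

text \<open>Cauchy--Schwarz in each row puts the image of the unit ball into the Hilbert cube with
  sides \<open>norm (hs_row k)\<close>.\<close>

lemma hs_compact: "compact_operator (operator_of_matrix a)"
  unfolding operator_of_hs_matrix
proof (rule compact_operator_subset[OF bounded_hs_operator])
  show "compact {x :: ell2. \<forall>k. cmod (ell2_nth x k) \<le> norm (hs_row k)}"
    by (rule compact_hilbert_cube[OF summable_norm_hs_row]) simp
  have "cmod (ell2_cinner x (hs_row k)) \<le> norm (hs_row k)" if "norm x \<le> 1" for x k
    using cinner_cauchy_schwarz[of x "hs_row k"] mult_right_mono[OF that norm_ge_zero[of "hs_row k"]] by simp
  then show "hs_operator ` cball 0 1 \<subseteq> {x :: ell2. \<forall>k. cmod (ell2_nth x k) \<le> norm (hs_row k)}"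
    by (auto simp: hs_operator(1))
qed

lemma hs_nth: "(\<lambda>j. a j k * ell2_nth x j) sums ell2_nth (operator_of_matrix a x) k"
  unfolding operator_of_hs_matrix hs_operator(1)
  using summable_sums[OF ell2_nth_prod_summable[of x "hs_row k"]]
  by (simp add: ell2_cinner_def hs_row mult.commute)

text \<open>Exchanging the sums turns the contribution of each row into a Bessel sum, so the
  orthonormal family need not be complete.\<close>

lemma hs_sum_orthonormal:
  assumes "finite I" "orthonormal I e"
  shows "(\<Sum>i\<in>I. (norm (operator_of_matrix a (e i)))\<^sup>2) \<le> C"
proof -
  have "(\<Sum>i\<in>I. (norm (hs_operator (e i)))\<^sup>2) = (\<Sum>i\<in>I. \<Sum>k. (cmod (ell2_nth (hs_operator (e i)) k))\<^sup>2)"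
    by (simp add: norm_ell2_power2)
  also have "\<dots> = (\<Sum>k. \<Sum>i\<in>I. (cmod (ell2_nth (hs_operator (e i)) k))\<^sup>2)"
    by (rule suminf_sum[OF ell2_nth_summable, symmetric])
  also have "\<dots> \<le> C"
  proof (rule suminf_le_const)
    show "summable (\<lambda>k. \<Sum>i\<in>I. (cmod (ell2_nth (hs_operator (e i)) k))\<^sup>2)"
      by (intro summable_sum ell2_nth_summable)
    fix n
    have "(\<Sum>i\<in>I. (cmod (ell2_nth (hs_operator (e i)) k))\<^sup>2) \<le> (norm (hs_row k))\<^sup>2" for k
    proof -
      have "cmod (ell2_nth (hs_operator (e i)) k) = cmod (ell2_cinner (hs_row k) (e i))" for i
        unfolding hs_operator(1) using cinner_commute[of "e i" "hs_row k"] by simp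
      then show ?thesis using bessel_inequality[OF assms] by simp
    qed
    then have "(\<Sum>k<n. \<Sum>i\<in>I. (cmod (ell2_nth (hs_operator (e i)) k))\<^sup>2) \<le> (\<Sum>k<n. (norm (hs_row k))\<^sup>2)"
      by (intro sum_mono)
    with sum_norm_hs_row[of n] show "(\<Sum>k<n. \<Sum>i\<in>I. (cmod (ell2_nth (hs_operator (e i)) k))\<^sup>2) \<le> C" by linarith
  qed
  finally show ?thesis unfolding operator_of_hs_matrix .
qed

text \<open>Chebyshev's inequality for the squared singular values.\<close>

lemma hs_singular_count:
  assumes "t > 0"
  shows "real (singular_count t (operator_of_matrix a)) \<le> C / t\<^sup>2"
proof -
  let ?n = "singular_count t (operator_of_matrix a)"
  obtain e l where e: "orthonormal {..<?n} e"
    "\<And>i. i < ?n \<Longrightarrow> l i > t \<and> (norm (operator_of_matrix a (e i)))\<^sup>2 = (l i)\<^sup>2"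
    by (rule singular_countE[OF hs_compact assms]) blast
  have "real ?n * t\<^sup>2 = (\<Sum>i<?n. t\<^sup>2)" by simp
  also have "\<dots> \<le> (\<Sum>i<?n. (norm (operator_of_matrix a (e i)))\<^sup>2)"
    using e(2) assms by (intro sum_mono) (auto intro!: power_mono intro: less_imp_le)
  also have "\<dots> \<le> C" by (rule hs_sum_orthonormal[OF _ e(1)]) simp
  finally show ?thesis using assms by (simp add: field_simps)
qed

lemma hs_small_off:
  assumes "t > 0" "C / t\<^sup>2 \<le> real m"
  shows "small_off (operator_of_matrix a) t m"
proof -
  have "singular_count t (operator_of_matrix a) \<le> m" using hs_singular_count[OF assms(1)] assms(2) by simp
  with small_off_singular_count[OF hs_compact assms(1)] show ?thesis
    unfolding small_off_def by (meson order_trans)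
qed

text \<open>A singular value above \<open>t 0\<close> contributes the square of the last node below
  it, which is at most its own square. In this way a single Hilbert--Schmidt bound constrains the
  counts at all levels at once.\<close>

lemma hs_layer_cake:
  assumes t: "\<And>i. i \<le> r \<Longrightarrow> 0 < t i" "\<And>i. i < r \<Longrightarrow> t i \<le> t (Suc i)"
  shows "(t 0)\<^sup>2 * singular_count (t 0) (operator_of_matrix a)
    + (\<Sum>i<r. ((t (Suc i))\<^sup>2 - (t i)\<^sup>2) * singular_count (t (Suc i)) (operator_of_matrix a)) \<le> C"
proof -
  let ?n = "singular_count (t 0) (operator_of_matrix a)"
  have t0: "t 0 > 0" using t(1) by simp
  obtain e l where e: "orthonormal {..<?n} e"
    "\<And>i. i < ?n \<Longrightarrow> l i > t 0 \<and> (norm (operator_of_matrix a (e i)))\<^sup>2 = (l i)\<^sup>2"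
    "\<And>t'. t 0 \<le> t' \<Longrightarrow> singular_count t' (operator_of_matrix a) = card {i\<in>{..<?n}. l i > t'}"
    by (rule singular_countE[OF hs_compact t0]) blast
  have t0_le: "t 0 \<le> t i" if "i \<le> r" for i
    using that
  proof (induction i)
    case (Suc i)
    have "t 0 \<le> t i" using Suc by simp
    also have "t i \<le> t (Suc i)" using t(2)[of i] Suc.prems by simp
    finally show ?case .
  qed simp
  have "(t 0)\<^sup>2 + (\<Sum>i<r. ((t (Suc i))\<^sup>2 - (t i)\<^sup>2) * (if x > t (Suc i) then 1 else 0)) \<le> x\<^sup>2" if "x > t 0" for x
  proof -
    \<comment> \<open>The minimum with \<open>t s\<close> is the induction invariant: once
      \<open>x\<close> does not exceed a node, all later terms vanish because the nodes
      increase.\<close>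
    have "s \<le> r \<Longrightarrow> (t 0)\<^sup>2 + (\<Sum>i<s. ((t (Suc i))\<^sup>2 - (t i)\<^sup>2) * (if x > t (Suc i) then 1 else 0)) \<le> (min x (t s))\<^sup>2" for s
    proof (induction s)
      case 0
      then show ?case using \<open>x > t 0\<close> by simp
    next
      case (Suc s)
      then have ts: "t s \<le> t (Suc s)" "0 < t s" using t by auto
      show ?case
      proof (cases "x > t (Suc s)")
        case True
        then show ?thesis using Suc ts by (simp add: min_def)
      next
        case False
        have "(min x (t s))\<^sup>2 \<le> (min x (t (Suc s)))\<^sup>2"
          using ts t0 \<open>x > t 0\<close> by (intro power_mono) auto
        with False Suc show ?thesis by simp
      qed
    qed
    from this[of r] have "(t 0)\<^sup>2 + (\<Sum>i<r. ((t (Suc i))\<^sup>2 - (t i)\<^sup>2) * (if x > t (Suc i) then 1 else 0)) \<le> (min x (t r))\<^sup>2"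
      by simp
    also have "\<dots> \<le> x\<^sup>2" using t0 t0_le[of r] that by (intro power_mono) auto
    finally show ?thesis .
  qed
  then have "(\<Sum>k<?n. (t 0)\<^sup>2 + (\<Sum>i<r. ((t (Suc i))\<^sup>2 - (t i)\<^sup>2) * (if l k > t (Suc i) then 1 else 0)))
      \<le> (\<Sum>k<?n. (norm (operator_of_matrix a (e k)))\<^sup>2)"
    using e(2) by (intro sum_mono) auto
  also have "\<dots> \<le> C" by (rule hs_sum_orthonormal[OF _ e(1)]) simp
  also have "(\<Sum>k<?n. (t 0)\<^sup>2 + (\<Sum>i<r. ((t (Suc i))\<^sup>2 - (t i)\<^sup>2) * (if l k > t (Suc i) then 1 else 0)))
     = (t 0)\<^sup>2 * ?n + (\<Sum>i<r. ((t (Suc i))\<^sup>2 - (t i)\<^sup>2) * (\<Sum>k<?n. if l k > t (Suc i) then 1 else 0))"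
    by (simp add: sum.distrib sum_distrib_left sum.swap[of _ "{..<r}"] mult.commute)
  also have "(\<Sum>i<r. ((t (Suc i))\<^sup>2 - (t i)\<^sup>2) * (\<Sum>k<?n. if l k > t (Suc i) then 1 else 0))
     = (\<Sum>i<r. ((t (Suc i))\<^sup>2 - (t i)\<^sup>2) * singular_count (t (Suc i)) (operator_of_matrix a))"
  proof (intro sum.cong refl arg_cong2[of _ _ _ _ "(*)"])
    fix i assume "i \<in> {..<r}"
    then have "singular_count (t (Suc i)) (operator_of_matrix a) = card {k\<in>{..<?n}. l k > t (Suc i)}"
      by (intro e(3) t0_le) auto
    then show "(\<Sum>k<?n. if l k > t (Suc i) then 1 else 0) = real (singular_count (t (Suc i)) (operator_of_matrix a))"
      by (simp add: sum.If_cases Int_def)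
  qed
  finally show ?thesis .
qed

end

section \<open>Schatten classes and uniformly bounded Schur multipliers\<close>

lemma compact_operator_scale:
  assumes "compact_operator K"
  shows "compact_operator (\<lambda>x. ell2_scale c (K x))"
proof -
  have "bounded_operator (ell2_scale c)"
    by (rule bounded_operatorI[of _ "cmod c"]) (auto simp: ell2.scale_right_distrib norm_ell2_scale mult.commute)
  from compact_operator_compose[OF this assms] show ?thesis by (simp add: o_def)
qed

lemma small_off_scale:
  assumes "small_off K t m"
  shows "small_off (\<lambda>x. ell2_scale c (K x)) (cmod c * t) m"
proof -
  obtain F where F: "finite F" "card F \<le> m" "\<And>x. \<forall>f\<in>F. ell2_cinner x f = 0 \<Longrightarrow> norm (K x) \<le> t * norm x"
    using assms unfolding small_off_def by blast
  have "norm (ell2_scale c (K x)) \<le> cmod c * t * norm x" if "\<forall>f\<in>F. ell2_cinner x f = 0" for x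
    using mult_left_mono[OF F(3)[OF that], of "cmod c"] by (simp add: norm_ell2_scale mult.assoc)
  with F show ?thesis unfolding small_off_def by blast
qed

lemma singular_count_scale_le:
  assumes "compact_operator K" "c \<noteq> 0" "t > 0"
  shows "singular_count (cmod c * t) (\<lambda>x. ell2_scale c (K x)) \<le> singular_count t K"
  using assms by (intro singular_count_le compact_operator_scale small_off_scale small_off_singular_count) auto

lemma singular_count_scale:
  assumes "compact_operator K" "c \<noteq> 0" "t > 0"
  shows "singular_count (cmod c * t) (\<lambda>x. ell2_scale c (K x)) = singular_count t K"
proof (rule antisym[OF singular_count_scale_le[OF assms]])
  have "singular_count (cmod (1/c) * (cmod c * t)) (\<lambda>x. ell2_scale (1/c) (ell2_scale c (K x)))
      \<le> singular_count (cmod c * t) (\<lambda>x. ell2_scale c (K x))"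
    using assms by (intro singular_count_scale_le compact_operator_scale) auto
  then show "singular_count t K \<le> singular_count (cmod c * t) (\<lambda>x. ell2_scale c (K x))"
    using assms by (simp add: norm_divide)
qed

lemma singular_count_large:
  assumes "compact_operator K"
  shows "\<exists>t>0. singular_count t K = 0"
proof -
  obtain B where B: "B > 0" "\<And>x. norm (K x) \<le> B * norm x"
    using bounded_operator_bound[OF compact_operator_bounded[OF assms]] by metis
  then have "small_off K B 0" unfolding small_off_def by (intro exI[of _ "{}"]) auto
  from singular_count_le[OF assms B(1) this] B(1) show ?thesis by blast
qed

lemma singular_value_set:
  assumes "compact_operator K"
  shows "{t. t > 0 \<and> singular_count t K \<le> n} \<noteq> {}" "bdd_below {t. t > 0 \<and> singular_count t K \<le> n}"
  using singular_count_large[OF assms] by (auto intro!: bdd_belowI[of _ 0])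

lemma singular_value_scale:
  assumes "compact_operator K" "c \<noteq> 0"
  shows "singular_value (\<lambda>x. ell2_scale c (K x)) n = cmod c * singular_value K n"
proof -
  let ?S = "{t. t > 0 \<and> singular_count t K \<le> n}"
  have "{t. t > 0 \<and> singular_count t (\<lambda>x. ell2_scale c (K x)) \<le> n} = (*) (cmod c) ` ?S"
  proof (intro equalityI subsetI)
    fix t assume "t \<in> {t. t > 0 \<and> singular_count t (\<lambda>x. ell2_scale c (K x)) \<le> n}"
    then have "t / cmod c \<in> ?S" "t = cmod c * (t / cmod c)"
      using singular_count_scale[OF assms, of "t / cmod c"] assms(2) by auto
    then show "t \<in> (*) (cmod c) ` ?S" by (rule rev_image_eqI)
  next
    fix t assume "t \<in> (*) (cmod c) ` ?S"
    then obtain s where "t = cmod c * s" "s > 0" "singular_count s K \<le> n" by auto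
    then show "t \<in> {t. t > 0 \<and> singular_count t (\<lambda>x. ell2_scale c (K x)) \<le> n}"
      using singular_count_scale[OF assms, of s] assms(2) by auto
  qed
  moreover have "cmod c * Inf ?S = Inf ((*) (cmod c) ` ?S)"
    by (rule continuous_at_Inf_mono[OF _ _ singular_value_set[OF assms(1)]])
      (auto intro!: monoI mult_left_mono continuous_intros)
  ultimately show ?thesis by (simp add: singular_value_def)
qed

lemma schatten_class_compact: "A \<in> schatten_class p \<Longrightarrow> compact_operator A"
  by (simp add: schatten_class_def)

lemma schatten_norm_powr:
  assumes "A \<in> schatten_class p" "p > 0"
  shows "schatten_norm p A powr p = (\<Sum>n. singular_value A n powr p)"
proof -
  have "0 \<le> (\<Sum>n. singular_value A n powr p)"
    using assms by (intro suminf_nonneg) (auto simp: schatten_class_def)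
  then show ?thesis using assms by (simp add: schatten_norm_def powr_powr)
qed

text \<open>The multiplier norm looks only at operators of Schatten norm 1; homogeneity carries its
  bound to an arbitrary nonzero one.\<close>

lemma schatten_scale:
  assumes A: "A \<in> schatten_class p" and p: "p > 0" and c: "c \<noteq> 0"
  shows "(\<lambda>x. ell2_scale c (A x)) \<in> schatten_class p"
    "schatten_norm p (\<lambda>x. ell2_scale c (A x)) = cmod c * schatten_norm p A"
proof -
  have K: "compact_operator A" by (rule schatten_class_compact[OF A])
  have s: "summable (\<lambda>n. singular_value A n powr p)" using A by (simp add: schatten_class_def)
  have eq: "singular_value (\<lambda>x. ell2_scale c (A x)) n powr p = cmod c powr p * singular_value A n powr p" for n
    by (simp add: singular_value_scale[OF K c] powr_mult)
  show "(\<lambda>x. ell2_scale c (A x)) \<in> schatten_class p"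
    unfolding schatten_class_def mem_Collect_eq eq using s K by (intro conjI summable_mult compact_operator_scale)
  have "0 \<le> (\<Sum>n. singular_value A n powr p)" using s by (intro suminf_nonneg) auto
  then show "schatten_norm p (\<lambda>x. ell2_scale c (A x)) = cmod c * schatten_norm p A"
    unfolding schatten_norm_def eq suminf_mult[OF s] using p by (simp add: powr_mult powr_powr)
qed

lemma singular_value_ge:
  assumes "compact_operator K" "t > 0" "n < singular_count t K"
  shows "t \<le> singular_value K n"
  unfolding singular_value_def
proof (rule cInf_greatest[OF singular_value_set(1)[OF assms(1)]])
  fix s assume s: "s \<in> {t. t > 0 \<and> singular_count t K \<le> n}"
  show "t \<le> s"
  proof (rule ccontr)
    assume "\<not> t \<le> s"
    with s assms have "singular_count t K \<le> singular_count s K" by (intro singular_count_antimono) auto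
    with s assms(3) show False by simp
  qed
qed

text \<open>Chebyshev's inequality: the first \<open>singular_count t A\<close> singular values are
  all at least \<open>t\<close>.\<close>

lemma schatten_singular_count:
  assumes A: "A \<in> schatten_class p" and p: "p > 0" and t: "t > 0"
  shows "real (singular_count t A) \<le> (schatten_norm p A / t) powr p"
proof -
  have K: "compact_operator A" by (rule schatten_class_compact[OF A])
  have "real (singular_count t A) * t powr p = (\<Sum>n<singular_count t A. t powr p)" by simp
  also have "\<dots> \<le> (\<Sum>n<singular_count t A. singular_value A n powr p)"
    using t p by (intro sum_mono powr_mono2 singular_value_ge[OF K]) auto
  also have "\<dots> \<le> (\<Sum>n. singular_value A n powr p)"
    using A by (intro sum_le_suminf) (auto simp: schatten_class_def)
  also have "\<dots> = schatten_norm p A powr p" by (rule schatten_norm_powr[OF A p, symmetric])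
  finally show ?thesis using t by (simp add: powr_divide schatten_norm_def field_simps)
qed

text \<open>Covers the operator that cannot be normalized. Norm 0 leaves no singular value above any
  t > 0, so each |A x| lies below every positive number.\<close>

lemma schatten_norm_zero:
  assumes A: "A \<in> schatten_class p" and p: "p > 0" and z: "schatten_norm p A = 0"
  shows "A x = 0"
proof -
  have K: "compact_operator A" by (rule schatten_class_compact[OF A])
  have "norm (A x) \<le> 0"
  proof (rule field_le_epsilon)
    fix e :: real assume e: "e > 0"
    define t where "t = e / (1 + norm x)"
    have t: "t > 0" using e by (simp add: t_def add_pos_nonneg)
    have "singular_count t A = 0" using schatten_singular_count[OF A p t] z by simp
    then have "small_off A t 0" using small_off_singular_count[OF K t] by simp
    then have "norm (A x) \<le> t * norm x" by (auto simp: small_off_def)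
    also have "\<dots> \<le> t * (1 + norm x)" using t by (intro mult_left_mono) auto
    also have "\<dots> = e" by (simp add: t_def) (metis add_nonneg_eq_0_iff norm_ge_zero zero_le_one zero_neq_one)
    finally show "norm (A x) \<le> 0 + e" by simp
  qed
  then show ?thesis by simp
qed

lemma matrix_entry_scale: "matrix_entry (\<lambda>x. ell2_scale c (A x)) j k = c * matrix_entry A j k"
  by (simp add: matrix_entry_def cinner_simps)

text \<open>Here condition (A_p) enters. After normalization to \<open>B\<close>, the Schur
  multiples of \<open>B\<close> have a common Schatten norm bound \<open>M\<close>, and Chebyshev's
  inequality bounds their singular counts at level t / a uniformly in N.\<close>

lemma multiplier_uniform_small_off:
  assumes p: "p > 0" and sup: "(SUP N\<in>{1..}. multiplier_norm p (\<sigma> N)) < \<infinity>" and A: "A \<in> schatten_class p"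
  shows "N \<ge> (1::nat) \<Longrightarrow> schur_defined (\<sigma> N) A \<and> compact_operator (schur (\<sigma> N) A)"
    and "t > 0 \<Longrightarrow> \<exists>m. \<forall>N\<ge>1. small_off (schur (\<sigma> N) A) t m"
proof -
  have K: "compact_operator A" by (rule schatten_class_compact[OF A])
  define a where "a = schatten_norm p A"
  have "(N \<ge> 1 \<longrightarrow> schur_defined (\<sigma> N) A \<and> compact_operator (schur (\<sigma> N) A)) \<and>
    (t > 0 \<longrightarrow> (\<exists>m. \<forall>N\<ge>1. small_off (schur (\<sigma> N) A) t m))" for N t
  proof (cases "a = 0")
    case True
    have "A = (\<lambda>x. 0)" using schatten_norm_zero[OF A p] True by (auto simp: a_def)
    then have ent: "(\<lambda>j k. \<sigma> N j k * matrix_entry A j k) = matrix_entry A" for N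
      by (simp add: matrix_entry_def fun_eq_iff)
    have s: "schur (\<sigma> N) A = A" for N
      unfolding schur_def ent by (rule operator_of_matrix_eq) (use compact_operator_bounded[OF K] in auto)
    have "schur_defined (\<sigma> N) A" for N
      unfolding schur_defined_def ent is_operator_matrix_def using compact_operator_bounded[OF K] by blast
    moreover have "small_off A t 0" if "t > 0" for t
      using that unfolding small_off_def \<open>A = (\<lambda>x. 0)\<close> by (intro exI[of _ "{}"]) auto
    ultimately show ?thesis using K by (auto simp: s)
  next
    case False
    then have a: "a > 0" by (simp add: a_def schatten_norm_def)
    define B where "B x = ell2_scale (1 / of_real a) (A x)" for x
    have B: "B \<in> schatten_class p" "schatten_norm p B = 1"
      using schatten_scale[OF A p, of "1 / of_real a"] a unfolding B_def[abs_def] a_def[symmetric]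
      by (simp_all add: norm_divide)
    define M where "M = enn2real (SUP N\<in>{1..}. multiplier_norm p (\<sigma> N))"
    have M: "(SUP N\<in>{1..}. multiplier_norm p (\<sigma> N)) = ennreal M"
      using sup by (simp add: M_def less_top)
    have sB: "schur_defined (\<sigma> N) B \<and> schur (\<sigma> N) B \<in> schatten_class p \<and> schatten_norm p (schur (\<sigma> N) B) \<le> M"
      if "N \<ge> 1" for N
    proof -
      have "(if schur_defined (\<sigma> N) B \<and> schur (\<sigma> N) B \<in> schatten_class p
        then ennreal (schatten_norm p (schur (\<sigma> N) B)) else \<infinity>) \<le> multiplier_norm p (\<sigma> N)"
        unfolding multiplier_norm_def by (rule SUP_upper) (use B in auto)
      also have "\<dots> \<le> ennreal M"
        unfolding M[symmetric] by (rule SUP_upper) (use that in auto)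
      finally have le: "(if schur_defined (\<sigma> N) B \<and> schur (\<sigma> N) B \<in> schatten_class p
        then ennreal (schatten_norm p (schur (\<sigma> N) B)) else \<infinity>) \<le> ennreal M" .
      \<comment> \<open>In \<open>multiplier_norm\<close> the value is infinite if the product does
        not exist or leaves the class. A finite supremum excludes this branch, so existence of the
        product is a consequence.\<close>
      then have d: "schur_defined (\<sigma> N) B \<and> schur (\<sigma> N) B \<in> schatten_class p"
        by (auto split: if_splits simp: top_unique)
      moreover have "0 \<le> M" by (simp add: M_def)
      ultimately show ?thesis using le by (simp add: ennreal_le_iff)
    qed
    have entB: "\<sigma> N j k * matrix_entry A j k = of_real a * (\<sigma> N j k * matrix_entry B j k)" for N j k
      using a by (simp add: B_def[abs_def] matrix_entry_scale)
    have sA: "schur_defined (\<sigma> N) A \<and> schur (\<sigma> N) A = (\<lambda>x. ell2_scale (of_real a) (schur (\<sigma> N) B x))"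
      if "N \<ge> 1" for N
    proof -
      have d: "bounded_operator (schur (\<sigma> N) B)" "matrix_entry (schur (\<sigma> N) B) = (\<lambda>j k. \<sigma> N j k * matrix_entry B j k)"
        using sB[OF that] is_operator_matrixD unfolding schur_defined_def schur_def by auto
      let ?C = "\<lambda>x. ell2_scale (of_real a) (schur (\<sigma> N) B x)"
      have C: "bounded_operator ?C" by (rule bounded_operator_scale[OF d(1)])
      have m: "matrix_entry ?C = (\<lambda>j k. \<sigma> N j k * matrix_entry A j k)"
        by (intro ext) (simp add: matrix_entry_scale d(2) entB)
      show ?thesis
        unfolding schur_defined_def is_operator_matrix_def schur_def[of _ A]
        using operator_of_matrix_eq[OF C m] C m by blast
    qed
    have "\<exists>m. \<forall>N\<ge>1. small_off (schur (\<sigma> N) A) t m" if t: "t > 0" for t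
    proof (intro exI allI impI)
      fix N :: nat assume N: "N \<ge> 1"
      let ?m = "nat \<lceil>(M / (t / a)) powr p\<rceil>"
      have ta: "t / a > 0" using t a by simp
      have "real (singular_count (t / a) (schur (\<sigma> N) B)) \<le> (schatten_norm p (schur (\<sigma> N) B) / (t / a)) powr p"
        by (rule schatten_singular_count) (use sB[OF N] p ta in auto)
      also have "\<dots> \<le> (M / (t / a)) powr p"
        using sB[OF N] p t a by (intro powr_mono2 divide_right_mono divide_nonneg_pos) (simp_all add: schatten_norm_def)
      finally have "singular_count (t / a) (schur (\<sigma> N) B) \<le> ?m" by linarith
      moreover have "small_off (schur (\<sigma> N) B) (t / a) (singular_count (t / a) (schur (\<sigma> N) B))"
        by (rule small_off_singular_count[OF schatten_class_compact ta]) (use sB[OF N] in auto)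
      ultimately have "small_off (schur (\<sigma> N) B) (t / a) ?m"
        unfolding small_off_def by (meson order_trans)
      from small_off_scale[OF this, of "of_real a"] show "small_off (schur (\<sigma> N) A) t ?m"
        using sA[OF N] a by simp
    qed
    moreover have "schur_defined (\<sigma> N) A \<and> compact_operator (schur (\<sigma> N) A)" if "N \<ge> 1"
      using sA[OF that] sB[OF that] schatten_class_compact compact_operator_scale by metis
    ultimately show ?thesis by blast
  qed
  then show "N \<ge> 1 \<Longrightarrow> schur_defined (\<sigma> N) A \<and> compact_operator (schur (\<sigma> N) A)"
    "t > 0 \<Longrightarrow> \<exists>m. \<forall>N\<ge>1. small_off (schur (\<sigma> N) A) t m" by blast+
qed

section \<open>Hankel matrices of bounded symbols\<close>

text \<open>The bound itself makes the rows square summable, so the coordinates of the image can be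
  defined as inner products with conjugated rows; the estimate then passes from finite vectors to
  all vectors by a limit.\<close>

lemma operator_matrixI:
  assumes bound: "\<And>m n (x :: nat \<Rightarrow> complex).
    (\<Sum>k<n. (cmod (\<Sum>j<m. a j k * x j))\<^sup>2) \<le> C * (\<Sum>j<m. (cmod (x j))\<^sup>2)"
  shows "is_operator_matrix a"
proof -
  have "0 \<le> (\<Sum>k<1. (cmod (\<Sum>j<1. a j k * 1))\<^sup>2)" by simp
  also have "\<dots> \<le> C" using bound[where m=1 and n=1 and x="\<lambda>_. 1"] by simp
  finally have C: "C \<ge> 0" .
  \<comment> \<open>If \<open>x\<close> is the conjugated row \<open>k\<close>, then the single
    coordinate \<open>k\<close> of the image already gives S^2 \<le> C S.\<close>
  have row: "(\<Sum>j<m. (cmod (cnj (a j k)))\<^sup>2) \<le> C" for m k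
  proof -
    define S where "S = (\<Sum>j<m. (cmod (a j k))\<^sup>2)"
    have S: "S \<ge> 0" by (simp add: S_def sum_nonneg)
    have eq: "(\<Sum>j<m. a j k * cnj (a j k)) = of_real S"
      by (simp add: S_def complex_norm_square del: of_real_power)
    have "S\<^sup>2 = (cmod (\<Sum>j<m. a j k * cnj (a j k)))\<^sup>2" using S by (simp add: eq)
    also have "\<dots> \<le> (\<Sum>k'<Suc k. (cmod (\<Sum>j<m. a j k' * cnj (a j k)))\<^sup>2)"
      by (rule member_le_sum[of k "{..<Suc k}" "\<lambda>k'. (cmod (\<Sum>j<m. a j k' * cnj (a j k)))\<^sup>2"]) auto
    finally have "S\<^sup>2 \<le> (\<Sum>k'<Suc k. (cmod (\<Sum>j<m. a j k' * cnj (a j k)))\<^sup>2)" .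
    also have "\<dots> \<le> C * (\<Sum>j<m. (cmod (cnj (a j k)))\<^sup>2)" by (rule bound)
    also have "\<dots> = C * S" by (simp add: S_def)
    finally have "S \<le> C" using S C by (cases "S = 0") (auto simp: power2_eq_square)
    then show ?thesis by (simp add: S_def)
  qed
  define v where "v k = Abs_ell2 (\<lambda>j. cnj (a j k))" for k
  have v: "ell2_nth (v k) j = cnj (a j k)" for k j
    unfolding v_def by (rule ell2_nth_Abs(1)[OF row])
  have cv: "(\<lambda>j. a j k * ell2_nth x j) sums ell2_cinner x (v k)" for x k
    using summable_sums[OF ell2_nth_prod_summable[of x "v k"]] by (simp add: ell2_cinner_def v mult.commute)
  have bnd: "(\<Sum>k<n. (cmod (ell2_cinner x (v k)))\<^sup>2) \<le> C * (norm x)\<^sup>2" for n x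
  proof (rule LIMSEQ_le_const2)
    show "(\<lambda>m. \<Sum>k<n. (cmod (\<Sum>j<m. a j k * ell2_nth x j))\<^sup>2) \<longlonglongrightarrow> (\<Sum>k<n. (cmod (ell2_cinner x (v k)))\<^sup>2)"
      using cv unfolding sums_def by (intro tendsto_intros)
    have "(\<Sum>k<n. (cmod (\<Sum>j<m. a j k * ell2_nth x j))\<^sup>2) \<le> C * (norm x)\<^sup>2" for m
      using bound[where n=n and m=m and x="ell2_nth x"] mult_left_mono[OF sum_cmod_nth_le[where n=m and x=x] C] by linarith
    then show "\<exists>N. \<forall>m\<ge>N. (\<Sum>k<n. (cmod (\<Sum>j<m. a j k * ell2_nth x j))\<^sup>2) \<le> C * (norm x)\<^sup>2" by blast
  qed
  define A where "A x = Abs_ell2 (\<lambda>k. ell2_cinner x (v k))" for x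
  have A: "ell2_nth (A x) k = ell2_cinner x (v k)" for x k
    unfolding A_def by (rule ell2_nth_Abs(1)[OF bnd])
  have nA: "(norm (A x))\<^sup>2 \<le> C * (norm x)\<^sup>2" for x
    unfolding A_def by (rule ell2_nth_Abs(2)[OF bnd])
  have "bounded_operator A"
  proof (rule bounded_operatorI)
    fix x y c
    show "A (x + y) = A x + A y" "A (ell2_scale c x) = ell2_scale c (A x)"
      by (auto intro!: ell2_eqI simp: A cinner_simps)
    have "(norm (A x))\<^sup>2 \<le> (sqrt C * norm x)\<^sup>2"
      using nA[of x] C by (simp add: power_mult_distrib)
    then show "norm (A x) \<le> sqrt C * norm x"
      by (rule power2_le_imp_le) (use C in auto)
  qed
  moreover have "matrix_entry A j k = a j k" for j k
    using cinner_commute[of "ell2_basis j" "v k"] by (simp add: matrix_entry_def cinner_basis A v)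
  ultimately show ?thesis unfolding is_operator_matrix_def by blast
qed

lemma cis_has_integral:
  fixes n :: int
  shows "((\<lambda>\<theta>. cis (of_int n * \<theta>)) has_integral (if n = 0 then 2 * pi else 0)) {0..2*pi}"
proof (cases "n = 0")
  case True
  then show ?thesis using has_integral_const_real[of "1::complex" 0 "2*pi"] by (simp add: scaleR_conv_of_real)
next
  case False
  have "((\<lambda>\<theta>. cis (of_int n * \<theta>)) has_integral
      (cis (of_int n * (2*pi)) / (\<i> * of_int n) - cis (of_int n * 0) / (\<i> * of_int n))) {0..2*pi}"
  proof (rule fundamental_theorem_of_calculus)
    fix x :: real
    have "((\<lambda>\<theta>. cis (of_int n * \<theta>)) has_derivative (\<lambda>h. (of_int n * h) *\<^sub>R (\<i> * cis (of_int n * x)))) (at x within {0..2*pi})"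
      by (auto intro!: derivative_eq_intros)
    then have "((\<lambda>\<theta>. cis (of_int n * \<theta>)) has_vector_derivative (of_int n *\<^sub>R (\<i> * cis (of_int n * x)))) (at x within {0..2*pi})"
      by (simp add: has_vector_derivative_def mult.commute)
    from has_vector_derivative_divide[OF this, of "\<i> * of_int n"]
    show "((\<lambda>\<theta>. cis (of_int n * \<theta>) / (\<i> * of_int n)) has_vector_derivative cis (of_int n * x)) (at x within {0..2*pi})"
      using False by (simp add: scaleR_conv_of_real)
  qed simp
  moreover have "cis (of_int n * (2*pi)) = 1"
    using cis_multiple_2pi[of "of_int n"] by (simp add: mult_ac)
  ultimately show ?thesis using False by simp
qed

lemma trig_poly_parseval:
  "((\<lambda>\<theta>. (cmod (\<Sum>j<m. x j * cis (- (real j * \<theta>))))\<^sup>2) has_integral 2 * pi * (\<Sum>j<m. (cmod (x j))\<^sup>2)) {0..2*pi}"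
proof -
  have "((\<lambda>\<theta>. \<Sum>j<m. \<Sum>l<m. x j * cnj (x l) * cis (of_int (int l - int j) * \<theta>)) has_integral
      (\<Sum>j<m. \<Sum>l<m. x j * cnj (x l) * (if int l - int j = 0 then 2 * pi else 0))) {0..2*pi}"
    by (intro has_integral_sum has_integral_mult_right cis_has_integral) auto
  moreover have "(\<Sum>j<m. \<Sum>l<m. x j * cnj (x l) * (if int l - int j = 0 then 2 * pi else 0))
      = (\<Sum>j<m. of_real (2 * pi * (cmod (x j))\<^sup>2))"
  proof (rule sum.cong[OF refl])
    fix j assume "j \<in> {..<m}"
    then have that: "j < m" by simp
    have "(\<Sum>l<m. x j * cnj (x l) * (if int l - int j = 0 then 2 * pi else 0))
        = (\<Sum>l<m. if j = l then x j * cnj (x j) * (2 * of_real pi) else 0)"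
      by (intro sum.cong) auto
    also have "\<dots> = x j * cnj (x j) * (2 * of_real pi)" using that by simp
    finally show "(\<Sum>l<m. x j * cnj (x l) * (if int l - int j = 0 then 2 * pi else 0))
        = of_real (2 * pi * (cmod (x j))\<^sup>2)" by (simp add: complex_norm_square del: of_real_power)
  qed
  moreover have "(\<Sum>j<m. \<Sum>l<m. x j * cnj (x l) * cis (of_int (int l - int j) * \<theta>))
      = of_real ((cmod (\<Sum>j<m. x j * cis (- (real j * \<theta>))))\<^sup>2)" for \<theta>
  proof -
    have "of_real ((cmod (\<Sum>j<m. x j * cis (- (real j * \<theta>))))\<^sup>2)
        = (\<Sum>j<m. x j * cis (- (real j * \<theta>))) * cnj (\<Sum>j<m. x j * cis (- (real j * \<theta>)))"
      by (rule complex_norm_square)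
    also have "\<dots> = (\<Sum>j<m. \<Sum>l<m. x j * cnj (x l) * (cis (- (real j * \<theta>)) * cis (real l * \<theta>)))"
      by (simp add: sum_product mult_ac cis_cnj)
    finally show ?thesis by (simp add: cis_mult algebra_simps)
  qed
  ultimately have "((\<lambda>\<theta>. complex_of_real ((cmod (\<Sum>j<m. x j * cis (- (real j * \<theta>))))\<^sup>2)) has_integral
      (\<Sum>j<m. of_real (2 * pi * (cmod (x j))\<^sup>2))) {0..2*pi}" by (simp only:)
  from has_integral_linear[OF this bounded_linear_Re] show ?thesis
    by (simp add: o_def sum_distrib_left)
qed

lemma bounded_symbol_set_integrable:
  assumes "bounded_symbol \<omega>" "continuous_on UNIV f"
  shows "set_integrable lebesgue {0..2*pi} (\<lambda>\<theta>. \<omega> (cis \<theta>) * f \<theta>)"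
proof -
  obtain C where C: "AE \<theta> in lebesgue. cmod (\<omega> (cis \<theta>)) \<le> C" using assms by (auto simp: bounded_symbol_def)
  have [measurable]: "(\<lambda>\<theta>. \<omega> (cis \<theta>)) \<in> borel_measurable lebesgue" using assms by (simp add: bounded_symbol_def)
  have [measurable]: "f \<in> borel_measurable lebesgue"
    using borel_measurable_continuous_onI[OF assms(2)] by (intro measurable_completion) simp
  have "compact (f ` {0..2*pi})"
    using assms(2) by (intro compact_continuous_image) (auto intro: continuous_on_subset)
  then obtain D where D: "\<And>x. x \<in> {0..2*pi} \<Longrightarrow> cmod (f x) \<le> D"
    using bounded_iff compact_imp_bounded by (metis image_eqI)
  show ?thesis
    unfolding set_integrable_def
  proof (rule integrableI_bounded_set_indicator)
    show "AE \<theta> in lebesgue. \<theta> \<in> {0..2*pi} \<longrightarrow> cmod (\<omega> (cis \<theta>) * f \<theta>) \<le> C * D"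
      using C
    proof eventually_elim
      case (elim \<theta>)
      then show ?case
        using D[of \<theta>] by (auto simp: norm_mult intro!: mult_mono order_trans[OF norm_ge_zero elim])
    qed
  qed (auto simp: emeasure_lborel_Icc)
qed

text \<open>The bilinear form of the matrix is the mean of \<omega> times two trigonometric
  polynomials, whose quadratic means are the coefficient norms by Parseval. The arithmetic-geometric
  mean inequality serves in place of Cauchy--Schwarz for integrals.\<close>

lemma hankel_is_operator_matrix:
  assumes "bounded_symbol \<omega>"
  shows "is_operator_matrix (\<lambda>j k. fourier_coeff \<omega> (int (j + k)))"
proof -
  obtain C0 where C0: "AE \<theta> in lebesgue. cmod (\<omega> (cis \<theta>)) \<le> C0" using assms by (auto simp: bounded_symbol_def)
  define C where "C = max C0 1"
  have C: "C > 0" "AE \<theta> in lebesgue. cmod (\<omega> (cis \<theta>)) \<le> C" using C0 by (auto simp: C_def elim: eventually_mono)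
  define a where "a j k = fourier_coeff \<omega> (int (j + k))" for j k
  define p where "p m x \<theta> = (\<Sum>j<m. x j * cis (- (real j * \<theta>)))" for m and x :: "nat \<Rightarrow> complex" and \<theta>
  have p_cont: "continuous_on UNIV (p m x)" for m x
    unfolding p_def[abs_def] by (intro continuous_intros continuous_on_cis)
  have bil: "cmod (\<Sum>k<n. (\<Sum>j<m. a j k * x j) * y k) \<le> C * (((\<Sum>j<m. (cmod (x j))\<^sup>2) + (\<Sum>k<n. (cmod (y k))\<^sup>2)) / 2)"
    for m n x y
  proof -
    have "(LINT \<theta>:{0..2*pi}|lebesgue. \<omega> (cis \<theta>) * (p m x \<theta> * p n y \<theta>))
        = (LINT \<theta>:{0..2*pi}|lebesgue. (\<Sum>k<n. \<Sum>j<m. x j * y k * (\<omega> (cis \<theta>) * cis (- (of_int (int (j + k)) * \<theta>)))))"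
    proof -
      have "\<omega> (cis \<theta>) * (p m x \<theta> * p n y \<theta>)
          = (\<Sum>k<n. \<Sum>j<m. x j * y k * (\<omega> (cis \<theta>) * cis (- (of_int (int (j + k)) * \<theta>))))" for \<theta>
      proof -
        have "\<omega> (cis \<theta>) * (p m x \<theta> * p n y \<theta>) = \<omega> (cis \<theta>) * (p n y \<theta> * p m x \<theta>)"
          by (simp add: mult.commute)
        also have "\<dots> = (\<Sum>k<n. \<Sum>j<m. x j * y k * (\<omega> (cis \<theta>) * (cis (- (real j * \<theta>)) * cis (- (real k * \<theta>)))))"
          unfolding p_def sum_product unfolding sum_distrib_left by (intro sum.cong refl) (simp add: mult_ac)
        finally show ?thesis by (simp add: cis_mult algebra_simps)
      qed
      then show ?thesis by simp
    qed
    also have "\<dots> = (\<Sum>k<n. \<Sum>j<m. x j * y k * (LINT \<theta>:{0..2*pi}|lebesgue. \<omega> (cis \<theta>) * cis (- (of_int (int (j + k)) * \<theta>))))"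
    proof -
      define g where "g l \<theta> = indicat_real {0..2*pi} \<theta> *\<^sub>R (\<omega> (cis \<theta>) * cis (- (of_int (int l) * \<theta>)))" for l \<theta>
      have "integrable lebesgue (g l)" for l
        unfolding g_def[abs_def] set_integrable_def[symmetric]
        by (intro bounded_symbol_set_integrable[OF assms] continuous_intros continuous_on_cis)
      then have "(LINT \<theta>|lebesgue. (\<Sum>k<n. \<Sum>j<m. x j * y k * g (j + k) \<theta>))
          = (\<Sum>k<n. \<Sum>j<m. x j * y k * (LINT \<theta>|lebesgue. g (j + k) \<theta>))" by simp
      then show ?thesis
        unfolding set_lebesgue_integral_def g_def scaleR_sum_right mult_scaleR_right .
    qed
    also have "\<dots> = 2 * pi * (\<Sum>k<n. (\<Sum>j<m. a j k * x j) * y k)"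
      by (simp add: a_def fourier_coeff_def sum_distrib_left sum_distrib_right mult_ac)
    finally have eq: "(LINT \<theta>:{0..2*pi}|lebesgue. \<omega> (cis \<theta>) * (p m x \<theta> * p n y \<theta>))
      = 2 * pi * (\<Sum>k<n. (\<Sum>j<m. a j k * x j) * y k)" .
    have sq: "set_integrable lebesgue {0..2*pi} (\<lambda>\<theta>. (cmod (p m x \<theta>))\<^sup>2)"
      "(LINT \<theta>:{0..2*pi}|lebesgue. (cmod (p m x \<theta>))\<^sup>2) = 2 * pi * (\<Sum>j<m. (cmod (x j))\<^sup>2)" for m x
    proof -
      have hi: "((\<lambda>\<theta>. (cmod (p m x \<theta>))\<^sup>2) has_integral 2 * pi * (\<Sum>j<m. (cmod (x j))\<^sup>2)) {0..2*pi}"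
        unfolding p_def by (rule trig_poly_parseval)
      then have "(\<lambda>\<theta>. (cmod (p m x \<theta>))\<^sup>2) absolutely_integrable_on {0..2*pi}"
        by (intro nonnegative_absolutely_integrable_1) auto
      then show *: "set_integrable lebesgue {0..2*pi} (\<lambda>\<theta>. (cmod (p m x \<theta>))\<^sup>2)"
        by (simp add: absolutely_integrable_on_def)
      show "(LINT \<theta>:{0..2*pi}|lebesgue. (cmod (p m x \<theta>))\<^sup>2) = 2 * pi * (\<Sum>j<m. (cmod (x j))\<^sup>2)"
        using set_lebesgue_integral_eq_integral(2)[OF *] integral_unique[OF hi] by simp
    qed
    have "cmod (LINT \<theta>:{0..2*pi}|lebesgue. \<omega> (cis \<theta>) * (p m x \<theta> * p n y \<theta>))
       \<le> (LINT \<theta>:{0..2*pi}|lebesgue. C * (((cmod (p m x \<theta>))\<^sup>2 + (cmod (p n y \<theta>))\<^sup>2) / 2))"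
      unfolding set_lebesgue_integral_def
    proof (rule order_trans[OF integral_norm_bound integral_mono_AE[OF integrable_norm]])
      show "integrable lebesgue (\<lambda>\<theta>. indicat_real {0..2*pi} \<theta> *\<^sub>R (\<omega> (cis \<theta>) * (p m x \<theta> * p n y \<theta>)))"
        using bounded_symbol_set_integrable[OF assms, of "\<lambda>\<theta>. p m x \<theta> * p n y \<theta>"] p_cont
        unfolding set_integrable_def by (simp add: continuous_on_mult)
    next
      have "set_integrable lebesgue {0..2*pi} (\<lambda>\<theta>. C * (((cmod (p m x \<theta>))\<^sup>2 + (cmod (p n y \<theta>))\<^sup>2) / 2))"
        using sq(1) by (intro set_integrable_mult_right set_integrable_divide set_integral_add) auto
      then show "integrable lebesgue (\<lambda>\<theta>. indicat_real {0..2*pi} \<theta> *\<^sub>R (C * (((cmod (p m x \<theta>))\<^sup>2 + (cmod (p n y \<theta>))\<^sup>2) / 2)))"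
        by (simp add: set_integrable_def)
    next
      have pq: "cmod (p m x \<theta>) * cmod (p n y \<theta>) \<le> ((cmod (p m x \<theta>))\<^sup>2 + (cmod (p n y \<theta>))\<^sup>2) / 2" for \<theta>
        using sum_squares_bound[of "cmod (p m x \<theta>)" "cmod (p n y \<theta>)"] by simp
      show "AE \<theta> in lebesgue. norm (indicat_real {0..2*pi} \<theta> *\<^sub>R (\<omega> (cis \<theta>) * (p m x \<theta> * p n y \<theta>)))
          \<le> indicat_real {0..2*pi} \<theta> *\<^sub>R (C * (((cmod (p m x \<theta>))\<^sup>2 + (cmod (p n y \<theta>))\<^sup>2) / 2))"
        using C(2)
      proof eventually_elim
        case (elim \<theta>)
        then have "cmod (\<omega> (cis \<theta>)) * (cmod (p m x \<theta>) * cmod (p n y \<theta>))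
            \<le> C * (((cmod (p m x \<theta>))\<^sup>2 + (cmod (p n y \<theta>))\<^sup>2) / 2)"
          using C(1) by (intro mult_mono pq) auto
        then show ?case by (simp add: norm_mult indicator_def)
      qed
    qed
    also have "\<dots> = C * ((2 * pi * (\<Sum>j<m. (cmod (x j))\<^sup>2) + 2 * pi * (\<Sum>k<n. (cmod (y k))\<^sup>2)) / 2)"
      using sq by (simp add: set_integral_add)
    finally have "2 * pi * cmod (\<Sum>k<n. (\<Sum>j<m. a j k * x j) * y k)
       \<le> 2 * pi * (C * (((\<Sum>j<m. (cmod (x j))\<^sup>2) + (\<Sum>k<n. (cmod (y k))\<^sup>2)) / 2))"
      unfolding eq by (simp add: norm_mult algebra_simps)
    then show ?thesis by simp
  qed
  have "is_operator_matrix a"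
  proof (rule operator_matrixI[of _ "C\<^sup>2"])
    fix m n and x :: "nat \<Rightarrow> complex"
    define c where "c k = (\<Sum>j<m. a j k * x j)" for k
    define S where "S = (\<Sum>k<n. (cmod (c k))\<^sup>2)"
    \<comment> \<open>The second vector is the conjugated image divided by \<open>C\<close>. This
      scaling balances the two halves of the arithmetic mean, so S \<le> C^2 |x|^2 comes out without
      loss.\<close>
    have "(\<Sum>k<n. c k * (cnj (c k) / C)) = of_real (S / C)"
      by (simp add: S_def sum_divide_distrib complex_norm_square del: of_real_power)
    moreover have "(\<Sum>k<n. (cmod (cnj (c k) / C))\<^sup>2) = S / C\<^sup>2"
      by (simp add: S_def sum_divide_distrib norm_divide power_divide)
    moreover have "S \<ge> 0" by (simp add: S_def sum_nonneg)
    ultimately have "S / C \<le> C * (((\<Sum>j<m. (cmod (x j))\<^sup>2) + S / C\<^sup>2) / 2)"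
      using bil[where x=x and n=n and m=m and y="\<lambda>k. cnj (c k) / C"] C(1)
      unfolding c_def[symmetric] by (simp add: norm_divide)
    then show "(\<Sum>k<n. (cmod (\<Sum>j<m. a j k * x j))\<^sup>2) \<le> C\<^sup>2 * (\<Sum>j<m. (cmod (x j))\<^sup>2)"
      using C(1) unfolding c_def[symmetric] S_def[symmetric]
      by (simp add: field_simps power2_eq_square)
  qed
  then show ?thesis unfolding a_def[abs_def] .
qed

section \<open>The sawtooth symbol and its Fourier coefficients\<close>

lemma Arg2pi_cis_shift:
  assumes "2 * pi * of_int m \<le> x" "x < 2 * pi * (of_int m + 1)"
  shows "Arg2pi (cis x) = x - 2 * pi * of_int m"
proof (rule Arg2pi_unique[of 1])
  show "complex_of_real 1 * exp (\<i> * complex_of_real (x - 2 * pi * of_int m)) = cis x"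
  proof -
    have "exp (\<i> * complex_of_real (x - 2 * pi * of_int m)) = cis (x - 2 * pi * of_int m)"
      by (simp add: cis_conv_exp)
    also have "\<dots> = cis x" using cis_multiple_2pi[of "of_int m"] by (simp add: cis_divide[symmetric])
    finally show ?thesis by simp
  qed
qed (use assms in \<open>auto simp: algebra_simps\<close>)

lemma Arg2pi_cis_floor: "Arg2pi (cis x) = x - 2 * pi * of_int \<lfloor>x / (2 * pi)\<rfloor>"
proof (rule Arg2pi_cis_shift)
  have "of_int \<lfloor>x / (2 * pi)\<rfloor> \<le> x / (2 * pi)" "x / (2 * pi) < of_int \<lfloor>x / (2 * pi)\<rfloor> + 1" by linarith+
  from mult_left_mono[OF this(1), of "2 * pi"] mult_strict_left_mono[OF this(2), of "2 * pi"]
  show "2 * pi * of_int \<lfloor>x / (2 * pi)\<rfloor> \<le> x" "x < 2 * pi * (of_int \<lfloor>x / (2 * pi)\<rfloor> + 1)"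
    by simp_all
qed

lemma gamma_symbol_cis:
  assumes "2 * pi * of_int m \<le> x" "x < 2 * pi * (of_int m + 1)"
  shows "gamma_symbol (cis x) = \<i> / pi * cis (- x) * of_real (pi - (x - 2 * pi * of_int m))"
proof -
  have "cis (- (x - 2 * pi * of_int m)) = cis (- x)"
    using cis_multiple_2pi[of "of_int m"] cis_mult[of "- x" "2 * pi * of_int m"] by simp
  then show ?thesis unfolding gamma_symbol_def Arg2pi_cis_shift[OF assms] by simp
qed

lemma norm_gamma_symbol: "cmod (gamma_symbol v) \<le> 1"
proof -
  have "\<bar>pi - Arg2pi v\<bar> \<le> pi" using Arg2pi_ge_0[of v] Arg2pi_lt_2pi[of v] by linarith
  moreover have "cmod (gamma_symbol v) = \<bar>pi - Arg2pi v\<bar> / pi"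
    unfolding gamma_symbol_def by (simp add: norm_mult norm_divide flip: of_real_diff)
  ultimately show ?thesis by (simp add: divide_le_eq)
qed

text \<open>Writing the argument of a rotated point with a floor function displays the symbol as a
  Borel function of the angle, across its jump.\<close>

lemma gamma_symbol_rotated_measurable:
  assumes "cmod z = 1"
  shows "(\<lambda>\<theta>. gamma_symbol (cnj z * cis \<theta>)) \<in> borel_measurable lebesgue"
proof -
  define \<phi> where "\<phi> = Arg2pi z"
  have z: "z = cis \<phi>" using Arg2pi_eq[of z] assms by (simp add: \<phi>_def cis_conv_exp)
  have "(\<lambda>\<theta>. gamma_symbol (cnj z * cis \<theta>)) = (\<lambda>\<theta>. \<i> / pi * cis (- ((\<theta> - \<phi>) - 2 * pi * of_int \<lfloor>(\<theta> - \<phi>) / (2 * pi)\<rfloor>))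
      * of_real (pi - ((\<theta> - \<phi>) - 2 * pi * of_int \<lfloor>(\<theta> - \<phi>) / (2 * pi)\<rfloor>)))"
  proof
    fix \<theta>
    have "cnj z * cis \<theta> = cis (\<theta> - \<phi>)" by (simp add: z cis_cnj cis_mult)
    then show "gamma_symbol (cnj z * cis \<theta>) = \<i> / pi * cis (- ((\<theta> - \<phi>) - 2 * pi * of_int \<lfloor>(\<theta> - \<phi>) / (2 * pi)\<rfloor>))
      * of_real (pi - ((\<theta> - \<phi>) - 2 * pi * of_int \<lfloor>(\<theta> - \<phi>) / (2 * pi)\<rfloor>))"
      by (simp add: gamma_symbol_def Arg2pi_cis_floor)
  qed
  moreover have "\<dots> \<in> borel_measurable borel"
  proof -
    have [measurable]: "cis \<in> borel_measurable borel"
      by (intro borel_measurable_continuous_onI continuous_on_cis continuous_on_id)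
    show ?thesis by measurable
  qed
  ultimately show ?thesis by (intro measurable_completion) simp
qed

lemma bounded_symbol_gamma:
  assumes "cmod z = 1"
  shows "bounded_symbol (\<lambda>v. gamma_symbol (cnj z * v))"
  unfolding bounded_symbol_def
  using gamma_symbol_rotated_measurable[OF assms] norm_gamma_symbol by (auto intro!: exI[of _ 1] always_eventually)

lemma bounded_symbol_add:
  assumes "bounded_symbol f" "bounded_symbol g"
  shows "bounded_symbol (\<lambda>v. f v + g v)"
proof -
  obtain C D where C: "AE \<theta> in lebesgue. cmod (f (cis \<theta>)) \<le> C" "AE \<theta> in lebesgue. cmod (g (cis \<theta>)) \<le> D"
    using assms by (auto simp: bounded_symbol_def)
  have "AE \<theta> in lebesgue. cmod (f (cis \<theta>) + g (cis \<theta>)) \<le> C + D"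
    using C by eventually_elim (auto intro: order_trans[OF norm_triangle_ineq] add_mono)
  with assms show ?thesis by (auto simp: bounded_symbol_def)
qed

lemma bounded_symbol_mult:
  assumes "bounded_symbol f"
  shows "bounded_symbol (\<lambda>v. c * f v)"
proof -
  obtain C where C: "AE \<theta> in lebesgue. cmod (f (cis \<theta>)) \<le> C"
    using assms by (auto simp: bounded_symbol_def)
  have "AE \<theta> in lebesgue. cmod (c * f (cis \<theta>)) \<le> cmod c * C"
    using C by eventually_elim (auto simp: norm_mult intro: mult_left_mono)
  with assms show ?thesis by (auto simp: bounded_symbol_def)
qed

lemma bounded_symbol_sum:
  assumes "\<And>i. i \<in> I \<Longrightarrow> bounded_symbol (f i)"
  shows "bounded_symbol (\<lambda>v. \<Sum>i\<in>I. f i v)"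
  using assms
proof (induction I rule: infinite_finite_induct)
  case (insert i I)
  then show ?case using bounded_symbol_add[of "f i" "\<lambda>v. \<Sum>i\<in>I. f i v"] by simp
qed (auto simp: bounded_symbol_def)

lemma bounded_symbol_cong:
  assumes "\<And>v. cmod v = 1 \<Longrightarrow> f v = g v"
  shows "bounded_symbol f = bounded_symbol g"
  using assms by (simp add: bounded_symbol_def)

lemma fourier_coeff_cong:
  assumes "\<And>v. cmod v = 1 \<Longrightarrow> f v = g v"
  shows "fourier_coeff f = fourier_coeff g"
  using assms by (simp add: fourier_coeff_def fun_eq_iff)

lemma symbol_set_integrable:
  assumes "bounded_symbol f"
  shows "set_integrable lebesgue {0..2*pi} (\<lambda>\<theta>. f (cis \<theta>) * cis (- (of_int j * \<theta>)))"
  by (intro bounded_symbol_set_integrable[OF assms] continuous_intros continuous_on_cis)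

lemma fourier_coeff_add:
  assumes "bounded_symbol f" "bounded_symbol g"
  shows "fourier_coeff (\<lambda>v. f v + g v) j = fourier_coeff f j + fourier_coeff g j"
  using symbol_set_integrable[OF assms(1)] symbol_set_integrable[OF assms(2)]
  by (simp add: fourier_coeff_def distrib_right set_integral_add add_divide_distrib)

lemma fourier_coeff_mult:
  "fourier_coeff (\<lambda>v. c * f v) j = c * fourier_coeff f j"
  by (simp add: fourier_coeff_def mult.assoc)

lemma fourier_coeff_sum:
  assumes "\<And>i. i \<in> I \<Longrightarrow> bounded_symbol (f i)"
  shows "fourier_coeff (\<lambda>v. \<Sum>i\<in>I. f i v) j = (\<Sum>i\<in>I. fourier_coeff (f i) j)"
  using assms
proof (induction I rule: infinite_finite_induct)
  case (insert i I)
  then show ?case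
    using fourier_coeff_add[of "f i" "\<lambda>v. \<Sum>i\<in>I. f i v"] bounded_symbol_sum[of I f] by simp
qed (auto simp: fourier_coeff_def)

text \<open>The primitive comes from integration by parts. The offset \<open>c\<close> is free
  because the sawtooth has different offsets on the two sides of its jump.\<close>

lemma ramp_has_integral:
  assumes "a \<le> b" "n \<noteq> 0"
  shows "((\<lambda>\<theta>. cis (- (n * \<theta>)) * of_real (c - \<theta>)) has_integral
    ((\<i> * of_real (c - b) / of_real n - 1 / of_real n ^ 2) * cis (- (n * b))
      - (\<i> * of_real (c - a) / of_real n - 1 / of_real n ^ 2) * cis (- (n * a)))) {a..b}"
proof (rule fundamental_theorem_of_calculus[OF assms(1)])
  fix x :: real
  have d1: "((\<lambda>\<theta>. cis (- (n * \<theta>))) has_vector_derivative (- n) *\<^sub>R (\<i> * cis (- (n * x)))) (at x within {a..b})"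
  proof -
    have "((\<lambda>\<theta>. cis (- (n * \<theta>))) has_derivative (\<lambda>h. (- (n * h)) *\<^sub>R (\<i> * cis (- (n * x))))) (at x within {a..b})"
      by (auto intro!: derivative_eq_intros)
    then show ?thesis by (simp add: has_vector_derivative_def mult.commute)
  qed
  have d2: "((\<lambda>\<theta>. \<i> * of_real (c - \<theta>) / of_real n - 1 / of_real n ^ 2) has_vector_derivative (- \<i> / of_real n)) (at x within {a..b})"
    using assms(2) by (auto intro!: derivative_eq_intros simp: has_vector_derivative_def scaleR_conv_of_real) 
  note D = has_vector_derivative_mult[OF d2 d1]
  show "((\<lambda>\<theta>. (\<i> * of_real (c - \<theta>) / of_real n - 1 / of_real n ^ 2) * cis (- (n * \<theta>))) has_vector_derivative
      cis (- (n * x)) * of_real (c - x)) (at x within {a..b})"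
    by (rule has_vector_derivative_eq_rhs[OF D])
      (use assms(2) in \<open>simp add: scaleR_conv_of_real field_simps power2_eq_square\<close>)
qed

text \<open>The integral is split at the argument \<phi> of z. By periodicity the boundary terms at
  0 and 2 pi cancel, and the quadratic terms cancel at \<phi>; what remains is the jump of the ramp
  by 2 pi, divided by n. The factor e^(-i \<theta>) in the symbol is responsible for n = j + 1
  instead of j.\<close>

lemma fourier_coeff_gamma:
  assumes "cmod z = 1"
  shows "fourier_coeff (\<lambda>v. gamma_symbol (cnj z * v)) (int j) = cnj z ^ j / (pi * (real j + 1))"
proof -
  define \<phi> where "\<phi> = Arg2pi z"
  have z: "z = cis \<phi>" using Arg2pi_eq[of z] assms by (simp add: \<phi>_def cis_conv_exp)
  have \<phi>: "0 \<le> \<phi>" "\<phi> < 2 * pi" using Arg2pi_ge_0 Arg2pi_lt_2pi by (auto simp: \<phi>_def)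
  define n where "n = real j + 1"
  have n: "n \<noteq> 0" by (simp add: n_def)
  have g: "gamma_symbol (cnj z * cis \<theta>) * cis (- (of_int (int j) * \<theta>)) =
      \<i> / pi * cis \<phi> * (cis (- (n * \<theta>)) * of_real (pi + \<phi> + 2 * pi * of_int m - \<theta>))"
    if "2 * pi * of_int m \<le> \<theta> - \<phi>" "\<theta> - \<phi> < 2 * pi * (of_int m + 1)" for \<theta> m
  proof -
    have e1: "cnj z * cis \<theta> = cis (\<theta> - \<phi>)" by (simp add: z cis_cnj cis_mult)
    have e2: "cis (- (\<theta> - \<phi>)) * cis (- (of_int (int j) * \<theta>)) = cis \<phi> * cis (- (n * \<theta>))"
      by (simp add: cis_mult n_def algebra_simps)
    have e3: "pi - (\<theta> - \<phi> - 2 * pi * of_int m) = pi + \<phi> + 2 * pi * of_int m - \<theta>" by simp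
    have "gamma_symbol (cnj z * cis \<theta>) * cis (- (of_int (int j) * \<theta>))
      = \<i> / pi * (cis (- (\<theta> - \<phi>)) * cis (- (of_int (int j) * \<theta>))) * of_real (pi - (\<theta> - \<phi> - 2 * pi * of_int m))"
      unfolding e1 gamma_symbol_cis[OF that] by (simp only: mult_ac)
    then show ?thesis unfolding e2 e3 by (simp only: mult_ac)
  qed
  define F where "F c x = (\<i> * of_real (c - x) / of_real n - 1 / of_real n ^ 2) * cis (- (n * x))" for c x
  \<comment> \<open>The shifted angle lies in the branch m = -1 before the jump at \<phi> and in m =
    0 after it, which moves the offset of the ramp from \<phi> - pi to \<phi> + pi.\<close>
  have i1: "((\<lambda>\<theta>. gamma_symbol (cnj z * cis \<theta>) * cis (- (of_int (int j) * \<theta>))) has_integral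
      \<i> / pi * cis \<phi> * (F (\<phi> - pi) \<phi> - F (\<phi> - pi) 0)) {0..\<phi>}"
  proof (rule has_integral_spike_finite[of "{\<phi>}"])
    show "((\<lambda>\<theta>. \<i> / pi * cis \<phi> * (cis (- (n * \<theta>)) * of_real (\<phi> - pi - \<theta>))) has_integral
      \<i> / pi * cis \<phi> * (F (\<phi> - pi) \<phi> - F (\<phi> - pi) 0)) {0..\<phi>}"
      unfolding F_def by (intro has_integral_mult_right ramp_has_integral \<phi> n)
    fix \<theta> assume "\<theta> \<in> {0..\<phi>} - {\<phi>}"
    then show "gamma_symbol (cnj z * cis \<theta>) * cis (- (of_int (int j) * \<theta>))
        = \<i> / pi * cis \<phi> * (cis (- (n * \<theta>)) * of_real (\<phi> - pi - \<theta>))"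
      using g[of "-1" \<theta>] \<phi> by (simp add: algebra_simps)
  qed simp
  have i2: "((\<lambda>\<theta>. gamma_symbol (cnj z * cis \<theta>) * cis (- (of_int (int j) * \<theta>))) has_integral
      \<i> / pi * cis \<phi> * (F (\<phi> + pi) (2 * pi) - F (\<phi> + pi) \<phi>)) {\<phi>..2 * pi}"
  proof (rule has_integral_spike_finite[of "{2 * pi}"])
    show "((\<lambda>\<theta>. \<i> / pi * cis \<phi> * (cis (- (n * \<theta>)) * of_real (\<phi> + pi - \<theta>))) has_integral
      \<i> / pi * cis \<phi> * (F (\<phi> + pi) (2 * pi) - F (\<phi> + pi) \<phi>)) {\<phi>..2 * pi}"
      unfolding F_def using \<phi> by (intro has_integral_mult_right ramp_has_integral n) auto
    fix \<theta> assume "\<theta> \<in> {\<phi>..2 * pi} - {2 * pi}"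
    then show "gamma_symbol (cnj z * cis \<theta>) * cis (- (of_int (int j) * \<theta>))
        = \<i> / pi * cis \<phi> * (cis (- (n * \<theta>)) * of_real (\<phi> + pi - \<theta>))"
      using g[of 0 \<theta>] \<phi> by (simp add: algebra_simps)
  qed simp
  have c1: "cis (- (n * (2 * pi))) = 1"
    using cis_multiple_2pi[of "- n"] by (simp add: n_def algebra_simps)
  have "(LINT \<theta>:{0..2*pi}|lebesgue. gamma_symbol (cnj z * cis \<theta>) * cis (- (of_int (int j) * \<theta>)))
      = integral {0..2*pi} (\<lambda>\<theta>. gamma_symbol (cnj z * cis \<theta>) * cis (- (of_int (int j) * \<theta>)))"
    by (rule set_lebesgue_integral_eq_integral(2)[OF symbol_set_integrable[OF bounded_symbol_gamma[OF assms]]])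
  also have "\<dots> = \<i> / pi * cis \<phi> * (F (\<phi> - pi) \<phi> - F (\<phi> - pi) 0) + \<i> / pi * cis \<phi> * (F (\<phi> + pi) (2 * pi) - F (\<phi> + pi) \<phi>)"
    by (rule integral_unique[OF has_integral_combine[OF _ _ i1 i2]]) (use \<phi> in auto)
  also have "\<dots> = \<i> / pi * cis \<phi> * ((F (\<phi> - pi) \<phi> - F (\<phi> + pi) \<phi>) + (F (\<phi> + pi) (2 * pi) - F (\<phi> - pi) 0))"
    by (simp add: algebra_simps)
  also have "F (\<phi> + pi) (2 * pi) - F (\<phi> - pi) 0 = 0"
    by (simp add: F_def c1)
  also have "F (\<phi> - pi) \<phi> - F (\<phi> + pi) \<phi> = - 2 * pi * \<i> / of_real n * cis (- (n * \<phi>))"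
    using n by (simp add: F_def field_simps)
  also have "\<i> / pi * cis \<phi> * (- 2 * pi * \<i> / of_real n * cis (- (n * \<phi>)) + 0) = 2 / of_real n * (cis \<phi> * cis (- (n * \<phi>)))"
    by (simp add: field_simps)
  also have "cis \<phi> * cis (- (n * \<phi>)) = cnj z ^ j"
  proof -
    have "cnj z ^ j = cis (real j * (- \<phi>))" unfolding z cis_cnj by (rule Complex.DeMoivre)
    then show ?thesis unfolding cis_mult by (simp add: n_def algebra_simps)
  qed
  finally have "fourier_coeff (\<lambda>v. gamma_symbol (cnj z * v)) (int j) = 2 / of_real n * cnj z ^ j / (2 * pi)"
    by (simp add: fourier_coeff_def)
  then show ?thesis by (simp add: n_def mult.commute)
qed

section \<open>The Fourier transform of the hyperbolic secant\<close>

lemma cosh_half_eq_0: "cosh (w / 2 :: complex) = 0 \<longleftrightarrow> (\<exists>n::int. w = - \<i> * of_real ((2 * of_int n + 1) * pi))"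
proof -
  have "\<i> * (w / 2) = of_real (of_int n * pi) + of_real pi / 2 \<longleftrightarrow> w = - \<i> * of_real ((2 * of_int n + 1) * pi)" for n :: int
    by (auto simp: complex_eq_iff field_simps)
  then show ?thesis by (simp add: cosh_conv_cos cos_eq_0)
qed

text \<open>Residues on the rectangle over [-X, X] of height 2 pi, with the single pole i pi inside.
  A shift by 2 pi i multiplies the integrand by -E, so the two horizontal sides add up to (1 + E) J;
  the vertical sides give the error. The error is explicit because uniformity in \<xi> is required
  later.\<close>

lemma sech_fourier_transform_bound:
  fixes \<xi> X :: real
  assumes X: "X > 0"
  shows "\<bar>integral {-X..X} (\<lambda>x. cos (\<xi> * x) / cosh (x / 2)) - 2 * pi / cosh (pi * \<xi>)\<bar>
    \<le> 4 * pi * exp (2 * pi * \<bar>\<xi>\<bar>) / sinh (X / 2)"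
proof -
  define f where "f w = exp (\<i> * of_real \<xi> * w) / cosh (w / 2)" for w :: complex
  \<comment> \<open>The strip is widened by 1 to be an open neighbourhood of the rectangle; since pi
    > 3 the neighbouring poles -i pi and 3 i pi remain outside.\<close>
  define S where "S = {w. Im w > -1} \<inter> {w. Im w < 2 * pi + 1}"
  have S: "open S" "connected S"
    unfolding S_def by (auto intro!: open_Int convex_connected convex_Int
        convex_halfspace_Im_gt convex_halfspace_Im_lt open_halfspace_Im_gt open_halfspace_Im_lt)
  have nz: "cosh (w / 2) \<noteq> 0" if w: "w \<in> S - {\<i> * pi}" for w
  proof
    assume "cosh (w / 2) = 0"
    then obtain n :: int where n: "w = - \<i> * of_real ((2 * of_int n + 1) * pi)" by (auto simp: cosh_half_eq_0)
    with w have "(2 * of_int n + 1) * pi < 1" "- ((2 * of_int n + 1) * pi) < 2 * pi + 1"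
      by (auto simp: S_def)
    then have h: "(2 * of_int n + 1) * pi < 1" "- ((2 * of_int n + 1) * pi) < 2 * pi + 1" by auto
    have "\<not> n \<ge> 0"
    proof
      assume "n \<ge> 0"
      then have "(2 * of_int n + 1) * pi \<ge> 1 * pi" by (intro mult_right_mono) auto
      with h pi_gt3 show False by simp
    qed
    moreover have "\<not> n \<le> -2"
    proof
      assume "n \<le> -2"
      then have "3 * pi \<le> (- (2 * of_int n + 1)) * pi" by (intro mult_right_mono) auto
      with h pi_gt3 show False by (simp only: mult_minus_left)
    qed
    ultimately have "n = -1" by simp
    with n w show False by simp
  qed
  have hc: "(\<lambda>w :: complex. cosh (w / 2)) holomorphic_on A" for A
    unfolding cosh_field_def by (intro holomorphic_intros) auto
  have holo: "f holomorphic_on S - {\<i> * pi}"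
    unfolding f_def[abs_def] using nz by (intro holomorphic_intros hc) auto
  have res: "residue f (\<i> * pi) = - 2 * \<i> * exp (- (pi * \<xi>))"
  proof -
    have "residue f (\<i> * pi) = exp (\<i> * of_real \<xi> * (\<i> * pi)) / (sinh (\<i> * pi / 2) / 2)"
      unfolding f_def[abs_def]
    proof (rule residue_simple_pole_deriv[where s = UNIV])
      show "((\<lambda>w. cosh (w / 2)) has_field_derivative sinh (\<i> * pi / 2) / 2) (at (\<i> * pi))"
        by (auto intro!: derivative_eq_intros)
      show "cosh (\<i> * complex_of_real pi / 2) = 0"
        unfolding cosh_half_eq_0 by (intro exI[of _ "-1"]) simp
      show "sinh (\<i> * complex_of_real pi / 2) / 2 \<noteq> 0" by (simp add: sinh_conv_sin)
    qed (auto intro!: holomorphic_intros hc)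
    also have "sinh (\<i> * complex_of_real pi / 2) = \<i>"
      by (simp add: sinh_conv_sin sin_of_real[of "pi / 2", symmetric, simplified] del: sin_of_real)
    also have "exp (\<i> * of_real \<xi> * (\<i> * pi)) = of_real (exp (- (pi * \<xi>)))"
      by (simp add: exp_of_real[symmetric] mult_ac)
    finally show ?thesis by (simp add: field_simps)
  qed
  define a1 a2 a3 a4 where "a1 = complex_of_real (-X)" and "a2 = complex_of_real X"
    and "a3 = Complex X (2 * pi)" and "a4 = Complex (-X) (2 * pi)"
  have rp: "rectpath a1 a3 = linepath a1 a2 +++ linepath a2 a3 +++ linepath a3 a4 +++ linepath a4 a1"
    by (simp add: rectpath_def Let_def a1_def a2_def a3_def a4_def complex_of_real_def)
  have box: "\<i> * pi \<in> box a1 a3" using X by (simp add: in_box_complex_iff a1_def a3_def)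
  have pim: "path_image (rectpath a1 a3) \<subseteq> S - {\<i> * pi}"
    using X pi_gt3 by (subst path_image_rectpath) (auto simp: a1_def a3_def S_def)
  have vp: "valid_path (rectpath a1 a3)"
    unfolding rp by (auto intro!: valid_path_join)
  have "contour_integral (rectpath a1 a3) f = 2 * pi * \<i> * (\<Sum>p\<in>{\<i> * pi}. winding_number (rectpath a1 a3) p * residue f p)"
  proof (rule Residue_theorem[OF S _ holo vp _ pim])
    show "\<forall>z. z \<notin> S \<longrightarrow> winding_number (rectpath a1 a3) z = 0"
      using X by (auto intro!: winding_number_rectpath_outside simp: in_cbox_complex_iff S_def a1_def a3_def)
  qed auto
  then have total: "contour_integral (rectpath a1 a3) f = 4 * pi * exp (- (pi * \<xi>))"
    by (simp add: winding_number_rectpath[OF box] res)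
  have cont: "continuous_on (S - {\<i> * pi}) f" by (rule holomorphic_on_imp_continuous_on[OF holo])
  have seg: "closed_segment a1 a2 \<subseteq> S - {\<i> * pi}" "closed_segment a2 a3 \<subseteq> S - {\<i> * pi}"
    "closed_segment a3 a4 \<subseteq> S - {\<i> * pi}" "closed_segment a4 a1 \<subseteq> S - {\<i> * pi}"
    using pim unfolding rp by (auto simp: path_image_join)
  have int: "f contour_integrable_on linepath a1 a2" "f contour_integrable_on linepath a2 a3"
    "f contour_integrable_on linepath a3 a4" "f contour_integrable_on linepath a4 a1"
    using seg by (auto intro!: contour_integrable_continuous_linepath continuous_on_subset[OF cont])
  define J where "J = contour_integral (linepath a1 a2) f"
  define E where "E = exp (- (2 * pi * \<xi>))"
  have split: "contour_integral (rectpath a1 a3) f = J + contour_integral (linepath a2 a3) f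
      + contour_integral (linepath a3 a4) f + contour_integral (linepath a4 a1) f"
    unfolding rp J_def using int by (simp add: contour_integral_join contour_integrable_joinI valid_path_join add_ac)
  have per: "f (w + 2 * pi * \<i>) = - E * f w" for w
  proof -
    have "cosh ((w + 2 * pi * \<i>) / 2) = cosh (w / 2 + \<i> * pi)" by (simp add: field_simps)
    also have "\<dots> = - cosh (w / 2)" by (simp add: cosh_add cosh_conv_cos[of "\<i> * pi"] sinh_conv_sin)
    finally have c: "cosh ((w + 2 * pi * \<i>) / 2) = - cosh (w / 2)" .
    have e: "exp (\<i> * of_real \<xi> * (w + 2 * pi * \<i>)) = exp (\<i> * of_real \<xi> * w) * exp (of_real (- (2 * pi * \<xi>)))"
      unfolding exp_add[symmetric] by (rule arg_cong[of _ _ exp]) (simp add: algebra_simps)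
    show ?thesis unfolding f_def c e E_def by (simp only: exp_of_real) simp
  qed
  have hJ: "(f has_contour_integral J) (linepath a1 a2)"
    unfolding J_def by (rule has_contour_integral_integral[OF int(1)])
  have top: "contour_integral (linepath a3 a4) f = E * J"
  proof -
    have rev: "(f has_contour_integral - J) (linepath a2 a1)"
      using has_contour_integral_reversepath[OF _ hJ] by simp
    have "((\<lambda>x. f (linepath a3 a4 x) * (a4 - a3)) has_integral (- E * - J)) {0..1}"
    proof -
      have l: "linepath a3 a4 x = linepath a2 a1 x + 2 * pi * \<i>" for x
        by (simp add: linepath_def a1_def a2_def a3_def a4_def complex_eq_iff algebra_simps)
      have d: "a4 - a3 = a1 - a2" by (simp add: a1_def a2_def a3_def a4_def complex_eq_iff)
      show ?thesis
        using has_integral_mult_right[OF rev[unfolded has_contour_integral_linepath], of "- E"]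
        unfolding l per d by (simp add: mult_ac)
    qed
    then have "(f has_contour_integral E * J) (linepath a3 a4)" unfolding has_contour_integral_linepath by simp
    then show ?thesis by (rule contour_integral_unique)
  qed
  have side: "cmod (contour_integral (linepath a b) f) \<le> 2 * pi * exp (2 * pi * \<bar>\<xi>\<bar>) / sinh (X / 2)"
    if ab: "f contour_integrable_on linepath a b" "cmod (b - a) = 2 * pi"
      "\<And>w. w \<in> closed_segment a b \<Longrightarrow> \<bar>Re w\<bar> = X \<and> 0 \<le> Im w \<and> Im w \<le> 2 * pi" for a b
  proof -
    have sX: "sinh (X / 2) > 0" using X by simp
    have "cmod (f w) \<le> exp (2 * pi * \<bar>\<xi>\<bar>) / sinh (X / 2)" if w: "w \<in> closed_segment a b" for w
    proof -
      note ab(3)[OF w]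
      have num: "cmod (exp (\<i> * of_real \<xi> * w)) \<le> exp (2 * pi * \<bar>\<xi>\<bar>)"
      proof -
        have "- (\<xi> * Im w) \<le> \<bar>\<xi>\<bar> * \<bar>Im w\<bar>" by (metis abs_ge_minus_self abs_mult)
        also have "\<dots> \<le> \<bar>\<xi>\<bar> * (2 * pi)" using ab(3)[OF w] by (intro mult_left_mono) auto
        finally show ?thesis by (simp add: norm_exp_eq_Re mult_ac)
      qed
      have "sinh (X / 2) = \<bar>exp (Re w / 2) - exp (- Re w / 2)\<bar> / 2"
        using ab(3)[OF w] X by (auto simp: abs_if sinh_field_def split: if_splits)
      also have "\<dots> \<le> cmod (exp (w / 2) + exp (- (w / 2))) / 2"
        using norm_triangle_ineq2[of "exp (w / 2)" "- exp (- (w / 2))"]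
          norm_triangle_ineq2[of "exp (- (w / 2))" "- exp (w / 2)"]
        by (simp add: norm_exp_eq_Re add.commute)
      also have "\<dots> = cmod (cosh (w / 2))" by (simp add: cosh_field_def norm_divide)
      finally show ?thesis
        unfolding f_def norm_divide using num sX by (intro frac_le) auto
    qed
    then have "cmod (contour_integral (linepath a b) f) \<le> exp (2 * pi * \<bar>\<xi>\<bar>) / sinh (X / 2) * cmod (b - a)"
      using sX by (intro contour_integral_bound_linepath[OF ab(1)]) auto
    then show ?thesis by (simp add: ab(2) mult_ac)
  qed
  have s1: "cmod (contour_integral (linepath a2 a3) f) \<le> 2 * pi * exp (2 * pi * \<bar>\<xi>\<bar>) / sinh (X / 2)"
  proof (rule side[OF int(2)])
    have "a3 - a2 = of_real (2 * pi) * \<i>" by (simp add: a2_def a3_def complex_eq_iff)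
    then show "cmod (a3 - a2) = 2 * pi" by (simp add: norm_mult)
    fix w assume "w \<in> closed_segment a2 a3"
    then show "\<bar>Re w\<bar> = X \<and> 0 \<le> Im w \<and> Im w \<le> 2 * pi"
      using X pi_gt_zero by (auto simp: closed_segment_same_Re a2_def a3_def closed_segment_eq_real_ivl split: if_splits)
  qed
  have s2: "cmod (contour_integral (linepath a4 a1) f) \<le> 2 * pi * exp (2 * pi * \<bar>\<xi>\<bar>) / sinh (X / 2)"
  proof (rule side[OF int(4)])
    have "a1 - a4 = of_real (- 2 * pi) * \<i>" by (simp add: a1_def a4_def complex_eq_iff)
    then show "cmod (a1 - a4) = 2 * pi" by (simp add: norm_mult)
    fix w assume "w \<in> closed_segment a4 a1"
    then show "\<bar>Re w\<bar> = X \<and> 0 \<le> Im w \<and> Im w \<le> 2 * pi"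
      using X pi_gt_zero by (auto simp: closed_segment_same_Re a4_def a1_def closed_segment_eq_real_ivl split: if_splits)
  qed
  have Jre: "Re J = integral {-X..X} (\<lambda>x. cos (\<xi> * x) / cosh (x / 2))"
  proof -
    have "((\<lambda>x. f (of_real x)) has_integral J) {-X..X}"
      using hJ X by (subst (asm) has_contour_integral_linepath_Reals_iff) (auto simp: a1_def a2_def)
    from has_integral_linear[OF this bounded_linear_Re]
    have "((\<lambda>x. Re (f (of_real x))) has_integral Re J) {-X..X}" by (simp add: o_def)
    moreover have "Re (f (of_real x)) = cos (\<xi> * x) / cosh (x / 2)" for x
    proof -
      have c: "cosh (complex_of_real x / 2) = of_real (cosh (x / 2))"
        by (simp add: cosh_field_def exp_of_real[symmetric])
      show ?thesis unfolding f_def c Re_divide_of_real by (simp add: Re_exp)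
    qed
    ultimately show ?thesis by (simp add: integral_unique)
  qed
  have E: "E > 0" by (simp add: E_def)
  have "J * (1 + E) - 4 * pi * exp (- (pi * \<xi>)) = - (contour_integral (linepath a2 a3) f + contour_integral (linepath a4 a1) f)"
    using split total top by (simp add: algebra_simps)
  then have "cmod (J * (1 + E) - 4 * pi * exp (- (pi * \<xi>)))
      = cmod (contour_integral (linepath a2 a3) f + contour_integral (linepath a4 a1) f)"
    by (simp only: norm_minus_cancel)
  also have "\<dots> \<le> 2 * (2 * pi * exp (2 * pi * \<bar>\<xi>\<bar>) / sinh (X / 2))"
    using norm_triangle_mono[OF s1 s2] by simp
  finally have "cmod (J * (1 + E) - 4 * pi * exp (- (pi * \<xi>))) \<le> 2 * (2 * pi * exp (2 * pi * \<bar>\<xi>\<bar>) / sinh (X / 2))" .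
  then have "\<bar>Re (J * (1 + E) - 4 * pi * exp (- (pi * \<xi>)))\<bar> \<le> 4 * pi * exp (2 * pi * \<bar>\<xi>\<bar>) / sinh (X / 2)"
    by (intro order_trans[OF abs_Re_le_cmod]) simp
  moreover have "Re (J * (1 + E) - 4 * pi * exp (- (pi * \<xi>))) = (1 + E) * (Re J - 2 * pi / cosh (pi * \<xi>))"
  proof -
    have "1 + E = 2 * exp (- (pi * \<xi>)) * cosh (pi * \<xi>)"
    proof -
      have "2 * exp (- (pi * \<xi>)) * cosh (pi * \<xi>) = exp (- (pi * \<xi>)) * exp (pi * \<xi>) + exp (- (pi * \<xi>)) * exp (- (pi * \<xi>))"
        by (simp add: cosh_field_def algebra_simps)
      then show ?thesis by (simp add: E_def exp_add[symmetric])
    qed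
    then have "(1 + E) * (2 * pi / cosh (pi * \<xi>)) = 4 * pi * exp (- (pi * \<xi>))"
      by (simp add: field_simps)
    then show ?thesis by (simp add: algebra_simps)
  qed
  ultimately have "(1 + E) * \<bar>Re J - 2 * pi / cosh (pi * \<xi>)\<bar> \<le> 4 * pi * exp (2 * pi * \<bar>\<xi>\<bar>) / sinh (X / 2)"
    using E by (simp add: abs_mult)
  moreover have "1 * \<bar>Re J - 2 * pi / cosh (pi * \<xi>)\<bar> \<le> (1 + E) * \<bar>Re J - 2 * pi / cosh (pi * \<xi>)\<bar>"
    using E by (intro mult_right_mono) auto
  ultimately show ?thesis by (simp add: Jre)
qed

section \<open>Riemann sums of the transform and finite quadratic forms\<close>

lemma lipschitz_riemann_sum:
  fixes f :: "real \<Rightarrow> real"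
  assumes cont: "continuous_on UNIV f" and lip: "\<And>x y. \<bar>f x - f y\<bar> \<le> L * \<bar>x - y\<bar>" and h: "h \<ge> 0"
  shows "\<bar>h * (\<Sum>i<n. f (a + real i * h)) - integral {a..a + real n * h} f\<bar> \<le> real n * (L * h\<^sup>2)"
proof (induction n)
  case (Suc n)
  define b where "b = a + real n * h"
  have bh: "a + real (Suc n) * h = b + h" by (simp add: b_def algebra_simps)
  have int: "f integrable_on {x..y}" for x y
    by (intro integrable_continuous_interval continuous_on_subset[OF cont]) auto
  have split: "integral {a..b + h} f = integral {a..b} f + integral {b..b + h} f"
    using h by (intro Henstock_Kurzweil_Integration.integral_combine[symmetric] int) (auto simp: b_def)
  have k0: "\<bar>integral {b..b + h} (\<lambda>x. f b - f x)\<bar> \<le> integral {b..b + h} (\<lambda>x. L * h)"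
    unfolding real_norm_def[symmetric]
  proof (rule integral_norm_bound_integral)
    fix x assume "x \<in> {b..b + h}"
    moreover have "L \<ge> 0" using lip[of 1 0] by (auto intro: order_trans[OF abs_ge_zero])
    ultimately have "L * \<bar>b - x\<bar> \<le> L * h" by (intro mult_left_mono) auto
    with lip[of b x] show "norm (f b - f x) \<le> L * h" by simp
  qed (auto intro!: integrable_diff int)
  have k1: "integral {b..b + h} (\<lambda>x. f b - f x) = h * f b - integral {b..b + h} f"
    using h by (subst Henstock_Kurzweil_Integration.integral_diff) (auto intro: int)
  have k2: "integral {b..b + h} (\<lambda>x. L * h) = L * h\<^sup>2" using h by (simp add: power2_eq_square)
  note k = k0[unfolded k1 k2]
  have "real (Suc n) * (L * h\<^sup>2) = real n * (L * h\<^sup>2) + L * h\<^sup>2" by (simp add: algebra_simps)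
  with Suc.IH k split show ?case
    unfolding bh sum.lessThan_Suc b_def[symmetric] distrib_left by linarith
qed simp

lemma sech_cos_lipschitz:
  fixes \<xi> :: real
  shows "\<bar>cos (\<xi> * x) / cosh (x / 2) - cos (\<xi> * y) / cosh (y / 2)\<bar> \<le> (\<bar>\<xi>\<bar> + 1/2) * \<bar>x - y\<bar>"
proof -
  define f' where "f' x = (- (\<xi> * sin (\<xi> * x)) * cosh (x / 2) - cos (\<xi> * x) * (sinh (x / 2) / 2)) / (cosh (x / 2) * cosh (x / 2))" for x
  have d: "((\<lambda>x. cos (\<xi> * x) / cosh (x / 2)) has_real_derivative f' x) (at x within UNIV)" for x
    unfolding f'_def by (auto intro!: derivative_eq_intros)
  have b: "norm (f' x) \<le> \<bar>\<xi>\<bar> + 1/2" for x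
  proof -
    have c1: "cosh (x / 2) \<ge> 1" by (rule cosh_real_ge_1)
    have sc: "\<bar>sinh (x / 2)\<bar> \<le> cosh (x / 2)"
      using sinh_le_cosh_real[of "x / 2"] sinh_le_cosh_real[of "- (x / 2)"] by (simp add: abs_le_iff)
    have f': "f' x = - (\<xi> * sin (\<xi> * x)) / cosh (x / 2) - cos (\<xi> * x) / cosh (x / 2) * (sinh (x / 2) / cosh (x / 2) / 2)"
      by (simp add: f'_def diff_divide_distrib)
    have "\<bar>\<xi> * sin (\<xi> * x)\<bar> / cosh (x / 2) \<le> \<bar>\<xi>\<bar> / 1"
      using c1 abs_sin_le_one[of "\<xi> * x"] by (intro frac_le) (auto simp: abs_mult mult_left_le)
    moreover have "\<bar>cos (\<xi> * x)\<bar> / cosh (x / 2) * (\<bar>sinh (x / 2)\<bar> / cosh (x / 2) / 2) \<le> 1 * (1 / 2)"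
      using c1 sc order_trans[OF abs_cos_le_one[of "\<xi> * x"] c1] by (intro mult_mono) (auto simp: divide_le_eq)
    moreover have "\<bar>f' x\<bar> \<le> \<bar>\<xi> * sin (\<xi> * x)\<bar> / cosh (x / 2) + \<bar>cos (\<xi> * x)\<bar> / cosh (x / 2) * (\<bar>sinh (x / 2)\<bar> / cosh (x / 2) / 2)"
      unfolding f' by (rule order_trans[OF abs_triangle_ineq4]) (simp add: abs_mult)
    ultimately show ?thesis unfolding real_norm_def by linarith
  qed
  show ?thesis
    using field_differentiable_bound[OF convex_UNIV d b, of x y] by simp
qed

text \<open>The cutoff \<open>X\<close> is fixed before the mesh, and both work for all |\<xi>|
  \<le> \<xi>0 at once: in the application one band width has to serve every admissible Fourier
  mode.\<close>

lemma sech_riemann_sum: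
  assumes \<xi>0: "\<xi>0 \<ge> 0" and \<epsilon>: "\<epsilon> > 0"
  shows "\<exists>X0. \<forall>X>0. X \<ge> X0 \<longrightarrow> (\<exists>h0>0. \<forall>R>0. X / real R \<le> h0 \<longrightarrow> (\<forall>\<xi>. \<bar>\<xi>\<bar> \<le> \<xi>0 \<longrightarrow>
    1 / cosh (pi * \<xi>) - \<epsilon> \<le> (\<Sum>d\<in>{-int R..int R}. (X / real R) * (cos (\<xi> * (X / real R) * of_int d) / (2 * pi * cosh ((X / real R) * of_int d / 2))))))"
proof -
  \<comment> \<open>Chosen so that sinh (X / 2) \<ge> c pushes the contour error below pi
    \<epsilon>.\<close>
  define c where "c = 4 * exp (2 * pi * \<xi>0) / \<epsilon>"
  have c: "c > 0" using \<epsilon> by (simp add: c_def)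
  obtain Y where Y: "\<And>y. y \<ge> Y \<Longrightarrow> sinh (y::real) \<ge> c"
    using sinh_real_at_top unfolding filterlim_at_top eventually_at_top_linorder by blast
  show ?thesis
  proof (rule exI[of _ "2 * Y"], intro allI impI)
    fix X :: real assume X: "X > 0" "X \<ge> 2 * Y"
    define L where "L = \<xi>0 + 1/2"
    have L: "L \<ge> 0" using \<xi>0 by (simp add: L_def)
    \<comment> \<open>Makes the Riemann error 2 X L h plus one further \<open>h\<close> at most pi
      \<epsilon>. The further \<open>h\<close> pays for the right end node d = R, which the
      symmetric sum has in addition to the left Riemann sum.\<close>
    define h0 where "h0 = pi * \<epsilon> / (2 * X * L + 1)"
    have den: "2 * X * L + 1 > 0" using X L by (intro add_nonneg_pos) auto
    have "h0 > 0" using \<epsilon> den by (simp add: h0_def)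
    moreover have "1 / cosh (pi * \<xi>) - \<epsilon> \<le> (\<Sum>d\<in>{-int R..int R}. (X / real R) * (cos (\<xi> * (X / real R) * of_int d) / (2 * pi * cosh ((X / real R) * of_int d / 2))))"
      if R: "R > 0" "X / real R \<le> h0" and \<xi>: "\<bar>\<xi>\<bar> \<le> \<xi>0" for R \<xi>
    proof -
      define h where "h = X / real R"
      have h: "h > 0" "real R * h = X" using X R by (auto simp: h_def)
      define f where "f x = cos (\<xi> * x) / cosh (x / 2)" for x
      have cont: "continuous_on UNIV f" unfolding f_def[abs_def] by (intro continuous_intros) auto
      have lip: "\<bar>f x - f y\<bar> \<le> L * \<bar>x - y\<bar>" for x y
      proof -
        have "(\<bar>\<xi>\<bar> + 1/2) * \<bar>x - y\<bar> \<le> L * \<bar>x - y\<bar>" using \<xi> by (intro mult_right_mono) (auto simp: L_def)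
        with sech_cos_lipschitz[of \<xi> x y] show ?thesis by (simp add: f_def)
      qed
      have f1: "\<bar>f x\<bar> \<le> 1" for x
        using order_trans[OF abs_cos_le_one[of "\<xi> * x"] cosh_real_ge_1[of "x / 2"]] by (simp add: f_def divide_le_eq)
      have r0: "\<bar>h * (\<Sum>i<2 * R. f (- X + real i * h)) - integral {- X..- X + real (2 * R) * h} f\<bar> \<le> real (2 * R) * (L * h\<^sup>2)"
        by (rule lipschitz_riemann_sum[OF cont lip]) (use h in auto)
      have r1: "- X + real (2 * R) * h = X" using h(2) by simp
      have r2: "real (2 * R) * (L * h\<^sup>2) = 2 * X * L * h"
        unfolding h(2)[symmetric] by (simp add: power2_eq_square)
      have r: "integral {-X..X} f - 2 * X * L * h \<le> h * (\<Sum>i<2 * R. f (- X + real i * h))"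
        using r0 unfolding r1 r2 abs_le_iff by linarith
      have "(\<Sum>d\<in>{-int R..int R}. f (h * of_int d)) = (\<Sum>i\<in>{..2 * R}. f (- X + real i * h))"
        by (rule sum.reindex_bij_witness[of _ "\<lambda>i. int i - int R" "\<lambda>d. nat (d + int R)"])
          (auto simp: h(2)[symmetric] algebra_simps)
      also have "\<dots> = (\<Sum>i<2 * R. f (- X + real i * h)) + f (- X + real (2 * R) * h)"
        by (simp add: lessThan_Suc_atMost[symmetric])
      finally have s: "h * (\<Sum>d\<in>{-int R..int R}. f (h * of_int d)) \<ge> integral {-X..X} f - 2 * X * L * h - h"
        using r f1[of "- X + real (2 * R) * h"] h(1) mult_left_mono[of "- 1" "f (- X + real (2 * R) * h)" h]
        by (auto simp: distrib_left abs_le_iff)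
      have "2 * X * L * h + h \<le> pi * \<epsilon>"
      proof -
        have "(2 * X * L + 1) * h \<le> (2 * X * L + 1) * h0"
          using den R by (intro mult_left_mono) (auto simp: h_def)
        also have "\<dots> = pi * \<epsilon>" using den by (simp add: h0_def)
        finally show ?thesis by (simp add: algebra_simps)
      qed
      moreover have "integral {-X..X} f \<ge> 2 * pi / cosh (pi * \<xi>) - pi * \<epsilon>"
      proof -
        have sX: "sinh (X / 2) \<ge> c" using X by (intro Y) auto
        have "4 * pi * exp (2 * pi * \<bar>\<xi>\<bar>) / sinh (X / 2) \<le> 4 * pi * exp (2 * pi * \<xi>0) / c"
          using sX c \<xi> by (intro frac_le) (auto intro!: mult_left_mono)
        also have "\<dots> = pi * \<epsilon>" using \<epsilon> by (simp add: c_def)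
        finally show ?thesis
          using sech_fourier_transform_bound[OF X(1), of \<xi>] by (simp add: f_def[abs_def] abs_le_iff)
      qed
      ultimately have "2 * pi / cosh (pi * \<xi>) - 2 * pi * \<epsilon> \<le> h * (\<Sum>d\<in>{-int R..int R}. f (h * of_int d))"
        using s by linarith
      then have "(2 * pi / cosh (pi * \<xi>) - 2 * pi * \<epsilon>) / (2 * pi) \<le> h * (\<Sum>d\<in>{-int R..int R}. f (h * of_int d)) / (2 * pi)"
        by (intro divide_right_mono) auto
      then show ?thesis
        unfolding h_def[symmetric]
        by (simp add: f_def diff_divide_distrib sum_divide_distrib sum_distrib_left mult_ac)
    qed
    ultimately show "\<exists>h0>0. \<forall>R>0. X / real R \<le> h0 \<longrightarrow> (\<forall>\<xi>. \<bar>\<xi>\<bar> \<le> \<xi>0 \<longrightarrow>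
      1 / cosh (pi * \<xi>) - \<epsilon> \<le> (\<Sum>d\<in>{-int R..int R}. (X / real R) * (cos (\<xi> * (X / real R) * of_int d) / (2 * pi * cosh ((X / real R) * of_int d / 2)))))"
      by blast
  qed
qed

text \<open>Each product is replaced by an arithmetic mean; symmetry of the moduli makes the row
  sums control both halves.\<close>

lemma schur_test:
  fixes E :: "nat \<Rightarrow> nat \<Rightarrow> real" and c :: "nat \<Rightarrow> complex"
  assumes row: "\<And>m. m < M \<Longrightarrow> (\<Sum>n<M. \<bar>E m n\<bar>) \<le> G" and sym: "\<And>m n. \<bar>E m n\<bar> = \<bar>E n m\<bar>"
  shows "cmod (\<Sum>m<M. \<Sum>n<M. of_real (E m n) * (c m * cnj (c n))) \<le> G * (\<Sum>m<M. (cmod (c m))\<^sup>2)"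
proof -
  have "cmod (\<Sum>m<M. \<Sum>n<M. of_real (E m n) * (c m * cnj (c n)))
      \<le> (\<Sum>m<M. \<Sum>n<M. \<bar>E m n\<bar> * (((cmod (c m))\<^sup>2 + (cmod (c n))\<^sup>2) / 2))"
  proof (intro sum_norm_le)
    fix m n
    show "cmod (of_real (E m n) * (c m * cnj (c n))) \<le> \<bar>E m n\<bar> * (((cmod (c m))\<^sup>2 + (cmod (c n))\<^sup>2) / 2)"
      using sum_squares_bound[of "cmod (c m)" "cmod (c n)"] unfolding norm_mult
      by (intro mult_mono) auto
  qed
  also have "\<dots> = (\<Sum>m<M. \<Sum>n<M. \<bar>E m n\<bar> * (cmod (c m))\<^sup>2) / 2 + (\<Sum>m<M. \<Sum>n<M. \<bar>E m n\<bar> * (cmod (c n))\<^sup>2) / 2"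
    by (simp add: sum.distrib add_divide_distrib distrib_left sum_divide_distrib)
  also have "(\<Sum>m<M. \<Sum>n<M. \<bar>E m n\<bar> * (cmod (c n))\<^sup>2) = (\<Sum>m<M. \<Sum>n<M. \<bar>E m n\<bar> * (cmod (c m))\<^sup>2)"
    using sym by (subst sum.swap) simp
  also have "(\<Sum>m<M. \<Sum>n<M. \<bar>E m n\<bar> * (cmod (c m))\<^sup>2) = (\<Sum>m<M. (\<Sum>n<M. \<bar>E m n\<bar>) * (cmod (c m))\<^sup>2)"
    by (simp add: sum_distrib_right)
  also have "(\<Sum>m<M. (\<Sum>n<M. \<bar>E m n\<bar>) * (cmod (c m))\<^sup>2) / 2 + (\<Sum>m<M. (\<Sum>n<M. \<bar>E m n\<bar>) * (cmod (c m))\<^sup>2) / 2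
      = (\<Sum>m<M. (\<Sum>n<M. \<bar>E m n\<bar>) * (cmod (c m))\<^sup>2)" by simp
  also have "\<dots> \<le> (\<Sum>m<M. G * (cmod (c m))\<^sup>2)" using row by (intro sum_mono mult_right_mono) auto
  finally show ?thesis by (simp add: sum_distrib_left)
qed

lemma cis_roots_orthogonal:
  fixes j :: int
  assumes "M > 0" "\<bar>j\<bar> < int M"
  shows "(\<Sum>n<M. cis (2 * pi * of_int j * real n / real M)) = (if j = 0 then of_nat M else 0)"
proof (cases "j = 0")
  case False
  define w where "w = cis (2 * pi * of_int j / real M)"
  have pw: "cis (2 * pi * of_int j * real n / real M) = w ^ n" for n
    unfolding w_def Complex.DeMoivre by (simp add: mult_ac)
  have "w \<noteq> 1"
  proof
    assume "w = 1"
    then have "cos (2 * pi * of_int j / real M) = 1" unfolding w_def by (metis Re_complex_of_real cis.sel(1) of_real_1)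
    then obtain k :: int where "2 * pi * of_int j / real M = of_int k * 2 * pi"
      using cos_one_2pi_int[of "2 * pi * of_int j / real M"] by auto
    then have "of_int j = (of_int k * real M :: real)" using assms(1) by (simp add: field_simps)
    then have "j = k * int M" by (metis of_int_eq_iff of_int_mult of_int_of_nat_eq)
    with assms False show False by (auto simp: abs_mult) 
  qed
  moreover have "w ^ M = 1"
    using pw[of M, symmetric] cis_multiple_2pi[of "of_int j"] assms(1) by (simp add: mult_ac)
  ultimately show ?thesis using False unfolding pw by (simp add: geometric_sum)
qed simp

section \<open>Many large eigenvalues of the truncated Hilbert matrix\<close>

text \<open>If \<open>c\<close> vanishes on the first \<open>R\<close> places, then a banded Toeplitz form of width \<open>R\<close> does not see
  the difference between \<open>c\<close> and its periodic continuation, so it is diagonalized by the discrete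
  Fourier transform.\<close>

lemma banded_toeplitz_form:
  fixes b :: "int \<Rightarrow> complex" and t :: "int \<Rightarrow> real" and M R k0 :: nat
  defines "c \<equiv> \<lambda>n::int. \<Sum>k\<in>{-int k0..int k0}. b k * cis (2 * pi * of_int k * of_int n / real M)"
  assumes M: "2 * k0 < M" and zero: "\<And>n. n < R \<Longrightarrow> c (int n) = 0"
  shows "(\<Sum>n<M. (cmod (c (int n)))\<^sup>2) = real M * (\<Sum>k\<in>{-int k0..int k0}. (cmod (b k))\<^sup>2)"
    and "Re (\<Sum>m<M. \<Sum>n<M. of_real (if \<bar>int m - int n\<bar> \<le> int R then t (int m - int n) else 0) * (c (int m) * cnj (c (int n))))
      = real M * (\<Sum>k\<in>{-int k0..int k0}. (cmod (b k))\<^sup>2 * (\<Sum>d\<in>{-int R..int R}. t d * cos (2 * pi * of_int k * of_int d / real M)))"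
proof -
  define K where "K = {-int k0..int k0}"
  define e where "e k n = cis (2 * pi * of_int k * of_int n / real M)" for k n :: int
  have c: "c n = (\<Sum>k\<in>K. b k * e k n)" for n by (simp add: c_def K_def e_def)
  \<comment> \<open>Correlations of \<open>c\<close> over a full period are diagonal in the Fourier
    coefficients, because two frequencies differ by at most 2 \<open>k0\<close>, which is less than
    M.\<close>
  have corr: "(\<Sum>n<M. c (int n + d) * cnj (c (int n))) = of_nat M * (\<Sum>k\<in>K. of_real ((cmod (b k))\<^sup>2) * e k d)" for d
  proof -
    have "c (int n + d) * cnj (c (int n)) = (\<Sum>k\<in>K. \<Sum>l\<in>K. b k * cnj (b l) * e k d * cis (2 * pi * of_int (k - l) * real n / real M))" for n
    proof -
      have "e k (int n + d) * cnj (e l (int n)) = e k d * cis (2 * pi * of_int (k - l) * real n / real M)" for k l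
        by (simp add: e_def cis_cnj cis_mult add_divide_distrib[symmetric] diff_divide_distrib[symmetric] algebra_simps)
      then have "b k * e k (int n + d) * (cnj (b l) * cnj (e l (int n)))
          = b k * cnj (b l) * e k d * cis (2 * pi * of_int (k - l) * real n / real M)" for k l
        by (simp add: mult_ac)
      then show ?thesis by (simp only: c cnj_sum sum_product complex_cnj_mult)
    qed
    then have "(\<Sum>n<M. c (int n + d) * cnj (c (int n)))
        = (\<Sum>n<M. \<Sum>k\<in>K. \<Sum>l\<in>K. b k * cnj (b l) * e k d * cis (2 * pi * of_int (k - l) * real n / real M))"
      by simp
    also have "\<dots> = (\<Sum>k\<in>K. \<Sum>l\<in>K. \<Sum>n<M. b k * cnj (b l) * e k d * cis (2 * pi * of_int (k - l) * real n / real M))"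
      by (subst sum.swap) (simp add: sum.swap[of _ K "{..<M}"])
    also have "\<dots> = (\<Sum>k\<in>K. \<Sum>l\<in>K. b k * cnj (b l) * e k d * (if k - l = 0 then of_nat M else 0))"
    proof (intro sum.cong refl)
      fix k l assume "k \<in> K" "l \<in> K"
      then have "\<bar>k - l\<bar> < int M" using M by (auto simp: K_def)
      from cis_roots_orthogonal[OF _ this] M
      show "(\<Sum>n<M. b k * cnj (b l) * e k d * cis (2 * pi * of_int (k - l) * real n / real M))
        = b k * cnj (b l) * e k d * (if k - l = 0 then of_nat M else 0)"
        unfolding sum_distrib_left[symmetric] by simp
    qed
    also have "\<dots> = (\<Sum>k\<in>K. of_nat M * (of_real ((cmod (b k))\<^sup>2) * e k d))"
    proof (intro sum.cong refl)
      fix k assume k: "k \<in> K"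
      have "(\<Sum>l\<in>K. b k * cnj (b l) * e k d * (if k - l = 0 then of_nat M else 0))
          = (\<Sum>l\<in>K. if k = l then b k * cnj (b k) * e k d * of_nat M else 0)"
        by (intro sum.cong) auto
      also have "\<dots> = b k * cnj (b k) * e k d * of_nat M" using k by (simp add: K_def)
      finally show "(\<Sum>l\<in>K. b k * cnj (b l) * e k d * (if k - l = 0 then of_nat M else 0))
          = of_nat M * (of_real ((cmod (b k))\<^sup>2) * e k d)"
        by (simp add: complex_norm_square mult_ac del: of_real_power)
    qed
    finally show ?thesis by (simp add: sum_distrib_left)
  qed
  have "complex_of_real (\<Sum>n<M. (cmod (c (int n)))\<^sup>2) = (\<Sum>n<M. c (int n + 0) * cnj (c (int n)))"
    by (simp add: complex_norm_square del: of_real_power)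
  also have "\<dots> = of_real (real M * (\<Sum>k\<in>K. (cmod (b k))\<^sup>2))"
    unfolding corr by (simp add: e_def)
  finally show "(\<Sum>n<M. (cmod (c (int n)))\<^sup>2) = real M * (\<Sum>k\<in>{-int k0..int k0}. (cmod (b k))\<^sup>2)"
    unfolding K_def[symmetric] by (rule of_real_eq_iff[THEN iffD1])
  have per: "c (j + int M) = c j" for j
  proof -
    have pp: "cis (x + 2 * pi * of_int k) = cis x" for x and k :: int
      using cis_multiple_2pi[of "of_int k"] by (simp add: cis_mult[symmetric])
    have "e k (j + int M) = e k j" for k
      using M by (simp add: e_def add_divide_distrib distrib_left pp)
    then show ?thesis by (simp add: c)
  qed
  \<comment> \<open>For n < R the factor c(n) vanishes. For n \<ge> R the window around n can leave
    {0..<M} only on the right, and there periodicity leads back to the first \<open>R\<close>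
    places, where c is 0.\<close>
  have inner: "(\<Sum>m<M. of_real (if \<bar>int m - int n\<bar> \<le> int R then t (int m - int n) else 0) * c (int m)) * cnj (c (int n))
      = (\<Sum>d\<in>{-int R..int R}. of_real (t d) * c (int n + d)) * cnj (c (int n))" if n: "n < M" for n
  proof (cases "n < R")
    case False
    define g where "g j = of_real (t (j - int n)) * c j" for j
    have "(\<Sum>m<M. of_real (if \<bar>int m - int n\<bar> \<le> int R then t (int m - int n) else 0) * c (int m))
        = (\<Sum>j\<in>{0..<int M}. of_real (if \<bar>j - int n\<bar> \<le> int R then t (j - int n) else 0) * c j)"
      by (rule sum.reindex_bij_witness[of _ nat int]) auto
    also have "\<dots> = (\<Sum>j\<in>{int n - int R..int n + int R}. g j)"
    proof (rule sum.mono_neutral_cong)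
      fix j assume j: "j \<in> {int n - int R..int n + int R} - {0..<int M}"
      then have "j \<ge> int M" using False by auto
      then obtain i where i: "j = int i + int M" by (metis add.commute nonneg_int_cases zle_iff_zadd)
      then have "i < R" using j n by auto
      then show "g j = 0" using per[of "int i"] zero by (simp add: g_def i)
    qed (auto simp: g_def)
    also have "\<dots> = (\<Sum>d\<in>{-int R..int R}. of_real (t d) * c (int n + d))"
      by (rule sum.reindex_bij_witness[of _ "\<lambda>d. int n + d" "\<lambda>j. j - int n"]) (auto simp: g_def)
    finally show ?thesis by simp
  qed (simp add: zero)
  have "(\<Sum>m<M. \<Sum>n<M. of_real (if \<bar>int m - int n\<bar> \<le> int R then t (int m - int n) else 0) * (c (int m) * cnj (c (int n))))
      = (\<Sum>n<M. (\<Sum>m<M. of_real (if \<bar>int m - int n\<bar> \<le> int R then t (int m - int n) else 0) * c (int m)) * cnj (c (int n)))"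
    by (subst sum.swap) (simp add: sum_distrib_right mult.assoc)
  also have "\<dots> = (\<Sum>n<M. (\<Sum>d\<in>{-int R..int R}. of_real (t d) * c (int n + d)) * cnj (c (int n)))"
    by (intro sum.cong refl inner) auto
  also have "\<dots> = (\<Sum>d\<in>{-int R..int R}. of_real (t d) * (\<Sum>n<M. c (int n + d) * cnj (c (int n))))"
    by (simp add: sum_distrib_right sum_distrib_left sum.swap[of _ "{..<M}"] mult.assoc)
  also have "Re \<dots> = (\<Sum>d\<in>{-int R..int R}. t d * (real M * (\<Sum>k\<in>K. (cmod (b k))\<^sup>2 * cos (2 * pi * of_int k * of_int d / real M))))"
    unfolding corr by (simp add: e_def Re_sum)
  also have "\<dots> = real M * (\<Sum>k\<in>K. (cmod (b k))\<^sup>2 * (\<Sum>d\<in>{-int R..int R}. t d * cos (2 * pi * of_int k * of_int d / real M)))"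
    by (simp add: sum_distrib_left sum.swap[of _ K] mult_ac)
  finally show "Re (\<Sum>m<M. \<Sum>n<M. of_real (if \<bar>int m - int n\<bar> \<le> int R then t (int m - int n) else 0) * (c (int m) * cnj (c (int n))))
      = real M * (\<Sum>k\<in>{-int k0..int k0}. (cmod (b k))\<^sup>2 * (\<Sum>d\<in>{-int R..int R}. t d * cos (2 * pi * of_int k * of_int d / real M)))"
    unfolding K_def .
qed

text \<open>The adjoint has the conjugate transposed matrix, and entries determine a bounded
  operator.\<close>

lemma self_adjoint_matrixI:
  assumes A: "bounded_operator A" and herm: "\<And>j k. matrix_entry A j k = cnj (matrix_entry A k j)"
  shows "self_adjoint A"
proof -
  obtain B where B: "bounded_operator B" "\<And>x y. ell2_cinner (A x) y = ell2_cinner x (B y)"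
    using adjoint_exists[OF A] by blast
  have "matrix_entry A j k = matrix_entry B j k" for j k
    using herm[of j k] B(2)[of "ell2_basis k" "ell2_basis j"] cinner_commute[of "ell2_basis k" "B (ell2_basis j)"]
    by (simp add: matrix_entry_def)
  then have "A = B" by (intro bounded_operator_eqI A B ext)
  with A B show ?thesis by (simp add: self_adjoint_def)
qed

lemma hs_bound_finite_support:
  assumes "\<And>j k. j + k \<ge> N \<Longrightarrow> a j k = 0"
  shows "hs_bound a (\<Sum>j<N. \<Sum>k<N. (cmod (a j k))\<^sup>2)"
  unfolding hs_bound_def
proof
  fix n
  have "(\<Sum>j<n. \<Sum>k<n. (cmod (a j k))\<^sup>2) \<le> (\<Sum>j<max n N. \<Sum>k<max n N. (cmod (a j k))\<^sup>2)"
    by (intro order.trans[OF sum_mono sum_mono2] sum_mono2 sum_nonneg) auto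
  also have "\<dots> = (\<Sum>j<max n N. \<Sum>k<N. (cmod (a j k))\<^sup>2)"
    using assms by (intro sum.cong refl sum.mono_neutral_right) auto
  also have "\<dots> = (\<Sum>j<N. \<Sum>k<N. (cmod (a j k))\<^sup>2)"
    using assms by (intro sum.mono_neutral_right) (auto intro!: sum.neutral)
  finally show "(\<Sum>j<n. \<Sum>k<n. (cmod (a j k))\<^sup>2) \<le> (\<Sum>j<N. \<Sum>k<N. (cmod (a j k))\<^sup>2)" .
qed

section \<open>The truncated Hilbert matrix and averages over geometric blocks\<close>

definition hilbert_matrix :: "nat \<Rightarrow> nat \<Rightarrow> nat \<Rightarrow> complex" where
  "hilbert_matrix N j k = (if j + k < N then of_real (1 / (pi * real (j + k + 1))) else 0)"

definition hilbert_operator :: "nat \<Rightarrow> ell2 \<Rightarrow> ell2" where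
  "hilbert_operator N = operator_of_matrix (hilbert_matrix N)"

lemma hs_bound_hilbert: "\<exists>C. hs_bound (hilbert_matrix N) C"
  using hs_bound_finite_support[of N "hilbert_matrix N"] by (auto simp: hilbert_matrix_def)

lemma hilbert_operator_compact: "compact_operator (hilbert_operator N)"
  unfolding hilbert_operator_def using hs_bound_hilbert hs_compact by blast

lemma matrix_entry_hilbert: "matrix_entry (hilbert_operator N) = hilbert_matrix N"
  unfolding hilbert_operator_def using hs_bound_hilbert hs_is_operator_matrix is_operator_matrixD(2) by blast

lemma hilbert_operator_self_adjoint: "self_adjoint (hilbert_operator N)"
  by (rule self_adjoint_matrixI[OF compact_operator_bounded[OF hilbert_operator_compact]])
    (simp add: matrix_entry_hilbert hilbert_matrix_def add.commute)

text \<open>Samples with step ln q of 1 / (2 pi cosh (x / 2)), whose Fourier transform is sech (pi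
  \<xi>). The weight q - 1 in place of ln q is what the block lengths produce.\<close>

definition log_toeplitz :: "real \<Rightarrow> int \<Rightarrow> real" where
  "log_toeplitz q d = (q - 1) / (2 * pi * cosh (ln q * of_int d / 2))"

lemma log_toeplitz_pos: "q > 1 \<Longrightarrow> log_toeplitz q d > 0"
  by (simp add: log_toeplitz_def)

lemma log_toeplitz_minus: "log_toeplitz q (- d) = log_toeplitz q d"
  by (simp add: log_toeplitz_def)

text \<open>The terms are dominated by a geometric series with ratio r = q^(-1/2).\<close>

lemma log_toeplitz_tail:
  assumes q: "q > 1" "q \<le> 2"
  shows "(\<Sum>d\<in>{d\<in>{-int D..int D}. \<bar>d\<bar> > int R}. log_toeplitz q d) \<le> 2 * exp (- (ln q * real R / 2))"
proof -
  define r where "r = exp (- (ln q / 2))"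
  have r: "0 < r" "r < 1" using q by (auto simp: r_def)
  have "r * r = exp (- ln q)" by (simp add: r_def flip: exp_add)
  then have rq: "1 / (r * r) = q" using q by (simp add: exp_minus divide_inverse)
  \<comment> \<open>The factor 1/r - 1 cancels the denominator 1 - r of the geometric series, so the
    bound does not deteriorate as q tends to 1.\<close>
  have q12: "q - 1 = (1 / r - 1) * (1 / r + 1)" unfolding rq[symmetric] using r by (simp add: field_simps)
  have r2: "1 / r + 1 \<le> 3"
  proof -
    have "(1 / r)\<^sup>2 \<le> 2\<^sup>2" using rq q by (simp add: power2_eq_square)
    then have "1 / r \<le> 2" by (rule power2_le_imp_le) simp
    then show ?thesis by simp
  qed
  have t: "log_toeplitz q d \<le> (q - 1) / pi * r ^ nat \<bar>d\<bar>" for d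
  proof -
    have "exp (ln q * real_of_int \<bar>d\<bar> / 2) \<le> 2 * cosh (ln q * of_int d / 2)"
      by (cases "d \<ge> 0") (simp_all add: cosh_field_def)
    then have "(q - 1) / (pi * (2 * cosh (ln q * of_int d / 2))) \<le> (q - 1) / (pi * exp (ln q * real_of_int \<bar>d\<bar> / 2))"
      using q by (intro divide_left_mono mult_left_mono mult_pos_pos) auto
    also have "\<dots> = (q - 1) / pi * r ^ nat \<bar>d\<bar>"
      by (simp add: r_def exp_of_nat_mult[symmetric] exp_minus field_simps)
    finally show ?thesis by (simp add: log_toeplitz_def mult_ac)
  qed
  have geo: "(\<Sum>i\<in>{R<..D}. log_toeplitz q (int i)) \<le> r ^ R"
  proof -
    have "(\<Sum>i\<in>{R<..D}. log_toeplitz q (int i)) \<le> (\<Sum>i\<in>{R<..D}. (q - 1) / pi * r ^ i)"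
      by (intro sum_mono) (use t in \<open>metis abs_of_nat nat_int\<close>)
    also have "\<dots> = (q - 1) / pi * (\<Sum>i\<in>{R<..D}. r ^ i)" by (simp add: sum_distrib_left)
    also have "(\<Sum>i\<in>{R<..D}. r ^ i) = (\<Sum>i<D - R. r ^ (Suc R + i))"
      by (rule sum.reindex_bij_witness[of _ "\<lambda>i. Suc R + i" "\<lambda>i. i - Suc R"]) auto
    also have "\<dots> = r ^ Suc R * ((1 - r ^ (D - R)) / (1 - r))"
      using r by (simp add: power_add sum_distrib_left[symmetric] sum_gp_strict)
    also have "(q - 1) / pi * \<dots> \<le> (q - 1) / pi * (r ^ Suc R * (1 / (1 - r)))"
      using r q by (intro mult_left_mono divide_right_mono) auto
    also have "\<dots> = r ^ R * ((1 / r + 1) / pi)"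
      unfolding q12 using r by (simp add: field_simps)
    also have "\<dots> \<le> r ^ R * 1"
    proof (rule mult_left_mono)
      show "(1 / r + 1) / pi \<le> 1" using r2 pi_gt3 by (subst pos_divide_le_eq) linarith+
    qed (use r in simp)
    finally show ?thesis by simp
  qed
  have "{d\<in>{-int D..int D}. \<bar>d\<bar> > int R} = int ` {R<..D} \<union> (\<lambda>i. - int i) ` {R<..D}"
  proof (intro equalityI subsetI)
    fix d assume d: "d \<in> {d\<in>{-int D..int D}. \<bar>d\<bar> > int R}"
    then show "d \<in> int ` {R<..D} \<union> (\<lambda>i. - int i) ` {R<..D}"
    proof (cases "d \<ge> 0")
      case True
      with d have "d = int (nat d)" "nat d \<in> {R<..D}" by auto
      then show ?thesis by blast
    next
      case False
      with d have "d = - int (nat (- d))" "nat (- d) \<in> {R<..D}" by auto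
      then show ?thesis by blast
    qed
  qed auto
  then have "(\<Sum>d\<in>{d\<in>{-int D..int D}. \<bar>d\<bar> > int R}. log_toeplitz q d)
      \<le> (\<Sum>d\<in>int ` {R<..D}. log_toeplitz q d) + (\<Sum>d\<in>(\<lambda>i. - int i) ` {R<..D}. log_toeplitz q d)"
    using log_toeplitz_pos[OF q(1)] by (simp add: sum_Un sum_nonneg less_imp_le)
  also have "\<dots> = 2 * (\<Sum>i\<in>{R<..D}. log_toeplitz q (int i))"
    by (simp add: sum.reindex inj_on_def log_toeplitz_minus)
  also have "\<dots> \<le> 2 * r ^ R" using geo by simp
  also have "r ^ R = exp (- (ln q * real R / 2))" by (simp add: r_def exp_of_nat_mult[symmetric] mult.commute)
  finally show ?thesis .
qed

lemma log_toeplitz_sum: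
  assumes q: "q > 1" "q \<le> 2"
  shows "(\<Sum>d\<in>{-int D..int D}. log_toeplitz q d) \<le> 3"
proof -
  have "{-int D..int D} = insert 0 {d\<in>{-int D..int D}. \<bar>d\<bar> > int 0}" by auto
  then have "(\<Sum>d\<in>{-int D..int D}. log_toeplitz q d)
      = log_toeplitz q 0 + (\<Sum>d\<in>{d\<in>{-int D..int D}. \<bar>d\<bar> > int 0}. log_toeplitz q d)"
    by (metis (no_types, lifting) abs_zero finite_atLeastAtMost_int finite_insert less_irrefl mem_Collect_eq of_nat_0 sum.insert)
  moreover have "log_toeplitz q 0 \<le> 1" using q pi_gt3 by (simp add: log_toeplitz_def divide_le_eq)
  ultimately show ?thesis using log_toeplitz_tail[OF q, of D 0] by simp
qed

definition block_start :: "real \<Rightarrow> nat \<Rightarrow> nat" where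
  "block_start q n = nat \<lceil>q ^ n\<rceil>"

lemma block_start: 
  assumes "q > 1"
  shows "q ^ n \<le> real (block_start q n)" "real (block_start q n) < q ^ n + 1"
proof -
  have "q ^ n > 0" using assms by simp
  then show "q ^ n \<le> real (block_start q n)" "real (block_start q n) < q ^ n + 1"
    unfolding block_start_def by linarith+
qed

text \<open>The hypothesis on \<open>n\<close> says that the rounding error, at most 1, is at most
  the fraction q - 1 of the ideal length (q - 1) q^n.\<close>

lemma block_length:
  assumes q: "q > 1" "q \<le> 9/8" and n: "1 \<le> (q - 1)\<^sup>2 * q ^ n"
  defines "b \<equiv> real (block_start q (Suc n)) - real (block_start q n)"
  shows "(q - 1) * q ^ n * (1 - (q - 1)) \<le> b" "b \<le> (q - 1) * q ^ n * (1 + (q - 1))" "0 < b"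
    "block_start q n < block_start q (Suc n)"
proof -
  have "b \<le> q ^ Suc n + 1 - q ^ n" "q ^ Suc n - q ^ n - 1 \<le> b"
    using block_start[OF q(1), of n] block_start[OF q(1), of "Suc n"] by (auto simp: b_def)
  then have 1: "b \<le> (q - 1) * q ^ n + (q - 1)\<^sup>2 * q ^ n" "(q - 1) * q ^ n - (q - 1)\<^sup>2 * q ^ n \<le> b"
    using n by (auto simp: algebra_simps)
  then show 2: "(q - 1) * q ^ n * (1 - (q - 1)) \<le> b" "b \<le> (q - 1) * q ^ n * (1 + (q - 1))"
    by (simp_all add: algebra_simps power2_eq_square)
  have "0 < (q - 1) * q ^ n * (1 - (q - 1))" using q by (intro mult_pos_pos) auto
  with 2 show "0 < b" by linarith
  then show "block_start q n < block_start q (Suc n)" by (simp add: b_def)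
qed

text \<open>On a pair of blocks the denominator j + k + 1 stays between s = q^m + q^n and (1 + 2
  \<kappa>) s, while the block lengths are known up to factors 1 - \<kappa> and 1 + \<kappa>. The
  Toeplitz entry is the value without these factors.\<close>

lemma block_average:
  assumes q: "q > 1" "q \<le> 9/8" and m: "1 \<le> (q - 1)\<^sup>2 * q ^ m" and n: "1 \<le> (q - 1)\<^sup>2 * q ^ n"
  defines "b \<equiv> \<lambda>n. real (block_start q (Suc n)) - real (block_start q n)"
  shows "\<bar>(\<Sum>j\<in>{block_start q m..<block_start q (Suc m)}. \<Sum>k\<in>{block_start q n..<block_start q (Suc n)}.
      1 / (pi * real (j + k + 1))) / sqrt (b m * b n) - log_toeplitz q (int m - int n)\<bar>
    \<le> 3 * (q - 1) * log_toeplitz q (int m - int n)"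
proof -
  define \<kappa> where "\<kappa> = q - 1"
  have \<kappa>: "0 < \<kappa>" "\<kappa> \<le> 1/8" using q by (auto simp: \<kappa>_def)
  define s where "s = q ^ m + q ^ n"
  have s: "s > 0" using q by (simp add: s_def add_pos_pos)
  define S where "S = (\<Sum>j\<in>{block_start q m..<block_start q (Suc m)}. \<Sum>k\<in>{block_start q n..<block_start q (Suc n)}.
      1 / (pi * real (j + k + 1)))"
  have bm: "\<kappa> * q ^ m * (1 - \<kappa>) \<le> b m" "b m \<le> \<kappa> * q ^ m * (1 + \<kappa>)" "0 < b m"
      "block_start q m < block_start q (Suc m)"
    and bn: "\<kappa> * q ^ n * (1 - \<kappa>) \<le> b n" "b n \<le> \<kappa> * q ^ n * (1 + \<kappa>)" "0 < b n"
      "block_start q n < block_start q (Suc n)"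
    unfolding \<kappa>_def b_def by (rule block_length[OF q m] block_length[OF q n])+
  have up: "1 / (pi * real (j + k + 1)) \<le> 1 / (pi * s)"
    and lo: "1 / (pi * ((1 + 2 * \<kappa>) * s)) \<le> 1 / (pi * real (j + k + 1))"
    if jk: "j \<in> {block_start q m..<block_start q (Suc m)}" "k \<in> {block_start q n..<block_start q (Suc n)}" for j k
  proof -
    have "real (block_start q m) \<le> real j" "real (block_start q n) \<le> real k" using jk by auto
    then have l: "s \<le> real (j + k + 1)"
      using block_start(1)[OF q(1), of m] block_start(1)[OF q(1), of n] by (simp add: s_def)
    show "1 / (pi * real (j + k + 1)) \<le> 1 / (pi * s)"
      using l s by (intro divide_left_mono mult_left_mono mult_pos_pos) auto
    have "real j + 1 \<le> real (block_start q (Suc m))" "real k + 1 \<le> real (block_start q (Suc n))" using jk by auto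
    then have "real (j + k + 1) \<le> q ^ Suc m + q ^ Suc n + 1"
      using block_start(2)[OF q(1), of "Suc m"] block_start(2)[OF q(1), of "Suc n"] by simp
    also have "1 \<le> \<kappa> * (\<kappa> * q ^ m)" using m by (simp add: \<kappa>_def power2_eq_square mult.assoc)
    also have "\<dots> \<le> 1 * (\<kappa> * q ^ m)" using \<kappa> q by (intro mult_right_mono) auto
    also have "\<dots> \<le> \<kappa> * s" using \<kappa> q by (simp add: s_def)
    finally have u: "real (j + k + 1) \<le> (1 + 2 * \<kappa>) * s" by (simp add: s_def \<kappa>_def algebra_simps)
    show "1 / (pi * ((1 + 2 * \<kappa>) * s)) \<le> 1 / (pi * real (j + k + 1))"
      using u s \<kappa> by (intro divide_left_mono mult_left_mono mult_pos_pos) (auto simp: add_pos_pos)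
  qed
  have card: "real (card {block_start q n..<block_start q (Suc n)}) = b n"
    "real (card {block_start q m..<block_start q (Suc m)}) = b m"
    using bm(4) bn(4) by (simp_all add: b_def of_nat_diff)
  have "S \<le> (\<Sum>j\<in>{block_start q m..<block_start q (Suc m)}. \<Sum>k\<in>{block_start q n..<block_start q (Suc n)}. 1 / (pi * s))"
    unfolding S_def by (intro sum_mono up)
  then have S1: "S \<le> b m * b n / (pi * s)" by (simp add: card del: card_atLeastLessThan)
  have "(\<Sum>j\<in>{block_start q m..<block_start q (Suc m)}. \<Sum>k\<in>{block_start q n..<block_start q (Suc n)}. 1 / (pi * ((1 + 2 * \<kappa>) * s))) \<le> S"
    unfolding S_def by (intro sum_mono lo)
  then have S2: "b m * b n / (pi * ((1 + 2 * \<kappa>) * s)) \<le> S" by (simp add: card del: card_atLeastLessThan)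
  define w where "w = sqrt (b m * b n)"
  define v where "v = sqrt (q ^ m * q ^ n)"
  have w: "w > 0" "w * w = b m * b n" using bm(3) bn(3) by (auto simp: w_def)
  have v: "v > 0" using q by (simp add: v_def)
  define t where "t = log_toeplitz q (int m - int n)"
  \<comment> \<open>Dividing q^m + q^n by its geometric part q^((m+n)/2) leaves 2 cosh of half the
    logarithmic distance; this is how the hyperbolic secant arises.\<close>
  have t: "t = \<kappa> * v / (pi * s)"
  proof -
    have e: "q ^ k = exp (ln q * real k)" for k using q by (simp add: exp_of_nat2_mult)
    define A B where "A = ln q * real m / 2" and "B = ln q * real n / 2"
    have v': "v = exp A * exp B"
      unfolding v_def by (rule real_sqrt_unique) (auto simp: e A_def B_def power2_eq_square exp_add[symmetric])
    have AB: "ln q * of_int (int m - int n) / 2 = A - B"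
      by (simp add: A_def B_def right_diff_distrib diff_divide_distrib)
    have "exp (A - B) * (exp A * exp B) = q ^ m" "exp (B - A) * (exp A * exp B) = q ^ n"
      by (simp_all add: e A_def B_def flip: exp_add)
    then have "2 * cosh (ln q * of_int (int m - int n) / 2) * v = s"
      unfolding AB v' s_def by (simp add: cosh_field_def distrib_right)
    moreover have "t = \<kappa> * v / (pi * (2 * cosh (ln q * of_int (int m - int n) / 2) * v))"
      using v by (simp add: t_def log_toeplitz_def \<kappa>_def)
    ultimately show ?thesis by simp
  qed
  have t0: "t > 0" unfolding t_def by (rule log_toeplitz_pos[OF q(1)])
  have wv: "w \<le> \<kappa> * v * (1 + \<kappa>)" "\<kappa> * v * (1 - \<kappa>) \<le> w"
  proof -
    have vv: "sqrt (q ^ m) * sqrt (q ^ n) = v" by (simp add: v_def real_sqrt_mult)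
    have "b m * b n \<le> (\<kappa> * q ^ m * (1 + \<kappa>)) * (\<kappa> * q ^ n * (1 + \<kappa>))"
      using bm bn \<kappa> q by (intro mult_mono) auto
    also have "\<dots> = (\<kappa> * v * (1 + \<kappa>))\<^sup>2"
      using q by (simp add: v_def power_mult_distrib power2_eq_square mult_ac)
    finally show "w \<le> \<kappa> * v * (1 + \<kappa>)"
      unfolding w_def using \<kappa> v by (intro real_le_lsqrt) auto
    have "(\<kappa> * v * (1 - \<kappa>))\<^sup>2 = (\<kappa> * q ^ m * (1 - \<kappa>)) * (\<kappa> * q ^ n * (1 - \<kappa>))"
      using q by (simp add: v_def power_mult_distrib power2_eq_square mult_ac)
    also have "\<dots> \<le> b m * b n"
      using bm bn \<kappa> q by (intro mult_mono mult_nonneg_nonneg) auto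
    finally show "\<kappa> * v * (1 - \<kappa>) \<le> w" unfolding w_def by (rule real_le_rsqrt)
  qed
  have "S / w \<le> w * w / (pi * s) / w" using S1 w by (intro divide_right_mono) auto
  also have "\<dots> = w / (pi * s)" using w(1) by simp
  also have "\<dots> \<le> \<kappa> * v * (1 + \<kappa>) / (pi * s)" using wv s by (intro divide_right_mono) auto
  finally have u: "S / w \<le> t * (1 + \<kappa>)" by (simp add: t)
  have "t * (1 - \<kappa>) / (1 + 2 * \<kappa>) = \<kappa> * v * (1 - \<kappa>) / (pi * ((1 + 2 * \<kappa>) * s))" by (simp add: t)
  also have "\<dots> \<le> w / (pi * ((1 + 2 * \<kappa>) * s))" using wv s \<kappa> by (intro divide_right_mono) auto
  also have "\<dots> = w * w / (pi * ((1 + 2 * \<kappa>) * s)) / w" using w(1) by simp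
  also have "\<dots> \<le> S / w" using S2 w by (intro divide_right_mono) auto
  finally have l: "t * (1 - \<kappa>) / (1 + 2 * \<kappa>) \<le> S / w" .
  have "(1 - 3 * \<kappa>) * (1 + 2 * \<kappa>) \<le> 1 - \<kappa>" using \<kappa> by (simp add: algebra_simps)
  then have "1 - 3 * \<kappa> \<le> (1 - \<kappa>) / (1 + 2 * \<kappa>)" using \<kappa> by (simp add: le_divide_eq)
  then have "t * (1 - 3 * \<kappa>) \<le> t * ((1 - \<kappa>) / (1 + 2 * \<kappa>))" using t0 by (intro mult_left_mono) auto
  with l have l': "t * (1 - 3 * \<kappa>) \<le> S / w" by simp
  have "\<bar>S / w - t\<bar> \<le> 3 * \<kappa> * t"
    using u l' \<kappa> t0 mult_pos_pos[OF t0 \<kappa>(1)] by (simp add: abs_le_iff algebra_simps)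
  then show ?thesis by (simp add: S_def w_def t_def \<kappa>_def)
qed

lemma block_start_mono:
  assumes "q > 1" "m \<le> n"
  shows "block_start q m \<le> block_start q n"
  unfolding block_start_def using assms by (intro nat_mono ceiling_mono power_increasing) auto

definition block_vector :: "real \<Rightarrow> nat \<Rightarrow> ell2" where
  "block_vector q n = lincomb {block_start q n..<block_start q (Suc n)}
     (\<lambda>_. of_real (1 / sqrt (real (block_start q (Suc n)) - real (block_start q n)))) ell2_basis"

lemma block_vector_nth:
  "ell2_nth (block_vector q n) j = (if j \<in> {block_start q n..<block_start q (Suc n)}
     then of_real (1 / sqrt (real (block_start q (Suc n)) - real (block_start q n))) else 0)"
  by (simp add: block_vector_def lincomb_def if_distrib[of "\<lambda>u. _ * u"] sum.delta' cong: if_cong)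

lemma block_vectors_orthonormal:
  assumes q: "q > 1" and less: "\<And>n. n \<in> I \<Longrightarrow> block_start q n < block_start q (Suc n)"
  shows "orthonormal I (block_vector q)"
  unfolding orthonormal_def
proof (intro ballI)
  fix m n assume mn: "m \<in> I" "n \<in> I"
  let ?B = "{block_start q n..<block_start q (Suc n)}"
  let ?b = "real (block_start q (Suc n)) - real (block_start q n)"
  have "ell2_cinner (block_vector q m) (block_vector q n) = (\<Sum>j\<in>?B. of_real (1 / sqrt ?b) * ell2_nth (block_vector q m) j)"
    by (subst block_vector_def[of q n]) (simp add: cinner_lincomb_right cinner_basis)
  also have "\<dots> = (if m = n then 1 else 0)"
  proof (cases "m = n")
    case True
    have "(\<Sum>j\<in>?B. of_real (1 / sqrt ?b) * ell2_nth (block_vector q m) j) = (\<Sum>j\<in>?B. of_real (1 / ?b))"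
      using less[OF mn(2)] by (intro sum.cong refl) (simp add: True block_vector_nth flip: of_real_mult)
    also have "\<dots> = of_real (?b * (1 / ?b))"
      using less[OF mn(2)] by (simp add: of_nat_diff)
    also have "?b * (1 / ?b) = 1" using less[OF mn(2)] by simp
    finally show ?thesis using True by simp
  next
    case False
    have "ell2_nth (block_vector q m) j = 0" if "j \<in> ?B" for j
      using that False block_start_mono[OF q, of "Suc m" n] block_start_mono[OF q, of "Suc n" m]
      by (cases "m < n") (auto simp: block_vector_nth)
    with False show ?thesis by simp
  qed
  finally show "ell2_cinner (block_vector q m) (block_vector q n) = (if m = n then 1 else 0)" .
qed

text \<open>All indices of the two blocks lie below N / 2, so j + k < N throughout and the
  truncation is not seen.\<close>

lemma block_vector_form:
  assumes q: "q > 1" and N: "2 * block_start q (Suc m) \<le> N" "2 * block_start q (Suc n) \<le> N"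
  defines "b \<equiv> \<lambda>n. real (block_start q (Suc n)) - real (block_start q n)"
  shows "ell2_cinner (hilbert_operator N (block_vector q m)) (block_vector q n) =
    of_real ((\<Sum>j\<in>{block_start q m..<block_start q (Suc m)}. \<Sum>k\<in>{block_start q n..<block_start q (Suc n)}.
      1 / (pi * real (j + k + 1))) / sqrt (b m * b n))"
proof -
  have e: "ell2_cinner (hilbert_operator N (ell2_basis j)) (ell2_basis k) = of_real (1 / (pi * real (j + k + 1)))"
    if "j \<in> {block_start q m..<block_start q (Suc m)}" "k \<in> {block_start q n..<block_start q (Suc n)}" for j k
  proof -
    have "j + k < N" using that N by auto
    then show ?thesis
      using fun_cong[OF fun_cong[OF matrix_entry_hilbert[of N]], of j k] by (simp add: matrix_entry_def hilbert_matrix_def)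
  qed
  have "ell2_cinner (hilbert_operator N (block_vector q m)) (block_vector q n) =
     (\<Sum>k\<in>{block_start q n..<block_start q (Suc n)}. of_real (1 / sqrt (b n)) *
       (\<Sum>j\<in>{block_start q m..<block_start q (Suc m)}. of_real (1 / sqrt (b m)) *
         ell2_cinner (hilbert_operator N (ell2_basis j)) (ell2_basis k)))"
    unfolding block_vector_def bounded_operatorD(8)[OF compact_operator_bounded[OF hilbert_operator_compact]]
      cinner_lincomb_right cinner_lincomb_left b_def by simp
  also have "\<dots> = (\<Sum>k\<in>{block_start q n..<block_start q (Suc n)}. of_real (1 / sqrt (b n)) *
       (\<Sum>j\<in>{block_start q m..<block_start q (Suc m)}. of_real (1 / sqrt (b m)) * of_real (1 / (pi * real (j + k + 1)))))"
    by (intro sum.cong refl arg_cong2[of _ _ _ _ "(*)"] e) auto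
  also have "\<dots> = of_real (\<Sum>k\<in>{block_start q n..<block_start q (Suc n)}. (1 / sqrt (b n)) *
       (\<Sum>j\<in>{block_start q m..<block_start q (Suc m)}. (1 / sqrt (b m)) * (1 / (pi * real (j + k + 1)))))"
    by simp
  also have "(\<Sum>k\<in>{block_start q n..<block_start q (Suc n)}. (1 / sqrt (b n)) *
       (\<Sum>j\<in>{block_start q m..<block_start q (Suc m)}. (1 / sqrt (b m)) * (1 / (pi * real (j + k + 1)))))
     = (\<Sum>j\<in>{block_start q m..<block_start q (Suc m)}. \<Sum>k\<in>{block_start q n..<block_start q (Suc n)}.
      1 / (pi * real (j + k + 1))) / sqrt (b m * b n)"
    unfolding sum_distrib_left sum_divide_distrib by (subst sum.swap) (simp add: real_sqrt_mult mult_ac)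
  finally show ?thesis .
qed

text \<open>Test vectors are Fourier modes on \<open>M\<close> consecutive blocks, with frequencies
  2 pi k / (M h) of modulus at most \<xi>0. There are 2 \<open>k0\<close> + 1 of them, which is
  (\<xi>0 / pi) ln N up to O(1); vanishing on the first \<open>R\<close> blocks costs
  \<open>R\<close> constraints, a number independent of N.\<close>

lemma hilbert_count_lower:
  assumes \<xi>0: "\<xi>0 \<ge> 0" and t: "t > 0" "t < 1 / cosh (pi * \<xi>0)"
  shows "\<exists>C. \<forall>N\<ge>1. \<xi>0 / pi * ln (real N) - C \<le> real (eigenvalue_count t (hilbert_operator N))"
proof -
  define s0 where "s0 = 1 / cosh (pi * \<xi>0)"
  \<comment> \<open>One \<epsilon> pays for the Riemann sum, two for the row sums of the error
    matrix, and the fourth keeps the inequality strict.\<close>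
  define \<epsilon> where "\<epsilon> = (s0 - t) / 4"
  have \<epsilon>: "\<epsilon> > 0" using t by (simp add: \<epsilon>_def s0_def)
  have s0: "s0 = t + 4 * \<epsilon>" by (simp add: \<epsilon>_def field_simps)
  obtain X0 where X0: "\<And>X. X > 0 \<Longrightarrow> X \<ge> X0 \<Longrightarrow> \<exists>h0>0. \<forall>R>0. X / real R \<le> h0 \<longrightarrow> (\<forall>\<xi>. \<bar>\<xi>\<bar> \<le> \<xi>0 \<longrightarrow>
    1 / cosh (pi * \<xi>) - \<epsilon> \<le> (\<Sum>d\<in>{-int R..int R}. (X / real R) * (cos (\<xi> * (X / real R) * of_int d) / (2 * pi * cosh ((X / real R) * of_int d / 2)))))"
    using sech_riemann_sum[OF \<xi>0 \<epsilon>] by blast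
  \<comment> \<open>Large enough both for the truncated Fourier integral and for the part of the
    Toeplitz matrix outside the band.\<close>
  define X where "X = max 1 (max X0 (2 * ln (2 / \<epsilon>)))"
  have X: "X > 0" "X \<ge> X0" "X \<ge> 2 * ln (2 / \<epsilon>)" by (auto simp: X_def)
  have eX: "2 * exp (- (X / 2)) \<le> \<epsilon>"
  proof -
    have "exp (ln (2 / \<epsilon>)) \<le> exp (X / 2)" using X(3) by simp
    then have "2 / \<epsilon> \<le> exp (X / 2)" using \<epsilon> by simp
    then show ?thesis using \<epsilon> by (simp add: exp_minus field_simps)
  qed
  obtain h0 where h0: "h0 > 0" "\<And>R \<xi>. R > 0 \<Longrightarrow> X / real R \<le> h0 \<Longrightarrow> \<bar>\<xi>\<bar> \<le> \<xi>0 \<Longrightarrow>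
    1 / cosh (pi * \<xi>) - \<epsilon> \<le> (\<Sum>d\<in>{-int R..int R}. (X / real R) * (cos (\<xi> * (X / real R) * of_int d) / (2 * pi * cosh ((X / real R) * of_int d / 2))))"
    using X0[OF X(1,2)] by blast
  \<comment> \<open>The four bounds on h: the mesh of the Riemann sum; q \<le> 9/8 for
    \<open>block_length\<close>; 9 (q - 1) \<le> \<epsilon> for the block error; h \<xi>0 < pi,
    which yields 2 k0 < M.\<close>
  define \<delta> where "\<delta> = min (min h0 (ln (9/8))) (min (ln (1 + \<epsilon> / 9)) (pi / (\<xi>0 + 1)))"
  have \<delta>: "\<delta> > 0" using h0(1) \<epsilon> \<xi>0 by (simp add: \<delta>_def)
  define R where "R = nat \<lceil>X / \<delta>\<rceil>"
  define h where "h = X / real R"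
  have RX: "real R \<ge> X / \<delta>" unfolding R_def by linarith
  moreover have "X / \<delta> > 0" using X \<delta> by simp
  ultimately have R0: "real R > 0" by linarith
  have "X \<le> \<delta> * real R" using RX \<delta> by (simp add: pos_divide_le_eq mult.commute)
  then have R: "R > 0" "h \<le> \<delta>" using R0 by (simp_all add: h_def pos_divide_le_eq)
  have h: "h > 0" "h * real R = X" using X R by (auto simp: h_def)
  define q where "q = exp h"
  have q: "q > 1" "ln q = h" using h by (auto simp: q_def)
  have q98: "q \<le> 9/8"
  proof -
    have "h \<le> ln (9/8)" using R(2) by (simp add: \<delta>_def)
    then have "exp h \<le> exp (ln (9/8))" by (simp only: exp_le_cancel_iff)
    then show ?thesis by (simp add: q_def)
  qed
  have q\<epsilon>: "q - 1 \<le> \<epsilon> / 9"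
  proof -
    have "exp h \<le> exp (ln (1 + \<epsilon> / 9))" using R(2) by (simp add: \<delta>_def)
    then show ?thesis using \<epsilon> by (simp add: q_def)
  qed
  have h\<xi>: "h * \<xi>0 < pi"
  proof -
    have "h * \<xi>0 \<le> pi / (\<xi>0 + 1) * \<xi>0" using R(2) \<xi>0 by (intro mult_right_mono) (auto simp: \<delta>_def)
    also have "\<dots> < pi" using \<xi>0 by (simp add: divide_less_eq)
    finally show ?thesis .
  qed
  obtain n0 where n0: "1 / (q - 1)\<^sup>2 < q ^ n0" using real_arch_pow[OF q(1)] by blast
  have large: "1 \<le> (q - 1)\<^sup>2 * q ^ n" if "n \<ge> n0" for n
  proof -
    have "1 \<le> (q - 1)\<^sup>2 * q ^ n0" using n0 q by (simp add: divide_less_eq mult.commute)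
    also have "\<dots> \<le> (q - 1)\<^sup>2 * q ^ n" using q that by (intro mult_left_mono power_increasing) auto
    finally show ?thesis .
  qed
  define C where "C = \<xi>0 / pi * (ln 4 + h + real n0 * h) + 1 + real R"
  have "\<xi>0 / pi * ln (real N) - C \<le> real (eigenvalue_count t (hilbert_operator N))" if N: "N \<ge> 1" for N
  proof -
    \<comment> \<open>Blocks before \<open>n0\<close> are skipped because rounding is too coarse
      there. The division by 4 covers the doubling j + k and the rounding up of block ends. If the
      subtraction leaves 0, the claimed bound is trivial.\<close>
    define M where "M = nat \<lfloor>ln (real N / 4) / h\<rfloor> - n0"
    define k0 where "k0 = nat \<lfloor>real M * h * \<xi>0 / (2 * pi)\<rfloor>"
    have "ln (real N / 4) / h \<le> real M + real n0 + 1"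
      unfolding M_def by linarith
    then have "ln (real N) - ln 4 \<le> (real M + real n0 + 1) * h"
      using N h by (simp add: ln_div divide_le_eq)
    then have Mh: "\<xi>0 / pi * (ln (real N) - (ln 4 + h + real n0 * h)) \<le> \<xi>0 / pi * (real M * h)"
      using \<xi>0 by (intro mult_left_mono) (auto simp: algebra_simps)
    show ?thesis
    proof (cases "M = 0")
      case True
      then have "\<xi>0 / pi * ln (real N) \<le> \<xi>0 / pi * (ln 4 + h + real n0 * h)"
        using Mh by (simp add: right_diff_distrib)
      then show ?thesis by (simp add: C_def)
    next
      case False
      have k0: "real k0 \<le> real M * h * \<xi>0 / (2 * pi)"
        unfolding k0_def using h \<xi>0 by simp
      have k0': "real M * h * \<xi>0 / (2 * pi) \<le> real k0 + 1" unfolding k0_def by linarith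
      have "2 * real k0 \<le> real M * (h * \<xi>0) / pi" using k0 by (simp add: field_simps)
      also have "\<dots> < real M * pi / pi" using False h\<xi> by (intro divide_strict_right_mono mult_strict_left_mono) auto
      finally have k0M: "2 * k0 < M" by simp
      have NM: "2 * block_start q (n0 + M) \<le> N"
      proof -
        have "M > 0" using False by simp
        then have "real (n0 + M) = of_int \<lfloor>ln (real N / 4) / h\<rfloor>" unfolding M_def by linarith
        then have "real (n0 + M) \<le> ln (real N / 4) / h" by linarith
        then have "h * real (n0 + M) \<le> ln (real N / 4)" using h by (simp add: field_simps)
        then have "exp (h * real (n0 + M)) \<le> real N / 4" using N by (simp add: ln_ge_iff)
        then have "q ^ (n0 + M) \<le> real N / 4" by (simp add: q_def exp_of_nat2_mult[symmetric] mult.commute)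
        moreover have "1 \<le> q ^ (n0 + M)" using q by simp
        moreover have "real (block_start q (n0 + M)) < q ^ (n0 + M) + 1" by (rule block_start(2)[OF q(1)])
        ultimately have "2 * real (block_start q (n0 + M)) \<le> real N" by linarith
        then show ?thesis by linarith
      qed
      define bv where "bv n = block_vector q (n0 + n)" for n
      have NM': "2 * block_start q (Suc (n0 + n)) \<le> N" if "n < M" for n
        using block_start_mono[OF q(1), of "Suc (n0 + n)" "n0 + M"] that NM by simp
      have on: "orthonormal {..<M} bv"
      proof -
        have "orthonormal {n0..<n0 + M} (block_vector q)"
          by (rule block_vectors_orthonormal[OF q(1) block_length(4)[OF q(1) q98 large]]) simp
        then show ?thesis unfolding orthonormal_def bv_def by simp
      qed
      define b where "b n = real (block_start q (Suc n)) - real (block_start q n)" for n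
      define T where "T m n = (\<Sum>j\<in>{block_start q (n0+m)..<block_start q (Suc (n0+m))}.
          \<Sum>k\<in>{block_start q (n0+n)..<block_start q (Suc (n0+n))}. 1 / (pi * real (j + k + 1))) / sqrt (b (n0+m) * b (n0+n))" for m n
      have T: "ell2_cinner (hilbert_operator N (bv m)) (bv n) = of_real (T m n)" if "m < M" "n < M" for m n
        unfolding bv_def T_def b_def by (rule block_vector_form[OF q(1) NM'[OF that(1)] NM'[OF that(2)]])
      have T_sym: "T m n = T n m" for m n
        unfolding T_def by (subst sum.swap) (simp add: add.commute mult.commute)
      have T_approx: "\<bar>T m n - log_toeplitz q (int m - int n)\<bar> \<le> 3 * (q - 1) * log_toeplitz q (int m - int n)" for m n
        using block_average[OF q(1) q98 large large, of "n0 + m" "n0 + n"] unfolding T_def b_def by simp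
      define band where "band m n = (if \<bar>int m - int n\<bar> \<le> int R then log_toeplitz q (int m - int n) else 0)" for m n
      \<comment> \<open>Collects the relative block error 3 (q - 1) and the Toeplitz entries outside
        the band. Its row sums are at most 9 (q - 1) + 2 exp (- X / 2), with both summands at most
        \<epsilon>.\<close>
      define E where "E m n = T m n - band m n" for m n
      have band_sym: "band m n = band n m" for m n
        unfolding band_def using log_toeplitz_minus[of q "int m - int n"] by (simp add: abs_minus_commute)
      define g where "g d = 3 * (q - 1) * log_toeplitz q d + (if \<bar>d\<bar> > int R then log_toeplitz q d else 0)" for d
      have g_nonneg: "g d \<ge> 0" for d using log_toeplitz_pos[OF q(1), of d] q by (simp add: g_def)
      have E_le: "\<bar>E m n\<bar> \<le> g (int m - int n)" for m n
        using T_approx[of m n] log_toeplitz_pos[OF q(1), of "int m - int n"] by (auto simp: E_def band_def g_def)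
      have row: "(\<Sum>n<M. \<bar>E m n\<bar>) \<le> 2 * \<epsilon>" if "m < M" for m
      proof -
        have "(\<Sum>n<M. \<bar>E m n\<bar>) \<le> (\<Sum>n<M. g (int m - int n))" by (intro sum_mono E_le)
        also have "\<dots> = (\<Sum>d\<in>(\<lambda>n. int m - int n) ` {..<M}. g d)"
          by (simp add: sum.reindex inj_on_def)
        also have "\<dots> \<le> (\<Sum>d\<in>{-int M..int M}. g d)"
          using that by (intro sum_mono2 g_nonneg) auto
        also have "\<dots> = 3 * (q - 1) * (\<Sum>d\<in>{-int M..int M}. log_toeplitz q d)
            + (\<Sum>d\<in>{d\<in>{-int M..int M}. \<bar>d\<bar> > int R}. log_toeplitz q d)"
          unfolding g_def sum.distrib sum_distrib_left by (simp only: sum.inter_filter[OF finite_atLeastAtMost_int])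
        also have "\<dots> \<le> 3 * (q - 1) * 3 + 2 * exp (- (ln q * real R / 2))"
          using q q98 by (intro add_mono mult_left_mono log_toeplitz_sum log_toeplitz_tail) auto
        also have "\<dots> \<le> 2 * \<epsilon>" using q\<epsilon> eX h by (simp add: q(2))
        finally show ?thesis .
      qed
      define K where "K = {-int k0..int k0}"
      define e where "e k n = cis (2 * pi * of_int k * of_int (int n) / real M)" for k :: int and n
      define v where "v k = lincomb {..<M} (e k) bv" for k
      have "card K \<le> eigenvalue_count t (hilbert_operator N) + card {..<R}"
      proof (rule eigenvalue_count_ge[where b = e and v = v])
        fix \<beta> :: "int \<Rightarrow> complex"
        assume nz: "\<exists>k\<in>K. \<beta> k \<noteq> 0" and zero: "\<forall>n\<in>{..<R}. (\<Sum>k\<in>K. \<beta> k * e k n) = 0"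
        define c where "c n = (\<Sum>k\<in>K. \<beta> k * cis (2 * pi * of_int k * of_int n / real M))" for n :: int
        have ce: "c (int n) = (\<Sum>k\<in>K. \<beta> k * e k n)" for n by (simp add: c_def e_def)
        define x where "x = lincomb K \<beta> v"
        have x: "x = lincomb {..<M} (\<lambda>n. c (int n)) bv"
          unfolding x_def v_def lincomb_def ce
          by (simp add: ell2.scale_sum_right ell2.scale_sum_left sum.swap[of _ K])
        note toep = banded_toeplitz_form[OF k0M, of R \<beta>, folded K_def, folded c_def]
        have zero': "c (int n) = 0" if "n < R" for n using zero that by (simp add: ce)
        define W where "W = real M * (\<Sum>k\<in>K. (cmod (\<beta> k))\<^sup>2)"
        have nx: "(\<Sum>n<M. (cmod (c (int n)))\<^sup>2) = W" unfolding W_def by (rule toep(1)[OF zero'])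
        have normx: "(norm x)\<^sup>2 = W" unfolding x norm_lincomb_orthonormal[OF finite_lessThan on] by (rule nx)
        have W: "W > 0"
        proof -
          obtain k where "k \<in> K" "\<beta> k \<noteq> 0" using nz by auto
          then have "(\<Sum>k\<in>K. (cmod (\<beta> k))\<^sup>2) > 0" by (intro sum_pos2[of _ k]) (auto simp: K_def)
          then show ?thesis using False by (simp add: W_def)
        qed
        have form: "ell2_cinner (hilbert_operator N x) x
          = (\<Sum>m<M. \<Sum>n<M. of_real (band m n) * (c (int m) * cnj (c (int n))))
          + (\<Sum>m<M. \<Sum>n<M. of_real (E m n) * (c (int m) * cnj (c (int n))))"
        proof -
          have "ell2_cinner (hilbert_operator N x) x = (\<Sum>n<M. cnj (c (int n)) * (\<Sum>m<M. c (int m) * ell2_cinner (hilbert_operator N (bv m)) (bv n)))"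
            unfolding x bounded_operatorD(8)[OF compact_operator_bounded[OF hilbert_operator_compact]]
              cinner_lincomb_right cinner_lincomb_left ..
          also have "\<dots> = (\<Sum>n<M. cnj (c (int n)) * (\<Sum>m<M. c (int m) * of_real (band m n + E m n)))"
            by (intro sum.cong refl arg_cong2[of _ _ _ _ "(*)"]) (use T in \<open>auto simp: E_def\<close>)
          also have "\<dots> = (\<Sum>m<M. \<Sum>n<M. of_real (band m n + E m n) * (c (int m) * cnj (c (int n))))"
            unfolding sum_distrib_left by (subst sum.swap) (simp add: mult_ac)
          finally show ?thesis by (simp add: sum.distrib distrib_right)
        qed
        have main: "(s0 - \<epsilon>) * W \<le> Re (\<Sum>m<M. \<Sum>n<M. of_real (band m n) * (c (int m) * cnj (c (int n))))"
        proof -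
          have sym: "s0 - \<epsilon> \<le> (\<Sum>d\<in>{-int R..int R}. log_toeplitz q d * cos (2 * pi * of_int k * of_int d / real M))" if k: "k \<in> K" for k
          proof -
            define \<xi> where "\<xi> = 2 * pi * of_int k / (real M * h)"
            have "\<bar>\<xi>\<bar> \<le> \<xi>0"
            proof -
              have "\<bar>real_of_int k\<bar> \<le> real k0" using k by (auto simp: K_def)
              then have "2 * pi * \<bar>real_of_int k\<bar> \<le> 2 * pi * (real M * h * \<xi>0 / (2 * pi))"
                using k0 by (intro mult_left_mono) auto
              then have "2 * pi * \<bar>real_of_int k\<bar> \<le> (real M * h) * \<xi>0" by simp
              then show ?thesis using False h by (simp add: \<xi>_def abs_mult pos_divide_le_eq mult.commute)
            qed
            note \<xi> = this
            define S where "S = (\<Sum>d\<in>{-int R..int R}. h * (cos (\<xi> * h * of_int d) / (2 * pi * cosh (h * of_int d / 2))))"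
            have "cosh (pi * \<bar>\<xi>\<bar>) \<le> cosh (pi * \<xi>0)"
              using \<xi> \<xi>0 by (subst cosh_real_nonneg_le_iff) auto
            then have "s0 \<le> 1 / cosh (pi * \<bar>\<xi>\<bar>)" unfolding s0_def by (intro divide_left_mono) auto
            also have "cosh (pi * \<bar>\<xi>\<bar>) = cosh (pi * \<xi>)" by (metis abs_mult abs_of_pos cosh_real_abs pi_gt_zero)
            finally have S: "s0 - \<epsilon> \<le> S"
              using h0(2)[OF R(1) _ \<xi>] R(2) unfolding S_def h_def[symmetric] by (simp add: \<delta>_def)
            have "(\<Sum>d\<in>{-int R..int R}. log_toeplitz q d * cos (2 * pi * of_int k * of_int d / real M)) = (q - 1) / h * S"
              unfolding S_def sum_distrib_left
            proof (intro sum.cong refl)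
              fix d :: int
              have "\<xi> * h * of_int d = 2 * pi * of_int k * of_int d / real M" using h False by (simp add: \<xi>_def)
              then show "log_toeplitz q d * cos (2 * pi * of_int k * of_int d / real M)
                = (q - 1) / h * (h * (cos (\<xi> * h * of_int d) / (2 * pi * cosh (h * of_int d / 2))))"
                using h by (simp add: log_toeplitz_def q(2))
            qed
            \<comment> \<open>The Toeplitz weight q - 1 exceeds the Riemann weight h, and the
              discrepancy goes in the right direction because S is nonnegative.\<close>
            moreover have "1 * S \<le> (q - 1) / h * S"
            proof (rule mult_right_mono)
              have "h \<le> exp h - 1" using exp_ge_add_one_self[of h] by linarith
              then show "1 \<le> (q - 1) / h" using h by (simp add: q_def le_divide_eq)
              show "0 \<le> S" using S t(1) \<epsilon> s0 by linarith
            qed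
            ultimately show ?thesis using S by simp
          qed
          have "(s0 - \<epsilon>) * W = real M * (\<Sum>k\<in>K. (cmod (\<beta> k))\<^sup>2 * (s0 - \<epsilon>))"
            by (simp add: W_def sum_distrib_right[symmetric])
          also have "\<dots> \<le> real M * (\<Sum>k\<in>K. (cmod (\<beta> k))\<^sup>2 * (\<Sum>d\<in>{-int R..int R}. log_toeplitz q d * cos (2 * pi * of_int k * of_int d / real M)))"
            by (intro mult_left_mono sum_mono sym) auto
          also have "\<dots> = Re (\<Sum>m<M. \<Sum>n<M. of_real (band m n) * (c (int m) * cnj (c (int n))))"
            unfolding band_def by (rule toep(2)[OF zero', symmetric])
          finally show ?thesis .
        qed
        have err: "\<bar>Re (\<Sum>m<M. \<Sum>n<M. of_real (E m n) * (c (int m) * cnj (c (int n))))\<bar> \<le> 2 * \<epsilon> * W"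
          unfolding nx[symmetric]
          by (rule order_trans[OF abs_Re_le_cmod schur_test[OF row]]) (auto simp: E_def T_sym band_sym)
        have "t * W < (s0 - \<epsilon>) * W - 2 * \<epsilon> * W"
        proof -
          have "t < s0 - \<epsilon> - 2 * \<epsilon>" using \<epsilon> s0 by linarith
          then have "t * W < (s0 - \<epsilon> - 2 * \<epsilon>) * W" using W by (intro mult_strict_right_mono)
          then show ?thesis by (simp only: left_diff_distrib)
        qed
        with main err have "t * W < Re (ell2_cinner (hilbert_operator N x) x)"
          unfolding form plus_complex.simps by linarith
        then show "t * (norm (lincomb K \<beta> v))\<^sup>2 < Re (ell2_cinner (hilbert_operator N (lincomb K \<beta> v)) (lincomb K \<beta> v))"
          unfolding x_def[symmetric] normx .
      qed (auto simp: K_def hilbert_operator_compact hilbert_operator_self_adjoint t)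
      then have "2 * real k0 + 1 \<le> real (eigenvalue_count t (hilbert_operator N)) + real R"
        by (simp add: K_def)
      moreover have "\<xi>0 / pi * (real M * h) \<le> 2 * real k0 + 2" using k0' by (simp add: field_simps)
      ultimately show ?thesis using Mh by (simp add: C_def right_diff_distrib)
    qed
  qed
  then show ?thesis by blast
qed

section \<open>Decoupling of different jumps\<close>

text \<open>The use of \<open>sgn\<close> makes this a contraction for every complex parameter; on
  the unit circle it multiplies coordinate n by the n-th power of the parameter.\<close>

lift_definition ell2_rotate :: "complex \<Rightarrow> ell2 \<Rightarrow> ell2" is "\<lambda>\<zeta> x n. sgn \<zeta> ^ n * x n"
proof -
  fix \<zeta> :: complex and x :: "nat \<Rightarrow> complex"
  assume x: "summable (\<lambda>n. (cmod (x n))\<^sup>2)"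
  have "cmod (sgn \<zeta> ^ n * x n) \<le> cmod (x n)" for n
    by (simp add: norm_mult norm_power norm_sgn power_0_left)
  then show "summable (\<lambda>n. (cmod (sgn \<zeta> ^ n * x n))\<^sup>2)"
    by (intro summable_comparison_test[OF _ x]) (auto intro!: exI[of _ 0] power_mono)
qed

lemma ell2_nth_rotate: "ell2_nth (ell2_rotate \<zeta> x) n = sgn \<zeta> ^ n * ell2_nth x n"
  by (simp add: ell2_rotate.rep_eq)

lemma rotate_rotate: "ell2_rotate \<zeta> (ell2_rotate \<xi> x) = ell2_rotate (\<zeta> * \<xi>) x"
  by (intro ell2_eqI) (simp add: ell2_nth_rotate sgn_mult power_mult_distrib)

lemma rotate_1 [simp]: "ell2_rotate 1 x = x"
  by (intro ell2_eqI) (simp add: ell2_nth_rotate)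

lemma cinner_rotate: "ell2_cinner (ell2_rotate \<zeta> x) y = ell2_cinner x (ell2_rotate (cnj \<zeta>) y)"
  unfolding ell2_cinner_def by (simp add: ell2_nth_rotate complex_sgn_def mult_ac)

lemma norm_rotate:
  assumes "cmod \<zeta> = 1"
  shows "norm (ell2_rotate \<zeta> x) = norm x"
proof -
  have "\<zeta> \<noteq> 0" using assms by auto
  then have "(norm (ell2_rotate \<zeta> x))\<^sup>2 = (norm x)\<^sup>2"
    using assms by (simp add: norm_ell2_power2 ell2_nth_rotate norm_mult norm_power norm_sgn)
  then show ?thesis by simp
qed

lemma norm_rotate_le: "norm (ell2_rotate \<zeta> x) \<le> norm x"
proof -
  have "(norm (ell2_rotate \<zeta> x))\<^sup>2 \<le> (norm x)\<^sup>2"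
    unfolding norm_ell2_power2
    by (intro suminf_le ell2_nth_summable) (auto simp: ell2_nth_rotate norm_mult norm_power norm_sgn power_0_left)
  then show ?thesis by (rule power2_le_imp_le) simp
qed

lemma bounded_operator_rotate: "bounded_operator (ell2_rotate \<zeta>)"
  by (rule bounded_operatorI[of _ 1])
    (auto intro!: ell2_eqI simp: ell2_nth_rotate algebra_simps norm_rotate_le)

lemma rotate_basis:
  assumes "cmod \<zeta> = 1"
  shows "ell2_rotate \<zeta> (ell2_basis j) = ell2_scale (\<zeta> ^ j) (ell2_basis j)"
  using assms by (intro ell2_eqI) (auto simp: ell2_nth_rotate complex_sgn_def)

text \<open>Summation by parts: the geometric partial sums are bounded by 2 / |1 - \<zeta>|, and the
  decrements of \<open>f\<close> telescope.\<close>

lemma abel_bound: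
  fixes \<zeta> :: complex
  assumes \<zeta>: "cmod \<zeta> = 1" "\<zeta> \<noteq> 1" and f: "\<And>n. f (Suc n) \<le> f n" "\<And>n. 0 \<le> f n"
  shows "cmod (\<Sum>l<n. \<zeta> ^ l * of_real (f l)) \<le> 2 / cmod (1 - \<zeta>) * f 0"
proof -
  define G where "G n = (\<Sum>l<n. \<zeta> ^ l)" for n
  define B where "B = 2 / cmod (1 - \<zeta>)"
  have G: "cmod (G n) \<le> B" for n
  proof -
    have "G n = (1 - \<zeta> ^ n) / (1 - \<zeta>)" unfolding G_def using \<zeta>(2) by (simp add: sum_gp_strict)
    then have "cmod (G n) = cmod (1 - \<zeta> ^ n) / cmod (1 - \<zeta>)" by (simp add: norm_divide)
    also have "\<dots> \<le> 2 / cmod (1 - \<zeta>)"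
      using norm_triangle_ineq4[of 1 "\<zeta> ^ n"] \<zeta>(1) by (intro divide_right_mono) (auto simp: norm_power)
    finally show ?thesis by (simp add: B_def)
  qed
  have "cmod ((\<Sum>l<n. \<zeta> ^ l * of_real (f l)) - G n * of_real (f n)) \<le> B * (f 0 - f n)"
  proof (induction n)
    case (Suc n)
    have "(\<Sum>l<Suc n. \<zeta> ^ l * of_real (f l)) - G (Suc n) * of_real (f (Suc n))
      = ((\<Sum>l<n. \<zeta> ^ l * of_real (f l)) - G n * of_real (f n)) + G (Suc n) * of_real (f n - f (Suc n))"
      by (simp add: G_def algebra_simps)
    also have "cmod \<dots> \<le> B * (f 0 - f n) + B * (f n - f (Suc n))"
      using Suc G[of "Suc n"] f(1)[of n] mult_right_mono[OF G[of "Suc n"], of "f n - f (Suc n)"]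
      by (intro order_trans[OF norm_triangle_ineq] add_mono) (auto simp: norm_mult simp flip: of_real_diff)
    finally show ?case by (simp add: algebra_simps)
  qed (simp add: G_def)
  moreover have "cmod (G n * of_real (f n)) \<le> B * f n"
    using G[of n] f(2)[of n] by (simp add: norm_mult mult_right_mono)
  ultimately have "cmod (\<Sum>l<n. \<zeta> ^ l * of_real (f l)) \<le> B * (f 0 - f n) + B * f n"
    using norm_triangle_ineq[of "(\<Sum>l<n. \<zeta> ^ l * of_real (f l)) - G n * of_real (f n)" "G n * of_real (f n)"] by simp
  also have "\<dots> = B * f 0" by (simp add: algebra_simps)
  finally show ?thesis by (simp add: B_def)
qed

lemma hilbert_operator_nth: "ell2_nth (hilbert_operator N x) k = (\<Sum>j<N. hilbert_matrix N j k * ell2_nth x j)"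
proof -
  obtain C where C: "hs_bound (hilbert_matrix N) C" using hs_bound_hilbert by blast
  have "(\<lambda>j. hilbert_matrix N j k * ell2_nth x j) sums (\<Sum>j<N. hilbert_matrix N j k * ell2_nth x j)"
    by (rule sums_finite) (auto simp: hilbert_matrix_def)
  with hs_nth[OF C, of k x] show ?thesis unfolding hilbert_operator_def by (rule sums_unique2)
qed

lemma hilbert_operator_nth_basis: "ell2_nth (hilbert_operator N (ell2_basis j)) k = hilbert_matrix N j k"
  using fun_cong[OF fun_cong[OF matrix_entry_hilbert[of N]], of j k] by (simp add: matrix_entry_def cinner_basis)

text \<open>Different jumps decouple: sandwiching a nontrivial rotation between two Hilbert matrices gives, by
  Abel summation, a matrix dominated by the square summable rank one matrix \<open>1 / ((j + 1) (k + 1))\<close>.\<close>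

lemma rotated_hilbert_hs:
  assumes \<zeta>: "cmod \<zeta> = 1" "\<zeta> \<noteq> 1"
  shows "\<exists>C. \<forall>N. hs_bound (matrix_entry (\<lambda>x. hilbert_operator N (ell2_rotate \<zeta> (hilbert_operator N x)))) C"
proof -
  define B where "B = 2 / cmod (1 - \<zeta>) / pi\<^sup>2"
  have B: "B \<ge> 0" by (simp add: B_def)
  define D where "D = (\<Sum>j. (1 / real (Suc j))\<^sup>2)"
  have sD: "summable (\<lambda>j. (1 / real (Suc j))\<^sup>2)"
    using inverse_power_summable[of 2, where 'a = real] by (subst summable_Suc_iff) (simp add: inverse_eq_divide power_divide)
  have entry: "cmod (matrix_entry (\<lambda>x. hilbert_operator N (ell2_rotate \<zeta> (hilbert_operator N x))) j k)
      \<le> B * (1 / real (Suc j) * (1 / real (Suc k)))" for N j k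
  proof -
    define f where "f l = 1 / (real (j + l + 1) * real (l + k + 1))" for l
    have "matrix_entry (\<lambda>x. hilbert_operator N (ell2_rotate \<zeta> (hilbert_operator N x))) j k
        = (\<Sum>l<N. hilbert_matrix N l k * (\<zeta> ^ l * hilbert_matrix N j l))"
      using \<zeta>(1) by (simp add: matrix_entry_def cinner_basis hilbert_operator_nth[of _ _ k] ell2_nth_rotate
          hilbert_operator_nth_basis complex_sgn_def)
    \<comment> \<open>Both truncations j + l < N and l + k < N must hold; on the remaining range the
      product of the entries is decreasing in \<open>l\<close>.\<close>
    also have "\<dots> = (\<Sum>l<N - max j k. hilbert_matrix N l k * (\<zeta> ^ l * hilbert_matrix N j l))"
      by (intro sum.mono_neutral_right) (auto simp: hilbert_matrix_def max_def)
    also have "\<dots> = (\<Sum>l<N - max j k. 1 / of_real (pi\<^sup>2) * (\<zeta> ^ l * of_real (f l)))"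
      by (intro sum.cong refl) (auto simp: hilbert_matrix_def f_def max_def power2_eq_square mult_ac split: if_splits)
    also have "\<dots> = 1 / of_real (pi\<^sup>2) * (\<Sum>l<N - max j k. \<zeta> ^ l * of_real (f l))"
      by (simp add: sum_distrib_left)
    also have "cmod \<dots> = 1 / pi\<^sup>2 * cmod (\<Sum>l<N - max j k. \<zeta> ^ l * of_real (f l))"
      by (simp add: norm_mult norm_divide norm_power)
    also have "\<dots> \<le> 1 / pi\<^sup>2 * (2 / cmod (1 - \<zeta>) * f 0)"
    proof (intro mult_left_mono abel_bound \<zeta>)
      fix n show "f (Suc n) \<le> f n" unfolding f_def by (intro divide_left_mono mult_mono mult_pos_pos) auto
    qed (auto simp: f_def)
    finally show ?thesis by (simp add: B_def f_def mult_ac)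
  qed
  have "hs_bound (matrix_entry (\<lambda>x. hilbert_operator N (ell2_rotate \<zeta> (hilbert_operator N x)))) (B\<^sup>2 * (D * D))" for N
    unfolding hs_bound_def
  proof
    fix n
    have "(\<Sum>j<n. \<Sum>k<n. (cmod (matrix_entry (\<lambda>x. hilbert_operator N (ell2_rotate \<zeta> (hilbert_operator N x))) j k))\<^sup>2)
       \<le> (\<Sum>j<n. \<Sum>k<n. (B * (1 / real (Suc j) * (1 / real (Suc k))))\<^sup>2)"
      by (intro sum_mono power_mono entry) auto
    also have "\<dots> = B\<^sup>2 * ((\<Sum>j<n. (1 / real (Suc j))\<^sup>2) * (\<Sum>k<n. (1 / real (Suc k))\<^sup>2))"
      unfolding sum_product unfolding sum_distrib_left
      by (intro sum.cong refl) (simp add: power_mult_distrib power_divide)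
    also have "\<dots> \<le> B\<^sup>2 * (D * D)"
      unfolding D_def using sD by (intro mult_left_mono mult_mono sum_le_suminf suminf_nonneg sum_nonneg) auto
    finally show "(\<Sum>j<n. \<Sum>k<n. (cmod (matrix_entry (\<lambda>x. hilbert_operator N (ell2_rotate \<zeta> (hilbert_operator N x))) j k))\<^sup>2)
       \<le> B\<^sup>2 * (D * D)" .
  qed
  then show ?thesis by blast
qed

lemma rotated_hilbert_small_off:
  assumes \<zeta>: "cmod \<zeta> = 1" "\<zeta> \<noteq> 1" and \<delta>: "\<delta> > 0"
  shows "\<exists>m. \<forall>N. small_off (\<lambda>x. hilbert_operator N (ell2_rotate \<zeta> (hilbert_operator N x))) \<delta> m"
proof -
  obtain C where C: "\<And>N. hs_bound (matrix_entry (\<lambda>x. hilbert_operator N (ell2_rotate \<zeta> (hilbert_operator N x)))) C"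
    using rotated_hilbert_hs[OF \<zeta>] by blast
  have "small_off (\<lambda>x. hilbert_operator N (ell2_rotate \<zeta> (hilbert_operator N x))) \<delta> (nat \<lceil>C / \<delta>\<^sup>2\<rceil>)" for N
  proof -
    let ?X = "\<lambda>x. hilbert_operator N (ell2_rotate \<zeta> (hilbert_operator N x))"
    have "bounded_operator (hilbert_operator N \<circ> (ell2_rotate \<zeta> \<circ> hilbert_operator N))"
      by (intro bounded_operator_compose bounded_operator_rotate compact_operator_bounded hilbert_operator_compact)
    then have "bounded_operator ?X" by (simp add: o_def)
    then have "operator_of_matrix (matrix_entry ?X) = ?X" by (rule operator_of_matrix_eq) simp
    with hs_small_off[OF C[of N] \<delta>, of "nat \<lceil>C / \<delta>\<^sup>2\<rceil>"] show ?thesis by (simp add: real_nat_ceiling_ge)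
  qed
  then show ?thesis by blast
qed

section \<open>Sums of rotated Hilbert operators and their test vectors\<close>

definition jump_matrix :: "complex set \<Rightarrow> (complex \<Rightarrow> complex) \<Rightarrow> nat \<Rightarrow> nat \<Rightarrow> nat \<Rightarrow> complex" where
  "jump_matrix Z a N j k = (\<Sum>z\<in>Z. a z * cnj z ^ (j + k)) * hilbert_matrix N j k"

text \<open>Since cnj z^(j+k) = cnj z^j cnj z^k, each jump is the Hilbert operator between two equal
  rotations. For z on the unit circle these are mutually inverse only at z = 1 and z = -1, which is
  why the form is tested between a vector and a different partner.\<close>

definition jump_operator :: "complex set \<Rightarrow> (complex \<Rightarrow> complex) \<Rightarrow> nat \<Rightarrow> ell2 \<Rightarrow> ell2" where
  "jump_operator Z a N x = (\<Sum>z\<in>Z. ell2_scale (a z) (ell2_rotate (cnj z) (hilbert_operator N (ell2_rotate (cnj z) x))))"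

lemma bounded_operator_sum:
  assumes "\<And>i. i \<in> I \<Longrightarrow> bounded_operator (A i)"
  shows "bounded_operator (\<lambda>x. \<Sum>i\<in>I. A i x)"
  using assms
proof (induction I rule: infinite_finite_induct)
  case (insert i I)
  then show ?case using bounded_operator_add[of "A i" "\<lambda>x. \<Sum>i\<in>I. A i x"] by simp
qed (auto intro!: bounded_operatorI[of _ 0])

lemma jump_operator:
  assumes Z: "\<And>z. z \<in> Z \<Longrightarrow> cmod z = 1"
  shows "bounded_operator (jump_operator Z a N)" "matrix_entry (jump_operator Z a N) = jump_matrix Z a N"
    "operator_of_matrix (jump_matrix Z a N) = jump_operator Z a N"
proof -
  show b: "bounded_operator (jump_operator Z a N)"
    unfolding jump_operator_def[abs_def]
  proof (intro bounded_operator_sum bounded_operator_scale)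
    fix z
    have "bounded_operator (ell2_rotate (cnj z) \<circ> (hilbert_operator N \<circ> ell2_rotate (cnj z)))"
      by (intro bounded_operator_compose bounded_operator_rotate compact_operator_bounded hilbert_operator_compact)
    then show "bounded_operator (\<lambda>x. ell2_rotate (cnj z) (hilbert_operator N (ell2_rotate (cnj z) x)))"
      by (simp add: o_def)
  qed
  show m: "matrix_entry (jump_operator Z a N) = jump_matrix Z a N"
  proof (intro ext)
    fix j k
    note bH = bounded_operatorD[OF compact_operator_bounded[OF hilbert_operator_compact[of N]]]
    show "matrix_entry (jump_operator Z a N) j k = jump_matrix Z a N j k"
      unfolding matrix_entry_def cinner_basis jump_operator_def jump_matrix_def ell2_nth_sum sum_distrib_right
      using Z by (intro sum.cong refl)
        (simp add: rotate_basis bH ell2_nth_rotate hilbert_operator_nth_basis complex_sgn_def power_add)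
  qed
  show "operator_of_matrix (jump_matrix Z a N) = jump_operator Z a N" by (rule operator_of_matrix_eq[OF b m])
qed

lemma norm_sum_almost_orthogonal:
  fixes f :: "'i \<Rightarrow> ell2"
  assumes "finite Z" and n: "\<And>z. z \<in> Z \<Longrightarrow> (norm (f z))\<^sup>2 \<le> r z" and c: "c \<ge> 0"
    and o: "\<And>z w. z \<in> Z \<Longrightarrow> w \<in> Z \<Longrightarrow> z \<noteq> w \<Longrightarrow> cmod (ell2_cinner (f z) (f w)) \<le> c"
  shows "(norm (\<Sum>z\<in>Z. f z))\<^sup>2 \<le> (\<Sum>z\<in>Z. r z) + (real (card Z))\<^sup>2 * c"
proof -
  have "(norm (\<Sum>z\<in>Z. f z))\<^sup>2 = Re (ell2_cinner (\<Sum>z\<in>Z. f z) (\<Sum>z\<in>Z. f z))" by (simp add: cinner_self)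
  also have "\<dots> = (\<Sum>z\<in>Z. \<Sum>w\<in>Z. Re (ell2_cinner (f z) (f w)))"
    by (simp only: cinner_sum_left Re_sum) (simp only: cinner_sum_right Re_sum)
  also have "\<dots> \<le> (\<Sum>z\<in>Z. \<Sum>w\<in>Z. (if w = z then r z else 0) + c)"
  proof (intro sum_mono)
    fix z w assume zw: "z \<in> Z" "w \<in> Z"
    show "Re (ell2_cinner (f z) (f w)) \<le> (if w = z then r z else 0) + c"
    proof (cases "w = z")
      case True
      then show ?thesis using n[OF zw(1)] c by (simp add: cinner_self)
    next
      case False
      then show ?thesis using o[OF zw] complex_Re_le_cmod order_trans by fastforce
    qed
  qed
  also have "\<dots> = (\<Sum>z\<in>Z. r z) + (real (card Z))\<^sup>2 * c"
    using assms(1) by (simp add: sum.distrib power2_eq_square)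
  finally show ?thesis .
qed

text \<open>In the triple sum over the jump w and the pieces z of x and z' of x', the term w = z =
  z' gives |a w| <H y, y>. In every other term a nontrivial rotation stands next to H, and writing y
  = H g exhibits a factor H U H, which is small. The same device makes the pieces of x and of x'
  almost orthogonal.\<close>

lemma jump_form_lower:
  fixes Z :: "complex set" and a \<beta> :: "complex \<Rightarrow> complex" and y g :: "complex \<Rightarrow> ell2"
  assumes fin: "finite Z" and Z: "\<And>z. z \<in> Z \<Longrightarrow> cmod z = 1"
    and y: "\<And>z. z \<in> Z \<Longrightarrow> y z = hilbert_operator N (g z)"
    and g: "\<And>z. z \<in> Z \<Longrightarrow> norm (g z) \<le> \<kappa> * norm (y z)"
    and small: "\<And>u w z. u \<in> Z \<Longrightarrow> w \<in> Z \<Longrightarrow> z \<in> Z \<Longrightarrow> u \<noteq> w \<Longrightarrow>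
      norm (hilbert_operator N (ell2_rotate (cnj u * w) (hilbert_operator N (g z)))) \<le> \<delta> * norm (g z)"
    and \<beta>: "\<And>z. z \<in> Z \<Longrightarrow> cmod (\<beta> z) \<le> 1" "\<And>z. z \<in> Z \<Longrightarrow> a z * cnj (\<beta> z) = of_real (cmod (a z))"
    and A: "\<And>z. z \<in> Z \<Longrightarrow> cmod (a z) \<le> A" "A \<ge> 0" and pos: "\<delta> \<ge> 0" "\<kappa> \<ge> 0"
    and form: "\<And>z. z \<in> Z \<Longrightarrow> t * (norm (y z))\<^sup>2 \<le> cmod (a z) * Re (ell2_cinner (hilbert_operator N (y z)) (y z))"
  defines "x \<equiv> \<Sum>z\<in>Z. ell2_rotate z (y z)" and "x' \<equiv> \<Sum>z\<in>Z. ell2_scale (\<beta> z) (ell2_rotate (cnj z) (y z))"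
    and "Y \<equiv> \<Sum>z\<in>Z. (norm (y z))\<^sup>2"
    and "\<eta> \<equiv> real (card Z) ^ 3 * (A * \<delta> * \<kappa>) + (real (card Z))\<^sup>2 * (\<delta> * \<kappa>\<^sup>2)"
  shows "(t - \<eta>) * Y \<le> Re (ell2_cinner (jump_operator Z a N x) x')"
    "(norm x)\<^sup>2 \<le> (1 + \<eta>) * Y" "(norm x')\<^sup>2 \<le> (1 + \<eta>) * Y"
proof -
  define H where "H = hilbert_operator N"
  note bH = bounded_operatorD[OF compact_operator_bounded[OF hilbert_operator_compact[of N]], folded H_def]
  note bR = bounded_operatorD[OF bounded_operator_rotate]
  note sa = self_adjointD[OF hilbert_operator_self_adjoint[of N], folded H_def]
  note y = y[folded H_def] and small = small[folded H_def] and form = form[folded H_def]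
  have Y0: "Y \<ge> 0" by (simp add: Y_def sum_nonneg)
  have yy: "norm (y z) * norm (y w) \<le> Y" if "z \<in> Z" "w \<in> Z" for z w
  proof -
    have "(norm (y z))\<^sup>2 \<le> Y" "(norm (y w))\<^sup>2 \<le> Y"
      unfolding Y_def using that fin by (auto intro!: member_le_sum)
    then show ?thesis using sum_squares_bound[of "norm (y z)" "norm (y w)"] by simp
  qed
  have gy: "norm (g z) * norm (y w) \<le> \<kappa> * Y" if "z \<in> Z" "w \<in> Z" for z w
  proof -
    have "norm (g z) * norm (y w) \<le> \<kappa> * norm (y z) * norm (y w)" by (intro mult_right_mono g that) simp
    also have "\<dots> \<le> \<kappa> * Y" using mult_left_mono[OF yy[OF that] pos(2)] by (simp add: mult.assoc)
    finally show ?thesis .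
  qed
  have gg: "norm (g z) * norm (g w) \<le> \<kappa>\<^sup>2 * Y" if "z \<in> Z" "w \<in> Z" for z w
  proof -
    have "norm (g z) * norm (g w) \<le> norm (g z) * (\<kappa> * norm (y w))" by (intro mult_left_mono g that) simp
    also have "\<dots> = \<kappa> * (norm (g z) * norm (y w))" by simp
    also have "\<dots> \<le> \<kappa> * (\<kappa> * Y)" by (intro mult_left_mono gy that pos)
    finally show ?thesis by (simp add: power2_eq_square)
  qed
  define m where "m = real (card Z)"
  \<comment> \<open>Each of the cubically many terms of the form costs at most A \<delta> \<kappa>
    Y, each of the quadratically many inner products in a norm at most \<delta> \<kappa>^2 Y; the
    sum of both totals serves all three claims.\<close>
  have \<eta>: "\<eta> = m ^ 3 * (A * \<delta> * \<kappa>) + m\<^sup>2 * (\<delta> * \<kappa>\<^sup>2)" by (simp add: \<eta>_def m_def)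
  have n1: "m ^ 3 * (A * \<delta> * \<kappa>) \<ge> 0" and n2: "m\<^sup>2 * (\<delta> * \<kappa>\<^sup>2) \<ge> 0" using A pos by (auto simp: m_def)
  have bound: "Y + m\<^sup>2 * (\<delta> * (\<kappa>\<^sup>2 * Y)) \<le> (1 + \<eta>) * Y"
    using mult_right_mono[OF n1 Y0] by (simp add: \<eta> algebra_simps)
  show "(norm x)\<^sup>2 \<le> (1 + \<eta>) * Y"
  proof (rule order_trans[OF _ bound])
    show "(norm x)\<^sup>2 \<le> Y + m\<^sup>2 * (\<delta> * (\<kappa>\<^sup>2 * Y))"
      unfolding x_def Y_def m_def
    proof (rule norm_sum_almost_orthogonal[OF fin])
      fix z w assume zw: "z \<in> Z" "w \<in> Z" "z \<noteq> w"
      have "ell2_cinner (ell2_rotate z (y z)) (ell2_rotate w (y w)) = ell2_cinner (ell2_rotate (cnj w * z) (y z)) (y w)"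
        using cinner_rotate[of "cnj w" "ell2_rotate z (y z)" "y w"] by (simp add: rotate_rotate)
      also have "\<dots> = ell2_cinner (H (ell2_rotate (cnj w * z) (H (g z)))) (g w)"
        using zw by (simp add: y sa)
      also have "cmod \<dots> \<le> \<delta> * norm (g z) * norm (g w)"
        using small[of w z z] zw by (intro order_trans[OF cinner_cauchy_schwarz] mult_right_mono) auto
      also have "\<dots> \<le> \<delta> * (\<kappa>\<^sup>2 * Y)" using mult_left_mono[OF gg[OF zw(1,2)] pos(1)] by (simp add: mult.assoc)
      finally show "cmod (ell2_cinner (ell2_rotate z (y z)) (ell2_rotate w (y w))) \<le> \<delta> * (\<kappa>\<^sup>2 * (\<Sum>z\<in>Z. (norm (y z))\<^sup>2))"
        by (simp add: Y_def)
    next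
      show "0 \<le> \<delta> * (\<kappa>\<^sup>2 * (\<Sum>z\<in>Z. (norm (y z))\<^sup>2))" using pos by (simp add: sum_nonneg)
    qed (auto simp: norm_rotate Z)
  qed
  show "(norm x')\<^sup>2 \<le> (1 + \<eta>) * Y"
  proof (rule order_trans[OF _ bound])
    show "(norm x')\<^sup>2 \<le> Y + m\<^sup>2 * (\<delta> * (\<kappa>\<^sup>2 * Y))"
      unfolding x'_def Y_def m_def
    proof (rule norm_sum_almost_orthogonal[OF fin])
      fix z w assume zw: "z \<in> Z" "w \<in> Z" "z \<noteq> w"
      have e: "ell2_cinner (ell2_rotate (cnj z) (y z)) (ell2_rotate (cnj w) (y w)) = ell2_cinner (g z) (H (ell2_rotate (cnj w * z) (H (g w))))"
        using zw by (simp add: cinner_rotate rotate_rotate mult.commute y sa)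
      have "cmod (ell2_cinner (ell2_scale (\<beta> z) (ell2_rotate (cnj z) (y z))) (ell2_scale (\<beta> w) (ell2_rotate (cnj w) (y w))))
        = cmod (\<beta> z) * cmod (\<beta> w) * cmod (ell2_cinner (g z) (H (ell2_rotate (cnj w * z) (H (g w)))))"
        by (simp add: cinner_simps norm_mult e)
      also have "\<dots> \<le> 1 * cmod (ell2_cinner (g z) (H (ell2_rotate (cnj w * z) (H (g w)))))"
        using zw \<beta>(1)[of z] \<beta>(1)[of w] by (intro mult_right_mono mult_le_one) auto
      also have "\<dots> \<le> norm (g z) * (\<delta> * norm (g w))"
        using small[of w z w] zw by (auto intro!: order_trans[OF cinner_cauchy_schwarz] mult_left_mono)
      also have "\<dots> \<le> \<delta> * (\<kappa>\<^sup>2 * Y)" using mult_left_mono[OF gg[OF zw(1,2)] pos(1)] by (simp add: mult_ac)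
      finally show "cmod (ell2_cinner (ell2_scale (\<beta> z) (ell2_rotate (cnj z) (y z))) (ell2_scale (\<beta> w) (ell2_rotate (cnj w) (y w))))
          \<le> \<delta> * (\<kappa>\<^sup>2 * (\<Sum>z\<in>Z. (norm (y z))\<^sup>2))"
        by (simp add: Y_def)
    next
      show "0 \<le> \<delta> * (\<kappa>\<^sup>2 * (\<Sum>z\<in>Z. (norm (y z))\<^sup>2))" using pos by (simp add: sum_nonneg)
      fix z assume z: "z \<in> Z"
      have "norm (ell2_scale (\<beta> z) (ell2_rotate (cnj z) (y z))) \<le> 1 * norm (y z)"
        unfolding norm_ell2_scale using \<beta>(1)[OF z] by (intro mult_mono norm_rotate_le) auto
      then show "(norm (ell2_scale (\<beta> z) (ell2_rotate (cnj z) (y z))))\<^sup>2 \<le> (norm (y z))\<^sup>2"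
        by (intro power_mono) auto
    qed
  qed
  define T where "T w z z' = a w * cnj (\<beta> z') * ell2_cinner (H (ell2_rotate (cnj w * z) (y z))) (ell2_rotate (w * cnj z') (y z'))" for w z z'
  have "ell2_cinner (jump_operator Z a N x) x' = (\<Sum>w\<in>Z. \<Sum>z\<in>Z. \<Sum>z'\<in>Z. T w z z')"
  proof -
    have "jump_operator Z a N x = (\<Sum>w\<in>Z. \<Sum>z\<in>Z. ell2_scale (a w) (ell2_rotate (cnj w) (H (ell2_rotate (cnj w * z) (y z)))))"
      unfolding jump_operator_def x_def H_def[symmetric] bR(7) bH(7) ell2.scale_sum_right rotate_rotate ..
    then have "ell2_cinner (jump_operator Z a N x) x' = (\<Sum>w\<in>Z. \<Sum>z\<in>Z. \<Sum>z'\<in>Z.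
        ell2_cinner (ell2_scale (a w) (ell2_rotate (cnj w) (H (ell2_rotate (cnj w * z) (y z))))) (ell2_scale (\<beta> z') (ell2_rotate (cnj z') (y z'))))"
      by (simp only: x'_def cinner_sum_left) (simp only: cinner_sum_right)
    then show ?thesis by (simp add: T_def cinner_simps cinner_rotate rotate_rotate mult_ac)
  qed
  then have "Re (ell2_cinner (jump_operator Z a N x) x') = (\<Sum>w\<in>Z. \<Sum>z\<in>Z. \<Sum>z'\<in>Z. Re (T w z z'))"
    by (simp add: Re_sum)
  moreover have "(\<Sum>w\<in>Z. \<Sum>z\<in>Z. \<Sum>z'\<in>Z. (if z = w then if z' = w then t * (norm (y w))\<^sup>2 else 0 else 0) - A * \<delta> * \<kappa> * Y)
      \<le> (\<Sum>w\<in>Z. \<Sum>z\<in>Z. \<Sum>z'\<in>Z. Re (T w z z'))"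
  proof (intro sum_mono)
    fix w z z' assume zs: "w \<in> Z" "z \<in> Z" "z' \<in> Z"
    have c0: "A * \<delta> * \<kappa> * Y \<ge> 0" using A pos Y0 by simp
    have ab: "cmod (a w) * cmod (\<beta> z') \<le> A * 1"
      using A(1)[OF zs(1)] \<beta>(1)[OF zs(3)] A(2) by (intro mult_mono) auto
    have rn: "norm (ell2_rotate (w * cnj z') (y z')) \<le> norm (y z')" by (rule norm_rotate_le)
    consider "z \<noteq> w" | "z = w" "z' \<noteq> w" | "z = w" "z' = w" by blast
    then show "(if z = w then if z' = w then t * (norm (y w))\<^sup>2 else 0 else 0) - A * \<delta> * \<kappa> * Y \<le> Re (T w z z')"
    proof cases
      \<comment> \<open>The rotation applied to the piece \<open>y z\<close> is nontrivial, so H U H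
        acts on \<open>g z\<close> in the left argument.\<close>
      case 1
      have "cmod (ell2_cinner (H (ell2_rotate (cnj w * z) (y z))) (ell2_rotate (w * cnj z') (y z'))) \<le> \<delta> * norm (g z) * norm (y z')"
        using small[of w z z] zs 1 rn y[OF zs(2)] pos by (intro order_trans[OF cinner_cauchy_schwarz] mult_mono) auto
      also have "\<dots> \<le> \<delta> * (\<kappa> * Y)" using mult_left_mono[OF gy[OF zs(2,3)] pos(1)] by (simp add: mult.assoc)
      finally have cc: "cmod (ell2_cinner (H (ell2_rotate (cnj w * z) (y z))) (ell2_rotate (w * cnj z') (y z'))) \<le> \<delta> * (\<kappa> * Y)" .
      have "cmod (T w z z') \<le> A * 1 * (\<delta> * (\<kappa> * Y))"
        unfolding T_def norm_mult complex_mod_cnj by (rule mult_mono[OF ab cc]) (use A(2) in auto)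
      then show ?thesis using 1 abs_Re_le_cmod[of "T w z z'"] by (simp add: mult_ac abs_le_iff)
    next
      \<comment> \<open>The rotation on the left is trivial. Self-adjointness moves H to the right
        argument, where H U H acts on \<open>g z'\<close>.\<close>
      case 2
      have ww: "cnj w * w = 1" "w * cnj w = 1" using Z[OF zs(1)] complex_norm_square[of w] by (simp_all add: mult.commute)
      have "ell2_cinner (H (ell2_rotate (cnj w * z) (y z))) (ell2_rotate (w * cnj z') (y z'))
        = ell2_cinner (y w) (H (ell2_rotate (cnj z' * w) (H (g z'))))"
        using 2 zs by (simp add: ww sa mult.commute y[OF zs(3)])
      also have "cmod \<dots> \<le> norm (y w) * (\<delta> * norm (g z'))"
        using small[of z' w z'] zs 2 by (auto intro!: order_trans[OF cinner_cauchy_schwarz] mult_left_mono)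
      also have "\<dots> \<le> \<delta> * (\<kappa> * Y)" using mult_left_mono[OF gy[OF zs(3,1)] pos(1)] by (simp add: mult_ac)
      finally have cc: "cmod (ell2_cinner (H (ell2_rotate (cnj w * z) (y z))) (ell2_rotate (w * cnj z') (y z'))) \<le> \<delta> * (\<kappa> * Y)" .
      have "cmod (T w z z') \<le> A * 1 * (\<delta> * (\<kappa> * Y))"
        unfolding T_def norm_mult complex_mod_cnj by (rule mult_mono[OF ab cc]) (use A(2) in auto)
      then show ?thesis using 2 abs_Re_le_cmod[of "T w z z'"] by (simp add: mult_ac abs_le_iff)
    next
      case 3
      have ww: "cnj w * w = 1" "w * cnj w = 1" using Z[OF zs(1)] complex_norm_square[of w] by (simp_all add: mult.commute)
      have "T w z z' = of_real (cmod (a w)) * ell2_cinner (H (y w)) (y w)"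
        using 3 by (simp add: T_def ww \<beta>(2)[OF zs(1)])
      then show ?thesis using 3 form[OF zs(1)] c0 by simp
    qed
  qed
  moreover have "(\<Sum>w\<in>Z. \<Sum>z\<in>Z. \<Sum>z'\<in>Z. (if z = w then if z' = w then t * (norm (y w))\<^sup>2 else 0 else 0) - A * \<delta> * \<kappa> * Y)
      = t * Y - m ^ 3 * (A * \<delta> * \<kappa>) * Y"
  proof -
    have "(\<Sum>z\<in>Z. \<Sum>z'\<in>Z. (if z = w then if z' = w then t * (norm (y w))\<^sup>2 else 0 else 0) - A * \<delta> * \<kappa> * Y)
        = t * (norm (y w))\<^sup>2 - m\<^sup>2 * (A * \<delta> * \<kappa> * Y)" if "w \<in> Z" for w
    proof -
      have "(\<Sum>z'\<in>Z. if z = w then if z' = w then t * (norm (y w))\<^sup>2 else 0 else 0) = (if z = w then t * (norm (y w))\<^sup>2 else 0)" for z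
        using fin that by simp
      then show ?thesis
        unfolding sum_subtractf using fin that by (simp add: m_def power2_eq_square)
    qed
    then have "(\<Sum>w\<in>Z. \<Sum>z\<in>Z. \<Sum>z'\<in>Z. (if z = w then if z' = w then t * (norm (y w))\<^sup>2 else 0 else 0) - A * \<delta> * \<kappa> * Y)
      = (\<Sum>w\<in>Z. t * (norm (y w))\<^sup>2 - m\<^sup>2 * (A * \<delta> * \<kappa> * Y))" by (intro sum.cong) auto
    also have "\<dots> = t * Y - m * (m\<^sup>2 * (A * \<delta> * \<kappa> * Y))"
      by (simp add: sum_subtractf Y_def sum_distrib_left m_def)
    finally show ?thesis by (simp add: power3_eq_cube power2_eq_square mult_ac)
  qed
  moreover have "(t - \<eta>) * Y \<le> t * Y - m ^ 3 * (A * \<delta> * \<kappa>) * Y"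
    using mult_right_mono[OF n2 Y0] by (simp add: \<eta> algebra_simps)
  ultimately show "(t - \<eta>) * Y \<le> Re (ell2_cinner (jump_operator Z a N x) x')" by linarith
qed

text \<open>Combinations of the \<open>v i\<close> satisfying the linear constraints indexed by \<open>Q\<close> have the form
  \<open>\<Sum>z. z\<^sup>n y\<^sub>z\<close> with \<open>y\<^sub>z = \<mu>\<^sub>z u\<^sub>\<pi>\<^sub>z\<close>, and the form of the jump operator is bounded below when such a vector is
  tested against its partner \<open>\<Sum>z. sgn a\<^sub>z cnj z\<^sup>n y\<^sub>z\<close>.\<close>

definition test_family :: "complex set \<Rightarrow> (complex \<Rightarrow> complex) \<Rightarrow> (complex \<Rightarrow> complex) \<Rightarrow> (complex \<Rightarrow> complex) \<Rightarrow>
    real \<Rightarrow> nat \<Rightarrow> 'i set \<Rightarrow> ('i \<Rightarrow> ell2) \<Rightarrow> 'q set \<Rightarrow> ('i \<Rightarrow> 'q \<Rightarrow> complex) \<Rightarrow> bool" where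
  "test_family Z a \<mu> \<pi> t' N I v Q b \<longleftrightarrow>
    (\<forall>c. (\<exists>i\<in>I. c i \<noteq> 0) \<longrightarrow> (\<forall>q\<in>Q. (\<Sum>i\<in>I. c i * b i q) = 0) \<longrightarrow>
      (\<exists>u. lincomb I c v = (\<Sum>z\<in>Z. ell2_rotate z (ell2_scale (\<mu> z) (u (\<pi> z)))) \<and>
        t' * norm (lincomb I c v) * norm (\<Sum>z\<in>Z. ell2_scale (sgn (a z)) (ell2_rotate (cnj z) (ell2_scale (\<mu> z) (u (\<pi> z)))))
        < Re (ell2_cinner (jump_operator Z a N (lincomb I c v))
            (\<Sum>z\<in>Z. ell2_scale (sgn (a z)) (ell2_rotate (cnj z) (ell2_scale (\<mu> z) (u (\<pi> z))))))))"

text \<open>Each representative in \<Theta> carries the eigenvectors of the Hilbert operator above t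
  / |a \<theta>|; \<pi> sends a jump to its representative, \<mu> is the phase with which the jump
  reuses the same vector, and \<mu> z = 0 leaves it out. Singular values take \<pi> z = z and \<mu>
  z = 1, eigenvalues tie z to cnj z. The constraints are one exceptional set per representative and
  pair of different jumps, bounded in number independently of N.\<close>

lemma jump_test_space:
  fixes Z \<Theta> :: "complex set" and a \<mu> :: "complex \<Rightarrow> complex" and \<pi> :: "complex \<Rightarrow> complex"
  assumes fin: "finite Z" and Z: "\<And>z. z \<in> Z \<Longrightarrow> cmod z = 1" and a: "\<And>z. z \<in> Z \<Longrightarrow> a z \<noteq> 0"
    and \<Theta>: "\<Theta> \<subseteq> Z" "\<And>\<theta>. \<theta> \<in> \<Theta> \<Longrightarrow> \<pi> \<theta> = \<theta> \<and> \<mu> \<theta> \<noteq> 0"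
    and \<mu>: "\<And>z. z \<in> Z \<Longrightarrow> \<mu> z \<noteq> 0 \<Longrightarrow> cmod (\<mu> z) = 1 \<and> \<pi> z \<in> \<Theta> \<and> cmod (a (\<pi> z)) = cmod (a z)"
    and t: "0 < t'" "t' < t"
  shows "\<exists>C. \<forall>N. \<exists>(I :: (complex \<times> nat) set) v (Q :: (complex \<times> ell2) set) b.
    finite I \<and> finite Q \<and> card Q \<le> C \<and>
    card I = (\<Sum>\<theta>\<in>\<Theta>. eigenvalue_count (t / cmod (a \<theta>)) (hilbert_operator N)) \<and>
    test_family Z a \<mu> \<pi> t' N I v Q b"
proof -
  define A where "A = (\<Sum>z\<in>Z. cmod (a z)) + 1"
  have A: "A > 0" by (simp add: A_def add_nonneg_pos sum_nonneg)
  have aA: "cmod (a z) \<le> A" if "z \<in> Z" for z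
    using member_le_sum[OF that, of "\<lambda>z. cmod (a z)"] fin by (simp add: A_def)
  \<comment> \<open>A level not above any t / |a z|. The eigenvectors used have eigenvalues above
    it, so on their span the Hilbert operator is inverted with norm at most \<kappa>.\<close>
  define t0 where "t0 = t / A"
  have t0: "t0 > 0" using t A by (simp add: t0_def)
  define \<kappa> where "\<kappa> = 1 / t0"
  have \<kappa>: "\<kappa> > 0" using t0 by (simp add: \<kappa>_def)
  define B where "B = real (card Z) ^ 3 * (A * \<kappa>) + (real (card Z))\<^sup>2 * \<kappa>\<^sup>2"
  have B: "B \<ge> 0" using A \<kappa> by (simp add: B_def)
  \<comment> \<open>With \<eta> = B \<delta> this gives \<eta> (1 + t') \<le> (t - t') / 2, which
    leaves t' (1 + \<eta>) < t - \<eta>.\<close>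
  define \<delta> where "\<delta> = (t - t') / (2 * (1 + t') * (B + 1))"
  have \<delta>: "\<delta> > 0" using t B by (simp add: \<delta>_def)
  define \<eta> where "\<eta> = real (card Z) ^ 3 * (A * \<delta> * \<kappa>) + (real (card Z))\<^sup>2 * (\<delta> * \<kappa>\<^sup>2)"
  have \<eta>: "\<eta> \<ge> 0" "t' * (1 + \<eta>) < t - \<eta>"
  proof -
    have e: "\<eta> = B * \<delta>" by (simp add: \<eta>_def B_def algebra_simps)
    then show "\<eta> \<ge> 0" using B \<delta> by simp
    have "B * \<delta> \<le> (B + 1) * \<delta>" using \<delta> by simp
    also have "(B + 1) * \<delta> = (t - t') / (2 * (1 + t'))" using B by (simp add: \<delta>_def)
    finally have "\<eta> * (1 + t') \<le> (t - t') / 2" using t unfolding e by (simp add: field_simps)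
    then show "t' * (1 + \<eta>) < t - \<eta>" using t by (simp add: algebra_simps)
  qed
  have "\<exists>m. \<forall>N. small_off (\<lambda>x. hilbert_operator N (ell2_rotate (cnj u * w) (hilbert_operator N x))) \<delta> m"
    if "u \<in> Z" "w \<in> Z" "u \<noteq> w" for u w
  proof (rule rotated_hilbert_small_off[OF _ _ \<delta>])
    show "cmod (cnj u * w) = 1" using Z that by (simp add: norm_mult)
    have uu: "u * cnj u = 1" using Z[OF that(1)] complex_norm_square[of u] by simp
    show "cnj u * w \<noteq> 1"
    proof
      assume "cnj u * w = 1"
      then have "u * cnj u * w = u" by (simp add: mult.assoc)
      with uu that show False by simp
    qed
  qed
  then obtain mm where mm: "\<And>u w N. u \<in> Z \<Longrightarrow> w \<in> Z \<Longrightarrow> u \<noteq> w \<Longrightarrow>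
      small_off (\<lambda>x. hilbert_operator N (ell2_rotate (cnj u * w) (hilbert_operator N x))) \<delta> (mm u w)"
    by metis
  define P where "P = {(u, w) \<in> Z \<times> Z. u \<noteq> w}"
  have P: "finite P" unfolding P_def using fin by (auto intro: finite_subset[of _ "Z \<times> Z"])
  define C where "C = card \<Theta> * (\<Sum>(u, w)\<in>P. mm u w)"
  have fin\<Theta>: "finite \<Theta>" using \<Theta>(1) fin finite_subset by blast
  show ?thesis
  proof (rule exI[of _ C], rule allI)
    fix N
    define H where "H = hilbert_operator N"
    have H: "compact_operator H" "self_adjoint H"
      unfolding H_def by (rule hilbert_operator_compact hilbert_operator_self_adjoint)+
    note bH = bounded_operatorD[OF compact_operator_bounded[OF H(1)]]
    define n where "n = eigenvalue_count t0 H"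
    obtain e l where e: "orthonormal {..<n} e" "\<And>i. i < n \<Longrightarrow> H (e i) = l i *\<^sub>R e i \<and> l i > t0"
      "\<And>x. \<forall>i<n. ell2_cinner x (e i) = 0 \<Longrightarrow> Re (ell2_cinner (H x) x) \<le> t0 * (norm x)\<^sup>2"
      unfolding n_def by (rule eigenvalue_countE[OF H t0]) blast
    define J where "J \<theta> = {i\<in>{..<n}. l i > t / cmod (a \<theta>)}" for \<theta>
    have J: "finite (J \<theta>)" "orthonormal (J \<theta>) e" "\<And>i. i \<in> J \<theta> \<Longrightarrow> i < n \<and> l i > t / cmod (a \<theta>)" for \<theta>
      using e(1) by (auto simp: J_def intro: orthonormal_subset)
    define I where "I = Sigma \<Theta> J"
    have finI: "finite I" using fin\<Theta> J by (simp add: I_def)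
    have cardI: "card I = (\<Sum>\<theta>\<in>\<Theta>. eigenvalue_count (t / cmod (a \<theta>)) H)"
    proof -
      have "eigenvalue_count (t / cmod (a \<theta>)) H = card (J \<theta>)" if "\<theta> \<in> \<Theta>" for \<theta>
        unfolding J_def
      proof (rule eigenvalue_count_eq[OF H(2) e])
        show "t0 \<le> t / cmod (a \<theta>)"
          unfolding t0_def using a[of \<theta>] aA[of \<theta>] that \<Theta>(1) t A by (intro divide_left_mono) auto
      qed
      then show ?thesis using fin\<Theta> J by (simp add: I_def card_SigmaI)
    qed
    define FF where "FF p = (SOME F. finite F \<and> card F \<le> (case p of (u, w) \<Rightarrow> mm u w) \<and>
      (\<forall>x. (\<forall>f\<in>F. ell2_cinner x f = 0) \<longrightarrow> norm (H (ell2_rotate (cnj (fst p) * snd p) (H x))) \<le> \<delta> * norm x))" for p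
    have FF: "finite (FF p) \<and> card (FF p) \<le> (case p of (u, w) \<Rightarrow> mm u w) \<and>
      (\<forall>x. (\<forall>f\<in>FF p. ell2_cinner x f = 0) \<longrightarrow> norm (H (ell2_rotate (cnj (fst p) * snd p) (H x))) \<le> \<delta> * norm x)"
      if "p \<in> P" for p
      unfolding FF_def by (rule someI_ex) (use mm that in \<open>auto simp: P_def small_off_def H_def\<close>)
    define F where "F = (\<Union>p\<in>P. FF p)"
    define Q where "Q = \<Theta> \<times> F"
    have finF: "finite F" using P FF by (auto simp: F_def)
    have "card F \<le> (\<Sum>p\<in>P. card (FF p))" unfolding F_def by (rule card_UN_le[OF P])
    also have "\<dots> \<le> (\<Sum>(u, w)\<in>P. mm u w)" using FF by (intro sum_mono) auto
    finally have cardQ: "card Q \<le> C" by (simp add: Q_def C_def card_cartesian_product)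
    \<comment> \<open>H U H is small on vectors orthogonal to the exceptional sets, and it acts on
      the preimage \<open>G\<close>, not on \<open>u\<close>; hence the division by the
      eigenvalue.\<close>
    define b :: "complex \<times> nat \<Rightarrow> complex \<times> ell2 \<Rightarrow> complex"
      where "b i q = (if fst i = fst q then ell2_cinner (e (snd i)) (snd q) / of_real (l (snd i)) else 0)" for i q
    define Z' where "Z' = {z\<in>Z. \<mu> z \<noteq> 0}"
    define v where "v i = (\<Sum>z\<in>{z\<in>Z'. \<pi> z = fst i}. ell2_rotate z (ell2_scale (\<mu> z) (e (snd i))))" for i :: "complex \<times> nat"
    have main: "\<exists>u. lincomb I c v = (\<Sum>z\<in>Z. ell2_rotate z (ell2_scale (\<mu> z) (u (\<pi> z)))) \<and>
        t' * norm (lincomb I c v) * norm (\<Sum>z\<in>Z. ell2_scale (sgn (a z)) (ell2_rotate (cnj z) (ell2_scale (\<mu> z) (u (\<pi> z)))))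
        < Re (ell2_cinner (jump_operator Z a N (lincomb I c v))
            (\<Sum>z\<in>Z. ell2_scale (sgn (a z)) (ell2_rotate (cnj z) (ell2_scale (\<mu> z) (u (\<pi> z))))))"
      if nz: "\<exists>i\<in>I. c i \<noteq> 0" and con: "\<forall>q\<in>Q. (\<Sum>i\<in>I. c i * b i q) = 0" for c
    proof -
      define u where "u \<theta> = lincomb (J \<theta>) (\<lambda>i. c (\<theta>, i)) e" for \<theta>
      define G where "G \<theta> = lincomb (J \<theta>) (\<lambda>i. c (\<theta>, i) / of_real (l i)) e" for \<theta>
      have l0: "l i > 0" if "i < n" for i using e(2)[OF that] t0 by simp
      have HG: "H (G \<theta>) = u \<theta>" for \<theta>
        unfolding G_def u_def bH(8) unfolding lincomb_def
      proof (intro sum.cong refl)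
        fix i assume "i \<in> J \<theta>"
        then have "i < n" by (simp add: J)
        then show "ell2_scale (c (\<theta>, i) / of_real (l i)) (H (e i)) = ell2_scale (c (\<theta>, i)) (e i)"
          using e(2)[of i] l0[of i] by (simp add: ell2_scaleR)
      qed
      have nu: "(norm (u \<theta>))\<^sup>2 = (\<Sum>i\<in>J \<theta>. (cmod (c (\<theta>, i)))\<^sup>2)" for \<theta>
        unfolding u_def by (rule norm_lincomb_orthonormal[OF J(1,2)])
      have nG: "norm (G \<theta>) \<le> \<kappa> * norm (u \<theta>)" for \<theta>
      proof (rule power2_le_imp_le)
        have "(norm (G \<theta>))\<^sup>2 = (\<Sum>i\<in>J \<theta>. (cmod (c (\<theta>, i) / of_real (l i)))\<^sup>2)"
          unfolding G_def by (rule norm_lincomb_orthonormal[OF J(1,2)])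
        also have "\<dots> \<le> (\<Sum>i\<in>J \<theta>. (\<kappa> * cmod (c (\<theta>, i)))\<^sup>2)"
        proof (intro sum_mono power_mono)
          fix i assume "i \<in> J \<theta>"
          then have i: "i < n" by (simp add: J)
          have "cmod (c (\<theta>, i)) / l i \<le> cmod (c (\<theta>, i)) / t0"
            using e(2)[OF i] t0 by (intro divide_left_mono) (auto intro: mult_pos_pos l0[OF i])
          then show "cmod (c (\<theta>, i) / of_real (l i)) \<le> \<kappa> * cmod (c (\<theta>, i))"
            using l0[OF i] by (simp add: norm_divide \<kappa>_def)
        qed simp
        also have "\<dots> = (\<kappa> * norm (u \<theta>))\<^sup>2" by (simp add: power_mult_distrib nu sum_distrib_left)
        finally show "(norm (G \<theta>))\<^sup>2 \<le> (\<kappa> * norm (u \<theta>))\<^sup>2" .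
      qed (use \<kappa> in simp)
      have uform: "t * (norm (u \<theta>))\<^sup>2 \<le> cmod (a \<theta>) * Re (ell2_cinner (H (u \<theta>)) (u \<theta>))" if "\<theta> \<in> \<Theta>" for \<theta>
      proof -
        have "H (u \<theta>) = lincomb (J \<theta>) (\<lambda>i. of_real (l i) * c (\<theta>, i)) e"
          unfolding u_def bH(8) unfolding lincomb_def
          by (intro sum.cong refl) (use e(2) J(3) in \<open>auto simp: ell2_scaleR mult.commute\<close>)
        then have "ell2_cinner (H (u \<theta>)) (u \<theta>) = (\<Sum>i\<in>J \<theta>. of_real (l i) * c (\<theta>, i) * cnj (c (\<theta>, i)))"
          by (simp add: u_def cinner_lincomb_lincomb[OF J(1,2)])
        then have f: "Re (ell2_cinner (H (u \<theta>)) (u \<theta>)) = (\<Sum>i\<in>J \<theta>. l i * (cmod (c (\<theta>, i)))\<^sup>2)"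
          by (simp only: mult.assoc complex_norm_square[symmetric] flip: of_real_mult of_real_sum) simp
        have "t * (norm (u \<theta>))\<^sup>2 = (\<Sum>i\<in>J \<theta>. t * (cmod (c (\<theta>, i)))\<^sup>2)" by (simp add: nu sum_distrib_left)
        also have "\<dots> \<le> (\<Sum>i\<in>J \<theta>. cmod (a \<theta>) * (l i * (cmod (c (\<theta>, i)))\<^sup>2))"
        proof (rule sum_mono)
          fix i assume "i \<in> J \<theta>"
          then have "t / cmod (a \<theta>) < l i" by (simp add: J)
          then have "t \<le> cmod (a \<theta>) * l i" using a[of \<theta>] that \<Theta>(1) by (auto simp: field_simps)
          from mult_right_mono[OF this, of "(cmod (c (\<theta>, i)))\<^sup>2"]
          show "t * (cmod (c (\<theta>, i)))\<^sup>2 \<le> cmod (a \<theta>) * (l i * (cmod (c (\<theta>, i)))\<^sup>2)" by (simp add: mult.assoc)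
        qed
        finally show ?thesis by (simp add: f sum_distrib_left)
      qed
      have GF: "ell2_cinner (G \<theta>) f = 0" if "\<theta> \<in> \<Theta>" "f \<in> F" for \<theta> f
      proof -
        have "0 = (\<Sum>i\<in>I. c i * b i (\<theta>, f))" using con that by (simp add: Q_def)
        also have "\<dots> = (\<Sum>\<theta>'\<in>\<Theta>. \<Sum>i\<in>J \<theta>'. c (\<theta>', i) * b (\<theta>', i) (\<theta>, f))"
          unfolding I_def using fin\<Theta> J by (subst sum.Sigma) (auto simp: case_prod_unfold)
        also have "\<dots> = (\<Sum>\<theta>'\<in>\<Theta>. if \<theta>' = \<theta> then \<Sum>i\<in>J \<theta>. c (\<theta>, i) / of_real (l i) * ell2_cinner (e i) f else 0)"
          by (intro sum.cong refl) (auto simp: b_def)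
        also have "\<dots> = ell2_cinner (G \<theta>) f"
          using that fin\<Theta> by (simp add: G_def cinner_lincomb_left)
        finally show ?thesis by simp
      qed
      define y where "y z = ell2_scale (\<mu> z) (u (\<pi> z))" for z
      define g where "g z = ell2_scale (\<mu> z) (G (\<pi> z))" for z
      define x where "x = (\<Sum>z\<in>Z. ell2_rotate z (y z))"
      define x' where "x' = (\<Sum>z\<in>Z. ell2_scale (sgn (a z)) (ell2_rotate (cnj z) (y z)))"
      define Y where "Y = (\<Sum>z\<in>Z. (norm (y z))\<^sup>2)"
      have hy: "y z = hilbert_operator N (g z)" if "z \<in> Z" for z
        unfolding H_def[symmetric] y_def g_def bH(3) HG ..
      have hg: "norm (g z) \<le> \<kappa> * norm (y z)" if "z \<in> Z" for z
        using mult_left_mono[OF nG[of "\<pi> z"], of "cmod (\<mu> z)"] by (simp add: y_def g_def norm_ell2_scale mult_ac)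
      have hs: "norm (hilbert_operator N (ell2_rotate (cnj p * w) (hilbert_operator N (g z)))) \<le> \<delta> * norm (g z)"
        if pw: "p \<in> Z" "w \<in> Z" "z \<in> Z" "p \<noteq> w" for p w z
      proof -
        have P': "(p, w) \<in> P" using pw by (simp add: P_def)
        have "ell2_cinner (g z) f = 0" if "f \<in> FF (p, w)" for f
        proof (cases "\<mu> z = 0")
          case False
          then have "\<pi> z \<in> \<Theta>" using \<mu>[OF pw(3)] by blast
          moreover have "f \<in> F" using that P' by (auto simp: F_def)
          ultimately show ?thesis by (simp add: g_def cinner_simps GF)
        qed (simp add: g_def)
        then show ?thesis using FF[OF P'] unfolding H_def by auto
      qed
      have hb1: "cmod (sgn (a z)) \<le> 1" for z by (simp add: norm_sgn)
      have hb2: "a z * cnj (sgn (a z)) = complex_of_real (cmod (a z))" if "z \<in> Z" for z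
        using a[OF that] complex_norm_square[of "a z"]
        by (simp add: complex_sgn_def scaleR_conv_of_real divide_simps power2_eq_square)
      have hf: "t * (norm (y z))\<^sup>2 \<le> cmod (a z) * Re (ell2_cinner (hilbert_operator N (y z)) (y z))"
        if z: "z \<in> Z" for z
      proof (cases "\<mu> z = 0")
        case True
        then show ?thesis by (simp add: y_def)
      next
        case False
        note m = \<mu>[OF z False]
        have mm1: "\<mu> z * cnj (\<mu> z) = 1" using m complex_norm_square[of "\<mu> z"] by simp
        have "ell2_cinner (H (y z)) (y z) = \<mu> z * cnj (\<mu> z) * ell2_cinner (H (u (\<pi> z))) (u (\<pi> z))"
          by (simp add: y_def bH(3) cinner_simps)
        then show ?thesis using uform[of "\<pi> z"] m by (simp add: mm1 y_def norm_ell2_scale flip: H_def)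
      qed
      note concl = jump_form_lower[where a = a and \<beta> = "\<lambda>z. sgn (a z)", OF fin Z hy hg hs hb1 hb2 aA less_imp_le[OF A]
          less_imp_le[OF \<delta>] less_imp_le[OF \<kappa>] hf, folded x_def x'_def Y_def, folded \<eta>_def]
      have xl: "lincomb I c v = x"
      proof -
        have "lincomb I c v = (\<Sum>\<theta>\<in>\<Theta>. \<Sum>i\<in>J \<theta>. ell2_scale (c (\<theta>, i)) (v (\<theta>, i)))"
          unfolding lincomb_def I_def using fin\<Theta> J by (subst sum.Sigma) (auto simp: case_prod_unfold)
        also have "\<dots> = (\<Sum>\<theta>\<in>\<Theta>. \<Sum>z\<in>{z\<in>Z'. \<pi> z = \<theta>}. ell2_rotate z (y z))"
        proof (intro sum.cong refl)
          fix \<theta>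
          have "(\<Sum>i\<in>J \<theta>. ell2_scale (c (\<theta>, i)) (v (\<theta>, i)))
              = (\<Sum>z\<in>{z\<in>Z'. \<pi> z = \<theta>}. \<Sum>i\<in>J \<theta>. ell2_scale (c (\<theta>, i)) (ell2_rotate z (ell2_scale (\<mu> z) (e i))))"
            unfolding v_def ell2.scale_sum_right by (subst sum.swap) simp
          also have "\<dots> = (\<Sum>z\<in>{z\<in>Z'. \<pi> z = \<theta>}. ell2_rotate z (y z))"
            by (intro sum.cong refl)
              (auto simp: y_def u_def lincomb_def ell2.scale_sum_right bounded_operatorD[OF bounded_operator_rotate] mult.commute)
          finally show "(\<Sum>i\<in>J \<theta>. ell2_scale (c (\<theta>, i)) (v (\<theta>, i))) = (\<Sum>z\<in>{z\<in>Z'. \<pi> z = \<theta>}. ell2_rotate z (y z))" .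
        qed
        also have "\<dots> = (\<Sum>z\<in>Z'. ell2_rotate z (y z))"
          by (rule sum.group) (use fin fin\<Theta> \<mu> in \<open>auto simp: Z'_def\<close>)
        also have "\<dots> = x"
          unfolding x_def Z'_def using fin
          by (intro sum.mono_neutral_left) (auto simp: y_def bounded_operatorD[OF bounded_operator_rotate])
        finally show ?thesis .
      qed
      have "Y > 0"
      proof -
        obtain \<theta> i where i: "\<theta> \<in> \<Theta>" "i \<in> J \<theta>" "c (\<theta>, i) \<noteq> 0" using nz by (auto simp: I_def)
        have "(norm (u \<theta>))\<^sup>2 > 0" unfolding nu by (rule sum_pos2[OF J(1) i(2)]) (use i in auto)
        moreover have "y \<theta> = ell2_scale (\<mu> \<theta>) (u \<theta>)" using \<Theta>(2)[OF i(1)] by (simp add: y_def)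
        ultimately have "(norm (y \<theta>))\<^sup>2 > 0" using \<Theta>(2)[OF i(1)] by (simp add: norm_ell2_scale)
        moreover have "(norm (y \<theta>))\<^sup>2 \<le> Y" unfolding Y_def using i(1) \<Theta>(1) fin by (intro member_le_sum) auto
        ultimately show ?thesis by linarith
      qed
      then have "t' * (1 + \<eta>) * Y < (t - \<eta>) * Y" using \<eta>(2) by (intro mult_strict_right_mono)
      moreover have "t' * (norm x * norm x') \<le> t' * ((1 + \<eta>) * Y)"
        using sum_squares_bound[of "norm x" "norm x'"] concl(2,3) t by (intro mult_left_mono) auto
      ultimately have "t' * norm x * norm x' < Re (ell2_cinner (jump_operator Z a N x) x')"
        using concl(1) by (simp add: mult.assoc)
      then show ?thesis
        by (intro exI[of _ u]) (simp add: xl x_def[symmetric] x'_def y_def[symmetric])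
    qed
    have tf: "test_family Z a \<mu> \<pi> t' N I v Q b"
      unfolding test_family_def using main by (intro allI impI)
    show "\<exists>(I :: (complex \<times> nat) set) v (Q :: (complex \<times> ell2) set) b.
    finite I \<and> finite Q \<and> card Q \<le> C \<and>
    card I = (\<Sum>\<theta>\<in>\<Theta>. eigenvalue_count (t / cmod (a \<theta>)) (hilbert_operator N)) \<and>
    test_family Z a \<mu> \<pi> t' N I v Q b"
      by (rule exI[of _ I], rule exI[of _ v], rule exI[of _ Q], rule exI[of _ b])
        (use tf finI cardI cardQ finF fin\<Theta> in \<open>simp add: Q_def H_def\<close>)
  qed
qed

text \<open>Only \<open>x\<close> has to avoid the exceptional set; the partner \<open>y\<close> is
  arbitrary, so constraints are imposed on one side of the form.\<close>

lemma jump_test_space_perturbed: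
  fixes K :: "nat \<Rightarrow> ell2 \<Rightarrow> ell2"
  assumes K: "\<And>N. N \<ge> 1 \<Longrightarrow> bounded_operator (K N)"
    and R: "\<And>N. N \<ge> 1 \<Longrightarrow> small_off (\<lambda>x. K N x - jump_operator Z a N x) \<rho> m" and N: "N \<ge> 1"
  shows "\<exists>F. finite F \<and> card F \<le> m \<and> (\<forall>x y. (\<forall>f\<in>F. ell2_cinner x f = 0) \<longrightarrow>
    Re (ell2_cinner (jump_operator Z a N x) y) - \<rho> * norm x * norm y \<le> Re (ell2_cinner (K N x) y))"
proof -
  obtain F where F: "finite F" "card F \<le> m"
    "\<And>x. \<forall>f\<in>F. ell2_cinner x f = 0 \<Longrightarrow> norm (K N x - jump_operator Z a N x) \<le> \<rho> * norm x"
    using R[OF N] unfolding small_off_def by blast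
  have "Re (ell2_cinner (jump_operator Z a N x) y) - \<rho> * norm x * norm y \<le> Re (ell2_cinner (K N x) y)"
    if "\<forall>f\<in>F. ell2_cinner x f = 0" for x y
  proof -
    have "- Re (ell2_cinner (K N x - jump_operator Z a N x) y) \<le> cmod (ell2_cinner (K N x - jump_operator Z a N x) y)"
      using abs_Re_le_cmod[of "ell2_cinner (K N x - jump_operator Z a N x) y"] by linarith
    also have "\<dots> \<le> norm (K N x - jump_operator Z a N x) * norm y" by (rule cinner_cauchy_schwarz)
    also have "\<dots> \<le> \<rho> * norm x * norm y" by (intro mult_right_mono F(3) that) simp
    finally show ?thesis by (simp add: cinner_simps)
  qed
  with F show ?thesis by blast
qed

text \<open>Cauchy--Schwarz removes the partner vector and leaves a lower bound for |K x|. The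
  exceptional set of the perturbation is adjoined to the constraints.\<close>

lemma jump_singular_lower:
  fixes K :: "nat \<Rightarrow> ell2 \<Rightarrow> ell2"
  assumes fin: "finite Z" and Z: "\<And>z. z \<in> Z \<Longrightarrow> cmod z = 1" and a: "\<And>z. z \<in> Z \<Longrightarrow> a z \<noteq> 0"
    and t: "0 < \<rho>" "\<rho> < t'" "t' < t"
    and K: "\<And>N. N \<ge> 1 \<Longrightarrow> compact_operator (K N)"
    and R: "\<And>N. N \<ge> 1 \<Longrightarrow> small_off (\<lambda>x. K N x - jump_operator Z a N x) \<rho> m"
  shows "\<exists>C. \<forall>N\<ge>1. (\<Sum>z\<in>Z. eigenvalue_count (t / cmod (a z)) (hilbert_operator N)) \<le> singular_count (t' - \<rho>) (K N) + C"
proof -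
  have "0 < t'" using t by simp
  have h1: "z = z \<and> (1::complex) \<noteq> 0" for z :: complex by simp
  have h2: "cmod 1 = 1 \<and> z \<in> Z \<and> cmod (a z) = cmod (a z)" if "z \<in> Z" for z using that by simp
  obtain C where C: "\<And>N. \<exists>(I :: (complex \<times> nat) set) v (Q :: (complex \<times> ell2) set) b.
    finite I \<and> finite Q \<and> card Q \<le> C \<and>
    card I = (\<Sum>\<theta>\<in>Z. eigenvalue_count (t / cmod (a \<theta>)) (hilbert_operator N)) \<and>
    test_family Z a (\<lambda>_. 1) (\<lambda>z. z) t' N I v Q b"
    using jump_test_space[of Z a Z "\<lambda>z. z" "\<lambda>_. 1", OF fin Z a order_refl h1 h2 \<open>0 < t'\<close> t(3)] by blast
  have "(\<Sum>z\<in>Z. eigenvalue_count (t / cmod (a z)) (hilbert_operator N)) \<le> singular_count (t' - \<rho>) (K N) + (C + m)" if N: "N \<ge> 1" for N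
  proof -
    obtain I :: "(complex \<times> nat) set" and v and Q :: "(complex \<times> ell2) set" and b where I: "finite I" "finite Q" "card Q \<le> C"
      "card I = (\<Sum>z\<in>Z. eigenvalue_count (t / cmod (a z)) (hilbert_operator N))"
      "test_family Z a (\<lambda>_. 1) (\<lambda>z. z) t' N I v Q b"
      using C[of N] by blast
    obtain F where F: "finite F" "card F \<le> m" "\<And>x y. \<forall>f\<in>F. ell2_cinner x f = 0 \<Longrightarrow>
      Re (ell2_cinner (jump_operator Z a N x) y) - \<rho> * norm x * norm y \<le> Re (ell2_cinner (K N x) y)"
      using jump_test_space_perturbed[where K = K, OF compact_operator_bounded[OF K] R N] by blast
    have "card I \<le> singular_count (t' - \<rho>) (K N) + card (Q <+> F)"
    proof (rule singular_count_ge[OF K[OF N], where b = "\<lambda>i. case_sum (b i) (\<lambda>f. ell2_cinner (v i) f)" and v = v])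
      fix c assume nz: "\<exists>i\<in>I. c i \<noteq> 0"
        and con: "\<forall>q\<in>Q <+> F. (\<Sum>i\<in>I. c i * case_sum (b i) (\<lambda>f. ell2_cinner (v i) f) q) = 0"
      define x where "x = lincomb I c v"
      have "\<forall>q\<in>Q. (\<Sum>i\<in>I. c i * b i q) = 0" using con by force
      then obtain x' where x': "t' * norm x * norm x' < Re (ell2_cinner (jump_operator Z a N x) x')"
        using I(5) nz unfolding x_def test_family_def by blast
      have "\<forall>f\<in>F. ell2_cinner x f = 0" using con by (force simp: x_def cinner_lincomb_left)
      from F(3)[OF this, of x'] x' have "(t' - \<rho>) * norm x * norm x' < Re (ell2_cinner (K N x) x')"
        by (simp add: left_diff_distrib)
      also have "\<dots> \<le> norm (K N x) * norm x'" by (rule Re_cinner_le)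
      finally show "(t' - \<rho>) * norm (lincomb I c v) < norm (K N (lincomb I c v))"
        unfolding x_def[symmetric] by (metis mult_less_cancel_right_disj norm_ge_zero not_le)
    qed (use I F t in auto)
    moreover have "card (Q <+> F) \<le> C + m" using I F by (simp add: card_Plus)
    ultimately show ?thesis using I(4) by linarith
  qed
  then show ?thesis by blast
qed

text \<open>The form must now be tested on x itself, so the partner has to coincide with x. This
  requires y (cnj z) = sgn (a z) y z: a conjugate pair shares one vector, and a real jump can take
  part only if a z > 0.\<close>

lemma jump_eigenvalue_lower:
  fixes K :: "nat \<Rightarrow> ell2 \<Rightarrow> ell2"
  assumes fin: "finite Z" and Z: "\<And>z. z \<in> Z \<Longrightarrow> cmod z = 1" and a: "\<And>z. z \<in> Z \<Longrightarrow> a z \<noteq> 0"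
    and sym: "\<And>z. z \<in> Z \<Longrightarrow> cnj z \<in> Z \<and> a (cnj z) = cnj (a z)"
    and t: "0 < \<rho>" "\<rho> < t'" "t' < t"
    and K: "\<And>N. N \<ge> 1 \<Longrightarrow> compact_operator (K N)" "\<And>N. N \<ge> 1 \<Longrightarrow> self_adjoint (K N)"
    and R: "\<And>N. N \<ge> 1 \<Longrightarrow> small_off (\<lambda>x. K N x - jump_operator Z a N x) \<rho> m"
  shows "\<exists>C. \<forall>N\<ge>1. (\<Sum>z\<in>{z\<in>Z. Im z > 0 \<or> Im z = 0 \<and> Re (a z) > 0}. eigenvalue_count (t / cmod (a z)) (hilbert_operator N))
    \<le> eigenvalue_count (t' - \<rho>) (K N) + C"
proof -
  define \<Theta> where "\<Theta> = {z\<in>Z. Im z > 0 \<or> Im z = 0 \<and> Re (a z) > 0}"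
  define \<pi> where "\<pi> z = (if Im z < 0 then cnj z else z)" for z
  \<comment> \<open>In the lower half plane the phase realizes y z = sgn (a (cnj z)) y (cnj z). Real
    points with negative coefficient are left out.\<close>
  define \<mu> where "\<mu> z = (if z \<in> \<Theta> then 1 else if Im z < 0 then sgn (a (cnj z)) else 0)" for z
  have "0 < t'" using t by simp
  have h1: "\<pi> \<theta> = \<theta> \<and> \<mu> \<theta> \<noteq> 0" if "\<theta> \<in> \<Theta>" for \<theta> using that by (auto simp: \<pi>_def \<mu>_def \<Theta>_def)
  have h2: "cmod (\<mu> z) = 1 \<and> \<pi> z \<in> \<Theta> \<and> cmod (a (\<pi> z)) = cmod (a z)" if "z \<in> Z" "\<mu> z \<noteq> 0" for z
    using that sym[of z] a[of z] by (auto simp: \<pi>_def \<mu>_def \<Theta>_def norm_sgn split: if_splits)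
  have real: "sgn (a z) = 1" if "z \<in> Z" "Im z = 0" "Re (a z) > 0" for z
  proof -
    have "cnj z = z" using that by (simp add: complex_eq_iff)
    then have "Im (a z) = 0" using sym[OF that(1)] by (metis complex_cnj_cancel_iff cnj.simps(2) neg_equal_zero)
    then have "a z = of_real (Re (a z))" by (simp add: complex_eq_iff)
    with that(3) show ?thesis by (metis of_real_1 sgn_of_real sgn_pos)
  qed
  have "\<Theta> \<subseteq> Z" by (auto simp: \<Theta>_def)
  from jump_test_space[of Z a \<Theta> \<pi> \<mu>, OF fin Z a this h1 h2 \<open>0 < t'\<close> t(3)]
  obtain C where C: "\<And>N. \<exists>(I :: (complex \<times> nat) set) v (Q :: (complex \<times> ell2) set) b.
    finite I \<and> finite Q \<and> card Q \<le> C \<and>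
    card I = (\<Sum>\<theta>\<in>\<Theta>. eigenvalue_count (t / cmod (a \<theta>)) (hilbert_operator N)) \<and>
    test_family Z a \<mu> \<pi> t' N I v Q b" by blast
  have fold: "(\<Sum>z\<in>Z. ell2_scale (sgn (a z)) (ell2_rotate (cnj z) (ell2_scale (\<mu> z) (u (\<pi> z)))))
      = (\<Sum>z\<in>Z. ell2_rotate z (ell2_scale (\<mu> z) (u (\<pi> z))))" for u
  proof (rule sum.reindex_bij_witness[of _ cnj cnj])
    fix z assume z: "z \<in> Z"
    show "cnj z \<in> Z" using sym z by blast
    have sg: "sgn (a z) * cnj (sgn (a z)) = 1"
      using complex_norm_square[of "sgn (a z)"] a[OF z] by (simp add: norm_sgn)
    have sc: "sgn (cnj (a z)) = cnj (sgn (a z))" by (simp add: complex_sgn_def)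
    have "sgn (a z) * \<mu> z = \<mu> (cnj z) \<and> (\<pi> (cnj z) = \<pi> z \<or> \<mu> (cnj z) = 0)"
    proof -
      consider "Im z > 0" | "Im z < 0" | "Im z = 0" by linarith
      then show ?thesis
      proof cases
        case 1
        then show ?thesis using z sym[OF z] by (auto simp: \<mu>_def \<Theta>_def \<pi>_def)
      next
        case 2
        then show ?thesis using z sym[OF z] sg sc by (auto simp: \<mu>_def \<Theta>_def \<pi>_def)
      next
        case 3
        then have e: "cnj z = z" by (simp add: complex_eq_iff)
        show ?thesis
        proof (cases "z \<in> \<Theta>")
          case True
          then have "Re (a z) > 0" using 3 by (simp add: \<Theta>_def)
          from real[OF z 3 this] show ?thesis by (simp only: e) simp
        next
          case False
          then have "\<mu> z = 0" using 3 by (simp add: \<mu>_def)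
          then show ?thesis by (simp only: e) simp
        qed
      qed
    qed
    then show "ell2_rotate (cnj z) (ell2_scale (\<mu> (cnj z)) (u (\<pi> (cnj z))))
      = ell2_scale (sgn (a z)) (ell2_rotate (cnj z) (ell2_scale (\<mu> z) (u (\<pi> z))))"
      by (auto simp: bounded_operatorD[OF bounded_operator_rotate])
  next
    fix z assume "z \<in> Z"
    then show "cnj z \<in> Z" using sym by blast
  qed auto
  have "(\<Sum>z\<in>\<Theta>. eigenvalue_count (t / cmod (a z)) (hilbert_operator N)) \<le> eigenvalue_count (t' - \<rho>) (K N) + (C + m)" if N: "N \<ge> 1" for N
  proof -
    obtain I :: "(complex \<times> nat) set" and v and Q :: "(complex \<times> ell2) set" and b where I: "finite I" "finite Q" "card Q \<le> C"
      "card I = (\<Sum>z\<in>\<Theta>. eigenvalue_count (t / cmod (a z)) (hilbert_operator N))"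
      "test_family Z a \<mu> \<pi> t' N I v Q b"
      using C[of N] by blast
    obtain F where F: "finite F" "card F \<le> m" "\<And>x y. \<forall>f\<in>F. ell2_cinner x f = 0 \<Longrightarrow>
      Re (ell2_cinner (jump_operator Z a N x) y) - \<rho> * norm x * norm y \<le> Re (ell2_cinner (K N x) y)"
      using jump_test_space_perturbed[where K = K, OF compact_operator_bounded[OF K(1)] R N] by blast
    have "card I \<le> eigenvalue_count (t' - \<rho>) (K N) + card (Q <+> F)"
    proof (rule eigenvalue_count_ge[OF K(1)[OF N] K(2)[OF N], where b = "\<lambda>i. case_sum (b i) (\<lambda>f. ell2_cinner (v i) f)" and v = v])
      fix c assume nz: "\<exists>i\<in>I. c i \<noteq> 0"
        and con: "\<forall>q\<in>Q <+> F. (\<Sum>i\<in>I. c i * case_sum (b i) (\<lambda>f. ell2_cinner (v i) f) q) = 0"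
      define x where "x = lincomb I c v"
      have "\<forall>q\<in>Q. (\<Sum>i\<in>I. c i * b i q) = 0" using con by force
      then obtain u where u: "x = (\<Sum>z\<in>Z. ell2_rotate z (ell2_scale (\<mu> z) (u (\<pi> z))))"
        "t' * norm x * norm (\<Sum>z\<in>Z. ell2_rotate z (ell2_scale (\<mu> z) (u (\<pi> z))))
          < Re (ell2_cinner (jump_operator Z a N x) (\<Sum>z\<in>Z. ell2_rotate z (ell2_scale (\<mu> z) (u (\<pi> z)))))"
        using I(5) nz unfolding x_def test_family_def fold by blast
      have x': "t' * norm x * norm x < Re (ell2_cinner (jump_operator Z a N x) x)"
        using u(2) unfolding u(1)[symmetric] .
      have "\<forall>f\<in>F. ell2_cinner x f = 0" using con by (force simp: x_def cinner_lincomb_left)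
      from F(3)[OF this, of x] x' have "(t' - \<rho>) * norm x * norm x < Re (ell2_cinner (K N x) x)"
        by (simp add: left_diff_distrib)
      then show "(t' - \<rho>) * (norm (lincomb I c v))\<^sup>2 < Re (ell2_cinner (K N (lincomb I c v)) (lincomb I c v))"
        unfolding x_def[symmetric] by (simp add: power2_eq_square mult.assoc)
    qed (use I F t in auto)
    moreover have "card (Q <+> F) \<le> C + m" using I F by (simp add: card_Plus)
    ultimately show ?thesis using I(4) by linarith
  qed
  then show ?thesis unfolding \<Theta>_def by blast
qed

section \<open>The logarithmic density\<close>

text \<open>With \<open>min t 1\<close> a single formula covers both sides of t = 1, from which
  continuity and monotonicity can be read off.\<close>

lemma log_density_min:
  assumes "t > 0"
  shows "log_density t = 1 / pi\<^sup>2 * (ln (1 + sqrt (1 - (min t 1)\<^sup>2)) - ln (min t 1))"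
proof -
  have "1 + sqrt (1 - (min t 1)\<^sup>2) > 0"
    using assms by (intro add_pos_nonneg) (auto simp: power_le_one min_def)
  then show ?thesis using assms by (auto simp: log_density_def min_def ln_div)
qed

lemma log_density_continuous: "continuous_on {0<..} log_density"
proof -
  have "continuous_on {0<..} (\<lambda>t. 1 / pi\<^sup>2 * (ln (1 + sqrt (1 - (min t 1)\<^sup>2)) - ln (min t (1::real))))"
  proof (intro continuous_intros ballI)
    fix t :: real assume "t \<in> {0<..}"
    then have "0 \<le> sqrt (1 - (min t 1)\<^sup>2)" by (auto simp: power_le_one min_def)
    then show "1 + sqrt (1 - (min t 1)\<^sup>2) \<noteq> 0" by linarith
  qed (auto simp: min_def)
  then show ?thesis by (rule continuous_on_eq) (simp add: log_density_min)
qed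

lemma log_density_ge_1: "t \<ge> 1 \<Longrightarrow> log_density t = 0"
  by (cases "t = 1") (auto simp: log_density_def)

lemma log_density_antimono:
  assumes "0 < s" "s \<le> t"
  shows "log_density t \<le> log_density s"
proof -
  let ?s = "min s 1" and ?t = "min t (1::real)"
  have m: "0 < ?s" "?s \<le> ?t" "?t \<le> 1" using assms by auto
  then have "?s\<^sup>2 \<le> ?t\<^sup>2" "?t\<^sup>2 \<le> 1" by (auto intro!: power_mono power_le_one)
  then have "ln (1 + sqrt (1 - ?t\<^sup>2)) \<le> ln (1 + sqrt (1 - ?s\<^sup>2))"
    by (intro ln_mono add_pos_nonneg add_left_mono real_sqrt_le_mono diff_left_mono) auto
  moreover have "ln ?s \<le> ln ?t" by (rule ln_mono[OF m(2,1)])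
  moreover have "0 < t" using assms by simp
  ultimately show ?thesis
    unfolding log_density_min[OF assms(1)] log_density_min[OF \<open>0 < t\<close>]
    by (intro mult_left_mono diff_mono) auto
qed

lemma log_density_nonneg: "0 \<le> log_density t"
proof (cases "0 < t \<and> t \<le> 1")
  case True
  then show ?thesis using log_density_antimono[of t 1] log_density_ge_1[of 1] by simp
next
  case False
  then have "log_density t = 0" unfolding log_density_def by (rule if_not_P)
  then show ?thesis by simp
qed

text \<open>Names the frequency at which the symbol sech (pi \<xi>) crosses the level
  \<open>t\<close>; the logarithm in \<open>log_density\<close> is arcosh (1 / t).\<close>

lemma log_density_arcosh:
  assumes "0 < t" "t < 1"
  obtains \<xi> where "\<xi> > 0" "cosh (pi * \<xi>) = 1 / t" "log_density t = \<xi> / pi"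
proof -
  define \<xi> where "\<xi> = arcosh (1 / t) / pi"
  have t1: "1 / t > 1" using assms by simp
  have c: "cosh (pi * \<xi>) = 1 / t" using t1 by (simp add: \<xi>_def cosh_arcosh_real)
  moreover have "arcosh (1 / t) > 0" using t1 by (subst arcosh_real_gt_1_iff) auto
  then have "\<xi> > 0" by (simp add: \<xi>_def)
  moreover have "log_density t = \<xi> / pi"
  proof -
    have "sqrt ((1 / t)\<^sup>2 - 1) = sqrt ((1 - t\<^sup>2) / t\<^sup>2)" using assms by (simp add: field_simps)
    also have "\<dots> = sqrt (1 - t\<^sup>2) / t" using assms by (simp add: real_sqrt_divide)
    finally have "arcosh (1 / t) = ln ((1 + sqrt (1 - t\<^sup>2)) / t)"
      using t1 by (simp add: arcosh_real_def add_divide_distrib)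
    then show ?thesis using assms by (simp add: log_density_def \<xi>_def power2_eq_square)
  qed
  ultimately show thesis using that by blast
qed

lemma hilbert_density_lower:
  assumes s: "s > 0" and \<epsilon>: "\<epsilon> > 0"
  shows "\<exists>C. \<forall>N\<ge>1. (log_density s - \<epsilon>) * ln (real N) - C \<le> real (eigenvalue_count s (hilbert_operator N))"
proof (cases "s < 1")
  case False
  have "(log_density s - \<epsilon>) * ln (real N) - 0 \<le> real (eigenvalue_count s (hilbert_operator N))" if "N \<ge> 1" for N
  proof -
    have "(log_density s - \<epsilon>) * ln (real N) \<le> 0"
      using False \<epsilon> that by (simp add: log_density_ge_1)
    then show ?thesis by simp
  qed
  then show ?thesis by blast
next
  case True
  obtain \<xi> where \<xi>: "\<xi> > 0" "cosh (pi * \<xi>) = 1 / s" "log_density s = \<xi> / pi"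
    using log_density_arcosh[OF s True] by metis
  \<comment> \<open>\<open>hilbert_count_lower\<close> needs the symbol strictly above the level, so
    the frequency is lowered a little; the loss in density is at most \<epsilon>.\<close>
  define \<xi>0 where "\<xi>0 = max 0 (\<xi> - pi * \<epsilon>)"
  have \<xi>0: "\<xi>0 \<ge> 0" "\<xi>0 < \<xi>" "\<xi> - pi * \<epsilon> \<le> \<xi>0" using \<xi> \<epsilon> by (auto simp: \<xi>0_def)
  have "cosh (pi * \<xi>0) < 1 / s" unfolding \<xi>(2)[symmetric] using \<xi>0 by (subst cosh_real_nonneg_less_iff) auto
  then have "s < 1 / cosh (pi * \<xi>0)" using s by (simp add: field_simps)
  then obtain C where C: "\<And>N. N \<ge> 1 \<Longrightarrow> \<xi>0 / pi * ln (real N) - C \<le> real (eigenvalue_count s (hilbert_operator N))"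
    using hilbert_count_lower[OF \<xi>0(1) s] by blast
  have "(log_density s - \<epsilon>) * ln (real N) - C \<le> real (eigenvalue_count s (hilbert_operator N))" if N: "N \<ge> 1" for N
  proof -
    have "(\<xi> - pi * \<epsilon>) / pi \<le> \<xi>0 / pi" using \<xi>0(3) by (intro divide_right_mono) auto
    then have "log_density s - \<epsilon> \<le> \<xi>0 / pi" by (simp add: \<xi>(3) diff_divide_distrib)
    then have "(log_density s - \<epsilon>) * ln (real N) \<le> \<xi>0 / pi * ln (real N)" using N by (intro mult_right_mono) auto
    with C[OF N] show ?thesis by linarith
  qed
  then show ?thesis by blast
qed

lemma log_density_sum_continuous:
  assumes "\<And>z. z \<in> Z \<Longrightarrow> \<alpha> z > 0"
  shows "continuous_on {0<..} (\<lambda>t. \<Sum>z\<in>Z. log_density (t / \<alpha> z))"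
proof -
  have nz: "\<alpha> z \<noteq> 0" if "z \<in> Z" for z using assms[OF that] by simp
  show ?thesis
    by (intro continuous_on_sum continuous_on_compose2[OF log_density_continuous] continuous_intros)
      (auto simp: nz assms)
qed

lemma log_density_sum_nearby:
  assumes \<alpha>: "\<And>z. z \<in> Z \<Longrightarrow> \<alpha> z > 0" and t: "t > 0" and \<epsilon>: "\<epsilon> > 0"
  shows "\<exists>\<delta>>0. \<forall>s>0. \<bar>s - t\<bar> < \<delta> \<longrightarrow>
    \<bar>(\<Sum>z\<in>Z. log_density (s / \<alpha> z)) - (\<Sum>z\<in>Z. log_density (t / \<alpha> z))\<bar> < \<epsilon>"
proof -
  let ?h = "\<lambda>t. \<Sum>z\<in>Z. log_density (t / \<alpha> z)"
  have c: "continuous_on {0<..} ?h" by (rule log_density_sum_continuous[OF \<alpha>])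
  have "t \<in> {0<..}" using t by simp
  with c \<epsilon> have "\<exists>\<delta>>0. \<forall>s\<in>{0<..}. dist s t < \<delta> \<longrightarrow> dist (?h s) (?h t) < \<epsilon>"
    unfolding continuous_on_iff by blast
  then show ?thesis by (simp add: dist_real_def Ball_def)
qed

text \<open>By continuity the level can be raised from t to some s > t at small cost in density; the
  gap s - t later pays for decoupling and perturbation.\<close>

lemma hilbert_density_sum_lower:
  assumes fin: "finite Z" and \<alpha>: "\<And>z. z \<in> Z \<Longrightarrow> \<alpha> z > 0" and t: "t > 0" and \<epsilon>: "\<epsilon> > 0"
  shows "\<exists>s>t. \<exists>C. \<forall>N\<ge>1. ((\<Sum>z\<in>Z. log_density (t / \<alpha> z)) - \<epsilon>) * ln (real N) - C
    \<le> real (\<Sum>z\<in>Z. eigenvalue_count (s / \<alpha> z) (hilbert_operator N))"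
proof -
  have e2: "\<epsilon> / 2 > 0" using \<epsilon> by simp
  obtain \<delta> where \<delta>: "\<delta> > 0" "\<And>s. s > 0 \<Longrightarrow> \<bar>s - t\<bar> < \<delta> \<Longrightarrow>
    \<bar>(\<Sum>z\<in>Z. log_density (s / \<alpha> z)) - (\<Sum>z\<in>Z. log_density (t / \<alpha> z))\<bar> < \<epsilon> / 2"
    using log_density_sum_nearby[where Z = Z and \<alpha> = \<alpha>, OF \<alpha> t e2] by blast
  define s where "s = t + \<delta> / 2"
  have s: "s > t" "s > 0" using t \<delta> by (auto simp: s_def)
  have h: "(\<Sum>z\<in>Z. log_density (t / \<alpha> z)) - \<epsilon> / 2 \<le> (\<Sum>z\<in>Z. log_density (s / \<alpha> z))"
  proof -
    have "\<bar>s - t\<bar> < \<delta>" using \<delta>(1) by (simp add: s_def)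
    from \<delta>(2)[OF s(2) this] show ?thesis by linarith
  qed
  define \<epsilon>' where "\<epsilon>' = \<epsilon> / (2 * (real (card Z) + 1))"
  have \<epsilon>': "\<epsilon>' > 0" using \<epsilon> by (simp add: \<epsilon>'_def)
  have "\<exists>C. \<forall>N\<ge>1. (log_density (s / \<alpha> z) - \<epsilon>') * ln (real N) - C \<le> real (eigenvalue_count (s / \<alpha> z) (hilbert_operator N))"
    if "z \<in> Z" for z
    using hilbert_density_lower[OF _ \<epsilon>', of "s / \<alpha> z"] \<alpha>[OF that] s by simp
  then obtain C where C: "\<And>z N. z \<in> Z \<Longrightarrow> N \<ge> 1 \<Longrightarrow> (log_density (s / \<alpha> z) - \<epsilon>') * ln (real N) - C z
      \<le> real (eigenvalue_count (s / \<alpha> z) (hilbert_operator N))" by metis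
  have "((\<Sum>z\<in>Z. log_density (t / \<alpha> z)) - \<epsilon>) * ln (real N) - (\<Sum>z\<in>Z. C z)
    \<le> real (\<Sum>z\<in>Z. eigenvalue_count (s / \<alpha> z) (hilbert_operator N))" if N: "N \<ge> 1" for N
  proof -
    have "real (card Z) * \<epsilon>' \<le> \<epsilon> / 2"
      using \<epsilon> by (simp add: \<epsilon>'_def divide_le_eq)
    then have "(\<Sum>z\<in>Z. log_density (t / \<alpha> z)) - \<epsilon> \<le> (\<Sum>z\<in>Z. log_density (s / \<alpha> z) - \<epsilon>')"
      using h by (simp add: sum_subtractf)
    then have "((\<Sum>z\<in>Z. log_density (t / \<alpha> z)) - \<epsilon>) * ln (real N) \<le> (\<Sum>z\<in>Z. log_density (s / \<alpha> z) - \<epsilon>') * ln (real N)"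
      using N by (intro mult_right_mono) auto
    also have "\<dots> - (\<Sum>z\<in>Z. C z) = (\<Sum>z\<in>Z. (log_density (s / \<alpha> z) - \<epsilon>') * ln (real N) - C z)"
      by (simp only: sum_distrib_right sum_subtractf[symmetric])
    finally have "((\<Sum>z\<in>Z. log_density (t / \<alpha> z)) - \<epsilon>) * ln (real N) - (\<Sum>z\<in>Z. C z)
        \<le> (\<Sum>z\<in>Z. (log_density (s / \<alpha> z) - \<epsilon>') * ln (real N) - C z)" by simp
    also have "\<dots> \<le> (\<Sum>z\<in>Z. real (eigenvalue_count (s / \<alpha> z) (hilbert_operator N)))"
      by (intro sum_mono C N)
    finally show ?thesis by simp
  qed
  with s show ?thesis by blast
qed

text \<open>On the positive axis, a primitive of 2 t \<open>log_density t\<close> that vanishes from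
  1 on. Its limit at 0 is -1 / pi^2, so 1 / pi^2 is the total mass of that density.\<close>

definition log_primitive :: "real \<Rightarrow> real" where
  "log_primitive t = t\<^sup>2 * log_density t - sqrt (1 - (min t 1)\<^sup>2) / pi\<^sup>2"

lemma log_primitive_ge_1: "t \<ge> 1 \<Longrightarrow> log_primitive t = 0"
  by (simp add: log_primitive_def log_density_ge_1)

lemma log_primitive_deriv:
  assumes "0 < u" "u < 1"
  shows "(log_primitive has_real_derivative 2 * u * log_density u) (at u)"
proof -
  define w where "w = sqrt (1 - u\<^sup>2)"
  have u2: "u\<^sup>2 < 1" using assms by (simp add: power_less_one_iff)
  then have w: "w > 0" "w * w = 1 - u * u" by (auto simp: w_def power2_eq_square)
  define f where "f u = u\<^sup>2 * (1 / pi\<^sup>2 * (ln (1 + sqrt (1 - u\<^sup>2)) - ln u)) - sqrt (1 - u\<^sup>2) / pi\<^sup>2" for u :: real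
  have ld: "log_density u = 1 / pi\<^sup>2 * (ln (1 + w) - ln u)" using assms by (simp add: log_density_min w_def)
  have dw: "((\<lambda>u. sqrt (1 - u\<^sup>2)) has_real_derivative - u / w) (at u)"
    using u2 by (auto intro!: derivative_eq_intros simp: w_def field_simps)
  have pos: "1 + sqrt (1 - u\<^sup>2) > 0" using w(1) unfolding w_def by linarith
  have d0: "((\<lambda>u. 1 + sqrt (1 - u\<^sup>2)) has_real_derivative - u / w) (at u)"
    using DERIV_add[OF DERIV_const dw] by simp
  have d3: "((\<lambda>u. u\<^sup>2) has_real_derivative 2 * u) (at u)" by (auto intro!: derivative_eq_intros)
  note D = DERIV_diff[OF DERIV_mult[OF d3 DERIV_cmult[OF DERIV_diff[OF DERIV_chain2[OF DERIV_ln[OF pos] d0] DERIV_ln[OF assms(1)]],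
    of "1 / pi\<^sup>2"]] DERIV_cdivide[OF dw, of "pi\<^sup>2"]]
  have e: "inverse (1 + w) * (- u / w) - inverse u = - 1 / (u * w)"
  proof -
    have *: "inverse v * (- u / w) - inverse u = - (u * u + w * v) / (u * w * v)" if "v \<noteq> 0" for v
      using that w(1) assms(1) by (simp add: field_simps)
    have w1: "1 + w \<noteq> 0" using w by simp
    have uw: "u * u + w * (1 + w) = 1 + w" using w(2) by (simp add: algebra_simps)
    have "- v / (u * w * v) = - 1 / (u * w)" if "v \<noteq> 0" for v using that by simp
    then show ?thesis unfolding *[OF w1] uw using w1 by blast
  qed
  have d: "(f has_real_derivative 2 * u * log_density u) (at u)"
    unfolding f_def[abs_def]
    by (rule DERIV_cong[OF D])
      (use w(1) assms(1) in \<open>simp only: w_def[symmetric] e ld, simp add: power2_eq_square\<close>)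
  show ?thesis
  proof (rule has_field_derivative_transform_within_open[OF d, of "{0<..<1}"])
    fix x :: real assume "x \<in> {0<..<1}"
    then show "f x = log_primitive x" by (simp add: f_def log_primitive_def log_density_min)
  qed (use assms in auto)
qed

text \<open>The derivative is 2 u times a decreasing density, so the density at the left end bounds
  the increment.\<close>

lemma log_primitive_diff_le:
  assumes "0 < x" "x \<le> y"
  shows "log_primitive y - log_primitive x \<le> (y\<^sup>2 - x\<^sup>2) * log_density x"
proof -
  have cont: "continuous_on {0<..} log_primitive"
    unfolding log_primitive_def[abs_def]
    by (intro continuous_intros log_density_continuous) auto
  have main: "log_primitive y - log_primitive x \<le> (y\<^sup>2 - x\<^sup>2) * log_density x" if "x \<le> y" "y \<le> 1" for y
  proof -
    have "x\<^sup>2 * log_density x - log_primitive x \<le> y\<^sup>2 * log_density x - log_primitive y"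
    proof (rule DERIV_nonneg_imp_increasing_open[of x y "\<lambda>u. u\<^sup>2 * log_density x - log_primitive u", OF that(1)])
      fix u assume u: "x < u" "u < y"
      have "((\<lambda>u. u\<^sup>2 * log_density x - log_primitive u) has_real_derivative 2 * u * log_density x - 2 * u * log_density u) (at u)"
        using u that assms(1) by (auto intro!: derivative_eq_intros log_primitive_deriv)
      moreover have "2 * u * log_density u \<le> 2 * u * log_density x"
        using u assms(1) by (intro mult_left_mono log_density_antimono) auto
      ultimately show "\<exists>d. ((\<lambda>u. u\<^sup>2 * log_density x - log_primitive u) has_real_derivative d) (at u) \<and> 0 \<le> d" by force
    next
      show "continuous_on {x..y} (\<lambda>u. u\<^sup>2 * log_density x - log_primitive u)"
        using assms(1) by (intro continuous_intros continuous_on_subset[OF cont]) auto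
    qed
    then show ?thesis by (simp add: algebra_simps)
  qed
  show ?thesis
  proof (cases "y \<le> 1")
    case True
    then show ?thesis using main assms by simp
  next
    case False
    show ?thesis
    proof (cases "x \<le> 1")
      case True
      have "log_primitive y - log_primitive x = log_primitive 1 - log_primitive x"
        using False by (simp add: log_primitive_ge_1)
      also have "\<dots> \<le> (1\<^sup>2 - x\<^sup>2) * log_density x" using main[of 1] True by simp
      also have "\<dots> \<le> (y\<^sup>2 - x\<^sup>2) * log_density x"
        using False log_density_nonneg[of x] by (intro mult_right_mono) (auto simp: power_mono)
      finally show ?thesis .
    next
      case x1: False
      then show ?thesis using False by (simp add: log_primitive_ge_1 log_density_ge_1)
    qed
  qed
qed

text \<open>Quantifies the approach to the limit -1 / pi^2 at 0, through ln v \<le> v - 1.\<close>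

lemma log_primitive_le:
  assumes "a > 0"
  shows "log_primitive a \<le> (3 * a - 1) / pi\<^sup>2"
proof (cases "a \<le> 1")
  case True
  have a2: "a\<^sup>2 \<le> a" using True assms by (simp add: power2_eq_square mult_left_le)
  have w: "1 - a\<^sup>2 \<le> sqrt (1 - a\<^sup>2)" "sqrt (1 - a\<^sup>2) \<le> 1"
  proof -
    have "(1 - a\<^sup>2)\<^sup>2 \<le> 1 - a\<^sup>2" using a2 True by (simp add: power2_eq_square mult_left_le)
    then show "1 - a\<^sup>2 \<le> sqrt (1 - a\<^sup>2)" by (rule real_le_rsqrt)
  qed auto
  have "(1 + sqrt (1 - a\<^sup>2)) / a > 0" using True assms by (intro divide_pos_pos add_pos_nonneg) (auto simp: power_le_one)
  then have "ln ((1 + sqrt (1 - a\<^sup>2)) / a) \<le> (1 + sqrt (1 - a\<^sup>2)) / a - 1" by (rule ln_le_minus_one)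
  also have "\<dots> \<le> 2 / a"
  proof -
    have "(1 + sqrt (1 - a\<^sup>2)) / a \<le> 2 / a" using w assms by (intro divide_right_mono) auto
    then show ?thesis by linarith
  qed
  finally have "a\<^sup>2 * ln ((1 + sqrt (1 - a\<^sup>2)) / a) \<le> a\<^sup>2 * (2 / a)" by (intro mult_left_mono) auto
  also have "\<dots> = 2 * a" using assms by (simp add: power2_eq_square)
  finally have "a\<^sup>2 * ln ((1 + sqrt (1 - a\<^sup>2)) / a) - sqrt (1 - a\<^sup>2) \<le> 3 * a - 1" using w a2 by linarith
  then have "(a\<^sup>2 * ln ((1 + sqrt (1 - a\<^sup>2)) / a) - sqrt (1 - a\<^sup>2)) / pi\<^sup>2 \<le> (3 * a - 1) / pi\<^sup>2"
    by (intro divide_right_mono) auto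
  then show ?thesis using True assms by (simp add: log_primitive_def log_density_def diff_divide_distrib)
qed (simp add: log_primitive_ge_1)

section \<open>Densities summed over several jumps\<close>

definition density_sum :: "'i set \<Rightarrow> ('i \<Rightarrow> real) \<Rightarrow> real \<Rightarrow> real" where
  "density_sum Z \<alpha> t = (\<Sum>z\<in>Z. log_density (t / \<alpha> z))"

definition primitive_sum :: "'i set \<Rightarrow> ('i \<Rightarrow> real) \<Rightarrow> real \<Rightarrow> real" where
  "primitive_sum Z \<alpha> t = (\<Sum>z\<in>Z. (\<alpha> z)\<^sup>2 * log_primitive (t / \<alpha> z))"

lemma density_sum_antimono:
  assumes "\<And>z. z \<in> Z \<Longrightarrow> \<alpha> z > 0" "0 < s" "s \<le> t"
  shows "density_sum Z \<alpha> t \<le> density_sum Z \<alpha> s"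
  unfolding density_sum_def using assms
  by (intro sum_mono log_density_antimono) (auto intro: divide_right_mono less_imp_le)

lemma primitive_sum_diff_le:
  assumes \<alpha>: "\<And>z. z \<in> Z \<Longrightarrow> \<alpha> z > 0" and xy: "0 < x" "x \<le> y"
  shows "primitive_sum Z \<alpha> y - primitive_sum Z \<alpha> x \<le> (y\<^sup>2 - x\<^sup>2) * density_sum Z \<alpha> x"
proof -
  have "(\<alpha> z)\<^sup>2 * log_primitive (y / \<alpha> z) - (\<alpha> z)\<^sup>2 * log_primitive (x / \<alpha> z) \<le> (y\<^sup>2 - x\<^sup>2) * log_density (x / \<alpha> z)"
    if "z \<in> Z" for z
  proof -
    have "log_primitive (y / \<alpha> z) - log_primitive (x / \<alpha> z) \<le> ((y / \<alpha> z)\<^sup>2 - (x / \<alpha> z)\<^sup>2) * log_density (x / \<alpha> z)"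
      using \<alpha>[OF that] xy by (intro log_primitive_diff_le) (auto intro: divide_right_mono)
    from mult_left_mono[OF this, of "(\<alpha> z)\<^sup>2"] show ?thesis
      using \<alpha>[OF that] by (simp add: power_divide algebra_simps)
  qed
  then show ?thesis
    unfolding primitive_sum_def density_sum_def sum_distrib_left sum_subtractf[symmetric] by (intro sum_mono)
qed

text \<open>A fine partition turns the increment of the primitive into a sum with the density at
  right end points. These are the levels that occur in the layer cake sum, and the lower bounds for
  the counts are inserted there.\<close>

lemma density_segment:
  fixes n :: "nat \<Rightarrow> real \<Rightarrow> real"
  assumes \<alpha>: "\<And>z. z \<in> Z \<Longrightarrow> \<alpha> z > 0"
    and lower: "\<And>t \<epsilon>. t > 0 \<Longrightarrow> \<epsilon> > 0 \<Longrightarrow> \<exists>C. \<forall>N\<ge>1. (density_sum Z \<alpha> t - \<epsilon>) * ln (real N) - C \<le> n N t"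
    and xy: "0 < x" "x \<le> y" and \<epsilon>: "\<epsilon> > 0"
  shows "\<exists>p r C. p 0 = x \<and> p r = y \<and> (\<forall>i\<le>r. 0 < p i) \<and> (\<forall>i<r. p i \<le> p (Suc i)) \<and>
    (\<forall>N\<ge>1. (primitive_sum Z \<alpha> y - primitive_sum Z \<alpha> x - \<epsilon>) * ln (real N) - C
       \<le> (\<Sum>i<r. ((p (Suc i))\<^sup>2 - (p i)\<^sup>2) * n N (p (Suc i))))"
proof -
  define h where "h = density_sum Z \<alpha>"
  define F where "F = primitive_sum Z \<alpha>"
  \<comment> \<open>So many nodes that the mesh of the squares times the total drop of the density
    is at most \<epsilon> / 2; the successor keeps \<open>r\<close> positive.\<close>
  define r where "r = Suc (nat \<lceil>2 * y * (y - x) * (h x - h y) / (\<epsilon> / 2)\<rceil>)"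
  define p where "p i = x + real i * ((y - x) / real r)" for i :: nat
  have r: "real r > 0" by (simp add: r_def)
  have p0: "p 0 = x" and pr: "p r = y" using r by (auto simp: p_def)
  have step: "p (Suc i) = p i + (y - x) / real r" for i unfolding p_def of_nat_Suc distrib_right by simp
  have st0: "(y - x) / real r \<ge> 0" using xy r by simp
  have px: "x \<le> p i" for i unfolding p_def using mult_nonneg_nonneg[OF of_nat_0_le_iff[of i] st0] by linarith
  have pos: "0 < p i" for i using px[of i] xy by simp
  have mono: "p i \<le> p (Suc i)" for i using st0 by (simp add: step)
  have py: "p i \<le> y" if "i \<le> r" for i
  proof -
    have "real i * ((y - x) / real r) \<le> real r * ((y - x) / real r)" using that st0 by (intro mult_right_mono) auto
    then show ?thesis using r by (simp add: p_def)
  qed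
  define \<Delta> where "\<Delta> i = (p (Suc i))\<^sup>2 - (p i)\<^sup>2" for i
  have \<Delta>0: "\<Delta> i \<ge> 0" for i unfolding \<Delta>_def using mono[of i] pos[of i] by (simp add: power_mono)
  define D where "D = 2 * y * (y - x) / real r"
  have \<Delta>D: "\<Delta> i \<le> D" if "i < r" for i
  proof -
    have "\<Delta> i = (y - x) / real r * (p (Suc i) + p i)" unfolding \<Delta>_def step by (simp add: power2_eq_square algebra_simps)
    also have "\<dots> \<le> (y - x) / real r * (2 * y)" using py[of i] py[of "Suc i"] that st0 by (intro mult_left_mono) auto
    finally show ?thesis by (simp add: D_def mult_ac)
  qed
  have hm: "h (p (Suc i)) \<le> h (p i)" for i
    unfolding h_def by (rule density_sum_antimono[OF \<alpha> pos mono])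
  have mesh: "D * (h x - h y) \<le> \<epsilon> / 2"
  proof -
    have "2 * y * (y - x) * (h x - h y) / (\<epsilon> / 2) \<le> real r" unfolding r_def by linarith
    then have "2 * y * (y - x) * (h x - h y) \<le> \<epsilon> / 2 * real r" using \<epsilon> by (subst (asm) pos_divide_le_eq) (auto simp: mult.commute)
    then show ?thesis using r by (simp add: D_def divide_le_eq)
  qed
  have sumh: "F y - F x - \<epsilon> / 2 \<le> (\<Sum>i<r. \<Delta> i * h (p (Suc i)))"
  proof -
    have "F y - F x = (\<Sum>i<r. F (p (Suc i)) - F (p i))" using sum_lessThan_telescope[of "\<lambda>i. F (p i)" r] by (simp add: p0 pr)
    also have "\<dots> \<le> (\<Sum>i<r. \<Delta> i * h (p i))"
      unfolding F_def h_def \<Delta>_def by (intro sum_mono primitive_sum_diff_le[OF \<alpha> pos mono])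
    also have "\<dots> = (\<Sum>i<r. \<Delta> i * h (p (Suc i))) + (\<Sum>i<r. \<Delta> i * (h (p i) - h (p (Suc i))))"
      by (simp add: sum.distrib[symmetric] algebra_simps)
    also have "(\<Sum>i<r. \<Delta> i * (h (p i) - h (p (Suc i)))) \<le> (\<Sum>i<r. D * (h (p i) - h (p (Suc i))))"
      using \<Delta>D hm by (intro sum_mono mult_right_mono) auto
    also have "\<dots> = D * (h x - h y)"
      using sum_lessThan_telescope'[of "\<lambda>i. h (p i)" r] by (simp add: sum_distrib_left[symmetric] p0 pr)
    finally show ?thesis using mesh by linarith
  qed
  have sum\<Delta>: "(\<Sum>i<r. \<Delta> i) = y\<^sup>2 - x\<^sup>2"
    unfolding \<Delta>_def using sum_lessThan_telescope[of "\<lambda>i. (p i)\<^sup>2" r] by (simp add: p0 pr)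
  have yx: "y\<^sup>2 - x\<^sup>2 \<ge> 0" using xy by (simp add: power_mono)
  \<comment> \<open>Spreads the other \<epsilon> / 2 over the partition; the summand 1 in the
    denominator covers x = y.\<close>
  define \<epsilon>' where "\<epsilon>' = \<epsilon> / (2 * (y\<^sup>2 - x\<^sup>2 + 1))"
  have \<epsilon>': "\<epsilon>' > 0" "(y\<^sup>2 - x\<^sup>2) * \<epsilon>' \<le> \<epsilon> / 2"
  proof -
    show "\<epsilon>' > 0" using \<epsilon> yx by (simp add: \<epsilon>'_def)
    have "(y\<^sup>2 - x\<^sup>2) * \<epsilon>' \<le> (y\<^sup>2 - x\<^sup>2 + 1) * \<epsilon>'" using \<open>\<epsilon>' > 0\<close> by simp
    also have "\<dots> = \<epsilon> / 2"
    proof -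
      have "v * (\<epsilon> / (2 * v)) = \<epsilon> / 2" if "v > 0" for v :: real using that by simp
      from this[of "y\<^sup>2 - x\<^sup>2 + 1"] show ?thesis unfolding \<epsilon>'_def using yx by linarith
    qed
    finally show "(y\<^sup>2 - x\<^sup>2) * \<epsilon>' \<le> \<epsilon> / 2" .
  qed
  have "\<exists>C. \<forall>N\<ge>1. (h (p (Suc i)) - \<epsilon>') * ln (real N) - C \<le> n N (p (Suc i))" for i
    unfolding h_def by (rule lower[OF pos \<epsilon>'(1)])
  then obtain C where C: "\<And>i N. N \<ge> 1 \<Longrightarrow> (h (p (Suc i)) - \<epsilon>') * ln (real N) - C i \<le> n N (p (Suc i))" by metis
  have "(F y - F x - \<epsilon>) * ln (real N) - (\<Sum>i<r. \<Delta> i * C i) \<le> (\<Sum>i<r. \<Delta> i * n N (p (Suc i)))" if N: "N \<ge> 1" for N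
  proof -
    have "F y - F x - \<epsilon> \<le> (\<Sum>i<r. \<Delta> i * h (p (Suc i))) - (y\<^sup>2 - x\<^sup>2) * \<epsilon>'" using sumh \<epsilon>'(2) by linarith
    also have "\<dots> = (\<Sum>i<r. \<Delta> i * (h (p (Suc i)) - \<epsilon>'))"
      by (simp add: right_diff_distrib sum_subtractf sum_distrib_right[symmetric] sum\<Delta>)
    finally have "(F y - F x - \<epsilon>) * ln (real N) \<le> (\<Sum>i<r. \<Delta> i * (h (p (Suc i)) - \<epsilon>')) * ln (real N)"
      using N by (intro mult_right_mono) auto
    then have "(F y - F x - \<epsilon>) * ln (real N) - (\<Sum>i<r. \<Delta> i * C i)
        \<le> (\<Sum>i<r. \<Delta> i * ((h (p (Suc i)) - \<epsilon>') * ln (real N) - C i))"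
      by (simp add: right_diff_distrib sum_subtractf sum_distrib_right mult.assoc left_diff_distrib)
    also have "\<dots> \<le> (\<Sum>i<r. \<Delta> i * n N (p (Suc i)))"
      by (intro sum_mono mult_left_mono C N \<Delta>0)
    finally show ?thesis .
  qed
  then show ?thesis
    unfolding F_def \<Delta>_def using p0 pr pos mono by blast
qed

text \<open>The lower bounds at all levels exhaust the total mass \<open>\<Sum>\<alpha>\<^sup>2 / \<pi>\<^sup>2\<close> of the layer-cake sum, so no level can
  exceed its lower bound by a positive proportion.\<close>

lemma density_upper:
  fixes n :: "nat \<Rightarrow> real \<Rightarrow> real"
  assumes fin: "finite Z" and \<alpha>: "\<And>z. z \<in> Z \<Longrightarrow> \<alpha> z > 0"
    and lower: "\<And>t \<epsilon>. t > 0 \<Longrightarrow> \<epsilon> > 0 \<Longrightarrow> \<exists>C. \<forall>N\<ge>1. (density_sum Z \<alpha> t - \<epsilon>) * ln (real N) - C \<le> n N t"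
    and nonneg: "\<And>N t. 0 \<le> n N t"
    and layer: "\<And>N p r. N \<ge> 1 \<Longrightarrow> (\<And>i. i \<le> r \<Longrightarrow> 0 < p i) \<Longrightarrow> (\<And>i. i < r \<Longrightarrow> p i \<le> p (Suc i)) \<Longrightarrow>
      (p 0)\<^sup>2 * n N (p 0) + (\<Sum>i<r. ((p (Suc i))\<^sup>2 - (p i)\<^sup>2) * n N (p (Suc i)))
        \<le> (\<Sum>z\<in>Z. (\<alpha> z)\<^sup>2) / pi\<^sup>2 * ln (real N) + C0"
    and t: "t > 0" and \<epsilon>: "\<epsilon> > 0"
  shows "\<exists>C. \<forall>N\<ge>1. n N t \<le> (density_sum Z \<alpha> t + \<epsilon>) * ln (real N) + C"
proof -
  define h where "h = density_sum Z \<alpha>"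
  define F where "F = primitive_sum Z \<alpha>"
  define q where "q = (\<Sum>z\<in>Z. (\<alpha> z)\<^sup>2) / pi\<^sup>2"
  obtain \<delta> where \<delta>: "\<delta> > 0" "\<And>s. s > 0 \<Longrightarrow> \<bar>s - t\<bar> < \<delta> \<Longrightarrow> \<bar>h s - h t\<bar> < \<epsilon> / 2"
    using log_density_sum_nearby[where Z = Z and \<alpha> = \<alpha> and \<epsilon> = "\<epsilon> / 2", OF \<alpha> t] \<epsilon>
    unfolding h_def density_sum_def by (auto simp: half_gt_zero)
  \<comment> \<open>Slightly below \<open>t\<close>, so that the density at \<open>s\<close> exceeds
    the one at \<open>t\<close> by less than \<epsilon> / 2, and still positive.\<close>
  define s where "s = max (t / 2) (t - \<delta> / 2)"
  have s: "0 < s" "s < t" using t \<delta> by (auto simp: s_def)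
  have hs: "h s \<le> h t + \<epsilon> / 2"
  proof -
    have "\<bar>s - t\<bar> < \<delta>" using s \<delta>(1) by (auto simp: s_def)
    from \<delta>(2)[OF s(1) this] show ?thesis by linarith
  qed
  have ts: "t\<^sup>2 - s\<^sup>2 > 0" using s by (simp add: power_strict_mono)
  \<comment> \<open>Three errors of this size occur: the mass below \<open>a\<close>, and one for
    each of the two segments. Together they use up the remaining \<epsilon> / 2.\<close>
  define \<epsilon>1 where "\<epsilon>1 = (t\<^sup>2 - s\<^sup>2) * (\<epsilon> / 2) / 3"
  have \<epsilon>1: "\<epsilon>1 > 0" using ts \<epsilon> by (simp add: \<epsilon>1_def)
  define S1 where "S1 = (\<Sum>z\<in>Z. \<alpha> z)"
  have S1: "S1 \<ge> 0" unfolding S1_def by (rule sum_nonneg) (use \<alpha> in \<open>auto intro: less_imp_le\<close>)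
  \<comment> \<open>So close to 0 that the primitive at \<open>a\<close> has all but \<epsilon>1 of
    the total mass above it.\<close>
  define a where "a = min (s / 2) (\<epsilon>1 / (S1 + 1))"
  have a: "0 < a" "a \<le> s" 
  proof -
    have "\<epsilon>1 / (S1 + 1) > 0" using \<epsilon>1 S1 by (intro divide_pos_pos) linarith+
    then show "0 < a" "a \<le> s" using s unfolding a_def by linarith+
  qed
  have Fa: "q + F a \<le> \<epsilon>1"
  proof -
    have "F a \<le> (\<Sum>z\<in>Z. (\<alpha> z)\<^sup>2 * ((3 * (a / \<alpha> z) - 1) / pi\<^sup>2))"
      unfolding F_def primitive_sum_def using \<alpha> a by (intro sum_mono mult_left_mono log_primitive_le) auto
    also have "\<dots> = (\<Sum>z\<in>Z. 3 * a / pi\<^sup>2 * \<alpha> z - (\<alpha> z)\<^sup>2 / pi\<^sup>2)"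
    proof (intro sum.cong refl)
      fix z assume "z \<in> Z"
      then have "\<alpha> z \<noteq> 0" using \<alpha> by force
      then show "(\<alpha> z)\<^sup>2 * ((3 * (a / \<alpha> z) - 1) / pi\<^sup>2) = 3 * a / pi\<^sup>2 * \<alpha> z - (\<alpha> z)\<^sup>2 / pi\<^sup>2"
        by (simp add: field_simps power2_eq_square)
    qed
    also have "\<dots> = 3 * a / pi\<^sup>2 * S1 - q"
      by (simp add: sum_subtractf S1_def q_def sum_distrib_left sum_divide_distrib)
    finally have "q + F a \<le> 3 / pi\<^sup>2 * (a * S1)" by simp
    also have "\<dots> \<le> 1 * (a * S1)"
    proof (rule mult_right_mono)
      have "3 * 1 \<le> pi * pi" using pi_gt3 by (intro mult_mono) auto
      then show "3 / pi\<^sup>2 \<le> 1" by (simp add: power2_eq_square)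
    qed (use a S1 in simp)
    also have "1 * (a * S1) \<le> \<epsilon>1 / (S1 + 1) * (S1 + 1)" unfolding mult_1_left
      using a S1 \<epsilon>1 by (intro mult_mono) (auto simp: a_def intro: divide_nonneg_pos)
    also have "\<dots> = \<epsilon>1" using S1 by simp
    finally show ?thesis by simp
  qed
  \<comment> \<open>Beyond every \<alpha> z, where the primitive vanishes.\<close>
  define T where "T = max t (S1 + 1)"
  have T: "t \<le> T" "S1 \<le> T" by (auto simp: T_def)
  have FT: "F T = 0"
  proof -
    have "log_primitive (T / \<alpha> z) = 0" if "z \<in> Z" for z
    proof -
      have "\<alpha> z \<le> S1" unfolding S1_def using that fin \<alpha> by (intro member_le_sum) (auto intro: less_imp_le)
      then show ?thesis using T \<alpha>[OF that] by (intro log_primitive_ge_1) (simp add: le_divide_eq)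
    qed
    then show ?thesis by (simp add: F_def primitive_sum_def)
  qed
  obtain p1 r1 C1 where p1: "p1 0 = a" "p1 r1 = s" "\<And>i. i \<le> r1 \<Longrightarrow> 0 < p1 i" "\<And>i. i < r1 \<Longrightarrow> p1 i \<le> p1 (Suc i)"
    "\<And>N. N \<ge> 1 \<Longrightarrow> (F s - F a - \<epsilon>1) * ln (real N) - C1 \<le> (\<Sum>i<r1. ((p1 (Suc i))\<^sup>2 - (p1 i)\<^sup>2) * n N (p1 (Suc i)))"
    using density_segment[OF \<alpha> lower a \<epsilon>1] unfolding F_def by blast
  obtain p2 r2 C2 where p2: "p2 0 = t" "p2 r2 = T" "\<And>i. i \<le> r2 \<Longrightarrow> 0 < p2 i" "\<And>i. i < r2 \<Longrightarrow> p2 i \<le> p2 (Suc i)"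
    "\<And>N. N \<ge> 1 \<Longrightarrow> (F T - F t - \<epsilon>1) * ln (real N) - C2 \<le> (\<Sum>i<r2. ((p2 (Suc i))\<^sup>2 - (p2 i)\<^sup>2) * n N (p2 (Suc i)))"
    using density_segment[OF \<alpha> lower t T(1) \<epsilon>1] unfolding F_def by blast
  \<comment> \<open>The nodes run from \<open>a\<close> to \<open>s\<close>, jump to
    \<open>t\<close>, and continue to \<open>T\<close>. The single step from \<open>s\<close> to
    \<open>t\<close> carries the count at level \<open>t\<close>; both segments are bounded below,
    so their mass can be subtracted from the total.\<close>
  define p where "p i = (if i \<le> r1 then p1 i else p2 (i - Suc r1))" for i
  define r where "r = Suc r1 + r2"
  have ppos: "0 < p i" if "i \<le> r" for i using that p1(3) p2(3) by (auto simp: p_def r_def)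
  have pmono: "p i \<le> p (Suc i)" if "i < r" for i
  proof -
    consider "i < r1" | "i = r1" | "i > r1" by linarith
    then show ?thesis
    proof cases
      case 3
      then have "Suc i - Suc r1 = Suc (i - Suc r1)" by simp
      then show ?thesis using 3 that p2(4)[of "i - Suc r1"] by (simp add: p_def r_def)
    qed (use p1 p2(1) s in \<open>auto simp: p_def\<close>)
  qed
  have "n N t \<le> (h t + \<epsilon>) * ln (real N) + (C0 + C1 + C2) / (t\<^sup>2 - s\<^sup>2)" if N: "N \<ge> 1" for N
  proof -
    let ?L = "ln (real N)"
    define f where "f i = ((p (Suc i))\<^sup>2 - (p i)\<^sup>2) * n N (p (Suc i))" for i
    have L0: "?L \<ge> 0" using N by simp
    have "(\<Sum>i<r. f i) = (\<Sum>i<r1. f i) + f r1 + (\<Sum>i<r2. f (Suc r1 + i))"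
    proof -
      have "(\<Sum>i<m + k. f i) = (\<Sum>i<m. f i) + (\<Sum>i<k. f (m + i))" for m k
        by (induction k) (simp_all add: add.assoc)
      from this[of "Suc r1" r2] show ?thesis by (simp add: r_def)
    qed
    moreover have "(\<Sum>i<r1. f i) = (\<Sum>i<r1. ((p1 (Suc i))\<^sup>2 - (p1 i)\<^sup>2) * n N (p1 (Suc i)))"
      by (intro sum.cong) (auto simp: f_def p_def)
    moreover have "f r1 = (t\<^sup>2 - s\<^sup>2) * n N t" by (simp add: f_def p_def p1 p2)
    moreover have "(\<Sum>i<r2. f (Suc r1 + i)) = (\<Sum>i<r2. ((p2 (Suc i))\<^sup>2 - (p2 i)\<^sup>2) * n N (p2 (Suc i)))"
      by (intro sum.cong) (auto simp: f_def p_def)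
    moreover have "(p 0)\<^sup>2 * n N (p 0) + (\<Sum>i<r. f i) \<le> q * ?L + C0"
      unfolding f_def q_def by (rule layer[where p = p and r = r, OF N ppos pmono])
    moreover have "(p 0)\<^sup>2 * n N (p 0) \<ge> 0" using nonneg by simp
    ultimately have "(t\<^sup>2 - s\<^sup>2) * n N t \<le> q * ?L + C0 - ((F s - F a - \<epsilon>1) * ?L - C1) - ((F T - F t - \<epsilon>1) * ?L - C2)"
      using p1(5)[OF N] p2(5)[OF N] by linarith
    also have "\<dots> = (q + F a + (F t - F s) + 2 * \<epsilon>1) * ?L + (C0 + C1 + C2)"
      by (simp add: FT algebra_simps)
    also have "\<dots> \<le> ((t\<^sup>2 - s\<^sup>2) * (h t + \<epsilon>)) * ?L + (C0 + C1 + C2)"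
    proof (intro add_right_mono mult_right_mono L0)
      have "F t - F s \<le> (t\<^sup>2 - s\<^sup>2) * h s"
        unfolding F_def h_def using s by (intro primitive_sum_diff_le \<alpha>) auto
      also have "\<dots> \<le> (t\<^sup>2 - s\<^sup>2) * (h t + \<epsilon> / 2)" using hs ts by (intro mult_left_mono) auto
      finally have "q + F a + (F t - F s) + 2 * \<epsilon>1 \<le> (t\<^sup>2 - s\<^sup>2) * (h t + \<epsilon> / 2) + 3 * \<epsilon>1" using Fa by linarith
      also have "3 * \<epsilon>1 = (t\<^sup>2 - s\<^sup>2) * (\<epsilon> / 2)" by (simp add: \<epsilon>1_def)
      also have "(t\<^sup>2 - s\<^sup>2) * (h t + \<epsilon> / 2) + (t\<^sup>2 - s\<^sup>2) * (\<epsilon> / 2) = (t\<^sup>2 - s\<^sup>2) * (h t + \<epsilon>)"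
        unfolding distrib_left[symmetric] by simp
      finally show "q + F a + (F t - F s) + 2 * \<epsilon>1 \<le> (t\<^sup>2 - s\<^sup>2) * (h t + \<epsilon>)" .
    qed
    finally have "n N t * (t\<^sup>2 - s\<^sup>2) \<le> (h t + \<epsilon>) * ?L * (t\<^sup>2 - s\<^sup>2) + (C0 + C1 + C2)" by (simp add: mult_ac)
    then have "n N t \<le> ((h t + \<epsilon>) * ?L * (t\<^sup>2 - s\<^sup>2) + (C0 + C1 + C2)) / (t\<^sup>2 - s\<^sup>2)"
      using ts by (simp add: pos_le_divide_eq)
    also have "\<dots> = (h t + \<epsilon>) * ?L + (C0 + C1 + C2) / (t\<^sup>2 - s\<^sup>2)" using ts by (simp add: add_divide_distrib)
    finally show ?thesis .
  qed
  then show ?thesis unfolding h_def by blast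
qed

section \<open>Two-sided counting estimates\<close>

text \<open>Eigenvectors for eigenvalues above t and below -t are mutually orthogonal, so together
  they are test vectors with |K x| > t |x|.\<close>

lemma eigenvalue_counts_le_singular_count:
  assumes K: "compact_operator K" "self_adjoint K" and t: "t > 0"
  shows "eigenvalue_count t K + eigenvalue_count t (\<lambda>x. - K x) \<le> singular_count t K"
proof -
  let ?m = "eigenvalue_count t K" and ?n = "eigenvalue_count t (\<lambda>x. - K x)"
  note bo = bounded_operatorD[OF compact_operator_bounded[OF K(1)]]
  obtain e l where e: "orthonormal {..<?m} e" "\<And>i. i < ?m \<Longrightarrow> K (e i) = l i *\<^sub>R e i \<and> l i > t"
    by (rule eigenvalue_countE[OF K t]) blast
  obtain f k where f: "orthonormal {..<?n} f" "\<And>i. i < ?n \<Longrightarrow> - K (f i) = k i *\<^sub>R f i \<and> k i > t"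
    by (rule eigenvalue_countE[OF compact_operator_uminus[OF K(1)] self_adjoint_uminus[OF K(2)] t]) blast
  have ef: "ell2_cinner (e i) (f j) = 0" if "i < ?m" "j < ?n" for i j
  proof -
    have Kf: "K (f j) = (- k j) *\<^sub>R f j" using f(2)[OF that(2)] by (metis minus_minus scaleR_minus_left)
    have "ell2_cinner (K (e i)) (f j) = ell2_cinner (e i) (K (f j))" by (rule self_adjointD[OF K(2)])
    then have "of_real (l i) * ell2_cinner (e i) (f j) = - (of_real (k j) * ell2_cinner (e i) (f j))"
      using e(2)[OF that(1)] unfolding Kf by (simp add: ell2_scaleR cinner_simps)
    then have "of_real (l i + k j) * ell2_cinner (e i) (f j) = 0" by (simp add: distrib_right)
    moreover have "l i + k j \<noteq> 0" using e(2)[OF that(1)] f(2)[OF that(2)] t by linarith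
    ultimately show ?thesis by (metis mult_eq_0_iff of_real_eq_0_iff)
  qed
  have fe: "ell2_cinner (f j) (e i) = 0" if "i < ?m" "j < ?n" for i j
    using ef[OF that] cinner_commute[of "f j" "e i"] by simp
  define I where "I = {..<?m} <+> {..<?n}"
  define v where "v = case_sum e f"
  define L where "L = case_sum l (\<lambda>j. - k j)"
  have I: "finite I" "card I = ?m + ?n" by (auto simp: I_def card_Plus)
  have v: "orthonormal I v"
    unfolding orthonormal_def
  proof (intro ballI)
    fix i j assume "i \<in> I" "j \<in> I"
    then show "ell2_cinner (v i) (v j) = (if i = j then 1 else 0)"
      using orthonormalD[OF e(1)] orthonormalD[OF f(1)] ef fe by (auto simp: I_def v_def split: if_splits)
  qed
  have Kv: "K (v i) = ell2_scale (of_real (L i)) (v i) \<and> t < \<bar>L i\<bar>" if "i \<in> I" for i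
  proof -
    have "K (v i) = L i *\<^sub>R v i \<and> t < \<bar>L i\<bar>"
    proof (cases i)
      case (Inl j)
      then show ?thesis using that e(2)[of j] t by (auto simp: I_def v_def L_def)
    next
      case (Inr j)
      then have "j < ?n" using that by (auto simp: I_def)
      from f(2)[OF this] have "K (f j) = (- k j) *\<^sub>R f j" "k j > t" by (metis minus_minus scaleR_minus_left, simp)
      then show ?thesis using Inr t by (simp add: v_def L_def)
    qed
    then show ?thesis by (simp add: ell2_scaleR)
  qed
  have "card I \<le> singular_count t K + card ({} :: nat set)"
  proof (rule singular_count_ge[OF K(1) t I(1), where v = v and b = "\<lambda>_ _. 0"])
    fix c :: "nat + nat \<Rightarrow> complex" assume "\<exists>i\<in>I. c i \<noteq> 0"
    then obtain i0 where i0: "i0 \<in> I" "c i0 \<noteq> 0" by blast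
    have "K (lincomb I c v) = lincomb I (\<lambda>i. c i * of_real (L i)) v"
      unfolding bo(8) using Kv by (simp add: lincomb_def)
    then have K2: "(norm (K (lincomb I c v)))\<^sup>2 = (\<Sum>i\<in>I. (L i)\<^sup>2 * (cmod (c i))\<^sup>2)"
      by (simp add: norm_lincomb_orthonormal[OF I(1) v] norm_mult power_mult_distrib mult.commute)
    have "(t * norm (lincomb I c v))\<^sup>2 = (\<Sum>i\<in>I. t\<^sup>2 * (cmod (c i))\<^sup>2)"
      by (simp add: norm_lincomb_orthonormal[OF I(1) v] power_mult_distrib sum_distrib_left)
    also have "\<dots> < (\<Sum>i\<in>I. (L i)\<^sup>2 * (cmod (c i))\<^sup>2)"
    proof (rule sum_strict_mono_ex1[OF I(1)])
      have lt: "t\<^sup>2 < (L i)\<^sup>2" if "i \<in> I" for i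
        using Kv[OF that] t power_strict_mono[of t "\<bar>L i\<bar>" 2] by simp
      then show "\<forall>i\<in>I. t\<^sup>2 * (cmod (c i))\<^sup>2 \<le> (L i)\<^sup>2 * (cmod (c i))\<^sup>2"
        by (intro ballI mult_right_mono) (auto intro: less_imp_le)
      show "\<exists>i\<in>I. t\<^sup>2 * (cmod (c i))\<^sup>2 < (L i)\<^sup>2 * (cmod (c i))\<^sup>2"
        using i0 lt by (intro bexI[of _ i0] mult_strict_right_mono) auto
    qed
    finally have "(t * norm (lincomb I c v))\<^sup>2 < (norm (K (lincomb I c v)))\<^sup>2" unfolding K2 .
    then show "t * norm (lincomb I c v) < norm (K (lincomb I c v))" by (rule power_less_imp_less_base) simp
  qed auto
  then show ?thesis using I(2) by simp
qed

lemma ln_order_limit: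
  fixes f :: "nat \<Rightarrow> real"
  assumes lower: "\<And>\<epsilon>. \<epsilon> > 0 \<Longrightarrow> \<exists>C. \<forall>N\<ge>1. (h - \<epsilon>) * ln (real N) - C \<le> f N"
    and upper: "\<And>\<epsilon>. \<epsilon> > 0 \<Longrightarrow> \<exists>C. \<forall>N\<ge>1. f N \<le> (h + \<epsilon>) * ln (real N) + C"
  shows "(\<lambda>N. f N / ln (real N)) \<longlonglongrightarrow> h"
proof (rule tendstoI)
  fix \<epsilon> :: real assume \<epsilon>: "\<epsilon> > 0"
  then have e2: "\<epsilon> / 2 > 0" by simp
  obtain C where C: "\<And>N. N \<ge> 1 \<Longrightarrow> (h - \<epsilon> / 2) * ln (real N) - C \<le> f N" using lower[OF e2] by blast
  obtain D where D: "\<And>N. N \<ge> 1 \<Longrightarrow> f N \<le> (h + \<epsilon> / 2) * ln (real N) + D" using upper[OF e2] by blast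
  define M where "M = max 0 (max C D) / (\<epsilon> / 2)"
  have M: "M \<ge> 0" "C \<le> M * (\<epsilon> / 2)" "D \<le> M * (\<epsilon> / 2)" using e2 by (auto simp: M_def)
  have "filterlim (\<lambda>N. ln (real N)) at_top sequentially"
    by (rule filterlim_compose[OF ln_at_top filterlim_real_sequentially])
  then have "\<forall>\<^sub>F N in sequentially. M < ln (real N)" unfolding filterlim_at_top_dense by blast
  moreover have "\<forall>\<^sub>F N in sequentially. (1::nat) \<le> N" by (rule eventually_ge_at_top)
  ultimately show "\<forall>\<^sub>F N in sequentially. dist (f N / ln (real N)) h < \<epsilon>"
  proof eventually_elim
    case (elim N)
    then have L: "ln (real N) > 0" using M by linarith
    have m: "M * (\<epsilon> / 2) < \<epsilon> / 2 * ln (real N)" using elim(1) e2 by (subst mult.commute) (rule mult_strict_left_mono)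
    have "(h - \<epsilon>) * ln (real N) < f N"
      using C[OF elim(2)] M(2) m by (simp add: algebra_simps)
    moreover have "f N < (h + \<epsilon>) * ln (real N)"
      using D[OF elim(2)] M(3) m by (simp add: algebra_simps)
    ultimately have "h - \<epsilon> < f N / ln (real N)" "f N / ln (real N) < h + \<epsilon>"
      using L by (auto simp: pos_less_divide_eq pos_divide_less_eq)
    then show ?case by (simp add: dist_real_def)
  qed
qed

text \<open>The number \<open>m\<close> may depend on \<rho> but not on N. This is all that the
  counting sees of the multiplier and of \<eta>.\<close>

definition jump_approximable :: "complex set \<Rightarrow> (complex \<Rightarrow> complex) \<Rightarrow> (nat \<Rightarrow> ell2 \<Rightarrow> ell2) \<Rightarrow> bool" where
  "jump_approximable Z a K \<longleftrightarrow> (\<forall>N\<ge>1. compact_operator (K N)) \<and>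
     (\<forall>\<rho>>0. \<exists>m. \<forall>N\<ge>1. small_off (\<lambda>x. K N x - jump_operator Z a N x) \<rho> m)"

lemma jump_operator_compact:
  assumes "\<And>z. z \<in> Z \<Longrightarrow> cmod z = 1"
  shows "compact_operator (jump_operator Z a N)"
proof -
  have "hs_bound (jump_matrix Z a N) (\<Sum>j<N. \<Sum>k<N. (cmod (jump_matrix Z a N j k))\<^sup>2)"
    by (rule hs_bound_finite_support) (simp add: jump_matrix_def hilbert_matrix_def)
  from hs_compact[OF this] jump_operator(3)[of Z a N, OF assms] show ?thesis by simp
qed

lemma jump_approximable_refl:
  assumes "\<And>z. z \<in> Z \<Longrightarrow> cmod z = 1"
  shows "jump_approximable Z a (jump_operator Z a)"
  unfolding jump_approximable_def small_off_def
  using jump_operator_compact[OF assms] by (auto intro!: exI[of _ 0] exI[of _ "{}"])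

context
  fixes Z :: "complex set" and a :: "complex \<Rightarrow> complex"
  assumes fin: "finite Z" and Z: "\<And>z. z \<in> Z \<Longrightarrow> cmod z = 1" and a: "\<And>z. z \<in> Z \<Longrightarrow> a z \<noteq> 0"
begin

lemma jump_density_lower:
  assumes K: "jump_approximable Z a K" and t: "t > 0" and \<epsilon>: "\<epsilon> > 0"
  shows "\<exists>C. \<forall>N\<ge>1. (density_sum Z (\<lambda>z. cmod (a z)) t - \<epsilon>) * ln (real N) - C \<le> real (singular_count t (K N))"
proof -
  obtain s C where s: "s > t" "\<And>N. N \<ge> 1 \<Longrightarrow> (density_sum Z (\<lambda>z. cmod (a z)) t - \<epsilon>) * ln (real N) - C
      \<le> real (\<Sum>z\<in>Z. eigenvalue_count (s / cmod (a z)) (hilbert_operator N))"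
    using hilbert_density_sum_lower[of Z "\<lambda>z. cmod (a z)", OF fin _ t \<epsilon>] a unfolding density_sum_def by auto
  \<comment> \<open>Half of the gap goes to the decoupling, from level s down to t + \<rho>, and
    half to the perturbation, from t + \<rho> down to t.\<close>
  define \<rho> where "\<rho> = (s - t) / 2"
  have \<rho>: "0 < \<rho>" "\<rho> < t + \<rho>" "t + \<rho> < s" using s t by (auto simp: \<rho>_def field_simps)
  obtain m where m: "\<And>N. N \<ge> 1 \<Longrightarrow> small_off (\<lambda>x. K N x - jump_operator Z a N x) \<rho> m"
    using K \<rho>(1) unfolding jump_approximable_def by blast
  have "compact_operator (K N)" if "N \<ge> 1" for N using K that by (simp add: jump_approximable_def)
  from jump_singular_lower[of Z a \<rho> "t + \<rho>" s K m, OF fin Z a \<rho> this m]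
  obtain C' where C': "\<And>N. N \<ge> 1 \<Longrightarrow>
      (\<Sum>z\<in>Z. eigenvalue_count (s / cmod (a z)) (hilbert_operator N)) \<le> singular_count t (K N) + C'" by auto
  have "(density_sum Z (\<lambda>z. cmod (a z)) t - \<epsilon>) * ln (real N) - (C + real C') \<le> real (singular_count t (K N))" if "N \<ge> 1" for N
    using s(2)[OF that] of_nat_mono[OF C'[OF that], where 'a = real] by simp
  then show ?thesis by blast
qed

lemma jump_density_lower_eigenvalue:
  assumes sym: "\<And>z. z \<in> Z \<Longrightarrow> cnj z \<in> Z \<and> a (cnj z) = cnj (a z)"
    and K: "jump_approximable Z a K" and sa: "\<And>N. N \<ge> 1 \<Longrightarrow> self_adjoint (K N)" and t: "t > 0" and \<epsilon>: "\<epsilon> > 0"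
  shows "\<exists>C. \<forall>N\<ge>1. (density_sum {z\<in>Z. Im z > 0 \<or> Im z = 0 \<and> Re (a z) > 0} (\<lambda>z. cmod (a z)) t - \<epsilon>) * ln (real N) - C
    \<le> real (eigenvalue_count t (K N))"
proof -
  define \<Theta> where "\<Theta> = {z\<in>Z. Im z > 0 \<or> Im z = 0 \<and> Re (a z) > 0}"
  have \<Theta>: "finite \<Theta>" "\<And>z. z \<in> \<Theta> \<Longrightarrow> cmod (a z) > 0" using fin a by (auto simp: \<Theta>_def)
  obtain s C where s: "s > t" "\<And>N. N \<ge> 1 \<Longrightarrow> (density_sum \<Theta> (\<lambda>z. cmod (a z)) t - \<epsilon>) * ln (real N) - C
      \<le> real (\<Sum>z\<in>\<Theta>. eigenvalue_count (s / cmod (a z)) (hilbert_operator N))"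
    using hilbert_density_sum_lower[of \<Theta> "\<lambda>z. cmod (a z)", OF \<Theta> t \<epsilon>] unfolding density_sum_def by auto
  define \<rho> where "\<rho> = (s - t) / 2"
  have \<rho>: "0 < \<rho>" "\<rho> < t + \<rho>" "t + \<rho> < s" using s t by (auto simp: \<rho>_def field_simps)
  obtain m where m: "\<And>N. N \<ge> 1 \<Longrightarrow> small_off (\<lambda>x. K N x - jump_operator Z a N x) \<rho> m"
    using K \<rho>(1) unfolding jump_approximable_def by blast
  have "compact_operator (K N)" if "N \<ge> 1" for N using K that by (simp add: jump_approximable_def)
  from jump_eigenvalue_lower[of Z a \<rho> "t + \<rho>" s K m, OF fin Z a sym \<rho> this sa m]
  obtain C' where C': "\<And>N. N \<ge> 1 \<Longrightarrow>
      (\<Sum>z\<in>\<Theta>. eigenvalue_count (s / cmod (a z)) (hilbert_operator N)) \<le> eigenvalue_count t (K N) + C'"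
    unfolding \<Theta>_def by auto
  have "(density_sum \<Theta> (\<lambda>z. cmod (a z)) t - \<epsilon>) * ln (real N) - (C + real C') \<le> real (eigenvalue_count t (K N))" if "N \<ge> 1" for N
    using s(2)[OF that] of_nat_mono[OF C'[OF that], where 'a = real] by simp
  then show ?thesis unfolding \<Theta>_def by blast
qed

end

section \<open>Hilbert--Schmidt norms of the truncation and of the cutoff error\<close>

text \<open>The antidiagonal j + k = m has at most m + 1 points.\<close>

lemma sum_antidiagonal_le:
  fixes w :: "nat \<Rightarrow> real"
  assumes "\<And>m. 0 \<le> w m"
  shows "(\<Sum>j<n. \<Sum>k<n. w (j + k)) \<le> (\<Sum>m<2 * n. (real m + 1) * w m)"
proof -
  have "(\<Sum>k<n. w (j + k)) \<le> (\<Sum>m<2 * n. if j \<le> m then w m else 0)" if "j < n" for j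
  proof -
    have "(\<Sum>k<n. w (j + k)) = sum w ((+) j ` {..<n})" by (subst sum.reindex) auto
    also have "\<dots> \<le> sum w {m\<in>{..<2 * n}. j \<le> m}" using that assms by (intro sum_mono2) auto
    also have "\<dots> = (\<Sum>m<2 * n. if j \<le> m then w m else 0)" by (subst sum.inter_filter) auto
    finally show ?thesis .
  qed
  then have "(\<Sum>j<n. \<Sum>k<n. w (j + k)) \<le> (\<Sum>j<n. \<Sum>m<2 * n. if j \<le> m then w m else 0)"
    by (intro sum_mono) auto
  also have "\<dots> = (\<Sum>m<2 * n. \<Sum>j<n. if j \<le> m then w m else 0)" by (rule sum.swap)
  also have "\<dots> \<le> (\<Sum>m<2 * n. (real m + 1) * w m)"
  proof (rule sum_mono)
    fix m
    have "(\<Sum>j<n. if j \<le> m then w m else 0) = (\<Sum>j\<in>{j\<in>{..<n}. j \<le> m}. w m)" by (subst sum.inter_filter) auto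
    also have "\<dots> \<le> (\<Sum>j\<in>{..m}. w m)" using assms by (intro sum_mono2) auto
    finally show "(\<Sum>j<n. if j \<le> m then w m else 0) \<le> (real m + 1) * w m" by (simp add: distrib_right)
  qed
  finally show ?thesis .
qed

lemma hs_bound_hankel_type:
  assumes e: "\<And>j k. (cmod (e j k))\<^sup>2 \<le> w (j + k)" and D: "\<And>n. (\<Sum>m<n. (real m + 1) * w m) \<le> D"
  shows "hs_bound e D"
  unfolding hs_bound_def
proof
  fix n
  have w: "0 \<le> w m" for m using order_trans[OF zero_le_power2 e[of m 0]] by simp
  have "(\<Sum>j<n. \<Sum>k<n. (cmod (e j k))\<^sup>2) \<le> (\<Sum>j<n. \<Sum>k<n. w (j + k))" by (intro sum_mono e)
  also have "\<dots> \<le> D" using sum_antidiagonal_le[of w n, OF w] D[of "2 * n"] by linarith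
  finally show "(\<Sum>j<n. \<Sum>k<n. (cmod (e j k))\<^sup>2) \<le> D" .
qed

text \<open>The weight m + 1 of an antidiagonal reduces its contribution to |b m|^2 / (pi^2 (m +
  1)). When |b m|^2 is expanded over pairs of jumps, equal jumps give a harmonic sum, hence ln N;
  different ones oscillate and stay bounded by Abel summation.\<close>

lemma jump_matrix_hs_bound:
  assumes fin: "finite Z" and Z: "\<And>z. z \<in> Z \<Longrightarrow> cmod z = 1"
  shows "\<exists>C. \<forall>N\<ge>1. hs_bound (jump_matrix Z a N) ((\<Sum>z\<in>Z. (cmod (a z))\<^sup>2) / pi\<^sup>2 * ln (real N) + C)"
proof -
  define S where "S = (\<Sum>z\<in>Z. (cmod (a z))\<^sup>2)"
  define B where "B z w = (if z = w then 1 else 2 / cmod (1 - cnj z * w))" for z w :: complex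
  define C where "C = (\<Sum>z\<in>Z. \<Sum>w\<in>Z. cmod (a z) * cmod (a w) * B z w)"
  have B: "B z w \<ge> 0" for z w by (simp add: B_def)
  have "hs_bound (jump_matrix Z a N) (S / pi\<^sup>2 * ln (real N) + C / pi\<^sup>2)" if N: "N \<ge> 1" for N
  proof -
    define b where "b m = (\<Sum>z\<in>Z. a z * cnj z ^ m)" for m
    have osc: "cmod (\<Sum>m<N. (cnj z * w) ^ m * of_real (1 / (real m + 1))) \<le> (if z = w then ln (real N) else 0) + B z w"
      if "z \<in> Z" "w \<in> Z" for z w
    proof (cases "z = w")
      case True
      have "cnj w * w = 1" using Z[OF that(2)] complex_norm_square[of w] by (simp add: mult.commute)
      then have "(\<Sum>m<N. (cnj z * w) ^ m * of_real (1 / (real m + 1))) = of_real (\<Sum>m<N. 1 / (real m + 1))"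
        using True by simp
      also have "(\<Sum>m<N. 1 / (real m + 1)) = harm N"
        unfolding harm_def by (rule sum.reindex_bij_witness[of _ "\<lambda>m. m - 1" Suc]) (auto simp: field_simps)
      also have "cmod (of_real (harm N)) = harm N" using harm_nonneg[of N, where 'a = real] by simp
      also have "\<dots> \<le> ln (real N) + 1" using euler_mascheroni_sequence_decreasing[of 1 N] N by (simp add: harm_def)
      finally show ?thesis using True by (simp add: B_def)
    next
      case False
      have n1: "cmod (cnj z * w) = 1" using Z that by (simp add: norm_mult)
      have ne: "cnj z * w \<noteq> 1"
      proof
        assume *: "cnj z * w = 1"
        have zz: "z * cnj z = 1" using complex_norm_square[of z] Z[OF that(1)] by simp
        have "w = (z * cnj z) * w" unfolding zz by simp
        also have "\<dots> = z * (cnj z * w)" by (rule mult.assoc)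
        also have "\<dots> = z" unfolding * by simp
        finally show False using False by simp
      qed
      have "cmod (\<Sum>m<N. (cnj z * w) ^ m * of_real (1 / (real m + 1))) \<le> 2 / cmod (1 - cnj z * w) * (1 / (real 0 + 1))"
        by (rule abel_bound[OF n1 ne, of "\<lambda>m. 1 / (real m + 1)"]) (auto simp: frac_le)
      then show ?thesis using False by (simp add: B_def)
    qed
    have "complex_of_real (\<Sum>m<N. (cmod (b m))\<^sup>2 / (real m + 1))
        = (\<Sum>m<N. \<Sum>z\<in>Z. \<Sum>w\<in>Z. a z * cnj (a w) * ((cnj z * w) ^ m * of_real (1 / (real m + 1))))"
    proof (simp only: of_real_sum, intro sum.cong refl)
      fix m
      have "complex_of_real ((cmod (b m))\<^sup>2) = (\<Sum>z\<in>Z. \<Sum>w\<in>Z. (a z * cnj z ^ m) * (cnj (a w) * w ^ m))"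
        unfolding complex_norm_square b_def by (simp add: sum_product)
      also have "\<dots> = (\<Sum>z\<in>Z. \<Sum>w\<in>Z. a z * cnj (a w) * (cnj z * w) ^ m)"
        by (simp add: power_mult_distrib mult_ac)
      finally show "complex_of_real ((cmod (b m))\<^sup>2 / (real m + 1))
        = (\<Sum>z\<in>Z. \<Sum>w\<in>Z. a z * cnj (a w) * ((cnj z * w) ^ m * of_real (1 / (real m + 1))))"
        by (simp add: sum_divide_distrib)
    qed
    also have "\<dots> = (\<Sum>z\<in>Z. \<Sum>w\<in>Z. a z * cnj (a w) * (\<Sum>m<N. (cnj z * w) ^ m * of_real (1 / (real m + 1))))"
      unfolding sum_distrib_left by (subst sum.swap, intro sum.cong refl, subst sum.swap, simp)
    finally have eq: "complex_of_real (\<Sum>m<N. (cmod (b m))\<^sup>2 / (real m + 1)) = \<dots>" .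
    have "(\<Sum>m<N. (cmod (b m))\<^sup>2 / (real m + 1)) \<le> cmod (complex_of_real (\<Sum>m<N. (cmod (b m))\<^sup>2 / (real m + 1)))"
      unfolding norm_of_real by (rule abs_ge_self)
    also have "\<dots> \<le> (\<Sum>z\<in>Z. \<Sum>w\<in>Z. cmod (a z) * cmod (a w) * ((if z = w then ln (real N) else 0) + B z w))"
      unfolding eq
    proof (intro sum_norm_le)
      fix z w assume "z \<in> Z" "w \<in> Z"
      from osc[OF this] show "cmod (a z * cnj (a w) * (\<Sum>m<N. (cnj z * w) ^ m * of_real (1 / (real m + 1))))
          \<le> cmod (a z) * cmod (a w) * ((if z = w then ln (real N) else 0) + B z w)"
        unfolding norm_mult complex_mod_cnj by (intro mult_left_mono) auto
    qed
    also have "\<dots> = (\<Sum>z\<in>Z. \<Sum>w\<in>Z. (if z = w then (cmod (a z))\<^sup>2 * ln (real N) else 0)) + C"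
      unfolding C_def sum.distrib[symmetric] by (intro sum.cong refl) (simp add: power2_eq_square algebra_simps)
    also have "(\<Sum>z\<in>Z. \<Sum>w\<in>Z. (if z = w then (cmod (a z))\<^sup>2 * ln (real N) else 0)) = S * ln (real N)"
      using fin by (simp add: S_def sum_distrib_right)
    finally have main: "(\<Sum>m<N. (cmod (b m))\<^sup>2 / (real m + 1)) \<le> S * ln (real N) + C" .
    define w where "w m = (if m < N then (cmod (b m))\<^sup>2 / (pi * (real m + 1))\<^sup>2 else 0)" for m
    show ?thesis
    proof (rule hs_bound_hankel_type[where w = w])
      fix j k
      show "(cmod (jump_matrix Z a N j k))\<^sup>2 \<le> w (j + k)"
      proof (cases "j + k < N")
        case True
        then have "jump_matrix Z a N j k = b (j + k) * of_real (1 / (pi * (real (j + k) + 1)))"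
          by (simp add: jump_matrix_def hilbert_matrix_def b_def add.commute)
        then show ?thesis using True by (simp only: norm_mult norm_of_real power_mult_distrib power2_abs w_def if_True) (simp add: power_divide power_mult_distrib)
      qed (simp add: jump_matrix_def hilbert_matrix_def w_def)
    next
      fix n
      have "(\<Sum>m<n. (real m + 1) * w m) \<le> (\<Sum>m<max n N. (real m + 1) * w m)"
        by (intro sum_mono2) (auto simp: w_def)
      also have "\<dots> = (\<Sum>m<N. (real m + 1) * w m)"
        by (rule sum.mono_neutral_right) (auto simp: w_def)
      also have "\<dots> = (\<Sum>m<N. (cmod (b m))\<^sup>2 / (real m + 1)) / pi\<^sup>2"
      proof (unfold sum_divide_distrib, intro sum.cong refl)
        fix m assume "m \<in> {..<N}"
        moreover have "real m + 1 \<noteq> 0" by linarith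
        ultimately show "(real m + 1) * w m = (cmod (b m))\<^sup>2 / (real m + 1) / pi\<^sup>2"
          by (simp add: w_def power_mult_distrib power2_eq_square)
      qed
      also have "\<dots> \<le> (S * ln (real N) + C) / pi\<^sup>2" by (intro divide_right_mono main) simp
      also have "\<dots> = S / pi\<^sup>2 * ln (real N) + C / pi\<^sup>2" by (simp add: add_divide_distrib)
      finally show "(\<Sum>m<n. (real m + 1) * w m) \<le> S / pi\<^sup>2 * ln (real N) + C / pi\<^sup>2" .
    qed
  qed
  then show ?thesis unfolding S_def by blast
qed

text \<open>\<open>G\<close> is a clamped primitive of ln (N / x)^(-2 \<beta>) / x, so sums of the
  listed terms telescope. Its total increase is bounded independently of N because 2 \<beta> >
  1.\<close>

lemma telescoping_near_zero:
  assumes \<beta>: "\<beta> > 1/2" and N: "N \<ge> (1::nat)"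
  shows "\<exists>G::nat \<Rightarrow> real. mono G \<and> (\<forall>n. G n - G 0 \<le> ln 2 powr (1 - 2 * \<beta>) / (2 * \<beta> - 1)) \<and>
    (\<forall>m\<ge>1. 4 * m \<le> N \<longrightarrow> ln (real N / real m) powr (- 2 * \<beta>) / (real m + 1) \<le> G (Suc m) - G m)"
proof -
  define g where "g x = ln (real N / x) powr (1 - 2 * \<beta>) / (2 * \<beta> - 1)" for x :: real
  \<comment> \<open>Clamped at N / 2, where ln (N / x) is still ln 2. The condition 4 m \<le> N
    gives m + 1 \<le> N / 2, so the clamp is inactive where the increments are used; the value 0 at
    n = 0 keeps clear of N / 0.\<close>
  define G where "G n = (if n = 0 then 0 else g (min (real n) (real N / 2)))" for n
  have b: "2 * \<beta> - 1 > 0" using \<beta> by simp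
  have N0: "real N > 0" using N by simp
  have gmono: "g x \<le> g y" if "0 < x" "x \<le> y" "y \<le> real N / 2" for x y
  proof -
    have "ln 2 \<le> ln (real N / y)" using that N0 by (subst ln_le_cancel_iff) (auto simp: field_simps)
    then have "0 < ln (real N / y)" using ln_gt_zero[of 2] by linarith
    moreover have "ln (real N / y) \<le> ln (real N / x)" using that N0 by (subst ln_le_cancel_iff) (auto simp: field_simps)
    ultimately have "ln (real N / x) powr (1 - 2 * \<beta>) \<le> ln (real N / y) powr (1 - 2 * \<beta>)"
      using b by (intro powr_mono2') auto
    then show ?thesis unfolding g_def using b by (intro divide_right_mono) auto
  qed
  have g0: "g x \<ge> 0" for x using b by (simp add: g_def)
  have mono: "mono G"
  proof (rule monoI)
    fix i j :: nat assume "i \<le> j"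
    then show "G i \<le> G j" using N0 g0 by (auto simp: G_def intro!: gmono)
  qed
  moreover have "G n - G 0 \<le> ln 2 powr (1 - 2 * \<beta>) / (2 * \<beta> - 1)" for n
  proof (cases "n = 0")
    case True
    then show ?thesis using b by simp
  next
    case False
    then have "G n \<le> g (real N / 2)" using N0 by (auto simp: G_def intro!: gmono)
    also have "\<dots> = ln 2 powr (1 - 2 * \<beta>) / (2 * \<beta> - 1)" using N0 by (simp add: g_def)
    finally show ?thesis by (simp add: G_def)
  qed
  moreover have "ln (real N / real m) powr (- 2 * \<beta>) / (real m + 1) \<le> G (Suc m) - G m" if m: "m \<ge> 1" "4 * m \<le> N" for m
  proof -
    have m': "real m \<ge> 1" "4 * real m \<le> real N" using m by (auto simp: le_divide_eq simp flip: of_nat_mult)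
    have der: "(g has_real_derivative ln (real N / x) powr (- 2 * \<beta>) / x) (at x)" if "real m \<le> x" "x \<le> real m + 1" for x
    proof -
      have x: "x > 0" "real N / x > 1" using that m' by (auto simp: field_simps)
      then have l: "ln (real N / x) > 0" by simp
      have "((\<lambda>x. ln (real N / x)) has_real_derivative - (1 / x)) (at x)"
        using x N0 by (auto intro!: derivative_eq_intros simp: field_simps power2_eq_square)
      from DERIV_fun_powr[OF this l, of "1 - 2 * \<beta>"]
      have "((\<lambda>x. ln (real N / x) powr (1 - 2 * \<beta>)) has_real_derivative
          (1 - 2 * \<beta>) * ln (real N / x) powr (1 - 2 * \<beta> - 1) * - (1 / x)) (at x)" by simp
      from DERIV_cdivide[OF this, of "2 * \<beta> - 1"]
      have "(g has_real_derivative (1 - 2 * \<beta>) * ln (real N / x) powr (- 2 * \<beta>) * - (1 / x) / (2 * \<beta> - 1)) (at x)"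
        unfolding g_def[abs_def] by simp
      moreover have "- c * P * - (1 / x) / c = P / x" if "c \<noteq> 0" for c P :: real using that by simp
      from this[of "2 * \<beta> - 1", unfolded minus_diff_eq]
      have "(1 - 2 * \<beta>) * P * - (1 / x) / (2 * \<beta> - 1) = P / x" for P using b by simp
      ultimately show ?thesis by (simp only:)
    qed
    obtain \<xi> where \<xi>: "real m < \<xi>" "\<xi> < real m + 1"
      "g (real m + 1) - g (real m) = (real m + 1 - real m) * (ln (real N / \<xi>) powr (- 2 * \<beta>) / \<xi>)"
      using MVT2[of "real m" "real m + 1" g "\<lambda>x. ln (real N / x) powr (- 2 * \<beta>) / x"] der by auto
    have "0 < ln (real N / \<xi>)" "ln (real N / \<xi>) \<le> ln (real N / real m)"
      using \<xi> m' N0 by (auto simp: field_simps)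
    then have "ln (real N / real m) powr (- 2 * \<beta>) \<le> ln (real N / \<xi>) powr (- 2 * \<beta>)"
      using \<beta> by (intro powr_mono2') auto
    then have "ln (real N / real m) powr (- 2 * \<beta>) / (real m + 1) \<le> ln (real N / \<xi>) powr (- 2 * \<beta>) / \<xi>"
      using \<xi> m' by (intro frac_le) auto
    also have "\<dots> = g (real m + 1) - g (real m)" using \<xi>(3) by simp
    also have "\<dots> = G (Suc m) - G m" using m' by (simp add: G_def min_def add.commute)
    finally show ?thesis .
  qed
  ultimately show ?thesis by blast
qed

text \<open>The same device beyond N. On the interval from m to m + 1 the argument x / N + 1 stays
  below m / N + 2, and the factor 2 absorbs the difference between 1 / (m + 1) and 1 / (x +
  N).\<close>

lemma telescoping_near_infinity:
  assumes \<alpha>: "\<alpha> > 1/2" and N: "N \<ge> (1::nat)"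
  shows "\<exists>G::nat \<Rightarrow> real. mono G \<and> (\<forall>n. G n - G 0 \<le> 2 * ln 2 powr (1 - 2 * \<alpha>) / (2 * \<alpha> - 1)) \<and>
    (\<forall>m\<ge>N. ln (real m / real N + 2) powr (- 2 * \<alpha>) / (real m + 1) \<le> G (Suc m) - G m)"
proof -
  define g where "g x = - (2 * ln (x / real N + 1) powr (1 - 2 * \<alpha>) / (2 * \<alpha> - 1))" for x :: real
  define G where "G n = g (max (real n) (real N))" for n
  have b: "2 * \<alpha> - 1 > 0" using \<alpha> by simp
  have N0: "real N > 0" using N by simp
  have ln2: "ln 2 \<le> ln (x / real N + 1)" if "real N \<le> x" for x
    using that N0 by (subst ln_le_cancel_iff) (auto simp: field_simps)
  have l0: "0 < ln (x / real N + 1)" if "real N \<le> x" for x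
    using ln2[OF that] ln_gt_zero[of 2] by linarith
  have gmono: "g x \<le> g y" if "real N \<le> x" "x \<le> y" for x y
  proof -
    have "ln (x / real N + 1) \<le> ln (y / real N + 1)"
      using that N0 by (subst ln_le_cancel_iff) (auto intro!: divide_right_mono add_pos_pos divide_pos_pos)
    then have "ln (y / real N + 1) powr (1 - 2 * \<alpha>) \<le> ln (x / real N + 1) powr (1 - 2 * \<alpha>)"
      using b l0[of x] that by (intro powr_mono2') auto
    then show ?thesis unfolding g_def neg_le_iff_le using b by (intro divide_right_mono mult_left_mono) auto
  qed
  have mono: "mono G" by (rule monoI) (auto simp: G_def intro!: gmono)
  moreover have "G n - G 0 \<le> 2 * ln 2 powr (1 - 2 * \<alpha>) / (2 * \<alpha> - 1)" for n
  proof -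
    have "G n \<le> 0" using b by (simp add: G_def g_def)
    moreover have "G 0 = - (2 * ln 2 powr (1 - 2 * \<alpha>) / (2 * \<alpha> - 1))" using N0 by (simp add: G_def g_def)
    ultimately show ?thesis by simp
  qed
  moreover have "ln (real m / real N + 2) powr (- 2 * \<alpha>) / (real m + 1) \<le> G (Suc m) - G m" if m: "m \<ge> N" for m
  proof -
    have m': "real m \<ge> real N" using m by simp
    have der: "(g has_real_derivative 2 * ln (x / real N + 1) powr (- 2 * \<alpha>) / (x + real N)) (at x)" if "real m \<le> x" for x
    proof -
      have x: "x > 0" using that m' N0 by linarith
      have l: "ln (x / real N + 1) > 0" using l0[of x] that m' by linarith
      have "((\<lambda>x. ln (x / real N + 1)) has_real_derivative 1 / (x + real N)) (at x)"
        using x N0 by (auto intro!: derivative_eq_intros add_pos_pos simp: field_simps)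
      from DERIV_fun_powr[OF this l, of "1 - 2 * \<alpha>"]
      have "((\<lambda>x. ln (x / real N + 1) powr (1 - 2 * \<alpha>)) has_real_derivative
          (1 - 2 * \<alpha>) * ln (x / real N + 1) powr (1 - 2 * \<alpha> - 1) * (1 / (x + real N))) (at x)" by simp
      from DERIV_cdivide[OF DERIV_cmult[OF this, of "- 2"], of "2 * \<alpha> - 1"]
      have "(g has_real_derivative - 2 * ((1 - 2 * \<alpha>) * ln (x / real N + 1) powr (- 2 * \<alpha>) * (1 / (x + real N))) / (2 * \<alpha> - 1)) (at x)"
        unfolding g_def[abs_def] by simp
      moreover have "- 2 * (- c * P * (1 / y)) / c = 2 * P / y" if "c \<noteq> 0" for c P y :: real using that by simp
      from this[of "2 * \<alpha> - 1", unfolded minus_diff_eq]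
      have "- 2 * ((1 - 2 * \<alpha>) * P * (1 / y)) / (2 * \<alpha> - 1) = 2 * P / y" for P y using b by simp
      ultimately show ?thesis by (simp only:)
    qed
    obtain \<xi> where \<xi>: "real m < \<xi>" "\<xi> < real m + 1"
      "g (real m + 1) - g (real m) = (real m + 1 - real m) * (2 * ln (\<xi> / real N + 1) powr (- 2 * \<alpha>) / (\<xi> + real N))"
      using MVT2[of "real m" "real m + 1" g "\<lambda>x. 2 * ln (x / real N + 1) powr (- 2 * \<alpha>) / (x + real N)"] der by auto
    have "\<xi> / real N \<le> (real m + 1) / real N" "1 / real N \<le> 1" using \<xi> N by (auto intro: divide_right_mono)
    then have "\<xi> / real N + 1 \<le> real m / real N + 2" unfolding add_divide_distrib by linarith
    moreover have "0 < \<xi> / real N" using \<xi> m' N0 by (intro divide_pos_pos) linarith+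
    ultimately have "ln (\<xi> / real N + 1) \<le> ln (real m / real N + 2)"
      by (subst ln_le_cancel_iff) linarith+
    then have p: "ln (real m / real N + 2) powr (- 2 * \<alpha>) \<le> ln (\<xi> / real N + 1) powr (- 2 * \<alpha>)"
      using \<alpha> l0[of \<xi>] \<xi>(1) m' by (intro powr_mono2') auto
    have "ln (real m / real N + 2) powr (- 2 * \<alpha>) / (real m + 1)
        = 2 * ln (real m / real N + 2) powr (- 2 * \<alpha>) / (2 * (real m + 1))"
      by (rule mult_divide_mult_cancel_left[symmetric]) simp
    also have "\<dots> \<le> 2 * ln (\<xi> / real N + 1) powr (- 2 * \<alpha>) / (\<xi> + real N)"
      using p \<xi> m' N0 by (intro frac_le mult_left_mono) auto
    also have "\<dots> = g (real m + 1) - g (real m)" using \<xi>(3) by simp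
    also have "\<dots> = G (Suc m) - G m" using m' by (simp add: G_def max_def add.commute)
    finally show ?thesis .
  qed
  ultimately show ?thesis by blast
qed

lemma telescoping_middle:
  assumes \<delta>: "\<delta> > 0" and N: "N \<ge> (1::nat)"
  shows "\<exists>G::nat \<Rightarrow> real. mono G \<and> (\<forall>n. G n - G 0 \<le> 1 / \<delta>) \<and>
    (\<forall>m<N. \<delta> * real N < real m \<longrightarrow> 1 / (real m + 1) \<le> G (Suc m) - G m)"
proof -
  define G where "G n = min (real n) (real N) / (\<delta> * real N)" for n
  have N0: "real N > 0" "\<delta> * real N > 0" using N \<delta> by auto
  have "mono G" using N0 by (auto simp: G_def intro!: monoI divide_right_mono min.mono)
  moreover have "G n - G 0 \<le> 1 / \<delta>" for n
  proof -
    have "G n \<le> real N / (\<delta> * real N)" unfolding G_def using N0 by (intro divide_right_mono) auto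
    then show ?thesis using N0 by (simp add: G_def)
  qed
  moreover have "1 / (real m + 1) \<le> G (Suc m) - G m" if m: "m < N" "\<delta> * real N < real m" for m
  proof -
    have "1 / (real m + 1) \<le> 1 / (\<delta> * real N)" using m N0 by (intro frac_le) auto
    also have "\<dots> = G (Suc m) - G m" using m by (simp add: G_def min_def add_divide_distrib)
    finally show ?thesis .
  qed
  ultimately show ?thesis by blast
qed

text \<open>The squared multiplier error is bounded in terms of m = j + k alone: by (B) for small m
  / N, by boundedness of \<tau> in between, and by (C) for m \<ge> N. Since |s m| \<le> A / (m + 1)
  and an antidiagonal has m + 1 entries, it remains to sum this bound divided by m + 1, which the
  three telescoping lemmas do uniformly in N.\<close>

lemma cutoff_error_hs_bound:
  fixes \<tau> :: "real \<Rightarrow> real \<Rightarrow> complex"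
  assumes bdd: "bounded {\<tau> x y | x y. 0 \<le> x \<and> 0 \<le> y}" and B0: "\<tau> 0 0 = 1"
    and B: "\<exists>\<epsilon>>0. \<exists>\<beta>>1/2. \<exists>C>0. \<forall>x y. 0 \<le> x \<and> x \<le> \<epsilon> \<and> 0 \<le> y \<and> y \<le> \<epsilon> \<longrightarrow>
              cmod (\<tau> x y - 1) \<le> C * \<bar>ln (x + y)\<bar> powr (- \<beta>)"
    and C: "\<exists>\<alpha>>1/2. \<exists>C. \<forall>x y. 0 \<le> x \<and> 0 \<le> y \<longrightarrow> cmod (\<tau> x y) \<le> C * ln (x + y + 2) powr (- \<alpha>)"
    and s: "\<And>n. cmod (s n) \<le> A / (real n + 1)"
  shows "\<exists>D. \<forall>N\<ge>1. hs_bound (\<lambda>j k. (dilate \<tau> N j k - (if j + k < N then 1 else 0)) * s (j + k)) D"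
proof -
  obtain \<epsilon> \<beta> Cb where b: "\<epsilon> > 0" "\<beta> > 1/2" "\<And>x y. 0 \<le> x \<Longrightarrow> x \<le> \<epsilon> \<Longrightarrow> 0 \<le> y \<Longrightarrow> y \<le> \<epsilon> \<Longrightarrow>
      cmod (\<tau> x y - 1) \<le> Cb * \<bar>ln (x + y)\<bar> powr (- \<beta>)"
    using B by blast
  obtain \<alpha> Cc where c: "\<alpha> > 1/2" "\<And>x y. 0 \<le> x \<Longrightarrow> 0 \<le> y \<Longrightarrow> cmod (\<tau> x y) \<le> Cc * ln (x + y + 2) powr (- \<alpha>)"
    using C by blast
  obtain M where M: "\<And>x y. 0 \<le> x \<Longrightarrow> 0 \<le> y \<Longrightarrow> cmod (\<tau> x y) \<le> M"
    using bdd unfolding bounded_iff by blast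
  \<comment> \<open>The bound \<epsilon> puts both arguments into the range of (B); the bound 1/4
    gives 4 m \<le> N, as \<open>telescoping_near_zero\<close> requires.\<close>
  define \<delta> where "\<delta> = min \<epsilon> (1 / 4)"
  have \<delta>: "\<delta> > 0" "\<delta> \<le> \<epsilon>" "\<delta> \<le> 1 / 4" using b(1) by (auto simp: \<delta>_def)
  define D where "D = A\<^sup>2 * (Cb\<^sup>2 * (ln 2 powr (1 - 2 * \<beta>) / (2 * \<beta> - 1)) + (M + 1)\<^sup>2 * (1 / \<delta>)
    + Cc\<^sup>2 * (2 * ln 2 powr (1 - 2 * \<alpha>) / (2 * \<alpha> - 1)))"
  have sq: "(u * L powr (- \<gamma>))\<^sup>2 = u\<^sup>2 * L powr (- 2 * \<gamma>)" for u L \<gamma> :: real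
    by (simp add: power2_eq_square powr_add[symmetric] algebra_simps)
  have "hs_bound (\<lambda>j k. (dilate \<tau> N j k - (if j + k < N then 1 else 0)) * s (j + k)) D" if N: "N \<ge> 1" for N
  proof -
    have N0: "real N > 0" using N by simp
    \<comment> \<open>The index m = 0 is kept apart from the logarithms: the error vanishes there
      because \<tau> is 1 at the origin.\<close>
    define \<phi> where "\<phi> m = (if m = 0 then 0 else if real m \<le> \<delta> * real N then Cb\<^sup>2 * ln (real N / real m) powr (- 2 * \<beta>)
      else if m < N then (M + 1)\<^sup>2 else Cc\<^sup>2 * ln (real m / real N + 2) powr (- 2 * \<alpha>))" for m
    have \<phi>0: "\<phi> m \<ge> 0" for m by (simp add: \<phi>_def)
    have small: "4 * m \<le> N" if "real m \<le> \<delta> * real N" for m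
    proof -
      have "\<delta> * real N \<le> 1 / 4 * real N" using \<delta>(3) N0 by (intro mult_right_mono) auto
      with that have "real (4 * m) \<le> real N" by simp
      then show ?thesis by (simp only: of_nat_le_iff)
    qed
    have d: "(cmod (dilate \<tau> N j k - (if m < N then 1 else 0)))\<^sup>2 \<le> \<phi> m" if m: "m = j + k" for j k m
    proof -
      let ?x = "real j / real N" and ?y = "real k / real N"
      have xy: "0 \<le> ?x" "0 \<le> ?y" "?x + ?y = real m / real N" by (auto simp: m add_divide_distrib)
      consider "m = 0" | "m > 0" "real m \<le> \<delta> * real N"
        | "m > 0" "\<not> real m \<le> \<delta> * real N" "m < N" | "m > 0" "\<not> real m \<le> \<delta> * real N" "\<not> m < N" by blast
      then show ?thesis
      proof cases
        case 1
        then show ?thesis using B0 N m by (simp add: dilate_def \<phi>_def)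
      next
        case 2
        have "real m / real N \<le> \<delta>" using 2 N0 by (simp add: pos_divide_le_eq)
        then have xe: "?x \<le> \<epsilon>" "?y \<le> \<epsilon>" using xy \<delta> by linarith+
        have less: "m < N" using small[OF 2(2)] 2(1) by linarith
        have "\<bar>ln (?x + ?y)\<bar> = ln (real N / real m)"
          unfolding xy(3) using less 2(1) by (subst (1 2) ln_div) auto
        with b(3)[OF xy(1) xe(1) xy(2) xe(2)]
        have "cmod (dilate \<tau> N j k - 1) \<le> Cb * ln (real N / real m) powr (- \<beta>)" by (simp add: dilate_def)
        from power_mono[OF this, of 2] show ?thesis using 2 less unfolding sq by (simp add: \<phi>_def)
      next
        case 3
        have "cmod (dilate \<tau> N j k - 1) \<le> M + 1"
          using M[OF xy(1,2)] norm_triangle_ineq4[of "dilate \<tau> N j k" 1] by (simp add: dilate_def)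
        from power_mono[OF this, of 2] show ?thesis using 3 by (simp add: \<phi>_def)
      next
        case 4
        from power_mono[OF c(2)[OF xy(1,2)], of 2] show ?thesis
          using 4 unfolding xy(3) sq by (simp add: \<phi>_def dilate_def)
      qed
    qed
    obtain G1 :: "nat \<Rightarrow> real" where G1: "mono G1" "\<And>n. G1 n - G1 0 \<le> ln 2 powr (1 - 2 * \<beta>) / (2 * \<beta> - 1)"
      "\<And>m. m \<ge> 1 \<Longrightarrow> 4 * m \<le> N \<Longrightarrow> ln (real N / real m) powr (- 2 * \<beta>) / (real m + 1) \<le> G1 (Suc m) - G1 m"
      using telescoping_near_zero[OF b(2) N] by blast
    obtain G2 :: "nat \<Rightarrow> real" where G2: "mono G2" "\<And>n. G2 n - G2 0 \<le> 1 / \<delta>"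
      "\<And>m. m < N \<Longrightarrow> \<delta> * real N < real m \<Longrightarrow> 1 / (real m + 1) \<le> G2 (Suc m) - G2 m"
      using telescoping_middle[OF \<delta>(1) N] by blast
    obtain G3 :: "nat \<Rightarrow> real" where G3: "mono G3" "\<And>n. G3 n - G3 0 \<le> 2 * ln 2 powr (1 - 2 * \<alpha>) / (2 * \<alpha> - 1)"
      "\<And>m. m \<ge> N \<Longrightarrow> ln (real m / real N + 2) powr (- 2 * \<alpha>) / (real m + 1) \<le> G3 (Suc m) - G3 m"
      using telescoping_near_infinity[OF c(1) N] by blast
    define H where "H n = Cb\<^sup>2 * G1 n + (M + 1)\<^sup>2 * G2 n + Cc\<^sup>2 * G3 n" for n
    have H: "\<phi> m / (real m + 1) \<le> H (Suc m) - H m" for m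
    proof -
      define u where "u = Cb\<^sup>2 * (G1 (Suc m) - G1 m)"
      define v where "v = (M + 1)\<^sup>2 * (G2 (Suc m) - G2 m)"
      define w where "w = Cc\<^sup>2 * (G3 (Suc m) - G3 m)"
      have nn: "0 \<le> u" "0 \<le> v" "0 \<le> w"
        using monoD[OF G1(1), of m "Suc m"] monoD[OF G2(1), of m "Suc m"] monoD[OF G3(1), of m "Suc m"]
        by (auto simp: u_def v_def w_def)
      have e: "H (Suc m) - H m = u + v + w" by (simp add: H_def u_def v_def w_def right_diff_distrib)
      consider "m = 0" | "m \<ge> 1" "real m \<le> \<delta> * real N" | "m \<ge> 1" "\<delta> * real N < real m" "m < N"
        | "m \<ge> 1" "\<delta> * real N < real m" "m \<ge> N" by linarith
      then show ?thesis
      proof cases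
        case 1
        then show ?thesis unfolding e using nn by (simp add: \<phi>_def)
      next
        case 2
        then have "\<phi> m / (real m + 1) \<le> u"
          using mult_left_mono[OF G1(3)[OF 2(1) small[OF 2(2)]], of "Cb\<^sup>2"] by (simp add: \<phi>_def u_def)
        then show ?thesis using nn by (simp add: e)
      next
        case 3
        then have "\<phi> m / (real m + 1) \<le> v"
          using mult_left_mono[OF G2(3)[OF 3(3,2)], of "(M + 1)\<^sup>2"] by (simp add: \<phi>_def v_def)
        then show ?thesis using nn by (simp add: e)
      next
        case 4
        then have "\<phi> m / (real m + 1) \<le> w"
          using mult_left_mono[OF G3(3)[OF 4(3)], of "Cc\<^sup>2"] by (simp add: \<phi>_def w_def)
        then show ?thesis using nn by (simp add: e)
      qed
    qed
    define w where "w m = (A / (real m + 1))\<^sup>2 * \<phi> m" for m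
    show ?thesis
    proof (rule hs_bound_hankel_type[where w = w])
      fix j k
      have "(cmod ((dilate \<tau> N j k - (if j + k < N then 1 else 0)) * s (j + k)))\<^sup>2
          = (cmod (dilate \<tau> N j k - (if j + k < N then 1 else 0)))\<^sup>2 * (cmod (s (j + k)))\<^sup>2"
        unfolding norm_mult power_mult_distrib ..
      also have "\<dots> \<le> \<phi> (j + k) * (A / (real (j + k) + 1))\<^sup>2"
        by (intro mult_mono d[OF refl] power_mono s \<phi>0) auto
      finally show "(cmod ((dilate \<tau> N j k - (if j + k < N then 1 else 0)) * s (j + k)))\<^sup>2 \<le> w (j + k)"
        by (simp add: w_def mult.commute)
    next
      fix n
      have "(real m + 1) * w m \<le> A\<^sup>2 * (H (Suc m) - H m)" for m
      proof -
        have "r * ((A / r)\<^sup>2 * p) = A\<^sup>2 * (p / r)" if "r \<noteq> 0" for r p :: real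
          using that by (simp add: power2_eq_square)
        from this[of "real m + 1"] have "(real m + 1) * w m = A\<^sup>2 * (\<phi> m / (real m + 1))" by (simp add: w_def)
        then show ?thesis using mult_left_mono[OF H[of m], of "A\<^sup>2"] by simp
      qed
      then have "(\<Sum>m<n. (real m + 1) * w m) \<le> (\<Sum>m<n. A\<^sup>2 * (H (Suc m) - H m))" by (rule sum_mono)
      also have "\<dots> = A\<^sup>2 * (H n - H 0)" by (simp add: sum_distrib_left[symmetric] sum_lessThan_telescope)
      also have "H n - H 0 = Cb\<^sup>2 * (G1 n - G1 0) + (M + 1)\<^sup>2 * (G2 n - G2 0) + Cc\<^sup>2 * (G3 n - G3 0)"
        by (simp add: H_def right_diff_distrib)
      also have "A\<^sup>2 * \<dots> \<le> D"
        unfolding D_def by (intro mult_left_mono add_mono G1(2) G2(2) G3(2)) auto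
      finally show "(\<Sum>m<n. (real m + 1) * w m) \<le> D" .
    qed
  qed
  then show ?thesis by blast
qed

section \<open>Upper bounds and limits of the counts\<close>

context
  fixes Z :: "complex set" and a :: "complex \<Rightarrow> complex"
  assumes fin: "finite Z" and Z: "\<And>z. z \<in> Z \<Longrightarrow> cmod z = 1" and a: "\<And>z. z \<in> Z \<Longrightarrow> a z \<noteq> 0"
begin

text \<open>Stated first for the truncation itself, whose Hilbert--Schmidt norm is known with the
  sharp coefficient of ln N.\<close>

lemma jump_operator_density_upper:
  assumes t: "t > 0" and \<epsilon>: "\<epsilon> > 0"
  shows "\<exists>C. \<forall>N\<ge>1. real (singular_count t (jump_operator Z a N))
    \<le> (density_sum Z (\<lambda>z. cmod (a z)) t + \<epsilon>) * ln (real N) + C"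
proof -
  obtain C0 where C0: "\<And>N. N \<ge> 1 \<Longrightarrow> hs_bound (jump_matrix Z a N) ((\<Sum>z\<in>Z. (cmod (a z))\<^sup>2) / pi\<^sup>2 * ln (real N) + C0)"
    using jump_matrix_hs_bound[OF fin Z] by blast
  show ?thesis
  proof (rule density_upper[OF fin, where n = "\<lambda>N t. real (singular_count t (jump_operator Z a N))" and ?C0.0 = C0])
    show "\<exists>C. \<forall>N\<ge>1. (density_sum Z (\<lambda>z. cmod (a z)) t - \<epsilon>) * ln (real N) - C \<le> real (singular_count t (jump_operator Z a N))"
      if "t > 0" "\<epsilon> > 0" for t \<epsilon>
      by (rule jump_density_lower[OF fin Z a jump_approximable_refl[OF Z] that])
    fix N :: nat and p :: "nat \<Rightarrow> real" and r
    assume N: "N \<ge> 1" and p: "\<And>i. i \<le> r \<Longrightarrow> 0 < p i" "\<And>i. i < r \<Longrightarrow> p i \<le> p (Suc i)"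
    show "(p 0)\<^sup>2 * real (singular_count (p 0) (jump_operator Z a N))
        + (\<Sum>i<r. ((p (Suc i))\<^sup>2 - (p i)\<^sup>2) * real (singular_count (p (Suc i)) (jump_operator Z a N)))
        \<le> (\<Sum>z\<in>Z. (cmod (a z))\<^sup>2) / pi\<^sup>2 * ln (real N) + C0"
    proof -
      have "operator_of_matrix (jump_matrix Z a N) = jump_operator Z a N" by (rule jump_operator(3)) (rule Z)
      then show ?thesis using hs_layer_cake[where t = p and r = r, OF C0[OF N], OF p(1) p(2)] by simp
    qed
  qed (use a t \<epsilon> in auto)
qed

text \<open>Lowering the level from t to s lets the difference t - s absorb the perturbation at the
  cost of \<open>m\<close> constraints; continuity of the density makes the change of level
  cheap.\<close>

lemma jump_density_upper:
  assumes K: "jump_approximable Z a K" and t: "t > 0" and \<epsilon>: "\<epsilon> > 0"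
  shows "\<exists>C. \<forall>N\<ge>1. real (singular_count t (K N)) \<le> (density_sum Z (\<lambda>z. cmod (a z)) t + \<epsilon>) * ln (real N) + C"
proof -
  have e2: "\<epsilon> / 2 > 0" using \<epsilon> by simp
  obtain \<delta> where \<delta>: "\<delta> > 0" "\<And>s. s > 0 \<Longrightarrow> \<bar>s - t\<bar> < \<delta> \<Longrightarrow>
      \<bar>density_sum Z (\<lambda>z. cmod (a z)) s - density_sum Z (\<lambda>z. cmod (a z)) t\<bar> < \<epsilon> / 2"
    using log_density_sum_nearby[of Z "\<lambda>z. cmod (a z)", OF _ t e2] a unfolding density_sum_def by auto
  define s where "s = max (t / 2) (t - \<delta> / 2)"
  have s: "0 < s" "s < t" "\<bar>s - t\<bar> < \<delta>" using t \<delta>(1) by (auto simp: s_def)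
  obtain C where C: "\<And>N. N \<ge> 1 \<Longrightarrow> real (singular_count s (jump_operator Z a N))
      \<le> (density_sum Z (\<lambda>z. cmod (a z)) s + \<epsilon> / 2) * ln (real N) + C"
    using jump_operator_density_upper[OF s(1) e2] by blast
  obtain m where m: "\<And>N. N \<ge> 1 \<Longrightarrow> small_off (\<lambda>x. K N x - jump_operator Z a N x) (t - s) m"
    using K s(2) unfolding jump_approximable_def by (metis diff_gt_0_iff_gt)
  have "real (singular_count t (K N)) \<le> (density_sum Z (\<lambda>z. cmod (a z)) t + \<epsilon>) * ln (real N) + (C + real m)" if N: "N \<ge> 1" for N
  proof -
    have "small_off (K N) t (singular_count s (jump_operator Z a N) + m)"
      using small_off_add[OF small_off_singular_count[OF jump_operator_compact[of Z a N, OF Z] s(1)] m[OF N]] by simp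
    moreover have "compact_operator (K N)" using K N by (simp add: jump_approximable_def)
    ultimately have "singular_count t (K N) \<le> singular_count s (jump_operator Z a N) + m" using t by (intro singular_count_le)
    then have "real (singular_count t (K N)) \<le> real (singular_count s (jump_operator Z a N)) + real m" by linarith
    moreover have "(density_sum Z (\<lambda>z. cmod (a z)) s + \<epsilon> / 2) * ln (real N) \<le> (density_sum Z (\<lambda>z. cmod (a z)) t + \<epsilon>) * ln (real N)"
    proof (rule mult_right_mono)
      show "density_sum Z (\<lambda>z. cmod (a z)) s + \<epsilon> / 2 \<le> density_sum Z (\<lambda>z. cmod (a z)) t + \<epsilon>"
        using \<delta>(2)[OF s(1,3)] by linarith
    qed (use N in simp)
    ultimately show ?thesis using C[OF N] by linarith
  qed
  then show ?thesis by blast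
qed

lemma jump_singular_limit:
  assumes "jump_approximable Z a K" "t > 0"
  shows "(\<lambda>N. real (singular_count t (K N)) / ln (real N)) \<longlonglongrightarrow> density_sum Z (\<lambda>z. cmod (a z)) t"
  by (rule ln_order_limit) (use jump_density_lower[OF fin Z a assms] jump_density_upper[OF assms] in blast)+

lemma jump_approximable_uminus:
  assumes "jump_approximable Z a K"
  shows "jump_approximable Z (\<lambda>z. - a z) (\<lambda>N x. - K N x)"
proof -
  have "jump_operator Z (\<lambda>z. - a z) N x = - jump_operator Z a N x" for N x
    unfolding jump_operator_def sum_negf[symmetric] by (simp add: ell2.scale_minus_left)
  moreover have "norm (- x + y) = norm (x - y)" for x y :: ell2 using norm_minus_commute[of y x] by simp
  ultimately show ?thesis
    using assms compact_operator_uminus unfolding jump_approximable_def small_off_def by simp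
qed

text \<open>Reflecting the lower half plane keeps the modulus of the coefficients, so a conjugate
  pair counts once in each of the two sums. At real points the coefficient is real and nonzero, and
  its sign selects the sum.\<close>

lemma jump_density_symmetric:
  assumes sym: "\<And>z. z \<in> Z \<Longrightarrow> cnj z \<in> Z \<and> a (cnj z) = cnj (a z)"
  shows "density_sum Z (\<lambda>z. cmod (a z)) t
    = density_sum {z\<in>Z. Im z > 0 \<or> Im z = 0 \<and> Re (a z) > 0} (\<lambda>z. cmod (a z)) t
    + density_sum {z\<in>Z. Im z > 0 \<or> Im z = 0 \<and> Re (a z) < 0} (\<lambda>z. cmod (a z)) t"
proof -
  let ?f = "\<lambda>z. log_density (t / cmod (a z))"
  have re: "Re (a z) \<noteq> 0" if "z \<in> Z" "Im z = 0" for z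
  proof -
    have "cnj z = z" using that by (simp add: complex_eq_iff)
    then have "Im (a z) = 0" using sym[OF that(1)] by (metis complex_cnj_cancel_iff cnj.simps(2) neg_equal_zero)
    then show ?thesis using a[OF that(1)] by (auto simp: complex_eq_iff)
  qed
  define P where "P = {z\<in>Z. Im z > 0 \<or> Im z = 0 \<and> Re (a z) > 0}"
  define Q where "Q = {z\<in>Z. Im z < 0 \<or> Im z = 0 \<and> Re (a z) < 0}"
  have "sum ?f Z = sum ?f P + sum ?f Q"
  proof -
    have "Z = P \<union> Q" using re by (auto simp: P_def Q_def not_less_iff_gr_or_eq)
    moreover have "sum ?f (P \<union> Q) = sum ?f P + sum ?f Q"
      using fin by (intro sum.union_disjoint) (auto simp: P_def Q_def)
    ultimately show ?thesis by simp
  qed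
  also have "sum ?f Q = sum ?f {z\<in>Z. Im z > 0 \<or> Im z = 0 \<and> Re (a z) < 0}"
    by (rule sum.reindex_bij_witness[of _ cnj cnj]) (use sym in \<open>auto simp: Q_def\<close>)
  finally show ?thesis by (simp add: density_sum_def P_def)
qed

end

lemma jump_eigenvalue_limit:
  assumes fin: "finite Z" and Z: "\<And>z. z \<in> Z \<Longrightarrow> cmod z = 1" and a: "\<And>z. z \<in> Z \<Longrightarrow> a z \<noteq> 0"
    and sym: "\<And>z. z \<in> Z \<Longrightarrow> cnj z \<in> Z \<and> a (cnj z) = cnj (a z)"
    and K: "jump_approximable Z a K" and sa: "\<And>N. N \<ge> 1 \<Longrightarrow> self_adjoint (K N)" and t: "t > 0"
  shows "(\<lambda>N. real (eigenvalue_count t (K N)) / ln (real N))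
    \<longlonglongrightarrow> density_sum {z\<in>Z. Im z > 0 \<or> Im z = 0 \<and> Re (a z) > 0} (\<lambda>z. cmod (a z)) t"
proof -
  define h where "h = density_sum {z\<in>Z. Im z > 0 \<or> Im z = 0 \<and> Re (a z) > 0} (\<lambda>z. cmod (a z)) t"
  define h' where "h' = density_sum {z\<in>Z. Im z > 0 \<or> Im z = 0 \<and> Re (a z) < 0} (\<lambda>z. cmod (a z)) t"
  have total: "density_sum Z (\<lambda>z. cmod (a z)) t = h + h'"
    unfolding h_def h'_def by (rule jump_density_symmetric[OF fin Z a sym])
  have "\<exists>C. \<forall>N\<ge>1. real (eigenvalue_count t (K N)) \<le> (h + \<epsilon>) * ln (real N) + C" if \<epsilon>: "\<epsilon> > 0" for \<epsilon>
  proof -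
    have e2: "\<epsilon> / 2 > 0" using \<epsilon> by simp
    obtain C where C: "\<And>N. N \<ge> 1 \<Longrightarrow> real (singular_count t (K N)) \<le> (h + h' + \<epsilon> / 2) * ln (real N) + C"
      using jump_density_upper[OF fin Z a K t e2] unfolding total by blast
    have "\<exists>C. \<forall>N\<ge>1. (density_sum {z\<in>Z. Im z > 0 \<or> Im z = 0 \<and> Re (- a z) > 0} (\<lambda>z. cmod (- a z)) t - \<epsilon> / 2) * ln (real N) - C
        \<le> real (eigenvalue_count t (\<lambda>x. - K N x))"
      by (rule jump_density_lower_eigenvalue[OF fin Z _ _ jump_approximable_uminus[OF fin Z a K] self_adjoint_uminus[OF sa] t e2])
        (use a sym in auto)
    then obtain D where D: "\<And>N. N \<ge> 1 \<Longrightarrow> (h' - \<epsilon> / 2) * ln (real N) - D \<le> real (eigenvalue_count t (\<lambda>x. - K N x))"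
      unfolding h'_def by auto
    have "real (eigenvalue_count t (K N)) \<le> (h + \<epsilon>) * ln (real N) + (C + D)" if N: "N \<ge> 1" for N
    proof -
      have "compact_operator (K N)" using K N by (simp add: jump_approximable_def)
      from of_nat_mono[OF eigenvalue_counts_le_singular_count[OF this sa[OF N] t], where 'a = real]
      show ?thesis using C[OF N] D[OF N] by (simp add: algebra_simps)
    qed
    then show ?thesis by blast
  qed
  moreover have "\<exists>C. \<forall>N\<ge>1. (h - \<epsilon>) * ln (real N) - C \<le> real (eigenvalue_count t (K N))" if "\<epsilon> > 0" for \<epsilon>
    unfolding h_def by (rule jump_density_lower_eigenvalue[OF fin Z a sym K sa t that])
  ultimately show ?thesis unfolding h_def[symmetric] by (intro ln_order_limit)
qed

section \<open>Hankel operators of piecewise continuous symbols\<close>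

lemma schur_jump_approximable:
  fixes \<tau> :: "real \<Rightarrow> real \<Rightarrow> complex"
  assumes p: "1 < p" and bdd: "bounded {\<tau> x y | x y. 0 \<le> x \<and> 0 \<le> y}"
    and A: "(SUP N \<in> {1..}. multiplier_norm p (dilate \<tau> N)) < \<infinity>" and B0: "\<tau> 0 0 = 1"
    and B: "\<exists>\<epsilon>>0. \<exists>\<beta>>1/2. \<exists>C>0. \<forall>x y. 0 \<le> x \<and> x \<le> \<epsilon> \<and> 0 \<le> y \<and> y \<le> \<epsilon> \<longrightarrow>
              cmod (\<tau> x y - 1) \<le> C * \<bar>ln (x + y)\<bar> powr (- \<beta>)"
    and C: "\<exists>\<alpha>>1/2. \<exists>C. \<forall>x y. 0 \<le> x \<and> 0 \<le> y \<longrightarrow> cmod (\<tau> x y) \<le> C * ln (x + y + 2) powr (- \<alpha>)"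
    and Z: "\<And>z. z \<in> Z \<Longrightarrow> cmod z = 1"
    and G: "\<And>j k. matrix_entry G j k
      = (\<Sum>z\<in>Z. a z * cnj z ^ (j + k)) * of_real (1 / (pi * real (j + k + 1))) + matrix_entry H j k"
    and H: "H \<in> schatten_class p"
  shows "jump_approximable Z a (\<lambda>N. schur (dilate \<tau> N) G)" and "N \<ge> 1 \<Longrightarrow> schur_defined (dilate \<tau> N) G"
proof -
  define s where "s n = (\<Sum>z\<in>Z. a z * cnj z ^ n) * of_real (1 / (pi * real (n + 1)))" for n
  define E where "E N j k = (dilate \<tau> N j k - (if j + k < N then 1 else 0)) * s (j + k)" for N j k
  have s: "cmod (s n) \<le> (\<Sum>z\<in>Z. cmod (a z)) / pi / (real n + 1)" for n
  proof -
    have "cmod (\<Sum>z\<in>Z. a z * cnj z ^ n) \<le> (\<Sum>z\<in>Z. cmod (a z))"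
      using Z by (intro sum_norm_le) (simp add: norm_mult norm_power)
    then have "cmod (\<Sum>z\<in>Z. a z * cnj z ^ n) * \<bar>1 / (pi * real (n + 1))\<bar> \<le> (\<Sum>z\<in>Z. cmod (a z)) * (1 / (pi * real (n + 1)))"
      by (intro mult_mono) (auto intro: sum_nonneg)
    then show ?thesis unfolding s_def norm_mult norm_of_real by (simp add: add.commute)
  qed
  obtain D where D: "\<And>N. N \<ge> 1 \<Longrightarrow> hs_bound (E N) D"
    using cutoff_error_hs_bound[OF bdd B0 B C s] unfolding E_def by blast
  have p0: "p > 0" using p by simp
  define S where "S N = schur (dilate \<tau> N) H" for N
  note mult = multiplier_uniform_small_off[OF p0 A H]
  \<comment> \<open>Guessed as a sum of three operators known to be compact. Comparing entries
    identifies it with the Schur product and shows at the same time that this product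
    exists.\<close>
  define K where "K N x = jump_operator Z a N x + (operator_of_matrix (E N) x + S N x)" for N x
  have cpt: "compact_operator (\<lambda>x. operator_of_matrix (E N) x + S N x)" if "N \<ge> 1" for N
    unfolding S_def using hs_compact[OF D[OF that]] mult(1)[OF that] by (intro compact_operator_add) auto
  have K: "compact_operator (K N)" if "N \<ge> 1" for N
    unfolding K_def[abs_def] by (intro compact_operator_add jump_operator_compact Z cpt that)
  have entry: "matrix_entry (K N) = (\<lambda>j k. dilate \<tau> N j k * matrix_entry G j k)" if N: "N \<ge> 1" for N
  proof (intro ext)
    fix j k
    have "is_operator_matrix (\<lambda>j k. dilate \<tau> N j k * matrix_entry H j k)"
      using mult(1)[OF N] by (simp add: schur_defined_def)
    then have 1: "matrix_entry (S N) = (\<lambda>j k. dilate \<tau> N j k * matrix_entry H j k)"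
      unfolding S_def schur_def by (rule is_operator_matrixD(2))
    have 2: "matrix_entry (operator_of_matrix (E N)) = E N" by (rule is_operator_matrixD(2)[OF hs_is_operator_matrix[OF D[OF N]]])
    have 3: "matrix_entry (jump_operator Z a N) = jump_matrix Z a N" by (rule jump_operator(2)) (rule Z)
    have "matrix_entry (K N) j k = matrix_entry (jump_operator Z a N) j k + (matrix_entry (operator_of_matrix (E N)) j k + matrix_entry (S N) j k)"
      by (simp add: matrix_entry_def K_def cinner_simps)
    also have "\<dots> = dilate \<tau> N j k * (s (j + k) + matrix_entry H j k)"
    proof -
      have "jump_matrix Z a N j k = (if j + k < N then s (j + k) else 0)"
        by (simp add: jump_matrix_def hilbert_matrix_def s_def)
      then show ?thesis unfolding 1 2 3 E_def by (simp add: algebra_simps)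
    qed
    finally show "matrix_entry (K N) j k = dilate \<tau> N j k * matrix_entry G j k" unfolding G s_def .
  qed
  show "schur_defined (dilate \<tau> N) G" if "N \<ge> 1" for N
    unfolding schur_defined_def is_operator_matrix_def using K[OF that] entry[OF that] compact_operator_bounded by blast
  have schur: "schur (dilate \<tau> N) G = K N" if "N \<ge> 1" for N
    unfolding schur_def by (rule operator_of_matrix_eq[OF compact_operator_bounded[OF K[OF that]] entry[OF that]])
  have "\<exists>m. \<forall>N\<ge>1. small_off (\<lambda>x. K N x - jump_operator Z a N x) \<rho> m" if \<rho>: "\<rho> > 0" for \<rho>
  proof -
    have \<rho>2: "\<rho> / 2 > 0" using \<rho> by simp
    obtain m where m: "\<And>N. N \<ge> 1 \<Longrightarrow> small_off (S N) (\<rho> / 2) m" using mult(2)[OF \<rho>2] unfolding S_def by blast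
    define m' where "m' = nat \<lceil>D / (\<rho> / 2)\<^sup>2\<rceil>"
    have "D / (\<rho> / 2)\<^sup>2 \<le> real m'" unfolding m'_def by linarith
    note E = hs_small_off[OF D \<rho>2 this]
    have "small_off (\<lambda>x. K N x - jump_operator Z a N x) \<rho> (m' + m)" if "N \<ge> 1" for N
      using small_off_add[OF E[OF that] m[OF that]] by (simp add: K_def)
    then show ?thesis by blast
  qed
  then show "jump_approximable Z a (\<lambda>N. schur (dilate \<tau> N) G)"
    unfolding jump_approximable_def using K schur by simp
qed

text \<open>The substitution of 2 pi - \<theta> for \<theta> conjugates the integrand.\<close>

lemma fourier_coeff_real:
  assumes \<omega>: "bounded_symbol \<omega>" and sym: "\<And>v. cmod v = 1 \<Longrightarrow> \<omega> v = cnj (\<omega> (cnj v))"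
  shows "cnj (fourier_coeff \<omega> j) = fourier_coeff \<omega> j"
proof -
  define f where "f \<theta> = \<omega> (cis \<theta>) * cis (- (of_int j * \<theta>))" for \<theta> :: real
  have si: "set_integrable lebesgue {0..2*pi} f" unfolding f_def by (rule symbol_set_integrable[OF \<omega>])
  have I: "(LINT \<theta>:{0..2*pi}|lebesgue. f \<theta>) = integral {0..2*pi} f" by (rule set_lebesgue_integral_eq_integral(2)[OF si])
  have "f integrable_on {0..2*pi}" by (rule set_lebesgue_integral_eq_integral(1)[OF si])
  then have h: "(f has_integral integral {0..2*pi} f) (cbox 0 (2*pi))" by (simp add: integrable_integral)
  have reflect: "f (- \<theta> + 2 * pi) = cnj (f \<theta>)" for \<theta>
  proof -
    have "cis (- \<theta> + 2 * pi) = cnj (cis \<theta>)" by (simp only: cis_mult[symmetric] cis_2pi cis_cnj mult_1_right)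
    moreover have "cis (- (of_int j * (- \<theta> + 2 * pi))) = cnj (cis (- (of_int j * \<theta>)))"
    proof -
      have "- (of_int j * (- \<theta> + 2 * pi)) = of_int j * \<theta> + 2 * pi * of_int (- j)" by (simp add: algebra_simps)
      then show ?thesis using cis_multiple_2pi[of "of_int (- j)"] by (simp only: cis_mult[symmetric] cis_cnj) simp
    qed
    moreover have "\<omega> (cis \<theta>) = cnj (\<omega> (cnj (cis \<theta>)))" by (rule sym) simp
    ultimately show ?thesis by (simp add: f_def)
  qed
  have img: "(\<lambda>x. (1 / (-1)) *\<^sub>R x + - ((1 / (-1)) *\<^sub>R (2 * pi))) ` cbox 0 (2 * pi) = cbox 0 (2 * pi :: real)"
  proof (intro equalityI subsetI)
    fix x :: real assume "x \<in> cbox 0 (2 * pi)"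
    then show "x \<in> (\<lambda>x. (1 / (-1)) *\<^sub>R x + - ((1 / (-1)) *\<^sub>R (2 * pi))) ` cbox 0 (2 * pi)"
      by (intro image_eqI[of _ _ "2 * pi - x"]) auto
  qed auto
  have "((\<lambda>\<theta>. f (- \<theta> + 2 * pi)) has_integral integral {0..2*pi} f) (cbox 0 (2 * pi))"
    using has_integral_affinity[OF h, of "-1" "2 * pi", unfolded img]
    by (simp only: scaleR_minus1_left abs_minus_cancel abs_one power_one div_by_1 scaleR_one
        neg_equal_0_iff_equal one_neq_zero not_False_eq_True simp_thms)
  moreover have "((\<lambda>\<theta>. cnj (f \<theta>)) has_integral cnj (integral {0..2*pi} f)) (cbox 0 (2 * pi))"
    using h unfolding has_integral_cnj[symmetric, of f] by (simp add: o_def)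
  ultimately have "cnj (integral {0..2*pi} f) = integral {0..2*pi} f"
    unfolding reflect by (rule has_integral_unique[symmetric])
  then show ?thesis using I by (simp add: fourier_coeff_def f_def)
qed

text \<open>Conjugation reverses the orientation of the circle and so exchanges the two one-sided
  limits, whence the sign.\<close>

lemma half_jump_cnj:
  assumes PC: "\<omega> \<in> PC" and sym: "\<And>v. cmod v = 1 \<Longrightarrow> \<omega> v = cnj (\<omega> (cnj v))" and z: "cmod z = 1"
  shows "half_jump \<omega> (cnj z) = - cnj (half_jump \<omega> z)"
proof -
  have zs: "z \<in> sphere 0 1" using z by simp
  obtain l where l: "((\<lambda>\<epsilon>. \<omega> (z * cis \<epsilon>)) \<longlongrightarrow> l) (at_right 0)" using PC zs unfolding PC_def by blast
  obtain m where m: "((\<lambda>\<epsilon>. \<omega> (z * cis (- \<epsilon>))) \<longlongrightarrow> m) (at_right 0)" using PC zs unfolding PC_def by blast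
  have e: "\<omega> (cnj z * cis \<epsilon>) = cnj (\<omega> (z * cis (- \<epsilon>)))" for \<epsilon>
    using sym[of "cnj z * cis \<epsilon>"] z by (simp add: norm_mult cis_cnj)
  have "((\<lambda>\<epsilon>. \<omega> (cnj z * cis \<epsilon>)) \<longlongrightarrow> cnj m) (at_right 0)" unfolding e by (intro tendsto_intros m)
  moreover have "((\<lambda>\<epsilon>. \<omega> (cnj z * cis (- \<epsilon>))) \<longlongrightarrow> cnj l) (at_right 0)" unfolding e minus_minus by (intro tendsto_intros l)
  ultimately have "limit_plus \<omega> (cnj z) = cnj m" "limit_minus \<omega> (cnj z) = cnj l" "limit_plus \<omega> z = l" "limit_minus \<omega> z = m"
    using l m unfolding limit_plus_def limit_minus_def by (auto intro!: tendsto_Lim)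
  then show ?thesis by (simp add: half_jump_def minus_divide_left)
qed

text \<open>The only real points of the circle are 1 and -1; \<open>P\<close> will be the sign
  condition on their coefficients.\<close>

lemma density_sum_upper_half:
  assumes fin: "finite Z" and Z: "\<And>z. z \<in> Z \<Longrightarrow> cmod z = 1" and P: "P 1 \<Longrightarrow> 1 \<in> Z" "P (-1) \<Longrightarrow> -1 \<in> Z"
  shows "density_sum {z\<in>Z. Im z > 0 \<or> Im z = 0 \<and> P z} \<alpha> t
    = (\<Sum>z | z \<in> Z \<and> Im z > 0. log_density (t / \<alpha> z)) + log_density (t / \<alpha> 1) * (if P 1 then 1 else 0)
      + log_density (t / \<alpha> (-1)) * (if P (-1) then 1 else 0)"
proof -
  have real: "z = 1 \<or> z = -1" if "z \<in> Z" "Im z = 0" for z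
  proof -
    have "\<bar>Re z\<bar> = 1" using Z[OF that(1)] that(2) by (simp add: cmod_eq_Re)
    then show ?thesis using that(2) by (auto simp: complex_eq_iff)
  qed
  have "{z\<in>Z. Im z > 0 \<or> Im z = 0 \<and> P z} = {z. z \<in> Z \<and> Im z > 0} \<union> ({z. z = 1 \<and> P z} \<union> {z. z = -1 \<and> P z})"
    using real P by auto
  moreover have "sum f ({z. z \<in> Z \<and> Im z > 0} \<union> ({z. z = 1 \<and> P z} \<union> {z. z = -1 \<and> P z}))
      = sum f {z. z \<in> Z \<and> Im z > 0} + (sum f {z. z = 1 \<and> P z} + sum f {z. z = -1 \<and> P z})" for f :: "complex \<Rightarrow> real"
    using fin by (subst sum.union_disjoint, simp, simp, force, subst sum.union_disjoint) auto
  moreover have "sum f {z. z = c \<and> P z} = f c * (if P c then 1 else 0)" for f :: "complex \<Rightarrow> real" and c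
    by (cases "P c") (simp_all add: Collect_conv_if cong: conj_cong)
  ultimately show ?thesis by (simp add: density_sum_def)
qed

theorem proposition1p3:
  fixes p :: real
    and \<tau> :: "real \<Rightarrow> real \<Rightarrow> complex"
    and \<omega> \<eta> :: "complex \<Rightarrow> complex"
  assumes p: "1 < p"
    and \<tau>_bounded: "bounded {\<tau> x y | x y. 0 \<le> x \<and> 0 \<le> y}"
    and A: "(SUP N \<in> {1..}. multiplier_norm p (dilate \<tau> N)) < \<infinity>"
    and B0: "\<tau> 0 0 = 1"
    and B: "\<exists>\<epsilon>>0. \<exists>\<beta>>1/2. \<exists>C>0. \<forall>x y. 0 \<le> x \<and> x \<le> \<epsilon> \<and> 0 \<le> y \<and> y \<le> \<epsilon> \<longrightarrow>
              cmod (\<tau> x y - 1) \<le> C * \<bar>ln (x + y)\<bar> powr (- \<beta>)"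
    and C: "\<exists>\<alpha>>1/2. \<exists>C. \<forall>x y. 0 \<le> x \<and> 0 \<le> y \<longrightarrow>
              cmod (\<tau> x y) \<le> C * ln (x + y + 2) powr (- \<alpha>)"
    and \<omega>_PC: "\<omega> \<in> PC"
    and \<omega>_jumps: "finite (jump_set \<omega>)"
    and \<omega>_eq: "\<forall>v \<in> sphere 0 1.
           \<omega> v = - \<i> * (\<Sum>z\<in>jump_set \<omega>. half_jump \<omega> z * gamma_symbol (cnj z * v)) + \<eta> v"
    and \<eta>_symbol: "bounded_symbol \<eta>"
    and \<eta>_Schatten: "hankel (fourier_coeff \<eta>) \<in> schatten_class p"
  shows
    "(\<forall>N\<ge>1. schur_defined (dilate \<tau> N) (hankel (fourier_coeff \<omega>)) \<and>
        compact_operator (schur (dilate \<tau> N) (hankel (fourier_coeff \<omega>)))) \<and>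
     (\<forall>t>0. (\<lambda>N. real (singular_count t (schur (dilate \<tau> N) (hankel (fourier_coeff \<omega>)))) / ln (real N))
        \<longlonglongrightarrow> (\<Sum>z\<in>jump_set \<omega>. log_density (t / cmod (half_jump \<omega> z)))) \<and>
     ((\<forall>x\<ge>0. \<forall>y\<ge>0. \<tau> x y = cnj (\<tau> y x)) \<and> (\<forall>v \<in> sphere 0 1. \<omega> v = cnj (\<omega> (cnj v))) \<longrightarrow>
        (\<forall>N\<ge>1. self_adjoint (schur (dilate \<tau> N) (hankel (fourier_coeff \<omega>)))) \<and>
        (\<forall>t>0.
          (\<lambda>N. real (n_plus t (schur (dilate \<tau> N) (hankel (fourier_coeff \<omega>)))) / ln (real N))
            \<longlonglongrightarrow> (\<Sum>z | z \<in> jump_set \<omega> \<and> Im z > 0. log_density (t / cmod (half_jump \<omega> z)))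
              + log_density (t / cmod (half_jump \<omega> 1)) * indicator {0<..} (Re (- \<i> * half_jump \<omega> 1))
              + log_density (t / cmod (half_jump \<omega> (-1))) * indicator {0<..} (Re (- \<i> * half_jump \<omega> (-1)))) \<and>
        (\<forall>t>0.
          (\<lambda>N. real (n_minus t (schur (dilate \<tau> N) (hankel (fourier_coeff \<omega>)))) / ln (real N))
            \<longlonglongrightarrow> (\<Sum>z | z \<in> jump_set \<omega> \<and> Im z > 0. log_density (t / cmod (half_jump \<omega> z)))
              + log_density (t / cmod (half_jump \<omega> 1)) * indicator {..<0} (Re (- \<i> * half_jump \<omega> 1))
              + log_density (t / cmod (half_jump \<omega> (-1))) * indicator {..<0} (Re (- \<i> * half_jump \<omega> (-1)))))"
proof -
  let ?G = "hankel (fourier_coeff \<omega>)" and ?H = "hankel (fourier_coeff \<eta>)"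
  define Z where "Z = jump_set \<omega>"
  \<comment> \<open>With this factor included, a symmetric symbol has a (cnj z) = cnj (a z); in
    particular the coefficients at 1 and -1 are then real, and their signs are those in the
    theorem.\<close>
  define a where "a z = - \<i> * half_jump \<omega> z" for z
  define K where "K N = schur (dilate \<tau> N) ?G" for N
  have fin: "finite Z" using \<omega>_jumps by (simp add: Z_def)
  have Z: "cmod z = 1" if "z \<in> Z" for z using that by (simp add: Z_def jump_set_def)
  have a: "a z \<noteq> 0" if "z \<in> Z" for z using that by (simp add: Z_def jump_set_def a_def)
  have abs_a: "cmod (a z) = cmod (half_jump \<omega> z)" for z by (simp add: a_def norm_mult)
  define \<psi> where "\<psi> v = (\<Sum>z\<in>Z. a z * gamma_symbol (cnj z * v))" for v
  have \<omega>: "\<omega> v = \<psi> v + \<eta> v" if "cmod v = 1" for v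
    using \<omega>_eq that by (simp add: \<psi>_def a_def Z_def sum_distrib_left mult.assoc sum_negf)
  have \<psi>: "bounded_symbol \<psi>"
    unfolding \<psi>_def by (intro bounded_symbol_sum bounded_symbol_mult bounded_symbol_gamma Z)
  have \<omega>_symbol: "bounded_symbol \<omega>"
  proof -
    have "bounded_symbol \<omega> = bounded_symbol (\<lambda>v. \<psi> v + \<eta> v)" by (rule bounded_symbol_cong) (rule \<omega>)
    then show ?thesis using bounded_symbol_add[OF \<psi> \<eta>_symbol] by simp
  qed
  have coeff_\<psi>: "fourier_coeff \<psi> (int n) = (\<Sum>z\<in>Z. a z * cnj z ^ n) * of_real (1 / (pi * real (n + 1)))" for n
  proof -
    have "fourier_coeff \<psi> (int n) = (\<Sum>z\<in>Z. fourier_coeff (\<lambda>v. a z * gamma_symbol (cnj z * v)) (int n))"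
      unfolding \<psi>_def by (intro fourier_coeff_sum bounded_symbol_mult bounded_symbol_gamma Z)
    also have "\<dots> = (\<Sum>z\<in>Z. a z * cnj z ^ n * of_real (1 / (pi * real (n + 1))))"
      by (intro sum.cong refl) (simp add: fourier_coeff_mult fourier_coeff_gamma Z add.commute)
    finally show ?thesis unfolding sum_distrib_right .
  qed
  have entry: "matrix_entry (hankel (fourier_coeff f)) j k = fourier_coeff f (int (j + k))" if "bounded_symbol f" for f j k
    unfolding hankel_def is_operator_matrixD(2)[OF hankel_is_operator_matrix[OF that]] ..
  have G: "matrix_entry ?G j k = (\<Sum>z\<in>Z. a z * cnj z ^ (j + k)) * of_real (1 / (pi * real (j + k + 1))) + matrix_entry ?H j k" for j k
  proof -
    have "fourier_coeff \<omega> = fourier_coeff (\<lambda>v. \<psi> v + \<eta> v)" by (rule fourier_coeff_cong) (rule \<omega>)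
    then show ?thesis
      unfolding entry[OF \<omega>_symbol] entry[OF \<eta>_symbol] by (simp only: fourier_coeff_add[OF \<psi> \<eta>_symbol] coeff_\<psi>)
  qed
  have approx: "jump_approximable Z a K" and defd: "\<And>N. N \<ge> 1 \<Longrightarrow> schur_defined (dilate \<tau> N) ?G"
    using schur_jump_approximable[of p \<tau> Z ?G a ?H, OF p \<tau>_bounded A B0 B C Z G \<eta>_Schatten] unfolding K_def by blast+
  have compact: "compact_operator (K N)" if "N \<ge> 1" for N using approx that by (simp add: jump_approximable_def)
  have part1: "(\<lambda>N. real (singular_count t (K N)) / ln (real N)) \<longlonglongrightarrow> (\<Sum>z\<in>jump_set \<omega>. log_density (t / cmod (half_jump \<omega> z)))"
    if "t > 0" for t
    using jump_singular_limit[OF fin Z a approx that] by (simp add: density_sum_def abs_a Z_def)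
  have part2: "(\<forall>N\<ge>1. self_adjoint (K N)) \<and>
    (\<forall>t>0. (\<lambda>N. real (n_plus t (K N)) / ln (real N))
       \<longlonglongrightarrow> (\<Sum>z | z \<in> jump_set \<omega> \<and> Im z > 0. log_density (t / cmod (half_jump \<omega> z)))
         + log_density (t / cmod (half_jump \<omega> 1)) * indicator {0<..} (Re (- \<i> * half_jump \<omega> 1))
         + log_density (t / cmod (half_jump \<omega> (-1))) * indicator {0<..} (Re (- \<i> * half_jump \<omega> (-1)))) \<and>
    (\<forall>t>0. (\<lambda>N. real (n_minus t (K N)) / ln (real N))
       \<longlonglongrightarrow> (\<Sum>z | z \<in> jump_set \<omega> \<and> Im z > 0. log_density (t / cmod (half_jump \<omega> z)))
         + log_density (t / cmod (half_jump \<omega> 1)) * indicator {..<0} (Re (- \<i> * half_jump \<omega> 1))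
         + log_density (t / cmod (half_jump \<omega> (-1))) * indicator {..<0} (Re (- \<i> * half_jump \<omega> (-1))))"
    if \<tau>_sym: "\<forall>x\<ge>0. \<forall>y\<ge>0. \<tau> x y = cnj (\<tau> y x)" and "\<forall>v \<in> sphere 0 1. \<omega> v = cnj (\<omega> (cnj v))"
  proof (intro conjI allI impI)
    have \<omega>_sym: "\<omega> v = cnj (\<omega> (cnj v))" if "cmod v = 1" for v
      by (rule bspec[OF \<open>\<forall>v \<in> sphere 0 1. \<omega> v = cnj (\<omega> (cnj v))\<close>]) (simp add: that)
    have hj: "half_jump \<omega> (cnj z) = - cnj (half_jump \<omega> z)" if "cmod z = 1" for z
      by (rule half_jump_cnj[OF \<omega>_PC \<omega>_sym that])
    have sym: "cnj z \<in> Z \<and> a (cnj z) = cnj (a z)" if "z \<in> Z" for z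
      using that hj[OF Z[OF that]] by (simp add: Z_def jump_set_def a_def)
    \<comment> \<open>At a point outside the jump set the coefficient is 0, so a nonzero real part
      certifies the membership that \<open>density_sum_upper_half\<close> asks for.\<close>
    have at_one: "1 \<in> Z" if "Re (a 1) \<noteq> 0" using that by (auto simp add: Z_def jump_set_def a_def)
    have at_minus_one: "-1 \<in> Z" if "Re (a (-1)) \<noteq> 0" using that by (auto simp add: Z_def jump_set_def a_def)
    show sa: "self_adjoint (K N)" if N: "N \<ge> 1" for N
    proof (rule self_adjoint_matrixI[OF compact_operator_bounded[OF compact[OF N]]])
      fix j k
      have e: "matrix_entry (K N) j k = dilate \<tau> N j k * fourier_coeff \<omega> (int (j + k))" for j k
      proof -
        have "matrix_entry (K N) = (\<lambda>j k. dilate \<tau> N j k * matrix_entry ?G j k)"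
          unfolding K_def schur_def by (rule is_operator_matrixD(2)) (use defd[OF N] in \<open>simp add: schur_defined_def\<close>)
        then show ?thesis by (simp only: entry[OF \<omega>_symbol])
      qed
      have d: "dilate \<tau> N j k = cnj (dilate \<tau> N k j)"
        unfolding dilate_def by (rule \<tau>_sym[rule_format]) simp_all
      have r: "cnj (fourier_coeff \<omega> i) = fourier_coeff \<omega> i" for i
        by (rule fourier_coeff_real[OF \<omega>_symbol]) (rule \<omega>_sym)
      show "matrix_entry (K N) j k = cnj (matrix_entry (K N) k j)"
        unfolding e complex_cnj_mult r d add.commute[of k j] ..
    qed
    fix t :: real assume t: "t > 0"
    show "(\<lambda>N. real (n_plus t (K N)) / ln (real N))
       \<longlonglongrightarrow> (\<Sum>z | z \<in> jump_set \<omega> \<and> Im z > 0. log_density (t / cmod (half_jump \<omega> z)))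
         + log_density (t / cmod (half_jump \<omega> 1)) * indicator {0<..} (Re (- \<i> * half_jump \<omega> 1))
         + log_density (t / cmod (half_jump \<omega> (-1))) * indicator {0<..} (Re (- \<i> * half_jump \<omega> (-1)))"
    proof -
      have ind: "(if 0 < x then 1 else 0) = (indicator {0<..} x :: real)" for x :: real by simp
      have eq: "density_sum {z\<in>Z. Im z > 0 \<or> Im z = 0 \<and> Re (a z) > 0} (\<lambda>z. cmod (a z)) t
          = (\<Sum>z | z \<in> Z \<and> Im z > 0. log_density (t / cmod (a z)))
            + log_density (t / cmod (a 1)) * (if Re (a 1) > 0 then 1 else 0)
            + log_density (t / cmod (a (-1))) * (if Re (a (-1)) > 0 then 1 else 0)"
        using at_one at_minus_one by (intro density_sum_upper_half fin Z) auto
      have "(\<lambda>N. real (eigenvalue_count t (K N)) / ln (real N))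
          \<longlonglongrightarrow> density_sum {z\<in>Z. Im z > 0 \<or> Im z = 0 \<and> Re (a z) > 0} (\<lambda>z. cmod (a z)) t"
        by (rule jump_eigenvalue_limit[OF fin Z a sym approx sa t])
      then show ?thesis unfolding eq ind n_plus_def unfolding abs_a unfolding Z_def a_def .
    qed
    show "(\<lambda>N. real (n_minus t (K N)) / ln (real N))
       \<longlonglongrightarrow> (\<Sum>z | z \<in> jump_set \<omega> \<and> Im z > 0. log_density (t / cmod (half_jump \<omega> z)))
         + log_density (t / cmod (half_jump \<omega> 1)) * indicator {..<0} (Re (- \<i> * half_jump \<omega> 1))
         + log_density (t / cmod (half_jump \<omega> (-1))) * indicator {..<0} (Re (- \<i> * half_jump \<omega> (-1)))"
    proof -
      have ind: "(if 0 < Re (- c) then 1 else 0) = (indicator {..<0} (Re c) :: real)" for c by simp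
      have eq: "density_sum {z\<in>Z. Im z > 0 \<or> Im z = 0 \<and> Re (- a z) > 0} (\<lambda>z. cmod (a z)) t
          = (\<Sum>z | z \<in> Z \<and> Im z > 0. log_density (t / cmod (a z)))
            + log_density (t / cmod (a 1)) * (if Re (- a 1) > 0 then 1 else 0)
            + log_density (t / cmod (a (-1))) * (if Re (- a (-1)) > 0 then 1 else 0)"
        using at_one at_minus_one by (intro density_sum_upper_half fin Z) auto
      have "(\<lambda>N. real (eigenvalue_count t (\<lambda>x. - K N x)) / ln (real N))
          \<longlonglongrightarrow> density_sum {z\<in>Z. Im z > 0 \<or> Im z = 0 \<and> Re (- a z) > 0} (\<lambda>z. cmod (- a z)) t"
        by (rule jump_eigenvalue_limit[OF fin Z _ _ jump_approximable_uminus[OF fin Z a approx] self_adjoint_uminus[OF sa] t])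
          (use a sym in auto)
      then show ?thesis unfolding norm_minus_cancel eq ind n_minus_def unfolding abs_a unfolding Z_def a_def .
    qed
  qed
  show ?thesis using defd compact part1 part2 unfolding K_def by blast
qed

end
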